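(* If $f,h\in H^1(\mathbb{R}^2)$, then for each $i=1,2,3$ $$2\int_{\mathbb{R}^2}\sigma_i\,\langle J_0\nabla^0f,\nabla^0h\rangle\,dw\;\le\;\|\nabla^0f\|_{L^2}\,\|\nabla^0h\|_{L^2}.$$ Furthermore, equality holds if and only if $f$ or $h$ vanishes.
   Context: $H^1(\mathbb{R}^2)$ is the usual Sobolev space of real-valued functions. $J_0$ is the canonical complex structure of $\mathbb{R}^2$ and $\nabla^0$ the Euclidean gradient. $\sigma=(\sigma_1,\sigma_2,\sigma_3):\mathbb{R}^2\to\mathbb{S}^2$ is the stereographic parametrization $$\sigma(w)=\left(\frac{|w|^2-1}{|w|^2+1},\frac{2w_1}{|w|^2+1},\frac{2w_2}{|w|^2+1}\right).$$ *)

theory Defs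
  imports "HOL-Analysis.Analysis"
begin

text \<open>
  Functions are taken with respect to the completed Lebesgue measure and are not quotiented
  by equality almost everywhere: an element of \<open>L2\<close> or \<open>H1\<close> is a representative of a class.
\<close>

primrec C_k :: "nat \<Rightarrow> ('a::euclidean_space \<Rightarrow> real) \<Rightarrow> bool" where
  "C_k 0 \<phi> \<longleftrightarrow> continuous_on UNIV \<phi>"
| "C_k (Suc k) \<phi> \<longleftrightarrow> (\<exists>G. (\<forall>x. GDERIV \<phi> x :> G x) \<and> (\<forall>b\<in>Basis. C_k k (\<lambda>x. G x \<bullet> b)))"

definition test_function :: "('a::euclidean_space \<Rightarrow> real) \<Rightarrow> bool" where
  "test_function \<phi> \<longleftrightarrow> (\<forall>k. C_k k \<phi>) \<and> compact (closure {x. \<phi> x \<noteq> 0})"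

definition locally_integrable :: "('a::euclidean_space \<Rightarrow> 'b::euclidean_space) \<Rightarrow> bool" where
  "locally_integrable f \<longleftrightarrow> (\<forall>K. compact K \<longrightarrow> set_integrable lebesgue K f)"

text \<open>Integration by parts against test functions, all partial derivatives at once.\<close>

definition has_weak_gradient :: "('a::euclidean_space \<Rightarrow> real) \<Rightarrow> ('a \<Rightarrow> 'a) \<Rightarrow> bool" where
  "has_weak_gradient f F \<longleftrightarrow>
     locally_integrable f \<and> locally_integrable F \<and>
     (\<forall>\<phi> G. test_function \<phi> \<and> (\<forall>x. GDERIV \<phi> x :> G x) \<longrightarrow>
        (LINT x|lebesgue. f x *\<^sub>R G x) = - (LINT x|lebesgue. \<phi> x *\<^sub>R F x))"

text \<open>A weak gradient is unique up to a null set; the choice operator fixes a representative.\<close>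

definition weak_gradient :: "('a::euclidean_space \<Rightarrow> real) \<Rightarrow> 'a \<Rightarrow> 'a" where
  "weak_gradient f = (SOME F. has_weak_gradient f F)"

definition L2 :: "('a::euclidean_space \<Rightarrow> 'b::euclidean_space) set" where
  "L2 = {f. f \<in> borel_measurable lebesgue \<and> integrable lebesgue (\<lambda>x. (norm (f x))\<^sup>2)}"

definition L2_norm :: "('a::euclidean_space \<Rightarrow> 'b::euclidean_space) \<Rightarrow> real" where
  "L2_norm f = sqrt (LINT x|lebesgue. (norm (f x))\<^sup>2)"

definition H1 :: "('a::euclidean_space \<Rightarrow> real) set" where
  "H1 = {f \<in> L2. \<exists>F\<in>L2. has_weak_gradient f F}"

definition J0 :: "real^2 \<Rightarrow> real^2" where
  "J0 v = vector [- v $ 2, v $ 1]"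

definition stereo :: "real^2 \<Rightarrow> real^3" where
  "stereo w = vector
     [((norm w)\<^sup>2 - 1) / ((norm w)\<^sup>2 + 1),
      2 * w $ 1 / ((norm w)\<^sup>2 + 1),
      2 * w $ 2 / ((norm w)\<^sup>2 + 1)]"

lemma stereo_in_sphere: "stereo w \<in> sphere 0 1"
proof -
  define r where "r = (w $ 1)\<^sup>2 + (w $ 2)\<^sup>2"
  have r: "(norm w)\<^sup>2 = r"
    unfolding r_def power2_norm_eq_inner inner_vec_def sum_2 by (simp add: power2_eq_square)
  have "r \<ge> 0" by (simp add: r_def)
  then have ne: "r + 1 \<noteq> 0" by linarith
  have "(norm (stereo w))\<^sup>2 = ((r - 1) / (r + 1))\<^sup>2 + (2 * w $ 1 / (r + 1))\<^sup>2 + (2 * w $ 2 / (r + 1))\<^sup>2"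
    unfolding power2_norm_eq_inner[of "stereo w"] inner_vec_def[of "stereo w"] sum_3
    by (simp add: stereo_def r[unfolded power2_eq_square] power2_eq_square)
  also have "\<dots> = ((r - 1)\<^sup>2 + 4 * r) / (r + 1)\<^sup>2"
    by (simp add: power_divide power_mult_distrib add_divide_distrib r_def)
  also have "(r - 1)\<^sup>2 + 4 * r = (r + 1)\<^sup>2"
    by (simp add: power2_eq_square algebra_simps)
  finally have "(norm (stereo w))\<^sup>2 = 1"
    using ne by simp
  then have "norm (stereo w) = 1"
    using norm_ge_zero[of "stereo w"] by (simp add: power2_eq_1_iff)
  then show ?thesis by simp
qed

end

theory Submission
  imports Defs
begin

text \<open>
  Write \<open>B(F, H)\<close> for the integral of \<open>\<sigma>\<^sub>i \<langle>J\<^sub>0 F, H\<rangle>\<close>. By scaling it suffices to show that the energy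
  \<open>\<parallel>F\<parallel>\<^sup>2 + \<parallel>H\<parallel>\<^sup>2 - 4 B(F, H)\<close> of a pair of gradients is nonnegative and vanishes only for \<open>f = h = 0\<close>.
  The energy and the form are conformally invariant. On compactly supported \<open>C\<^sup>1\<close> functions, integration by parts
  turns \<open>B\<close> into an integral over the circles of latitude around the \<open>i\<close>-th axis, where nonnegativity is the
  isoperimetric inequality of Hurwitz. For a pair of zero energy the Euler--Lagrange equations on the sphere become
  \<open>\<Delta>u = 2i R u\<close> for \<open>u = f + i h\<close> and the rotation field \<open>R\<close>. Testing with the monomials \<open>\<zeta>\<^sup>m z\<^sup>k\<close>, where \<open>z = \<sigma>\<^sub>i\<close> and
  \<open>\<zeta>\<close> is one of the conjugate complex combinations of the other two coordinates, gives a recursion for the moments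
  of \<open>u\<close> that forces \<open>u\<close> to be an affine combination of \<open>1\<close> and the conjugate of \<open>\<zeta>\<close>; such a function is square
  integrable on the plane only if it is zero.
\<close>

subsection \<open>Test functions\<close>

text \<open>Coordinates of the sphere are at most 1 in modulus, so the pointwise estimate bounds
  only \<open>2 B\<close> by the two squared norms; the same bound for \<open>4 B\<close> fails
  pointwise near the poles. Hence \<open>4 B\<close> is split into equal halves. One half is
  completed to squares in the frame of the coordinate gradient and the rotation field, which leaves
  exactly the derivatives along the circles of latitude; the other half, integrated by parts, is the
  enclosed-area term of the circle inequality. On the sphere the inequality is not strict: the
  solutions listed above do have zero energy. Strictness comes from the infinite measure of the
  plane near the projection point. Zero-energy pairs have only weak derivatives, so their equations
  are kept in tested form. Tests on the whole sphere are admissible because a point has zero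
  capacity in dimension two, here in the form of cutoffs whose gradients stay bounded in L2. The
  recursion for the moment of degree \<open>n = m + k\<close> has the coefficient
  \<open>n (n + 1) - 2 e m\<close>, with \<open>e\<close> equal to 1 or -1, and this vanishes
  precisely at the two moments that detect the solutions.\<close>

primrec bump_poly :: "nat \<Rightarrow> real poly" where
  "bump_poly 0 = 1"
| "bump_poly (Suc n) = [:0, 0, 1:] * (bump_poly n - pderiv (bump_poly n))"

text \<open>The \<open>n\<close>-th derivative of exp(-1/t), extended by 0. With s = 1/t,
  differentiating p(s) exp(-s) in t gives s^2 (p - p')(s) exp(-s), which is the recursion of
  \<open>bump_poly\<close>.\<close>

definition bump_deriv :: "nat \<Rightarrow> real \<Rightarrow> real" where
  "bump_deriv n t = (if t > 0 then poly (bump_poly n) (1 / t) * exp (- (1 / t)) else 0)"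

lemma poly_times_exp_minus_tendsto_0:
  "((\<lambda>s::real. poly p s * exp (- s)) \<longlongrightarrow> 0) at_top"
proof -
  have "((\<lambda>s. \<Sum>i\<le>degree p. coeff p i * (s ^ i / exp s)) \<longlongrightarrow> (\<Sum>i\<le>degree p. coeff p i * 0)) at_top"
    by (intro tendsto_intros tendsto_power_div_exp_0)
  then show ?thesis
    by (simp add: poly_altdef sum_distrib_left exp_minus divide_inverse mult_ac)
qed

lemma bump_deriv_DERIV: "(bump_deriv n has_real_derivative bump_deriv (Suc n) t) (at t)"
proof (cases t "0 :: real" rule: linorder_cases)
  case less
  have "((\<lambda>_. 0) has_real_derivative bump_deriv (Suc n) t) (at t)"
    using less by (simp add: bump_deriv_def)
  then show ?thesis
    by (rule has_field_derivative_transform_within_open[where S = "{..<0}"])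
       (use less in \<open>auto simp: bump_deriv_def\<close>)
next
  case greater
  have "((\<lambda>t. poly (bump_poly n) (1 / t) * exp (- (1 / t))) has_real_derivative
          bump_deriv (Suc n) t) (at t)"
    using greater
    by (auto intro!: derivative_eq_intros DERIV_chain2[OF poly_DERIV]
             simp: bump_deriv_def field_simps power2_eq_square)
  then show ?thesis
    by (rule has_field_derivative_transform_within_open[where S = "{0<..}"])
       (use greater in \<open>auto simp: bump_deriv_def\<close>)
next
  case equal
  have "((\<lambda>h. bump_deriv n h / h) \<longlongrightarrow> 0) (at_right 0)"
  proof -
    \<comment> \<open>The difference quotient at 0 from the right is s p(s) exp(-s) with s = 1/h;
      \<open>pCons 0\<close> supplies the factor s.\<close>
    have "((\<lambda>h. poly (pCons 0 (bump_poly n)) (inverse h) * exp (- inverse h)) \<longlongrightarrow> 0) (at_right (0::real))"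
      by (rule filterlim_compose[OF poly_times_exp_minus_tendsto_0 filterlim_inverse_at_top_right])
    moreover have "\<forall>\<^sub>F h in at_right (0::real).
        poly (pCons 0 (bump_poly n)) (inverse h) * exp (- inverse h) = bump_deriv n h / h"
      by (rule eventually_at_rightI[of 0 1]) (auto simp: bump_deriv_def field_simps)
    ultimately show ?thesis
      by (rule Lim_transform_eventually)
  qed
  moreover have "((\<lambda>h. bump_deriv n h / h) \<longlongrightarrow> 0) (at_left 0)"
    by (rule tendsto_eventually, rule eventually_at_leftI[of "-1" 0]) (auto simp: bump_deriv_def)
  ultimately have "((\<lambda>h. bump_deriv n h / h) \<longlongrightarrow> 0) (at 0)"
    by (simp add: filterlim_split_at)
  then show ?thesis
    using equal by (simp add: DERIV_def bump_deriv_def)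
qed

lemma bump_deriv_nonneg: "0 \<le> bump_deriv 0 t"
  by (simp add: bump_deriv_def)

lemma continuous_bump_deriv [continuous_intros]:
  "continuous_on S f \<Longrightarrow> continuous_on S (\<lambda>x. bump_deriv n (f x))"
  by (rule continuous_on_compose2[of UNIV "bump_deriv n"])
     (auto intro: DERIV_isCont[OF bump_deriv_DERIV] continuous_at_imp_continuous_on)

lemma GDERIV_imp_continuous_on:
  "(\<And>x. GDERIV f x :> G x) \<Longrightarrow> continuous_on UNIV f"
  unfolding gderiv_def by (meson continuous_at_imp_continuous_on has_derivative_continuous)

lemma C_k_SucI:
  "(\<And>x. GDERIV f x :> F x) \<Longrightarrow> (\<And>b. b \<in> Basis \<Longrightarrow> C_k k (\<lambda>x. F x \<bullet> b)) \<Longrightarrow> C_k (Suc k) f"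
  by auto

lemma C_k_SucE:
  assumes "C_k (Suc k) f"
  obtains F where "\<And>x. GDERIV f x :> F x" "\<And>b. b \<in> Basis \<Longrightarrow> C_k k (\<lambda>x. F x \<bullet> b)"
  using assms by auto

lemma C_k_SucD: "C_k (Suc k) f \<Longrightarrow> C_k k f"
proof (induction k arbitrary: f)
  case 0
  then show ?case by (auto intro: GDERIV_imp_continuous_on)
next
  case (Suc k)
  then obtain G where "\<forall>x. GDERIV f x :> G x" "\<forall>b\<in>Basis. C_k (Suc k) (\<lambda>x. G x \<bullet> b)"
    unfolding C_k.simps(2)[of "Suc k"] by blast
  then show ?case using Suc.IH by (simp del: C_k.simps(2) add: C_k.simps(2)[of k]) blast
qed

lemma C_k_const: "C_k k (\<lambda>_. c)"
  by (induction k arbitrary: c) (auto intro!: exI[of _ "\<lambda>_. 0"] GDERIV_const)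

lemma C_k_add: "C_k k f \<Longrightarrow> C_k k g \<Longrightarrow> C_k k (\<lambda>x. f x + g x)"
proof (induction k arbitrary: f g)
  case (Suc k)
  obtain F where F: "\<And>x. GDERIV f x :> F x" "\<And>b. b \<in> Basis \<Longrightarrow> C_k k (\<lambda>x. F x \<bullet> b)"
    using Suc.prems(1) by (elim C_k_SucE) (rule that, auto)
  obtain G where G: "\<And>x. GDERIV g x :> G x" "\<And>b. b \<in> Basis \<Longrightarrow> C_k k (\<lambda>x. G x \<bullet> b)"
    using Suc.prems(2) by (elim C_k_SucE) (rule that, auto)
  show ?case
    by (rule C_k_SucI[OF GDERIV_add[OF F(1) G(1)]]) (simp add: inner_add_left Suc.IH F G)
qed (auto intro: continuous_intros)

lemma C_k_mult: "C_k k f \<Longrightarrow> C_k k g \<Longrightarrow> C_k k (\<lambda>x. f x * g x)"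
proof (induction k arbitrary: f g)
  case (Suc k)
  have fg: "C_k k f" "C_k k g"
    using Suc.prems C_k_SucD by blast+
  obtain F where F: "\<And>x. GDERIV f x :> F x" "\<And>b. b \<in> Basis \<Longrightarrow> C_k k (\<lambda>x. F x \<bullet> b)"
    using Suc.prems(1) by (elim C_k_SucE) (rule that, auto)
  obtain G where G: "\<And>x. GDERIV g x :> G x" "\<And>b. b \<in> Basis \<Longrightarrow> C_k k (\<lambda>x. G x \<bullet> b)"
    using Suc.prems(2) by (elim C_k_SucE) (rule that, auto)
  show ?case
    by (rule C_k_SucI[OF GDERIV_mult[OF F(1) G(1)]])
       (simp add: inner_add_left C_k_add Suc.IH F G fg)
qed (auto intro: continuous_intros)

lemma C_k_bump: "C_k k q \<Longrightarrow> C_k k (\<lambda>x. bump_deriv n (q x))"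
proof (induction k arbitrary: n q)
  case (Suc k)
  have q: "C_k k q"
    using Suc.prems C_k_SucD by blast
  obtain G where G: "\<And>x. GDERIV q x :> G x" "\<And>b. b \<in> Basis \<Longrightarrow> C_k k (\<lambda>x. G x \<bullet> b)"
    using Suc.prems by (elim C_k_SucE) (rule that, auto)
  show ?case
    by (rule C_k_SucI[OF GDERIV_DERIV_compose[OF G(1) bump_deriv_DERIV]])
       (simp add: C_k_mult Suc.IH q G)
qed (auto intro: continuous_intros)

lemma GDERIV_norm_squared: "GDERIV (\<lambda>y. (norm (a - y))\<^sup>2) y :> 2 *\<^sub>R (y - a)"
  unfolding gderiv_def power2_norm_eq_inner
  by (auto intro!: derivative_eq_intros simp: fun_eq_iff inner_diff_left inner_diff_right inner_commute)

lemma C_k_affine: "C_k k (\<lambda>x. c + d * (x \<bullet> b))"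
proof (cases k)
  case 0
  then show ?thesis by (auto intro!: continuous_intros)
next
  case (Suc k)
  have "GDERIV (\<lambda>x. c + d * (x \<bullet> b)) x :> d *\<^sub>R b" for x
    unfolding gderiv_def by (auto intro!: derivative_eq_intros)
  then show ?thesis
    using Suc by (auto intro!: exI[of _ "\<lambda>_. d *\<^sub>R b"] C_k_const)
qed

definition bump :: "real \<Rightarrow> 'a::euclidean_space \<Rightarrow> real" where
  "bump r z = bump_deriv 0 (r\<^sup>2 - (norm z)\<^sup>2)"

definition bump_grad :: "real \<Rightarrow> 'a::euclidean_space \<Rightarrow> 'a" where
  "bump_grad r z = (- 2 * bump_deriv 1 (r\<^sup>2 - (norm z)\<^sup>2)) *\<^sub>R z"

lemma bump_nonneg: "0 \<le> bump r z"
  by (simp add: bump_def bump_deriv_nonneg)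

lemma bump_eq_0: "norm z \<ge> r \<Longrightarrow> r > 0 \<Longrightarrow> bump r z = 0"
  and bump_grad_eq_0: "norm z \<ge> r \<Longrightarrow> r > 0 \<Longrightarrow> bump_grad r z = 0"
proof -
  assume "norm z \<ge> r" "r > 0"
  then have "\<not> r\<^sup>2 - (norm z)\<^sup>2 > 0"
    using power_mono[of r "norm z" 2] by linarith
  then show "bump r z = 0" "bump_grad r z = 0"
    by (simp_all add: bump_def bump_grad_def bump_deriv_def)
qed

lemma bump_pos: "norm z < r \<Longrightarrow> bump r z > 0"
  using power_strict_mono[of "norm z" r 2] by (simp add: bump_def bump_deriv_def)

lemma continuous_bump: "continuous_on UNIV (bump r)"
  unfolding bump_def[abs_def] by (intro continuous_intros)

lemma continuous_bump_grad: "continuous_on UNIV (bump_grad r)"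
  unfolding bump_grad_def[abs_def] by (intro continuous_intros)

lemma GDERIV_bump_diff: "GDERIV (\<lambda>y. bump r (x - y)) y :> - bump_grad r (x - y)"
proof -
  have "GDERIV (\<lambda>y. r\<^sup>2 - (norm (x - y))\<^sup>2) y :> 0 - 2 *\<^sub>R (y - x)"
    by (intro GDERIV_diff GDERIV_const GDERIV_norm_squared)
  from GDERIV_DERIV_compose[OF this bump_deriv_DERIV[of 0]] show ?thesis
    by (simp add: bump_def[abs_def] bump_grad_def algebra_simps)
qed

lemma GDERIV_bump: "GDERIV (bump r) z :> bump_grad r z"
proof -
  have "GDERIV (\<lambda>z. r\<^sup>2 - (norm (0 - z))\<^sup>2) z :> 0 - 2 *\<^sub>R (z - 0)"
    by (intro GDERIV_diff GDERIV_const GDERIV_norm_squared)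
  from GDERIV_DERIV_compose[OF this bump_deriv_DERIV[of 0]] show ?thesis
    by (simp add: bump_def[abs_def] bump_grad_def algebra_simps)
qed

lemma test_function_bump:
  assumes "r > 0"
  shows "test_function (\<lambda>y. bump r (x - y))"
proof -
  have q: "C_k k (\<lambda>y. r\<^sup>2 - (norm (x - y))\<^sup>2)" for k
  proof (cases k)
    case 0
    then show ?thesis by (auto intro!: continuous_intros)
  next
    case (Suc k)
    have "GDERIV (\<lambda>y. r\<^sup>2 - (norm (x - y))\<^sup>2) y :> 0 - 2 *\<^sub>R (y - x)" for y
      by (intro GDERIV_diff GDERIV_const GDERIV_norm_squared)
    moreover have "C_k k (\<lambda>y. (0 - 2 *\<^sub>R (y - x)) \<bullet> b)" for b
      using C_k_affine[of k "2 * (x \<bullet> b)" "-2" b] by (simp add: inner_diff_left algebra_simps)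
    ultimately show ?thesis
      unfolding Suc by (rule C_k_SucI)
  qed
  have "{y. bump r (x - y) \<noteq> 0} \<subseteq> cball x r"
    using bump_eq_0[of r "x - _", OF less_imp_le assms] by (auto simp: dist_norm simp flip: not_less)
  then have "bounded {y. bump r (x - y) \<noteq> 0}"
    using bounded_cball bounded_subset by blast
  then have "compact (closure {y. bump r (x - y) \<noteq> 0})"
    by (simp add: compact_closure)
  then show ?thesis
    unfolding test_function_def bump_def using C_k_bump[OF q] by blast
qed

subsection \<open>Square integrable functions\<close>

text \<open>Square integrability for Borel functions and the uncompleted measure, so that product
  measures, translations and image measures apply directly. Classes in \<open>L2\<close> enter
  through Borel representatives.\<close>

definition sqint :: "('a::euclidean_space \<Rightarrow> 'b::euclidean_space) \<Rightarrow> bool" where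
  "sqint f \<longleftrightarrow> f \<in> borel_measurable lborel \<and> integrable lborel (\<lambda>x. (norm (f x))\<^sup>2)"

lemma sqint_measurable [measurable_dest]: "sqint f \<Longrightarrow> f \<in> borel_measurable borel"
  by (simp add: sqint_def)

lemma sqint_integrable: "sqint f \<Longrightarrow> integrable lborel (\<lambda>x. (norm (f x))\<^sup>2)"
  by (simp add: sqint_def)

lemma sqint_mono:
  assumes "sqint f" "g \<in> borel_measurable lborel" "AE x in lborel. norm (g x) \<le> C * norm (f x)"
  shows "sqint g"
  unfolding sqint_def
proof
  show "integrable lborel (\<lambda>x. (norm (g x))\<^sup>2)"
  proof (rule Bochner_Integration.integrable_bound)
    show "integrable lborel (\<lambda>x. C\<^sup>2 * (norm (f x))\<^sup>2)"
      using assms(1) by (simp add: sqint_def)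
    show "(\<lambda>x. (norm (g x))\<^sup>2) \<in> borel_measurable lborel"
      using assms(2) by measurable
    show "AE x in lborel. norm ((norm (g x))\<^sup>2) \<le> norm (C\<^sup>2 * (norm (f x))\<^sup>2)"
      using assms(3)
    proof eventually_elim
      case (elim x)
      have "(norm (g x))\<^sup>2 \<le> (C * norm (f x))\<^sup>2"
        using elim by (rule power_mono) simp
      then show ?case
        by (simp add: power_mult_distrib)
    qed
  qed
qed (rule assms)

lemma norm_add_squared_le:
  fixes x y :: "'a::real_inner"
  shows "(norm (x + y))\<^sup>2 \<le> 2 * (norm x)\<^sup>2 + 2 * (norm y)\<^sup>2"
proof -
  have "0 \<le> (norm (x - y))\<^sup>2" by simp
  then show ?thesis
    by (simp add: power2_norm_eq_inner inner_add_left inner_add_right inner_diff_left inner_diff_right inner_commute)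
qed

lemma sqint_add:
  assumes "sqint f" "sqint g"
  shows "sqint (\<lambda>x. f x + g x)"
  unfolding sqint_def
proof
  have [measurable]: "f \<in> borel_measurable lborel" "g \<in> borel_measurable lborel"
    using assms by (simp_all add: sqint_def)
  show "(\<lambda>x. f x + g x) \<in> borel_measurable lborel" by measurable
  show "integrable lborel (\<lambda>x. (norm (f x + g x))\<^sup>2)"
  proof (rule Bochner_Integration.integrable_bound)
    show "integrable lborel (\<lambda>x. 2 * (norm (f x))\<^sup>2 + 2 * (norm (g x))\<^sup>2)"
      using assms by (simp add: sqint_def)
  qed (auto simp: norm_add_squared_le)
qed

lemma sqint_scaleR: "sqint f \<Longrightarrow> sqint (\<lambda>x. c *\<^sub>R f x)"
  by (rule sqint_mono[where C = "\<bar>c\<bar>"]) (auto simp: sqint_def)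

lemma sqint_cmult: "sqint f \<Longrightarrow> sqint (\<lambda>x. c * f x)" for f :: "_ \<Rightarrow> real"
  using sqint_scaleR[of f c] by simp

lemma sqint_minus: "sqint f \<Longrightarrow> sqint (\<lambda>x. - f x)"
  using sqint_scaleR[of f "-1"] by simp

lemma sqint_diff: "sqint f \<Longrightarrow> sqint g \<Longrightarrow> sqint (\<lambda>x. f x - g x)"
  using sqint_add[of f "\<lambda>x. - g x"] sqint_minus[of g] by simp

lemma sqint_norm: "sqint f \<Longrightarrow> sqint (\<lambda>x. norm (f x))"
  by (rule sqint_mono[where C = 1 and f = f]) (auto simp: sqint_def)

lemma integrable_inner_sqint:
  assumes "sqint f" "sqint g"
  shows "integrable lborel (\<lambda>x. f x \<bullet> g x)"
proof (rule Bochner_Integration.integrable_bound)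
  have [measurable]: "f \<in> borel_measurable lborel" "g \<in> borel_measurable lborel"
    using assms by (simp_all add: sqint_def)
  show "(\<lambda>x. f x \<bullet> g x) \<in> borel_measurable lborel" by measurable
  show "integrable lborel (\<lambda>x. (norm (f x))\<^sup>2 + (norm (g x))\<^sup>2)"
    using assms by (simp add: sqint_def)
  have "\<bar>f x \<bullet> g x\<bar> \<le> (norm (f x))\<^sup>2 + (norm (g x))\<^sup>2" for x
    using Cauchy_Schwarz_ineq2[of "f x" "g x"] sum_squares_bound[of "norm (f x)" "norm (g x)"]
      mult_nonneg_nonneg[of "norm (f x)" "norm (g x)"] by (simp add: power2_eq_square)
  then show "AE x in lborel. norm (f x \<bullet> g x) \<le> norm ((norm (f x))\<^sup>2 + (norm (g x))\<^sup>2)"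
    by simp
qed

lemma integrable_mult_sqint:
  "sqint f \<Longrightarrow> sqint g \<Longrightarrow> integrable lborel (\<lambda>x. f x * g x)" for f :: "_ \<Rightarrow> real"
  using integrable_inner_sqint[of f g] by simp

definition sqnorm :: "('a::euclidean_space \<Rightarrow> 'b::euclidean_space) \<Rightarrow> real" where
  "sqnorm f = (LINT x|lborel. (norm (f x))\<^sup>2)"

lemma sqnorm_nonneg: "0 \<le> sqnorm f"
  unfolding sqnorm_def by (intro Bochner_Integration.integral_nonneg) simp

lemma sqnorm_add_le:
  assumes "sqint f" "sqint g"
  shows "sqnorm (\<lambda>x. f x + g x) \<le> 2 * sqnorm f + 2 * sqnorm g"
proof -
  have "sqnorm (\<lambda>x. f x + g x) \<le> (LINT x|lborel. 2 * (norm (f x))\<^sup>2 + 2 * (norm (g x))\<^sup>2)"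
    unfolding sqnorm_def
    using assms sqint_add[OF assms]
    by (intro integral_mono) (auto simp: sqint_def norm_add_squared_le)
  then show ?thesis
    using assms by (simp add: sqnorm_def sqint_def)
qed

lemma sqnorm_scaleR: "sqnorm (\<lambda>x. c *\<^sub>R f x) = c\<^sup>2 * sqnorm f"
  by (simp add: sqnorm_def power_mult_distrib)

lemma sqnorm_diff_commute: "sqnorm (\<lambda>x. f x - g x) = sqnorm (\<lambda>x. g x - f x)"
  by (simp add: sqnorm_def norm_minus_commute)

lemma sqnorm_triangle:
  assumes "sqint f" "sqint g" "sqint h"
  shows "sqnorm (\<lambda>x. f x - h x) \<le> 2 * sqnorm (\<lambda>x. f x - g x) + 2 * sqnorm (\<lambda>x. g x - h x)"
  using sqnorm_add_le[OF sqint_diff[OF assms(1,2)] sqint_diff[OF assms(2,3)]] by simp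

lemma sqnorm_mono:
  assumes "sqint f" "g \<in> borel_measurable lborel" "AE x in lborel. norm (g x) \<le> C * norm (f x)"
  shows "sqnorm g \<le> C\<^sup>2 * sqnorm f"
proof -
  have "sqnorm g \<le> (LINT x|lborel. C\<^sup>2 * (norm (f x))\<^sup>2)"
    unfolding sqnorm_def
  proof (rule integral_mono_AE)
    show "integrable lborel (\<lambda>x. (norm (g x))\<^sup>2)"
      using sqint_mono[OF assms] by (rule sqint_integrable)
    show "integrable lborel (\<lambda>x. C\<^sup>2 * (norm (f x))\<^sup>2)"
      using assms(1) by (simp add: sqint_def)
    show "AE x in lborel. (norm (g x))\<^sup>2 \<le> C\<^sup>2 * (norm (f x))\<^sup>2"
      using assms(3)
    proof eventually_elim
      case (elim x)
      have "(norm (g x))\<^sup>2 \<le> (C * norm (f x))\<^sup>2"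
        using elim by (rule power_mono) simp
      then show ?case
        by (simp add: power_mult_distrib)
    qed
  qed
  then show ?thesis by (simp add: sqnorm_def)
qed

lemma quadratic_nonneg_imp:
  fixes A B C :: real
  assumes "\<And>t. 0 \<le> A + 2 * t * C + t\<^sup>2 * B" "B \<ge> 0"
  shows "C\<^sup>2 \<le> A * B"
proof (cases "B = 0")
  case True
  have "C = 0"
  proof (rule ccontr)
    assume "C \<noteq> 0"
    then show False
      \<comment> \<open>With \<open>B = 0\<close> the polynomial is affine in \<open>t\<close>, and
        this choice of \<open>t\<close> gives it the value -1.\<close>
      using assms(1)[of "- (A + 1) / (2 * C)"] True by (simp add: field_simps)
  qed
  with True show ?thesis by simp
next
  case False
  then show ?thesis
    using assms(1)[of "- C / B"] assms(2)
    by (simp add: field_simps power2_eq_square)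
qed

lemma sqnorm_linear_combination:
  assumes "sqint f" "sqint g"
  shows "sqnorm (\<lambda>x. f x + t *\<^sub>R g x) =
           sqnorm f + 2 * t * (LINT x|lborel. f x \<bullet> g x) + t\<^sup>2 * sqnorm g"
proof -
  have "(norm (f x + t *\<^sub>R g x))\<^sup>2 = (norm (f x))\<^sup>2 + 2 * t * (f x \<bullet> g x) + t\<^sup>2 * (norm (g x))\<^sup>2" for x
    unfolding power2_norm_eq_inner
    by (simp add: inner_add_left inner_add_right inner_commute power2_eq_square algebra_simps)
  then show ?thesis
    using assms integrable_inner_sqint[OF assms] by (simp add: sqnorm_def sqint_def)
qed

lemma Cauchy_Schwarz_sqint:
  assumes "sqint f" "sqint g"
  shows "\<bar>LINT x|lborel. f x \<bullet> g x\<bar> \<le> sqrt (sqnorm f) * sqrt (sqnorm g)"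
proof -
  have "(LINT x|lborel. f x \<bullet> g x)\<^sup>2 \<le> sqnorm f * sqnorm g"
  proof (rule quadratic_nonneg_imp[OF _ sqnorm_nonneg])
    show "0 \<le> sqnorm f + 2 * t * (LINT x|lborel. f x \<bullet> g x) + t\<^sup>2 * sqnorm g" for t
      using sqnorm_nonneg[of "\<lambda>x. f x + t *\<^sub>R g x"] sqnorm_linear_combination[OF assms] by simp
  qed
  from real_sqrt_le_mono[OF this] show ?thesis
    by (simp add: real_sqrt_mult)
qed

section \<open>Convergence in mean square\<close>

definition L2lim :: "(nat \<Rightarrow> 'a::euclidean_space \<Rightarrow> 'b::euclidean_space) \<Rightarrow> ('a \<Rightarrow> 'b) \<Rightarrow> bool" where
  "L2lim fs f \<longleftrightarrow> (\<forall>n. sqint (fs n)) \<and> sqint f \<and> (\<lambda>n. sqnorm (\<lambda>x. fs n x - f x)) \<longlonglongrightarrow> 0"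

lemma L2limD:
  assumes "L2lim fs f"
  shows "sqint (fs n)" "sqint f" "(\<lambda>n. sqnorm (\<lambda>x. fs n x - f x)) \<longlonglongrightarrow> 0"
  using assms by (auto simp: L2lim_def)

lemma L2lim_const: "sqint f \<Longrightarrow> L2lim (\<lambda>_. f) f"
  by (simp add: L2lim_def sqnorm_def)

lemma L2lim_add:
  assumes "L2lim fs f" "L2lim gs g"
  shows "L2lim (\<lambda>n x. fs n x + gs n x) (\<lambda>x. f x + g x)"
  unfolding L2lim_def
proof (intro conjI allI)
  show "(\<lambda>n. sqnorm (\<lambda>x. fs n x + gs n x - (f x + g x))) \<longlonglongrightarrow> 0"
  proof (rule tendsto_sandwich[OF _ _ tendsto_const])
    show "\<forall>\<^sub>F n in sequentially. 0 \<le> sqnorm (\<lambda>x. fs n x + gs n x - (f x + g x))"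
      by (simp add: sqnorm_nonneg)
    have "sqnorm (\<lambda>x. fs n x + gs n x - (f x + g x)) \<le>
        2 * sqnorm (\<lambda>x. fs n x - f x) + 2 * sqnorm (\<lambda>x. gs n x - g x)" for n
      using sqnorm_add_le[OF sqint_diff[OF L2limD(1,2)[OF assms(1)]] sqint_diff[OF L2limD(1,2)[OF assms(2)]]]
      by (simp add: algebra_simps)
    then show "\<forall>\<^sub>F n in sequentially. sqnorm (\<lambda>x. fs n x + gs n x - (f x + g x)) \<le>
        2 * sqnorm (\<lambda>x. fs n x - f x) + 2 * sqnorm (\<lambda>x. gs n x - g x)" by simp
    show "(\<lambda>n. 2 * sqnorm (\<lambda>x. fs n x - f x) + 2 * sqnorm (\<lambda>x. gs n x - g x)) \<longlonglongrightarrow> 0"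
      using assms by (auto intro!: tendsto_eq_intros simp: L2lim_def)
  qed
qed (use assms in \<open>auto simp: L2lim_def intro: sqint_add\<close>)

lemma L2lim_bounded_image:
  assumes "L2lim fs f" "\<And>n. gs n \<in> borel_measurable lborel" "sqint g"
    and "\<And>n x. norm (gs n x - g x) \<le> C * norm (fs n x - f x)"
  shows "L2lim gs g"
  unfolding L2lim_def
proof (intro conjI allI)
  have [measurable]: "g \<in> borel_measurable lborel" using assms(3) by (simp add: sqint_def)
  note [measurable] = assms(2)
  have d: "sqint (\<lambda>x. fs n x - f x)" for n
    using L2limD[OF assms(1)] sqint_diff by blast
  have "sqint (\<lambda>x. gs n x - g x)" for n
    by (rule sqint_mono[OF d[of n], where C = C]) (auto simp: assms(4))
  from sqint_add[OF this assms(3)] show "sqint (gs n)" for n by simp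
  show "(\<lambda>n. sqnorm (\<lambda>x. gs n x - g x)) \<longlonglongrightarrow> 0"
  proof (rule tendsto_sandwich[OF _ _ tendsto_const])
    show "\<forall>\<^sub>F n in sequentially. 0 \<le> sqnorm (\<lambda>x. gs n x - g x)"
      by (simp add: sqnorm_nonneg)
    have "sqnorm (\<lambda>x. gs n x - g x) \<le> C\<^sup>2 * sqnorm (\<lambda>x. fs n x - f x)" for n
      by (rule sqnorm_mono[OF d]) (auto simp: assms(4))
    then show "\<forall>\<^sub>F n in sequentially. sqnorm (\<lambda>x. gs n x - g x) \<le> C\<^sup>2 * sqnorm (\<lambda>x. fs n x - f x)"
      by simp
    show "(\<lambda>n. C\<^sup>2 * sqnorm (\<lambda>x. fs n x - f x)) \<longlonglongrightarrow> 0"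
      using assms by (auto intro!: tendsto_eq_intros simp: L2lim_def)
  qed
qed fact

text \<open>Writing each factor as limit plus error leaves three cross terms, all controlled by
  Cauchy-Schwarz. Passages from smooth functions to Sobolev functions in bilinear integrals rest on
  this.\<close>

lemma L2lim_inner:
  fixes f :: "'a::euclidean_space \<Rightarrow> 'b::euclidean_space"
  assumes "L2lim fs f" "L2lim gs g"
  shows "(\<lambda>n. LINT x|lborel. fs n x \<bullet> gs n x) \<longlonglongrightarrow> (LINT x|lborel. f x \<bullet> g x)"
proof -
  note F = L2limD[OF assms(1)] and G = L2limD[OF assms(2)]
  have Fd: "sqint (\<lambda>x. fs n x - f x)" and Gd: "sqint (\<lambda>x. gs n x - g x)" for n
    using F G sqint_diff by blast+
  have add4: "(LINT x|lborel. a x + b x + c x + d x) =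
      (LINT x|lborel. a x) + (LINT x|lborel. b x) + (LINT x|lborel. c x) + (LINT x|lborel. d x)"
    if "integrable lborel a" "integrable lborel b" "integrable lborel c" "integrable lborel d"
    for a b c d :: "'a \<Rightarrow> real"
    using that by simp
  let ?a = "\<lambda>n. sqrt (sqnorm (\<lambda>x. fs n x - f x))" and ?b = "\<lambda>n. sqrt (sqnorm (\<lambda>x. gs n x - g x))"
  have bound: "\<bar>(LINT x|lborel. fs n x \<bullet> gs n x) - (LINT x|lborel. f x \<bullet> g x)\<bar> \<le>
      ?a n * ?b n + ?a n * sqrt (sqnorm g) + sqrt (sqnorm f) * ?b n" for n
  proof -
    have "(LINT x|lborel. fs n x \<bullet> gs n x) = (LINT x|lborel. (fs n x - f x) \<bullet> (gs n x - g x)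
        + (fs n x - f x) \<bullet> g x + f x \<bullet> (gs n x - g x) + f x \<bullet> g x)"
      by (simp add: inner_diff_left inner_diff_right)
    also have "\<dots> = (LINT x|lborel. (fs n x - f x) \<bullet> (gs n x - g x))
        + (LINT x|lborel. (fs n x - f x) \<bullet> g x) + (LINT x|lborel. f x \<bullet> (gs n x - g x))
        + (LINT x|lborel. f x \<bullet> g x)"
      by (rule add4) (intro integrable_inner_sqint Fd Gd F(2) G(2))+
    finally show ?thesis
      using Cauchy_Schwarz_sqint[OF Fd[of n] Gd[of n]] Cauchy_Schwarz_sqint[OF Fd[of n] G(2)]
        Cauchy_Schwarz_sqint[OF F(2) Gd[of n]] by linarith
  qed
  have lim: "(\<lambda>n. ?a n * ?b n + ?a n * sqrt (sqnorm g) + sqrt (sqnorm f) * ?b n) \<longlonglongrightarrow>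
      sqrt 0 * sqrt 0 + sqrt 0 * sqrt (sqnorm g) + sqrt (sqnorm f) * sqrt 0"
    by (intro tendsto_intros F(3) G(3))
  have "(\<lambda>n. (LINT x|lborel. fs n x \<bullet> gs n x) - (LINT x|lborel. f x \<bullet> g x)) \<longlonglongrightarrow> 0"
  proof (rule Lim_null_comparison)
    show "\<forall>\<^sub>F n in sequentially. norm ((LINT x|lborel. fs n x \<bullet> gs n x) - (LINT x|lborel. f x \<bullet> g x)) \<le>
        ?a n * ?b n + ?a n * sqrt (sqnorm g) + sqrt (sqnorm f) * ?b n"
      unfolding real_norm_def by (intro always_eventually allI bound)
    show "(\<lambda>n. ?a n * ?b n + ?a n * sqrt (sqnorm g) + sqrt (sqnorm f) * ?b n) \<longlonglongrightarrow> 0"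
      using lim by (simp only: real_sqrt_zero mult_zero_left mult_zero_right add_0)
  qed
  then show ?thesis
    by (rule LIM_zero_cancel)
qed

lemma L2lim_sqnorm: "L2lim fs f \<Longrightarrow> (\<lambda>n. sqnorm (fs n)) \<longlonglongrightarrow> sqnorm f"
  using L2lim_inner[of fs f fs f] by (simp add: sqnorm_def power2_norm_eq_inner)

lemma L2lim_dominated:
  fixes f :: "'a::euclidean_space \<Rightarrow> 'b::euclidean_space"
  assumes "AE x in lborel. (\<lambda>n. fs n x) \<longlonglongrightarrow> f x" "sqint w"
    and "\<And>n. AE x in lborel. norm (fs n x) \<le> norm (w x)"
    and [measurable]: "\<And>n. fs n \<in> borel_measurable lborel" "f \<in> borel_measurable lborel"
  shows "L2lim fs f"
  unfolding L2lim_def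
proof (intro conjI allI)
  have fw: "AE x in lborel. norm (f x) \<le> norm (w x)"
  proof -
    have "AE x in lborel. \<forall>n. norm (fs n x) \<le> norm (w x)"
      using assms(3) by (simp add: AE_all_countable)
    with assms(1) show ?thesis
    proof eventually_elim
      case (elim x)
      then show ?case by (intro tendsto_upperbound[OF tendsto_norm]) auto
    qed
  qed
  show "sqint (fs n)" for n
    using assms(2) by (rule sqint_mono[where C = 1]) (use assms(3)[of n] in auto)
  show "sqint f"
    using assms(2) by (rule sqint_mono[where C = 1]) (use fw in auto)
  have "(\<lambda>n. sqnorm (\<lambda>x. fs n x - f x)) \<longlonglongrightarrow> (LINT x|(lborel :: 'a measure). (0::real))"
    unfolding sqnorm_def
  proof (rule integral_dominated_convergence)
    show "integrable lborel (\<lambda>x. 4 * (norm (w x))\<^sup>2)"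
      using assms(2) by (simp add: sqint_def)
    show "AE x in lborel. (\<lambda>n. (norm (fs n x - f x))\<^sup>2) \<longlonglongrightarrow> 0"
      using assms(1)
    proof eventually_elim
      case (elim x)
      have "(\<lambda>n. (norm (fs n x - f x))\<^sup>2) \<longlonglongrightarrow> (norm (f x - f x))\<^sup>2"
        by (intro tendsto_intros elim)
      then show ?case by simp
    qed
    show "AE x in lborel. norm ((norm (fs n x - f x))\<^sup>2) \<le> 4 * (norm (w x))\<^sup>2" for n
      using assms(3)[of n] fw
    proof eventually_elim
      case (elim x)
      have "norm (fs n x - f x) \<le> 2 * norm (w x)"
        using elim norm_triangle_ineq4[of "fs n x" "f x"] by linarith
      then have "(norm (fs n x - f x))\<^sup>2 \<le> (2 * norm (w x))\<^sup>2"
        by (rule power_mono) simp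
      then show ?case by (simp add: power_mult_distrib)
    qed
  qed measurable
  then show "(\<lambda>n. sqnorm (\<lambda>x. fs n x - f x)) \<longlonglongrightarrow> 0" by simp
qed

lemma AE_not_negligible:
  assumes "negligible N"
  shows "AE x in lborel. x \<notin> N"
proof -
  have "AE x in lebesgue. x \<notin> N"
    using assms by (simp add: negligible_iff_null_sets AE_not_in)
  then show ?thesis
    by (simp add: AE_completion_iff)
qed

lemma integrable_indicator_cball:
  "integrable lborel (indicator (cball c R) :: 'a::euclidean_space \<Rightarrow> real)"
  using emeasure_bounded_finite[OF bounded_cball, of c R] by (intro integrable_real_indicator) auto

lemma integrable_bounded_support:
  fixes f :: "'a::euclidean_space \<Rightarrow> 'b::euclidean_space"
  assumes [measurable]: "f \<in> borel_measurable borel"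
    and "\<And>x. norm (f x) \<le> B" "\<And>x. norm x > R \<Longrightarrow> f x = 0"
  shows "integrable lborel f"
proof (rule Bochner_Integration.integrable_bound)
  show "integrable lborel (\<lambda>x. indicator (cball 0 R) x *\<^sub>R B)"
    by (intro integrable_scaleR_left integrable_indicator_cball)
  show "AE x in lborel. norm (f x) \<le> norm (indicator (cball 0 R) x *\<^sub>R B)"
    using assms(2,3) by (auto simp: indicator_def intro: order_trans[OF _ abs_ge_self])
qed measurable

lemma sqint_bounded_support:
  fixes f :: "'a::euclidean_space \<Rightarrow> 'b::euclidean_space"
  assumes [measurable]: "f \<in> borel_measurable borel"
    and "\<And>x. norm (f x) \<le> B" "\<And>x. norm x > R \<Longrightarrow> f x = 0"
  shows "sqint f"
  unfolding sqint_def
  using assms by (auto intro!: integrable_bounded_support[of _ "B\<^sup>2" R] power_mono)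

text \<open>A measurable function is an almost everywhere limit of continuous functions. Projecting
  their values onto the ball of radius \<open>B\<close> and multiplying by a radial cutoff enforces
  the bound and the support, and does not move the limit, which already satisfies both.\<close>

lemma Cc_approx_bounded:
  fixes f :: "'a::euclidean_space \<Rightarrow> 'b::euclidean_space"
  assumes "f \<in> borel_measurable borel"
    and B: "\<And>x. norm (f x) \<le> B" and R: "\<And>x. norm x > R \<Longrightarrow> f x = 0"
  obtains g where "\<And>n. continuous_on UNIV (g n)" "\<And>n x. norm (g n x) \<le> B"
    "\<And>n x. norm x > R + 1 \<Longrightarrow> g n x = 0" "AE x in lborel. (\<lambda>n. g n x) \<longlonglongrightarrow> f x"
proof -
  have B0: "0 \<le> B"
    using B[of 0] norm_ge_zero order_trans by blast
  have "f \<in> borel_measurable lebesgue"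
    using assms(1) by (simp add: measurable_completion)
  then have "f measurable_on UNIV"
    by (subst measurable_on_iff_borel_measurable) (auto simp: lebesgue_on_UNIV_eq)
  then obtain N h where N: "negligible N" and h: "\<And>n. continuous_on UNIV (h n)"
      and lim: "\<And>x. x \<notin> N \<Longrightarrow> (\<lambda>n. h n x) \<longlonglongrightarrow> f x"
    by (auto simp: measurable_on_def)
  let ?P = "closest_point (cball (0::'b) B)" and ?c = "\<lambda>x::'a. max 0 (min 1 (R + 1 - norm x))"
  have ne: "cball (0::'b) B \<noteq> {}" using B0 by simp
  have contP: "continuous_on UNIV ?P"
    by (rule continuous_on_closest_point) (use ne in auto)
  have normP: "norm (?P y) \<le> B" for y
    using closest_point_in_set[of "cball 0 B" y] ne by simp
  show ?thesis
  proof (rule that[of "\<lambda>n x. ?c x *\<^sub>R ?P (h n x)"])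
    show "continuous_on UNIV (\<lambda>x. ?c x *\<^sub>R ?P (h n x))" for n
      by (intro continuous_intros continuous_on_compose2[OF contP h]) auto
    show "norm (?c x *\<^sub>R ?P (h n x)) \<le> B" for n x
    proof -
      have "\<bar>?c x\<bar> * norm (?P (h n x)) \<le> 1 * B"
        by (intro mult_mono normP) auto
      then show ?thesis by simp
    qed
    show "?c x *\<^sub>R ?P (h n x) = 0" if "norm x > R + 1" for n x
      using that by simp
    show "AE x in lborel. (\<lambda>n. ?c x *\<^sub>R ?P (h n x)) \<longlonglongrightarrow> f x"
      using AE_not_negligible[OF N]
    proof eventually_elim
      case (elim x)
      have "(\<lambda>n. ?P (h n x)) \<longlonglongrightarrow> ?P (f x)"
        by (rule continuous_on_tendsto_compose[OF contP lim[OF elim]]) auto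
      moreover have "?P (f x) = f x"
        by (rule closest_point_self) (use B in auto)
      ultimately have "(\<lambda>n. ?c x *\<^sub>R ?P (h n x)) \<longlonglongrightarrow> ?c x *\<^sub>R f x"
        by (intro tendsto_intros) simp
      moreover have "?c x *\<^sub>R f x = f x"
        using R[of x] by (cases "norm x > R") auto
      ultimately show ?case by simp
    qed
  qed
qed

lemma Cc_dense:
  fixes f :: "'a::euclidean_space \<Rightarrow> 'b::euclidean_space"
  assumes f: "sqint f" and e: "e > 0"
  obtains g R B where "continuous_on UNIV g" "\<And>x. norm x > R \<Longrightarrow> g x = 0" "\<And>x. norm (g x) \<le> B"
    "sqint g" "sqnorm (\<lambda>x. f x - g x) < e"
proof -
  have [measurable]: "f \<in> borel_measurable borel" using f by (rule sqint_measurable)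
  define fk where "fk k x = (if norm x \<le> real k \<and> norm (f x) \<le> real k then f x else 0)" for k x
  have [measurable]: "fk k \<in> borel_measurable borel" for k
    unfolding fk_def by measurable
  have "L2lim fk f"
  proof (rule L2lim_dominated[OF _ f])
    have "(\<lambda>k. fk k x) \<longlonglongrightarrow> f x" for x
    proof (rule tendsto_eventually)
      have "\<forall>\<^sub>F k in sequentially. max (norm x) (norm (f x)) \<le> real k"
        using filterlim_real_sequentially by (simp only: filterlim_at_top)
      then show "\<forall>\<^sub>F k in sequentially. fk k x = f x"
        by eventually_elim (simp add: fk_def)
    qed
    then show "AE x in lborel. (\<lambda>k. fk k x) \<longlonglongrightarrow> f x" by simp
  qed (auto simp: fk_def)
  note fk = L2limD[OF this]
  have "\<forall>\<^sub>F k in sequentially. sqnorm (\<lambda>x. fk k x - f x) < e / 4"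
    using order_tendstoD(2)[OF fk(3), of "e / 4"] e by simp
  then obtain k where k: "sqnorm (\<lambda>x. fk k x - f x) < e / 4"
    by (auto dest: eventually_happens)
  obtain g where g: "\<And>n. continuous_on UNIV (g n)" "\<And>n x. norm (g n x) \<le> real k"
    "\<And>n x. norm x > real k + 1 \<Longrightarrow> g n x = 0" "AE x in lborel. (\<lambda>n. g n x) \<longlonglongrightarrow> fk k x"
    by (rule Cc_approx_bounded[of "fk k" "real k" "real k"]) (auto simp: fk_def)
  have [measurable]: "g n \<in> borel_measurable borel" for n
    by (rule borel_measurable_continuous_onI) (rule g)
  have gs: "sqint (g n)" for n
    by (rule sqint_bounded_support[OF _ g(2,3)]) auto
  let ?w = "\<lambda>x::'a. indicator (cball 0 (real k + 1)) x * real k"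
  have "L2lim g (fk k)"
  proof (rule L2lim_dominated[OF g(4)])
    show "sqint ?w"
      by (rule sqint_bounded_support[where B = k and R = "real k + 1"]) (auto simp: indicator_def)
    show "AE x in lborel. norm (g n x) \<le> norm (?w x)" for n
      using g(2,3)[where n = n] by (auto simp: indicator_def)
  qed auto
  then have "(\<lambda>n. sqnorm (\<lambda>x. g n x - fk k x)) \<longlonglongrightarrow> 0"
    by (rule L2limD)
  then have "\<forall>\<^sub>F n in sequentially. sqnorm (\<lambda>x. g n x - fk k x) < e / 4"
    using e by (intro order_tendstoD(2)) auto
  then obtain n where n: "sqnorm (\<lambda>x. g n x - fk k x) < e / 4"
    by (auto dest: eventually_happens)
  have "sqnorm (\<lambda>x. f x - g n x) < e"
    using sqnorm_triangle[OF fk(2,1) gs, of n k] k n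
    by (simp add: sqnorm_diff_commute[of f "fk k"] sqnorm_diff_commute[of "fk k" "g n"])
  with that[of "g n" "real k + 1" "real k"] g gs show ?thesis by blast
qed

lemma integral_lborel_translate:
  fixes f :: "'a::euclidean_space \<Rightarrow> 'b::euclidean_space"
  assumes [measurable]: "f \<in> borel_measurable borel"
  shows "(LINT x|lborel. f (c + x)) = (LINT x|lborel. f x)"
    and "integrable lborel (\<lambda>x. f (c + x)) \<longleftrightarrow> integrable lborel f"
  using integral_distr[of "(+) c" lborel borel f] integrable_distr_eq[of "(+) c" lborel borel f]
  by (simp_all add: lborel_distr_plus)

lemma integral_lborel_reflect:
  fixes f :: "'a::euclidean_space \<Rightarrow> 'b::euclidean_space"
  assumes [measurable]: "f \<in> borel_measurable borel"
  shows "(LINT x|lborel. f (c - x)) = (LINT x|lborel. f x)"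
    and "integrable lborel (\<lambda>x. f (c - x)) \<longleftrightarrow> integrable lborel f"
  using integral_distr[of "\<lambda>x. c + (-1) *\<^sub>R x" lborel borel f] integrable_distr_eq[of "\<lambda>x. c + (-1) *\<^sub>R x" lborel borel f]
    lborel_affine[of "-1" c]
  by (simp_all add: density_1)

lemma sqnorm_translate:
  assumes "sqint f"
  shows "sqint (\<lambda>x. f (x - z))" "sqnorm (\<lambda>x. f (x - z)) = sqnorm f"
proof -
  have [measurable]: "f \<in> borel_measurable borel" using assms by (rule sqint_measurable)
  show "sqint (\<lambda>x. f (x - z))" "sqnorm (\<lambda>x. f (x - z)) = sqnorm f"
    using assms integral_lborel_translate[of "\<lambda>x. (norm (f x))\<^sup>2" "- z"]
    by (simp_all add: sqint_def sqnorm_def)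
qed

lemma Cc_uniformly_continuous:
  fixes g :: "'a::euclidean_space \<Rightarrow> 'b::euclidean_space"
  assumes g: "continuous_on UNIV g" "\<And>x. norm x > R \<Longrightarrow> g x = 0" and e: "e > 0"
  obtains d where "d > 0" "\<And>x y. norm (x - y) < d \<Longrightarrow> norm (g x - g y) < e"
proof -
  have "uniformly_continuous_on (cball 0 (R + 2)) g"
    by (rule compact_uniformly_continuous) (auto intro: continuous_on_subset[OF g(1)])
  then obtain d where d: "d > 0"
      "\<And>x y. x \<in> cball 0 (R + 2) \<Longrightarrow> y \<in> cball 0 (R + 2) \<Longrightarrow> dist y x < d \<Longrightarrow> dist (g y) (g x) < e"
    using e unfolding uniformly_continuous_on_def by blast
  show ?thesis
  proof (rule that[of "min d 1"])
    fix x y :: 'a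
    assume xy: "norm (x - y) < min d 1"
    have "norm x \<le> norm y + norm (x - y)" "norm y \<le> norm x + norm (x - y)"
      using norm_triangle_sub[of x y] norm_triangle_sub[of y x] by (simp_all add: norm_minus_commute)
    then consider "norm x \<le> R + 2" "norm y \<le> R + 2" | "norm x > R" "norm y > R"
      using xy by fastforce
    then show "norm (g x - g y) < e"
    proof cases
      case 1
      then show ?thesis using d(2)[of y x] xy by (simp add: dist_norm)
    next
      case 2
      then show ?thesis using g(2) e by simp
    qed
  qed (use d in auto)
qed

lemma sqnorm_translation_continuous:
  fixes f :: "'a::euclidean_space \<Rightarrow> 'b::euclidean_space"
  assumes f: "sqint f" and e: "e > 0"
  obtains d where "d > 0" "\<And>z. norm z < d \<Longrightarrow> sqnorm (\<lambda>x. f (x - z) - f x) \<le> e"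
proof -
  \<comment> \<open>Each use of the triangle inequality for squared norms costs a factor 2, so the
    tolerances add up to 2 (e/12) + 4 (e/8) + 4 (e/12) = e.\<close>
  obtain g R B where g: "continuous_on UNIV g" "\<And>x. norm x > R \<Longrightarrow> g x = 0" "sqint g"
      "sqnorm (\<lambda>x. f x - g x) < e / 12"
    by (rule Cc_dense[OF f, of "e / 12"]) (use e in auto)
  \<comment> \<open>Shifts shorter than 1 keep the support of the difference inside this ball;
    \<open>V + 1\<close> below keeps the quotient defined when \<open>V\<close> is 0.\<close>
  define V where "V = measure lborel (cball (0::'a) (R + 1))"
  define \<eta> where "\<eta> = sqrt (e / (8 * (V + 1)))"
  have V: "V \<ge> 0" by (simp add: V_def)
  then have \<eta>: "\<eta> > 0" "\<eta>\<^sup>2 * V \<le> e / 8"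
    using e by (auto simp: \<eta>_def field_simps)
  obtain d where d: "d > 0" "\<And>x y. norm (x - y) < d \<Longrightarrow> norm (g x - g y) < \<eta>"
    by (rule Cc_uniformly_continuous[OF g(1,2) \<eta>(1)]) auto
  have [measurable]: "g \<in> borel_measurable borel" using g(3) by (rule sqint_measurable)
  show ?thesis
  proof (rule that[of "min d 1"])
    fix z :: 'a
    assume z: "norm z < min d 1"
    have gz: "sqint (\<lambda>x. g (x - z))" and fz: "sqint (\<lambda>x. f (x - z))"
      using sqnorm_translate(1) g(3) f by blast+
    have "sqnorm (\<lambda>x. g (x - z) - g x) \<le> (LINT x|lborel. indicator (cball (0::'a) (R + 1)) x * \<eta>\<^sup>2)"
      unfolding sqnorm_def
    proof (rule integral_mono)
      show "integrable lborel (\<lambda>x. (norm (g (x - z) - g x))\<^sup>2)"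
        using sqint_diff[OF gz g(3)] by (rule sqint_integrable)
      show "integrable lborel (\<lambda>x. indicator (cball (0::'a) (R + 1)) x * \<eta>\<^sup>2)"
        by (intro integrable_mult_left integrable_indicator_cball)
      fix x :: 'a
      show "(norm (g (x - z) - g x))\<^sup>2 \<le> indicator (cball 0 (R + 1)) x * \<eta>\<^sup>2"
      proof (cases "norm x \<le> R + 1")
        case True
        then show ?thesis
          using d(2)[of "x - z" x] z by (auto simp: indicator_def intro!: power_mono)
      next
        case False
        moreover have "norm x \<le> norm (x - z) + norm z"
          using norm_triangle_ineq[of "x - z" z] by simp
        ultimately show ?thesis
          using z g(2)[of x] g(2)[of "x - z"] by (auto simp: indicator_def)
      qed
    qed
    also have "\<dots> = \<eta>\<^sup>2 * V"
      by (simp add: V_def)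
    finally have 1: "sqnorm (\<lambda>x. g (x - z) - g x) \<le> e / 8"
      using \<eta>(2) by linarith
    have 2: "sqnorm (\<lambda>x. f (x - z) - g (x - z)) < e / 12"
      using sqnorm_translate(2)[OF sqint_diff[OF f g(3)], of z] g(4) by simp
    have 3: "sqnorm (\<lambda>x. g x - f x) < e / 12"
      using g(4) by (simp add: sqnorm_diff_commute[of g f])
    have "sqnorm (\<lambda>x. f (x - z) - f x) \<le>
        2 * sqnorm (\<lambda>x. f (x - z) - g (x - z)) + 2 * sqnorm (\<lambda>x. g (x - z) - f x)"
      by (rule sqnorm_triangle[OF fz gz f])
    moreover have "sqnorm (\<lambda>x. g (x - z) - f x) \<le>
        2 * sqnorm (\<lambda>x. g (x - z) - g x) + 2 * sqnorm (\<lambda>x. g x - f x)"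
      by (rule sqnorm_triangle[OF gz g(3) f])
    ultimately show "sqnorm (\<lambda>x. f (x - z) - f x) \<le> e"
      using 1 2 3 by linarith
  qed (use d in auto)
qed

subsection \<open>Mollification\<close>

definition locint :: "('a::euclidean_space \<Rightarrow> 'b::euclidean_space) \<Rightarrow> bool" where
  "locint f \<longleftrightarrow> f \<in> borel_measurable borel \<and> (\<forall>R. integrable lborel (\<lambda>x. indicator (cball 0 R) x *\<^sub>R f x))"

lemma locint_measurable [measurable_dest]: "locint f \<Longrightarrow> f \<in> borel_measurable borel"
  by (simp add: locint_def)

lemma indicator_cball_measurable [measurable]:
  "(indicator (cball c R) :: 'a::euclidean_space \<Rightarrow> real) \<in> borel_measurable borel"
  by (intro borel_measurable_indicator borel_closed closed_cball)

lemma sqint_imp_locint: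
  assumes "sqint f"
  shows "locint f"
  unfolding locint_def
proof (intro conjI allI)
  fix R
  have [measurable]: "f \<in> borel_measurable borel" using assms by (rule sqint_measurable)
  show "integrable lborel (\<lambda>x. indicator (cball 0 R) x *\<^sub>R f x)"
  proof (rule Bochner_Integration.integrable_bound)
    show "integrable lborel (\<lambda>x. (norm (f x))\<^sup>2 + indicator (cball 0 R) x :: real)"
      by (intro Bochner_Integration.integrable_add sqint_integrable assms integrable_indicator_cball)
    have "norm (f x) \<le> (norm (f x))\<^sup>2 + 1" for x
      using sum_squares_bound[of "norm (f x)" 1] norm_ge_zero[of "f x"] unfolding power_one mult_1_right by linarith
    then show "AE x in lborel. norm (indicator (cball 0 R) x *\<^sub>R f x) \<le> norm ((norm (f x))\<^sup>2 + indicator (cball 0 R) x :: real)"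
      by (auto simp: indicator_def)
    show "(\<lambda>x. indicator (cball 0 R) x *\<^sub>R f x) \<in> borel_measurable lborel"
      by (intro borel_measurable_scaleR) simp_all
  qed
qed (use assms in \<open>rule sqint_measurable\<close>)

lemma integrable_kernel_scaleR:
  fixes f :: "'a::euclidean_space \<Rightarrow> 'b::euclidean_space" and k :: "'a \<Rightarrow> real"
  assumes f: "locint f" and [measurable]: "k \<in> borel_measurable borel"
    and k: "\<And>y. \<bar>k y\<bar> \<le> B" "\<And>y. norm y > R \<Longrightarrow> k y = 0"
  shows "integrable lborel (\<lambda>y. k y *\<^sub>R f y)"
proof (rule Bochner_Integration.integrable_bound)
  have [measurable]: "f \<in> borel_measurable borel" using f by (simp add: locint_def)
  show "integrable lborel (\<lambda>x. B *\<^sub>R (indicator (cball 0 R) x *\<^sub>R f x))"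
    using f by (intro integrable_scaleR_right) (simp add: locint_def)
  show "AE y in lborel. norm (k y *\<^sub>R f y) \<le> norm (B *\<^sub>R (indicator (cball 0 R) y *\<^sub>R f y))"
  proof (intro AE_I2)
    fix y
    show "norm (k y *\<^sub>R f y) \<le> norm (B *\<^sub>R (indicator (cball 0 R) y *\<^sub>R f y))"
      using k(1)[of y] k(2)[of y] by (auto simp: indicator_def intro!: mult_right_mono)
  qed
  show "(\<lambda>y. k y *\<^sub>R f y) \<in> borel_measurable lborel" by measurable
qed

lemma integrable_scaleR_kernel:
  fixes f :: "'a::euclidean_space \<Rightarrow> real" and k :: "'a \<Rightarrow> 'b::euclidean_space"
  assumes f: "locint f" and [measurable]: "k \<in> borel_measurable borel"
    and k: "\<And>y. norm (k y) \<le> B" "\<And>y. norm y > R \<Longrightarrow> k y = 0"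
  shows "integrable lborel (\<lambda>y. f y *\<^sub>R k y)"
proof (rule Bochner_Integration.integrable_bound)
  have [measurable]: "f \<in> borel_measurable borel" using f by (simp add: locint_def)
  show "integrable lborel (\<lambda>x. B *\<^sub>R (indicator (cball 0 R) x *\<^sub>R f x))"
    using f by (intro integrable_scaleR_right) (simp add: locint_def)
  show "AE y in lborel. norm (f y *\<^sub>R k y) \<le> norm (B *\<^sub>R (indicator (cball 0 R) y *\<^sub>R f y))"
  proof (intro AE_I2)
    fix y
    have "norm (k y) \<le> \<bar>B\<bar>" using k(1)[of y] by linarith
    then have "\<bar>f y\<bar> * norm (k y) \<le> \<bar>B\<bar> * \<bar>f y\<bar>"
      by (subst mult.commute) (rule mult_right_mono, auto)
    then show "norm (f y *\<^sub>R k y) \<le> norm (B *\<^sub>R (indicator (cball 0 R) y *\<^sub>R f y))"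
      using k(2)[of y] by (auto simp: indicator_def)
  qed
  show "(\<lambda>y. f y *\<^sub>R k y) \<in> borel_measurable lborel" by measurable
qed

lemma bump_bounded: "\<exists>B. \<forall>z::'a::euclidean_space. \<bar>bump r z\<bar> \<le> B" if "r > 0"
proof -
  have "compact (bump r ` cball (0::'a) r)"
    by (intro compact_continuous_image continuous_on_subset[OF continuous_bump]) auto
  then obtain B where B: "\<And>z::'a. z \<in> cball 0 r \<Longrightarrow> \<bar>bump r z\<bar> \<le> B"
    by (force dest!: compact_imp_bounded simp: bounded_iff)
  have "\<bar>bump r z\<bar> \<le> max B 0" for z :: 'a
    using B[of z] bump_eq_0[of r z] that by (cases "norm z \<le> r") auto
  then show ?thesis by blast
qed

lemma bump_grad_bounded: "\<exists>B. \<forall>z::'a::euclidean_space. norm (bump_grad r z) \<le> B" if "r > 0"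
proof -
  have "compact (bump_grad r ` cball (0::'a) r)"
    by (intro compact_continuous_image continuous_on_subset[OF continuous_bump_grad]) auto
  then obtain B where B: "\<And>z::'a. z \<in> cball 0 r \<Longrightarrow> norm (bump_grad r z) \<le> B"
    by (force dest!: compact_imp_bounded simp: bounded_iff)
  have "norm (bump_grad r z) \<le> max B 0" for z :: 'a
    using B[of z] bump_grad_eq_0[of r z] that by (cases "norm z \<le> r") auto
  then show ?thesis by blast
qed

lemma bump_measurable [measurable]: "bump r \<in> borel_measurable borel"
  by (rule borel_measurable_continuous_onI[OF continuous_bump])

lemma bump_grad_measurable [measurable]: "bump_grad r \<in> borel_measurable borel"
  by (rule borel_measurable_continuous_onI[OF continuous_bump_grad])

lemma norm_gt_diff: "norm y > norm x + r \<Longrightarrow> norm (x - y) > r" for x y :: "'a::real_normed_vector"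
  using norm_triangle_sub[of y x] by (simp add: norm_minus_commute)

lemma integrable_bump_conv:
  fixes f :: "'a::euclidean_space \<Rightarrow> 'b::euclidean_space"
  assumes "locint f" "r > 0"
  shows "integrable lborel (\<lambda>y. bump r (x - y) *\<^sub>R f y)"
proof -
  obtain B where "\<And>z::'a. \<bar>bump r z\<bar> \<le> B"
    using bump_bounded[OF assms(2)] by blast
  then show ?thesis
    using assms norm_gt_diff[of x r]
    by (intro integrable_kernel_scaleR[where B = B and R = "norm x + r"])
       (auto intro!: bump_eq_0 simp: less_imp_le)
qed

lemma integrable_bump_grad_conv:
  fixes f :: "'a::euclidean_space \<Rightarrow> real"
  assumes "locint f" "r > 0"
  shows "integrable lborel (\<lambda>y. f y *\<^sub>R bump_grad r (x - y))"
proof -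
  obtain B where "\<And>z::'a. norm (bump_grad r z) \<le> B"
    using bump_grad_bounded[OF assms(2)] by blast
  then show ?thesis
    using assms norm_gt_diff[of x r]
    by (intro integrable_scaleR_kernel[where B = B and R = "norm x + r"])
       (auto intro!: bump_grad_eq_0 simp: less_imp_le)
qed

lemma continuous_bump_conv:
  fixes f :: "'a::euclidean_space \<Rightarrow> 'b::euclidean_space"
  assumes f: "locint f" and r: "r > 0"
  shows "continuous_on UNIV (\<lambda>x. LINT y|lborel. bump r (x - y) *\<^sub>R f y)"
  unfolding continuous_on_iff
proof (intro ballI allI impI)
  fix x :: 'a and e :: real
  assume e: "e > 0"
  \<comment> \<open>The ball contains the support of the kernel for every centre within distance 1
    of \<open>x\<close>. Dividing by \<open>A + 1\<close> instead of \<open>A\<close> covers the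
    case of zero mass.\<close>
  define A where "A = (LINT y|lborel. indicator (cball 0 (norm x + r + 1)) y * norm (f y))"
  have [measurable]: "f \<in> borel_measurable borel" using f by (simp add: locint_def)
  have intA: "integrable lborel (\<lambda>y. indicator (cball 0 (norm x + r + 1)) y * norm (f y))"
    using f integrable_norm[of lborel "\<lambda>y. indicator (cball 0 (norm x + r + 1)) y *\<^sub>R f y"]
    by (simp add: locint_def)
  have A: "A \<ge> 0" unfolding A_def by (intro Bochner_Integration.integral_nonneg) auto
  have "e / (A + 1) > 0" using e A by simp
  then obtain d where d: "d > 0" "\<And>u v::'a. norm (u - v) < d \<Longrightarrow> norm (bump r u - bump r v) < e / (A + 1)"
    using Cc_uniformly_continuous[OF continuous_bump, of r r "e / (A + 1)"] bump_eq_0[of r] r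
    by (metis less_imp_le)
  show "\<exists>d>0. \<forall>x'\<in>UNIV. dist x' x < d \<longrightarrow>
      dist (LINT y|lborel. bump r (x' - y) *\<^sub>R f y) (LINT y|lborel. bump r (x - y) *\<^sub>R f y) < e"
  proof (intro exI[of _ "min d 1"] conjI ballI impI)
    fix x'
    assume x': "dist x' x < min d 1"
    have nx': "norm x' \<le> norm x + 1"
      using x' norm_triangle_sub[of x' x] by (simp add: dist_norm)
    have "norm ((LINT y|lborel. bump r (x' - y) *\<^sub>R f y) - (LINT y|lborel. bump r (x - y) *\<^sub>R f y)) =
        norm (LINT y|lborel. (bump r (x' - y) - bump r (x - y)) *\<^sub>R f y)"
      using integrable_bump_conv[OF f r] by (simp add: scaleR_diff_left)
    also have "\<dots> \<le> (LINT y|lborel. e / (A + 1) * (indicator (cball 0 (norm x + r + 1)) y * norm (f y)))"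
    proof (rule Bochner_Integration.integral_norm_bound_integral)
      show "integrable lborel (\<lambda>y. (bump r (x' - y) - bump r (x - y)) *\<^sub>R f y)"
        using integrable_bump_conv[OF f r] by (simp add: scaleR_diff_left)
      fix y :: 'a
      show "norm ((bump r (x' - y) - bump r (x - y)) *\<^sub>R f y)
          \<le> e / (A + 1) * (indicator (cball 0 (norm x + r + 1)) y * norm (f y))"
      proof (cases "norm y \<le> norm x + r + 1")
        case True
        have "norm (bump r (x' - y) - bump r (x - y)) \<le> e / (A + 1)"
          using d(2)[of "x' - y" "x - y"] x' by (simp add: dist_norm)
        then have "\<bar>bump r (x' - y) - bump r (x - y)\<bar> * norm (f y) \<le> e / (A + 1) * norm (f y)"
          by (intro mult_right_mono) auto
        then show ?thesis using True by simp
      next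
        case False
        then have "bump r (x' - y) = 0" "bump r (x - y) = 0"
          using nx' r norm_gt_diff[of x r y] norm_gt_diff[of x' r y] by (auto intro!: bump_eq_0)
        then show ?thesis using False by simp
      qed
    qed (use intA in simp)
    also have "\<dots> = e / (A + 1) * A"
      by (simp add: A_def)
    also have "\<dots> < e"
      using e A by (simp add: field_simps)
    finally show "dist (LINT y|lborel. bump r (x' - y) *\<^sub>R f y) (LINT y|lborel. bump r (x - y) *\<^sub>R f y) < e"
      by (simp add: dist_norm)
  qed (use d in auto)
qed

text \<open>The mean value theorem on the segment, with uniform continuity of the compactly
  supported gradient, makes the remainder uniform in \<open>z\<close>. That uniformity is what
  differentiation under the integral sign requires.\<close>

lemma bump_first_order_uniform:
  fixes e :: real
  assumes r: "r > 0" and e: "e > 0"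
  obtains d where "d > 0"
    "\<And>z h :: 'a::euclidean_space. norm h < d \<Longrightarrow> \<bar>bump r (z + h) - bump r z - h \<bullet> bump_grad r z\<bar> \<le> e * norm h"
proof -
  obtain d where d: "d > 0" "\<And>u v::'a. norm (u - v) < d \<Longrightarrow> norm (bump_grad r u - bump_grad r v) < e"
    using Cc_uniformly_continuous[OF continuous_bump_grad, of r r e] bump_grad_eq_0[of r] r e
    by (metis less_imp_le)
  show ?thesis
  proof (rule that[OF d(1)])
    fix z h :: 'a
    assume h: "norm h < d"
    have der: "((\<lambda>t. bump r (z + t *\<^sub>R h)) has_derivative (\<lambda>s. (s *\<^sub>R h) \<bullet> bump_grad r (z + t *\<^sub>R h))) (at t)" for t
    proof (rule has_derivative_compose[of "\<lambda>t. z + t *\<^sub>R h" "\<lambda>s. s *\<^sub>R h" t UNIV "bump r"])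
      show "((\<lambda>t. z + t *\<^sub>R h) has_derivative (\<lambda>s. s *\<^sub>R h)) (at t)"
        by (auto intro!: derivative_eq_intros)
      show "(bump r has_derivative (\<lambda>k. k \<bullet> bump_grad r (z + t *\<^sub>R h))) (at (z + t *\<^sub>R h))"
        using GDERIV_bump[of r "z + t *\<^sub>R h"] by (simp add: gderiv_def)
    qed
    have "\<exists>t\<in>{0<..<1}. bump r (z + 1 *\<^sub>R h) - bump r (z + 0 *\<^sub>R h) = ((1 - 0) *\<^sub>R h) \<bullet> bump_grad r (z + t *\<^sub>R h)"
      by (rule mvt_simple) (rule zero_less_one, rule has_derivative_at_withinI[OF der])
    then obtain t where t: "0 < t" "t < 1" "bump r (z + h) - bump r z = h \<bullet> bump_grad r (z + t *\<^sub>R h)"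
      by auto
    have "norm (t *\<^sub>R h) < d"
      using t h mult_right_mono[of t 1 "norm h"] by simp
    then have "norm (bump_grad r (z + t *\<^sub>R h) - bump_grad r z) \<le> e"
      using d(2)[of "z + t *\<^sub>R h" z] by simp
    then have "norm h * norm (bump_grad r (z + t *\<^sub>R h) - bump_grad r z) \<le> norm h * e"
      by (intro mult_left_mono) auto
    moreover have "\<bar>bump r (z + h) - bump r z - h \<bullet> bump_grad r z\<bar> \<le>
        norm h * norm (bump_grad r (z + t *\<^sub>R h) - bump_grad r z)"
      unfolding t(3) inner_diff_right[symmetric] by (rule Cauchy_Schwarz_ineq2)
    ultimately show "\<bar>bump r (z + h) - bump r z - h \<bullet> bump_grad r z\<bar> \<le> e * norm h"
      by (simp add: mult.commute)
  qed
qed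

lemma GDERIV_bump_conv:
  fixes f :: "'a::euclidean_space \<Rightarrow> real"
  assumes f: "locint f" and r: "r > 0"
  shows "GDERIV (\<lambda>x. LINT y|lborel. bump r (x - y) *\<^sub>R f y) x :> (LINT y|lborel. f y *\<^sub>R bump_grad r (x - y))"
proof -
  define A where "A = (LINT y|lborel. indicator (cball 0 (norm x + r + 1)) y * \<bar>f y\<bar>)"
  have [measurable]: "f \<in> borel_measurable borel" using f by (simp add: locint_def)
  have intA: "integrable lborel (\<lambda>y. indicator (cball 0 (norm x + r + 1)) y * \<bar>f y\<bar>)"
    using f integrable_norm[of lborel "\<lambda>y. indicator (cball 0 (norm x + r + 1)) y *\<^sub>R f y"]
    by (simp add: locint_def abs_mult)
  have A: "A \<ge> 0" unfolding A_def by (intro Bochner_Integration.integral_nonneg) auto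
  have diff3: "(LINT x|lborel. a x) - (LINT x|lborel. b x) - (LINT x|lborel. c x) = (LINT x|lborel. a x - b x - c x)"
    if "integrable lborel a" "integrable lborel b" "integrable lborel c" for a b c :: "'a \<Rightarrow> real"
    using that by simp
  show ?thesis
    unfolding gderiv_def has_derivative_at_alt
  proof (intro conjI allI impI)
    fix e :: real
    assume e: "e > 0"
    have "e / (A + 1) > 0" using e A by simp
    then obtain d where d: "d > 0" "\<And>z h::'a. norm h < d \<Longrightarrow>
        \<bar>bump r (z + h) - bump r z - h \<bullet> bump_grad r z\<bar> \<le> e / (A + 1) * norm h"
      using bump_first_order_uniform[OF r, of "e / (A + 1)"] by blast
    show "\<exists>d>0. \<forall>y. norm (y - x) < d \<longrightarrow>
      norm ((LINT z|lborel. bump r (y - z) *\<^sub>R f z) - (LINT z|lborel. bump r (x - z) *\<^sub>R f z)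
        - (y - x) \<bullet> (LINT z|lborel. f z *\<^sub>R bump_grad r (x - z))) \<le> e * norm (y - x)"
    proof (intro exI[of _ "min d 1"] conjI allI impI)
      fix y
      assume y: "norm (y - x) < min d 1"
      let ?h = "y - x"
      have ny: "norm y \<le> norm x + 1"
        using y norm_triangle_sub[of y x] by simp
      have ig: "integrable lborel (\<lambda>z. ?h \<bullet> (f z *\<^sub>R bump_grad r (x - z)))"
        by (intro integrable_inner_right integrable_bump_grad_conv f r)
      have eq: "bump r (y - z) *\<^sub>R f z - bump r (x - z) *\<^sub>R f z - ?h \<bullet> (f z *\<^sub>R bump_grad r (x - z)) =
          (bump r ((x - z) + ?h) - bump r (x - z) - ?h \<bullet> bump_grad r (x - z)) * f z" for z
        by (simp add: algebra_simps)
      have "(LINT z|lborel. bump r (y - z) *\<^sub>R f z) - (LINT z|lborel. bump r (x - z) *\<^sub>R f z)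
          - ?h \<bullet> (LINT z|lborel. f z *\<^sub>R bump_grad r (x - z)) =
          (LINT z|lborel. bump r (y - z) *\<^sub>R f z - bump r (x - z) *\<^sub>R f z - ?h \<bullet> (f z *\<^sub>R bump_grad r (x - z)))"
        by (subst integral_inner_right[symmetric], intro integrable_bump_grad_conv f r)
           (rule diff3[OF integrable_bump_conv[OF f r] integrable_bump_conv[OF f r] ig])
      also have "norm \<dots> \<le> (LINT z|lborel. e / (A + 1) * norm ?h * (indicator (cball 0 (norm x + r + 1)) z * \<bar>f z\<bar>))"
      proof (rule Bochner_Integration.integral_norm_bound_integral)
        show "integrable lborel (\<lambda>z. bump r (y - z) *\<^sub>R f z - bump r (x - z) *\<^sub>R f z - ?h \<bullet> (f z *\<^sub>R bump_grad r (x - z)))"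
          by (intro Bochner_Integration.integrable_diff integrable_bump_conv[OF f r] ig)
        fix z :: 'a
        show "norm (bump r (y - z) *\<^sub>R f z - bump r (x - z) *\<^sub>R f z - ?h \<bullet> (f z *\<^sub>R bump_grad r (x - z)))
          \<le> e / (A + 1) * norm ?h * (indicator (cball 0 (norm x + r + 1)) z * \<bar>f z\<bar>)"
        proof (cases "norm z \<le> norm x + r + 1")
          case True
          have "\<bar>bump r ((x - z) + ?h) - bump r (x - z) - ?h \<bullet> bump_grad r (x - z)\<bar> * \<bar>f z\<bar> \<le> e / (A + 1) * norm ?h * \<bar>f z\<bar>"
            using y by (intro mult_right_mono d) auto
          then show ?thesis unfolding eq using True by (simp add: abs_mult)
        next
          case False
          then have "norm (y - z) \<ge> r" "norm (x - z) \<ge> r"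
            using ny norm_gt_diff[of x r z] norm_gt_diff[of y r z] by auto
          then have "bump r (y - z) = 0" "bump r (x - z) = 0" "bump_grad r (x - z) = 0"
            using r by (simp_all add: bump_eq_0 bump_grad_eq_0)
          then show ?thesis using False by simp
        qed
      qed (use intA in simp)
      also have "\<dots> = e * norm ?h * (A / (A + 1))"
        by (simp add: A_def)
      also have "\<dots> \<le> e * norm ?h * 1"
        using e A by (intro mult_left_mono) (auto simp: field_simps)
      finally show "norm ((LINT z|lborel. bump r (y - z) *\<^sub>R f z) - (LINT z|lborel. bump r (x - z) *\<^sub>R f z)
        - (y - x) \<bullet> (LINT z|lborel. f z *\<^sub>R bump_grad r (x - z))) \<le> e * norm (y - x)"
        by simp
    qed (use d in auto)
  qed (rule bounded_linear_inner_left)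
qed

lemma integrable_bump:
  assumes "r > 0"
  shows "integrable lborel (bump r :: 'a::euclidean_space \<Rightarrow> real)"
proof -
  obtain B where "\<And>z::'a. \<bar>bump r z\<bar> \<le> B" using bump_bounded[OF assms] by blast
  then show ?thesis
    using assms by (intro integrable_bounded_support[where B = B and R = r]) (auto simp: bump_eq_0)
qed

lemma integral_bump_pos:
  assumes r: "r > 0"
  shows "0 < (LINT z|lborel. bump r (z :: 'a::euclidean_space))"
proof -
  have "(LINT z|lborel. bump r (z :: 'a)) \<noteq> 0"
  proof
    assume "(LINT z|lborel. bump r (z :: 'a)) = 0"
    then have "AE z in lborel. bump r (z :: 'a) = 0"
      using integrable_bump[OF r] by (subst (asm) integral_nonneg_eq_0_iff_AE) (auto simp: bump_nonneg)
    then have "AE z in lborel. (z :: 'a) \<notin> ball 0 r"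
      by eventually_elim (use bump_pos[of _ r] in force)
    then have "emeasure lborel (ball (0::'a) r) = 0"
      by (subst (asm) AE_iff_measurable[of "ball 0 r"]) auto
    then show False
      using content_ball_pos[OF r, of "0 :: 'a"] by (simp add: measure_def)
  qed
  moreover have "0 \<le> (LINT z|lborel. bump r (z :: 'a))"
    by (intro Bochner_Integration.integral_nonneg) (simp add: bump_nonneg)
  ultimately show ?thesis by simp
qed

definition moll :: "real \<Rightarrow> 'a::euclidean_space \<Rightarrow> real" where
  "moll r z = bump r z / (LINT y|(lborel :: 'a measure). bump r y)"

definition mollify :: "real \<Rightarrow> ('a::euclidean_space \<Rightarrow> 'b::euclidean_space) \<Rightarrow> 'a \<Rightarrow> 'b" where
  "mollify r f x = (LINT y|lborel. moll r (x - y) *\<^sub>R f y)"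

lemma mollify_eq_bump:
  fixes f :: "'a::euclidean_space \<Rightarrow> 'b::euclidean_space"
  assumes "locint f" "r > 0"
  shows "mollify r f x = (1 / (LINT z|(lborel :: 'a measure). bump r z)) *\<^sub>R (LINT y|lborel. bump r (x - y) *\<^sub>R f y)"
  using integrable_bump_conv[OF assms, of x]
  by (simp add: mollify_def moll_def flip: integral_scaleR_right)

lemma moll_nonneg: "0 \<le> moll r z"
  unfolding moll_def by (intro divide_nonneg_nonneg Bochner_Integration.integral_nonneg bump_nonneg)

lemma moll_eq_0: "norm z \<ge> r \<Longrightarrow> r > 0 \<Longrightarrow> moll r z = 0"
  by (simp add: moll_def bump_eq_0)

lemma moll_minus: "moll r (- z) = moll r z"
  by (simp add: moll_def bump_def)

lemma moll_measurable [measurable]: "moll r \<in> borel_measurable borel"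
  unfolding moll_def[abs_def] by measurable

lemma moll_bounded: "\<exists>B. \<forall>z::'a::euclidean_space. \<bar>moll r z\<bar> \<le> B" if "r > 0"
proof -
  obtain B where B: "\<And>z::'a. \<bar>bump r z\<bar> \<le> B" using bump_bounded[OF \<open>r > 0\<close>] by blast
  have "\<bar>moll r z\<bar> \<le> B / (LINT y|(lborel :: 'a measure). bump r y)" for z :: 'a
    using B[of z] integral_bump_pos[OF that, where 'a = 'a] by (simp add: moll_def divide_right_mono)
  then show ?thesis by blast
qed

lemma integrable_moll: "r > 0 \<Longrightarrow> integrable lborel (moll r :: 'a::euclidean_space \<Rightarrow> real)"
  unfolding moll_def[abs_def] using integrable_bump[where 'a = 'a, of r] by simp

lemma integral_moll: "r > 0 \<Longrightarrow> (LINT z|lborel. moll r (z :: 'a::euclidean_space)) = 1"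
  unfolding moll_def[abs_def] using integral_bump_pos[where 'a = 'a, of r] by simp

lemma integrable_moll_scaleR:
  fixes f :: "'a::euclidean_space \<Rightarrow> 'b::euclidean_space"
  assumes "locint f" "r > 0"
  shows "integrable lborel (\<lambda>z. moll r z *\<^sub>R f z)"
proof -
  obtain B where "\<And>z::'a. \<bar>moll r z\<bar> \<le> B" using moll_bounded[OF assms(2)] by blast
  then show ?thesis
    using assms by (intro integrable_kernel_scaleR[where B = B and R = r]) (auto simp: moll_eq_0)
qed

lemma locint_translate:
  assumes "locint f"
  shows "locint (\<lambda>z. f (x - z))"
  unfolding locint_def
proof (intro conjI allI)
  have [measurable]: "f \<in> borel_measurable borel" using assms by (simp add: locint_def)
  show "(\<lambda>z. f (x - z)) \<in> borel_measurable borel" by measurable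
  fix R
  have "integrable lborel (\<lambda>z. indicator (cball 0 R) (x - z) *\<^sub>R f z)"
  proof (rule integrable_kernel_scaleR[OF assms, where B = 1 and R = "norm x + R"])
    show "indicator (cball 0 R) (x - z) = (0 :: real)" if "norm z > norm x + R" for z
      using norm_gt_diff[of x R z] that by simp
  qed (auto simp: indicator_def)
  then show "integrable lborel (\<lambda>z. indicator (cball 0 R) z *\<^sub>R f (x - z))"
    using integral_lborel_reflect(2)[of "\<lambda>z. indicator (cball 0 R) z *\<^sub>R f (x - z)" x] by simp
qed

text \<open>Jensen's inequality for the square, obtained by expanding the nonnegative variance of
  \<open>k\<close> about its mean \<open>m\<close>.\<close>

lemma weighted_norm_squared_le:
  fixes k :: "'a::euclidean_space \<Rightarrow> 'b::euclidean_space" and \<rho> :: "'a \<Rightarrow> real"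
  assumes "\<And>z. 0 \<le> \<rho> z" "integrable lborel \<rho>" "(LINT z|lborel. \<rho> z) = 1"
    and "integrable lborel (\<lambda>z. \<rho> z *\<^sub>R k z)" "integrable lborel (\<lambda>z. \<rho> z * (norm (k z))\<^sup>2)"
  shows "(norm (LINT z|lborel. \<rho> z *\<^sub>R k z))\<^sup>2 \<le> (LINT z|lborel. \<rho> z * (norm (k z))\<^sup>2)"
proof -
  define m where "m = (LINT z|lborel. \<rho> z *\<^sub>R k z)"
  have "0 \<le> (LINT z|lborel. \<rho> z * (norm (k z - m))\<^sup>2)"
    by (intro Bochner_Integration.integral_nonneg) (simp add: assms(1))
  also have "(\<lambda>z. \<rho> z * (norm (k z - m))\<^sup>2) = (\<lambda>z. \<rho> z * (norm (k z))\<^sup>2 - 2 * ((\<rho> z *\<^sub>R k z) \<bullet> m) + \<rho> z * (norm m)\<^sup>2)"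
    by (simp add: fun_eq_iff power2_norm_eq_inner inner_diff_left inner_diff_right inner_commute algebra_simps)
  also have "(LINT z|lborel. \<rho> z * (norm (k z))\<^sup>2 - 2 * ((\<rho> z *\<^sub>R k z) \<bullet> m) + \<rho> z * (norm m)\<^sup>2) =
      (LINT z|lborel. \<rho> z * (norm (k z))\<^sup>2) - 2 * (m \<bullet> m) + (norm m)\<^sup>2"
  proof -
    have "integrable lborel (\<lambda>z. (\<rho> z *\<^sub>R k z) \<bullet> m)"
      by (intro integrable_inner_left assms(4))
    moreover have "(LINT z|lborel. (\<rho> z *\<^sub>R k z) \<bullet> m) = m \<bullet> m"
      using assms(4) by (subst integral_inner_left) (simp_all add: m_def)
    ultimately
    show ?thesis using assms by (simp del: inner_scaleR_left)
  qed
  finally show ?thesis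
    by (simp add: m_def power2_norm_eq_inner)
qed

lemma mollify_minus_eq:
  fixes f :: "'a::euclidean_space \<Rightarrow> 'b::euclidean_space"
  assumes f: "locint f" and r: "r > 0"
  shows "mollify r f x - f x = (LINT z|lborel. moll r z *\<^sub>R (f (x - z) - f x))"
proof -
  have [measurable]: "f \<in> borel_measurable borel" using f by (simp add: locint_def)
  have "mollify r f x = (LINT z|lborel. moll r z *\<^sub>R f (x - z))"
    unfolding mollify_def
    using integral_lborel_reflect(1)[of "\<lambda>y. moll r (x - y) *\<^sub>R f y" x] by simp
  moreover have "(LINT z|lborel. moll r (z::'a) *\<^sub>R f x) = f x"
    using integrable_moll[OF r, where 'a = 'a] integral_moll[OF r, where 'a = 'a]
    by (subst integral_scaleR_left) simp_all
  moreover have "(LINT z|lborel. moll r z *\<^sub>R f (x - z) - moll r z *\<^sub>R f x) =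
      (LINT z|lborel. moll r z *\<^sub>R f (x - z)) - (LINT z|lborel. moll r (z::'a) *\<^sub>R f x)"
    by (intro Bochner_Integration.integral_diff integrable_moll_scaleR locint_translate[OF f] r
         integrable_scaleR_left integrable_moll)
  ultimately show ?thesis
    by (simp add: scaleR_diff_right)
qed

text \<open>Jensen in \<open>z\<close> for each \<open>x\<close>, then Tonelli to integrate in
  \<open>x\<close> before \<open>z\<close>: the mollification error is at most an average of
  translation errors over shifts shorter than \<open>r\<close>.\<close>

lemma sqnorm_mollify_diff_le:
  fixes f :: "'a::euclidean_space \<Rightarrow> 'b::euclidean_space"
  assumes f: "sqint f" and r: "r > 0"
    and close: "\<And>z. norm z < r \<Longrightarrow> sqnorm (\<lambda>x. f (x - z) - f x) \<le> e"
  shows "sqint (mollify r f)" "sqnorm (\<lambda>x. mollify r f x - f x) \<le> e"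
proof -
  have lf: "locint f" using f by (rule sqint_imp_locint)
  have [measurable]: "f \<in> borel_measurable borel" using f by (rule sqint_measurable)
  have [measurable]: "mollify r f \<in> borel_measurable borel"
    unfolding mollify_eq_bump[OF lf r, abs_def]
    by (intro borel_measurable_continuous_onI continuous_intros continuous_bump_conv lf r)
  have e: "0 \<le> e"
    using close[of 0] r by (simp add: sqnorm_def)
  have jensen: "(norm (mollify r f x - f x))\<^sup>2 \<le> (LINT z|lborel. moll r z * (norm (f (x - z) - f x))\<^sup>2)"
    and int: "integrable lborel (\<lambda>z. moll r z * (norm (f (x - z) - f x))\<^sup>2)" for x
  proof -
    have lsq: "locint (\<lambda>y. (norm (f y - f x))\<^sup>2)"
      unfolding locint_def
    proof (intro conjI allI)
      fix R
      show "integrable lborel (\<lambda>y. indicator (cball 0 R) y *\<^sub>R (norm (f y - f x))\<^sup>2)"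
      proof (rule Bochner_Integration.integrable_bound)
        show "integrable lborel (\<lambda>y. 2 * (norm (f y))\<^sup>2 + indicator (cball 0 R) y * (2 * (norm (f x))\<^sup>2))"
          by (intro Bochner_Integration.integrable_add integrable_mult_right integrable_mult_left
               sqint_integrable f integrable_indicator_cball)
        show "AE y in lborel. norm (indicator (cball 0 R) y *\<^sub>R (norm (f y - f x))\<^sup>2) \<le>
            norm (2 * (norm (f y))\<^sup>2 + indicator (cball 0 R) y * (2 * (norm (f x))\<^sup>2))"
          using norm_add_squared_le[of "f _" "- f x"] by (auto simp: indicator_def)
        show "(\<lambda>y. indicator (cball 0 R) y *\<^sub>R (norm (f y - f x))\<^sup>2) \<in> borel_measurable lborel"
          by (intro borel_measurable_scaleR) simp_all
      qed
      show "(\<lambda>y. (norm (f y - f x))\<^sup>2) \<in> borel_measurable borel" by measurable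
    qed
    show int: "integrable lborel (\<lambda>z. moll r z * (norm (f (x - z) - f x))\<^sup>2)"
      using integrable_moll_scaleR[OF locint_translate[OF lsq] r, of x] by simp
    have "integrable lborel (\<lambda>z. moll r z *\<^sub>R f (x - z) - moll r z *\<^sub>R f x)"
      by (intro Bochner_Integration.integrable_diff integrable_moll_scaleR locint_translate[OF lf] r
           integrable_scaleR_left integrable_moll)
    then show "(norm (mollify r f x - f x))\<^sup>2 \<le> (LINT z|lborel. moll r z * (norm (f (x - z) - f x))\<^sup>2)"
      unfolding mollify_minus_eq[OF lf r] using int
      by (intro weighted_norm_squared_le moll_nonneg integrable_moll integral_moll r)
         (simp_all add: scaleR_diff_right)
  qed
  have "(\<integral>\<^sup>+x. ennreal ((norm (mollify r f x - f x))\<^sup>2) \<partial>lborel) \<le>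
      (\<integral>\<^sup>+x. ennreal (LINT z|lborel. moll r z * (norm (f (x - z) - f x))\<^sup>2) \<partial>lborel)"
    by (intro nn_integral_mono ennreal_leI jensen)
  also have "\<dots> = (\<integral>\<^sup>+x. \<integral>\<^sup>+z. ennreal (moll r z * (norm (f (x - z) - f x))\<^sup>2) \<partial>lborel \<partial>lborel)"
    by (intro nn_integral_cong nn_integral_eq_integral[symmetric] int AE_I2 mult_nonneg_nonneg moll_nonneg) auto
  also have "\<dots> = (\<integral>\<^sup>+z. \<integral>\<^sup>+x. ennreal (moll r z * (norm (f (x - z) - f x))\<^sup>2) \<partial>lborel \<partial>lborel)"
    by (rule lborel_pair.Fubini') measurable
  also have "\<dots> \<le> (\<integral>\<^sup>+z. ennreal (moll r (z::'a) * e) \<partial>lborel)"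
  proof (intro nn_integral_mono)
    fix z :: 'a
    have fz: "integrable lborel (\<lambda>x. (norm (f (x - z) - f x))\<^sup>2)"
      by (intro sqint_integrable sqint_diff sqnorm_translate f)
    have "(\<integral>\<^sup>+x. ennreal (moll r z * (norm (f (x - z) - f x))\<^sup>2) \<partial>lborel) =
        ennreal (LINT x|lborel. moll r z * (norm (f (x - z) - f x))\<^sup>2)"
      using fz by (intro nn_integral_eq_integral) (auto simp: moll_nonneg)
    also have "\<dots> = ennreal (moll r z * sqnorm (\<lambda>x. f (x - z) - f x))"
      by (simp add: sqnorm_def)
    also have "\<dots> \<le> ennreal (moll r z * e)"
      using close[of z] moll_eq_0[of r z] r moll_nonneg[of r z]
      by (cases "norm z < r") (auto intro!: ennreal_leI mult_left_mono)
    finally show "(\<integral>\<^sup>+x. ennreal (moll r z * (norm (f (x - z) - f x))\<^sup>2) \<partial>lborel) \<le> ennreal (moll r z * e)" .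
  qed
  also have "\<dots> = ennreal (LINT z|lborel. moll r (z::'a) * e)"
    using integrable_moll[OF r, where 'a = 'a] e by (intro nn_integral_eq_integral) (auto simp: moll_nonneg)
  also have "\<dots> = ennreal e"
    using integral_moll[OF r, where 'a = 'a] by simp
  finally have bound: "(\<integral>\<^sup>+x. ennreal ((norm (mollify r f x - f x))\<^sup>2) \<partial>lborel) \<le> ennreal e" .
  have int': "integrable lborel (\<lambda>x. (norm (mollify r f x - f x))\<^sup>2)"
    by (rule integrableI_bounded) (use bound in \<open>auto intro: le_less_trans\<close>)
  then have "sqint (\<lambda>x. mollify r f x - f x)"
    by (simp add: sqint_def)
  from sqint_add[OF this f] show "sqint (mollify r f)" by simp
  have "ennreal (sqnorm (\<lambda>x. mollify r f x - f x)) \<le> ennreal e"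
    using bound int' by (simp add: sqnorm_def nn_integral_eq_integral)
  then show "sqnorm (\<lambda>x. mollify r f x - f x) \<le> e"
    using e by simp
qed

lemma integrable_product_lborel:
  fixes a :: "'a::euclidean_space \<Rightarrow> real" and b :: "'b::euclidean_space \<Rightarrow> real"
  assumes a: "integrable lborel a" and b: "integrable lborel b"
  shows "integrable (lborel \<Otimes>\<^sub>M lborel) (\<lambda>(x, y). a x * b y)"
proof (rule lborel_pair.Fubini_integrable)
  have [measurable]: "a \<in> borel_measurable borel" "b \<in> borel_measurable borel"
    using a b borel_measurable_integrable by auto
  show "(\<lambda>(x, y). a x * b y) \<in> borel_measurable (lborel \<Otimes>\<^sub>M lborel)" by measurable
  show "integrable lborel (\<lambda>x. LINT y|lborel. norm (case (x, y) of (x, y) \<Rightarrow> a x * b y))"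
    using a by (simp add: abs_mult)
  show "AE x in lborel. integrable lborel (\<lambda>y. case (x, y) of (x, y) \<Rightarrow> a x * b y)"
    using b by simp
qed

text \<open>The fundamental lemma of the calculus of variations, with translated bumps of all radii
  as tests. Fubini moves the mollifier from a continuous compactly supported \<open>g\<close> to
  \<open>w\<close>, so \<open>w\<close> annihilates the mollifications of \<open>g\<close> and, in
  the limit, \<open>g\<close> itself. Approximating the sign of \<open>w\<close> on a ball by such
  \<open>g\<close> leaves the integral of the modulus of \<open>w\<close>.\<close>

lemma AE_zero_of_bump_integrals:
  fixes w :: "'a::euclidean_space \<Rightarrow> real"
  assumes w: "locint w" and zero: "\<And>x r. r > 0 \<Longrightarrow> (LINT y|lborel. bump r (x - y) *\<^sub>R w y) = 0"
  shows "AE x in lborel. w x = 0"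
proof -
  have [measurable]: "w \<in> borel_measurable borel" using w by (rule locint_measurable)
  have Cc: "(LINT y|lborel. g y * w y) = 0"
    if g: "continuous_on UNIV g" "\<And>x. norm x > R \<Longrightarrow> g x = 0" "\<And>x. \<bar>g x\<bar> \<le> B" for g :: "'a \<Rightarrow> real" and R B
  proof -
    have [measurable]: "g \<in> borel_measurable borel"
      using g(1) by (rule borel_measurable_continuous_onI)
    have B0: "0 \<le> B" using g(3)[of 0] by linarith
    have lg: "locint g"
      unfolding locint_def
      using g B0 by (auto intro!: integrable_bounded_support[where B = B and R = R] simp: indicator_def)
    define r where "r n = 1 / (real n + 1)" for n
    have r: "r n > 0" "r n \<le> 1" for n by (auto simp: r_def)
    have moll0: "(LINT y|lborel. mollify (r n) g y * w y) = 0" for n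
    proof -
      obtain C where C: "\<And>z::'a. \<bar>moll (r n) z\<bar> \<le> C" using moll_bounded[OF r(1)] by blast
      have C0: "0 \<le> C" using C[of 0] by linarith
      have "integrable (lborel \<Otimes>\<^sub>M lborel) (\<lambda>(y, x). moll (r n) (y - x) * g x * w y)"
      proof (rule Bochner_Integration.integrable_bound)
        show "integrable (lborel \<Otimes>\<^sub>M lborel) (\<lambda>(y, x). (indicator (cball 0 (R + 1)) y *\<^sub>R w y) * (indicator (cball 0 R) x * (C * B)))"
          using w by (intro integrable_product_lborel) (simp_all add: locint_def integrable_indicator_cball)
        show "AE p in lborel \<Otimes>\<^sub>M lborel. norm (case p of (y, x) \<Rightarrow> moll (r n) (y - x) * g x * w y) \<le>
          norm (case p of (y, x) \<Rightarrow> (indicator (cball 0 (R + 1)) y *\<^sub>R w y) * (indicator (cball 0 R) x * (C * B)))"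
        proof (intro AE_I2, clarify)
          fix y x :: 'a
          show "norm (moll (r n) (y - x) * g x * w y) \<le>
            norm ((indicator (cball 0 (R + 1)) y *\<^sub>R w y) * (indicator (cball 0 R) x * (C * B)))"
          proof (cases "norm x \<le> R \<and> norm y \<le> R + 1")
            case True
            have "\<bar>moll (r n) (y - x)\<bar> * \<bar>g x\<bar> \<le> C * B"
              by (intro mult_mono C g C0) auto
            then have "\<bar>moll (r n) (y - x)\<bar> * \<bar>g x\<bar> * \<bar>w y\<bar> \<le> \<bar>C * B\<bar> * \<bar>w y\<bar>"
              by (intro mult_right_mono) auto
            then show ?thesis using True by (simp add: abs_mult mult_ac)
          next
            case False
            have "g x = 0 \<or> moll (r n) (y - x) = 0"
            proof (cases "norm x \<le> R")
              case True
              then have "norm y > R + 1" using False by simp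
              then have "norm (y - x) \<ge> r n"
                using True r(2)[of n] norm_triangle_sub[of y x] by simp
              then show ?thesis using moll_eq_0[OF _ r(1)] by blast
            qed (use g in auto)
            then show ?thesis by auto
          qed
        qed
      qed measurable
      then have swap: "(LINT y|lborel. LINT x|lborel. moll (r n) (y - x) * g x * w y) =
          (LINT x|lborel. LINT y|lborel. moll (r n) (y - x) * g x * w y)"
        by (rule lborel_pair.Fubini_integral[symmetric])
      have "(LINT y|lborel. moll (r n) (y - x) * g x * w y) = 0" for x
      proof -
        have "(LINT y|lborel. moll (r n) (y - x) * g x * w y) = g x * (LINT y|lborel. moll (r n) (x - y) * w y)"
          using moll_minus[of "r n" "x - _"]
          by (simp flip: Bochner_Integration.integral_mult_right_zero) (simp add: mult_ac)
        also have "(LINT y|lborel. moll (r n) (x - y) * w y) = 0"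
          using mollify_eq_bump[OF w r(1), of n x] zero[OF r(1), of n x] by (simp add: mollify_def)
        finally show ?thesis by simp
      qed
      with swap show ?thesis
        by (simp add: mollify_def)
    qed
    have lim: "(\<lambda>n. mollify (r n) g y) \<longlonglongrightarrow> g y" for y
    proof (rule LIMSEQ_I)
      fix e :: real
      assume "e > 0"
      then obtain d where d: "d > 0" "\<And>x y. norm (x - y) < d \<Longrightarrow> norm (g x - g y) < e / 2"
        using Cc_uniformly_continuous[OF g(1,2), where e = "e / 2"] half_gt_zero by blast
      obtain N where N: "r N < d"
        using reals_Archimedean[OF d(1)] by (auto simp: r_def inverse_eq_divide add.commute)
      show "\<exists>no. \<forall>n\<ge>no. norm (mollify (r n) g y - g y) < e"
      proof (intro exI[of _ N] allI impI)
        fix n assume "n \<ge> N"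
        then have "r n \<le> r N" by (auto simp: r_def field_simps)
        then have rn: "r n < d" using N by simp
        have "norm (mollify (r n) g y - g y) \<le> (LINT z|lborel. moll (r n) (z::'a) * (e / 2))"
          unfolding mollify_minus_eq[OF lg r(1)]
        proof (rule Bochner_Integration.integral_norm_bound_integral)
          have "integrable lborel (\<lambda>z. moll (r n) z *\<^sub>R g (y - z) - moll (r n) z *\<^sub>R g y)"
            by (intro Bochner_Integration.integrable_diff integrable_moll_scaleR locint_translate[OF lg] r
                 integrable_scaleR_left integrable_moll)
          then show "integrable lborel (\<lambda>z. moll (r n) z *\<^sub>R (g (y - z) - g y))"
            by (simp add: right_diff_distrib)
          fix z :: 'a
          show "norm (moll (r n) z *\<^sub>R (g (y - z) - g y)) \<le> moll (r n) z * (e / 2)"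
          proof (cases "norm z < r n")
            case True
            then have "norm (g (y - z) - g y) \<le> e / 2"
              using d(2)[of "y - z" y] rn by simp
            then show ?thesis
              by (simp add: abs_mult moll_nonneg mult_left_mono del: times_divide_eq_right)
          next
            case False
            then show ?thesis using moll_eq_0[OF _ r(1), of n z] by simp
          qed
        qed (use integrable_moll[OF r(1)[of n], where 'a = 'a] in auto)
        also have "\<dots> = e / 2"
          using integral_moll[OF r(1)[of n], where 'a = 'a] by simp
        finally show "norm (mollify (r n) g y - g y) < e"
          using \<open>e > 0\<close> by simp
      qed
    qed
    have bound: "\<bar>mollify (r n) g y\<bar> \<le> indicator (cball 0 (R + 1)) y * B" for n y
    proof (cases "norm y \<le> R + 1")
      case True
      have "\<bar>mollify (r n) g y\<bar> \<le> (LINT z|lborel. B * moll (r n) (y - z))"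
        unfolding mollify_def real_norm_def[symmetric]
      proof (rule Bochner_Integration.integral_norm_bound_integral)
        show "integrable lborel (\<lambda>z. moll (r n) (y - z) *\<^sub>R g z)"
          using integrable_moll_scaleR[OF locint_translate[OF lg] r(1), of n y]
            integral_lborel_reflect(2)[of "\<lambda>z. moll (r n) z *\<^sub>R g (y - z)" y] by simp
        show "integrable lborel (\<lambda>z. B * moll (r n) (y - z))"
          using integrable_moll[OF r(1)[of n], where 'a = 'a] integral_lborel_reflect(2)[of "moll (r n)" y] by simp
        show "norm (moll (r n) (y - z) *\<^sub>R g z) \<le> B * moll (r n) (y - z)" for z
          using mult_left_mono[OF g(3)[of z] moll_nonneg[of "r n" "y - z"]]
          by (simp add: abs_mult moll_nonneg mult.commute)
      qed
      also have "\<dots> = B"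
        using integral_moll[OF r(1)[of n], where 'a = 'a] integral_lborel_reflect(1)[of "moll (r n)" y] by simp
      finally show ?thesis using True by simp
    next
      case False
      have "moll (r n) (y - z) *\<^sub>R g z = 0" for z
      proof (cases "norm z \<le> R")
        case True
        then have "norm (y - z) \<ge> r n"
          using False r(2)[of n] norm_triangle_sub[of y z] by simp
        then show ?thesis using moll_eq_0[OF _ r(1), of n "y - z"] by simp
      qed (use g in auto)
      then have "(\<lambda>z. moll (r n) (y - z) *\<^sub>R g z) = (\<lambda>_. 0)" by (rule ext)
      then have "mollify (r n) g y = 0" unfolding mollify_def by (simp only: Bochner_Integration.integral_zero)
      then show ?thesis using False by simp
    qed
    have [measurable]: "mollify (r n) g \<in> borel_measurable borel" for n
      unfolding mollify_eq_bump[OF lg r(1), abs_def]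
      by (intro borel_measurable_continuous_onI continuous_intros continuous_bump_conv lg r)
    have "(\<lambda>n. LINT y|lborel. mollify (r n) g y * w y) \<longlonglongrightarrow> (LINT y|lborel. g y * w y)"
    proof (rule integral_dominated_convergence)
      show "integrable lborel (\<lambda>y. B *\<^sub>R norm (indicator (cball 0 (R + 1)) y *\<^sub>R w y))"
        using w by (intro integrable_scaleR_right integrable_norm) (simp add: locint_def)
      show "AE y in lborel. (\<lambda>n. mollify (r n) g y * w y) \<longlonglongrightarrow> g y * w y"
        by (intro AE_I2 tendsto_intros lim)
      show "AE y in lborel. norm (mollify (r n) g y * w y) \<le> B *\<^sub>R norm (indicator (cball 0 (R + 1)) y *\<^sub>R w y)" for n
        using mult_right_mono[OF bound[of n], of "\<bar>w _\<bar>"] by (auto simp: abs_mult mult_ac indicator_def)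
    qed measurable
    then show ?thesis by (simp add: moll0 LIMSEQ_const_iff)
  qed
  have local: "AE x in lborel. norm x \<le> real R \<longrightarrow> w x = 0" for R :: nat
  proof -
    let ?s = "\<lambda>x. indicator (cball 0 (real R)) x * sgn (w x)"
    obtain g where g: "\<And>n. continuous_on UNIV (g n)" "\<And>n x. norm (g n x) \<le> 1"
      "\<And>n x. norm x > real R + 1 \<Longrightarrow> g n x = 0" "AE x in lborel. (\<lambda>n. g n x) \<longlonglongrightarrow> ?s x"
      by (rule Cc_approx_bounded[of ?s 1 "real R"]) (auto simp: indicator_def sgn_if)
    have [measurable]: "g n \<in> borel_measurable borel" for n
      using g(1) by (rule borel_measurable_continuous_onI)
    have "(\<lambda>n. LINT y|lborel. g n y * w y) \<longlonglongrightarrow> (LINT y|lborel. ?s y * w y)"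
    proof (rule integral_dominated_convergence)
      show "integrable lborel (\<lambda>y. norm (indicator (cball 0 (real R + 1)) y *\<^sub>R w y))"
        using w by (intro integrable_norm) (simp add: locint_def)
      show "AE y in lborel. (\<lambda>n. g n y * w y) \<longlonglongrightarrow> ?s y * w y"
        using g(4) by eventually_elim (intro tendsto_intros)
      show "AE y in lborel. norm (g n y * w y) \<le> norm (indicator (cball 0 (real R + 1)) y *\<^sub>R w y)" for n
      proof (intro AE_I2)
        fix y
        show "norm (g n y * w y) \<le> norm (indicator (cball 0 (real R + 1)) y *\<^sub>R w y)"
          using g(2)[of n y] g(3)[of y n] mult_right_mono[of "\<bar>g n y\<bar>" 1 "\<bar>w y\<bar>"]
          by (auto simp: indicator_def abs_mult)
      qed
    qed measurable
    moreover have zero: "(LINT y|lborel. g n y * w y) = 0" for n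
      by (rule Cc[OF g(1) g(3)]) (use g(2) in auto)
    ultimately have "(LINT y|lborel. ?s y * w y) = 0"
      by (simp only: zero LIMSEQ_const_iff)
    moreover have "?s y * w y = norm (indicator (cball 0 (real R)) y *\<^sub>R w y)" for y
      by (auto simp: indicator_def sgn_if)
    ultimately have "(LINT y|lborel. norm (indicator (cball 0 (real R)) y *\<^sub>R w y)) = 0" by simp
    moreover have "integrable lborel (\<lambda>y. norm (indicator (cball 0 (real R)) y *\<^sub>R w y))"
      using w by (intro integrable_norm) (simp add: locint_def)
    ultimately have "AE y in lborel. norm (indicator (cball 0 (real R)) y *\<^sub>R w y) = 0"
      by (subst (asm) integral_nonneg_eq_0_iff_AE) auto
    then show ?thesis
      by eventually_elim (auto simp: indicator_def split: if_splits)
  qed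
  then have "AE x in lborel. \<forall>R. norm x \<le> real R \<longrightarrow> w x = 0"
    unfolding AE_all_countable by blast
  then show ?thesis
    by eventually_elim (use real_arch_simple in blast)
qed

subsection \<open>Sobolev functions\<close>

lemma lebesgue_measurable_borel_representative:
  fixes f :: "'a::euclidean_space \<Rightarrow> 'b::euclidean_space"
  assumes f: "f \<in> borel_measurable lebesgue"
  obtains g where "g \<in> borel_measurable borel" "AE x in lborel. f x = g x"
proof -
  have "\<exists>g. g \<in> borel_measurable lborel \<and> (AE x in lborel. f x \<bullet> b = g x)" for b
  proof -
    have "(\<lambda>x. f x \<bullet> b) \<in> borel_measurable lebesgue"
      using f by measurable
    from completion_ex_borel_measurable_real[OF this] show ?thesis by blast
  qed
  then obtain g where g: "\<And>b. g b \<in> borel_measurable lborel" "\<And>b. AE x in lborel. f x \<bullet> b = g b x"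
    by metis
  show ?thesis
  proof (rule that[of "\<lambda>x. \<Sum>b\<in>Basis. g b x *\<^sub>R b"])
    have [measurable]: "g b \<in> borel_measurable borel" for b
      using g(1) by simp
    show "(\<lambda>x. \<Sum>b\<in>Basis. g b x *\<^sub>R b) \<in> borel_measurable borel" by measurable
    have "AE x in lborel. \<forall>b\<in>Basis. f x \<bullet> b = g b x"
      using g(2) by (intro AE_finite_allI) auto
    then show "AE x in lborel. f x = (\<Sum>b\<in>Basis. g b x *\<^sub>R b)"
    proof eventually_elim
      case (elim x)
      then have "(\<Sum>b\<in>Basis. g b x *\<^sub>R b) = (\<Sum>b\<in>Basis. (f x \<bullet> b) *\<^sub>R b)"
        by (intro sum.cong) auto
      then show ?case by (simp add: euclidean_representation)
    qed
  qed
qed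

lemma integral_lebesgue_eq_lborel:
  fixes f g :: "'a::euclidean_space \<Rightarrow> 'b::euclidean_space"
  assumes "f \<in> borel_measurable lebesgue" "g \<in> borel_measurable borel" "AE x in lborel. f x = g x"
  shows "integral\<^sup>L lebesgue f = integral\<^sup>L lborel g" "integrable lebesgue f \<longleftrightarrow> integrable lborel g"
proof -
  have g: "g \<in> borel_measurable lborel" "g \<in> borel_measurable lebesgue"
    using assms(2) by (simp_all add: measurable_completion)
  have ae: "AE x in lebesgue. f x = g x"
    using assms(3) by (rule AE_completion)
  show "integral\<^sup>L lebesgue f = integral\<^sup>L lborel g"
    using integral_cong_AE[OF assms(1) g(2) ae] integral_completion[OF g(1)] by simp
  show "integrable lebesgue f \<longleftrightarrow> integrable lborel g"
    using integrable_cong_AE[OF assms(1) g(2) ae] integrable_completion[OF g(1)] by simp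
qed

lemma locally_integrable_measurable:
  fixes f :: "'a::euclidean_space \<Rightarrow> 'b::euclidean_space"
  assumes "locally_integrable f"
  shows "f \<in> borel_measurable lebesgue"
proof (rule borel_measurable_LIMSEQ_metric)
  show "(\<lambda>x. indicator (cball 0 (real n)) x *\<^sub>R f x) \<in> borel_measurable lebesgue" for n
    using assms by (intro borel_measurable_integrable) (simp add: locally_integrable_def set_integrable_def)
  fix x :: 'a
  obtain N where "norm x \<le> real N" using real_arch_simple by blast
  then have "\<forall>\<^sub>F n in sequentially. indicator (cball 0 (real n)) x *\<^sub>R f x = f x"
    by (intro eventually_sequentiallyI[of N]) (auto simp: indicator_def)
  then show "(\<lambda>n. indicator (cball 0 (real n)) x *\<^sub>R f x) \<longlonglongrightarrow> f x"
    by (rule tendsto_eventually)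
qed

lemma locally_integrable_imp_locint:
  assumes f: "locally_integrable f" and [measurable]: "g \<in> borel_measurable borel" and ae: "AE x in lborel. f x = g x"
  shows "locint g"
  unfolding locint_def
proof (intro conjI allI)
  fix R
  have "integrable lebesgue (\<lambda>x. indicator (cball 0 R) x *\<^sub>R f x)"
    using f by (simp add: locally_integrable_def set_integrable_def)
  moreover have "AE x in lborel. indicator (cball 0 R) x *\<^sub>R f x = indicator (cball 0 R) x *\<^sub>R g x"
    using ae by eventually_elim simp
  moreover have "(\<lambda>x. indicator (cball 0 R) x *\<^sub>R g x) \<in> borel_measurable borel"
    by (intro borel_measurable_scaleR) simp_all
  ultimately show "integrable lborel (\<lambda>x. indicator (cball 0 R) x *\<^sub>R g x)"
    using integral_lebesgue_eq_lborel(2)[OF borel_measurable_integrable] by blast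
qed fact

text \<open>Translated bumps are the only tests kept: they suffice both for mollification and for
  uniqueness of the gradient. The minus sign of integration by parts is absorbed, because
  differentiating \<open>bump r (x - y)\<close> in \<open>y\<close> gives
  \<open>- bump_grad r (x - y)\<close>.\<close>

definition weak_pair :: "('a::euclidean_space \<Rightarrow> real) \<Rightarrow> ('a \<Rightarrow> 'a) \<Rightarrow> bool" where
  "weak_pair f F \<longleftrightarrow> locint f \<and> locint F \<and>
     (\<forall>x r. r > 0 \<longrightarrow> (LINT y|lborel. f y *\<^sub>R bump_grad r (x - y)) = (LINT y|lborel. bump r (x - y) *\<^sub>R F y))"

lemma has_weak_gradient_imp_weak_pair:
  assumes fF: "has_weak_gradient f F"
    and [measurable]: "f' \<in> borel_measurable borel" "F' \<in> borel_measurable borel"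
    and ae: "AE x in lborel. f x = f' x" "AE x in lborel. F x = F' x"
  shows "weak_pair f' F'"
  unfolding weak_pair_def
proof (intro conjI allI impI)
  have li: "locally_integrable f" "locally_integrable F"
    using fF by (auto simp: has_weak_gradient_def)
  show "locint f'" "locint F'"
    using locally_integrable_imp_locint li ae assms(2,3) by blast+
  have [measurable]: "f \<in> borel_measurable lebesgue" "F \<in> borel_measurable lebesgue"
    using li by (auto intro: locally_integrable_measurable)
  fix x r :: "'a" and \<rho> :: real
  assume r: "\<rho> > 0"
  have m: "(\<lambda>y. bump \<rho> (x - y)) \<in> borel_measurable lebesgue" "(\<lambda>y. - bump_grad \<rho> (x - y)) \<in> borel_measurable lebesgue"
    by (intro measurable_completion, simp)+
  have "(LINT y|lebesgue. f y *\<^sub>R (- bump_grad \<rho> (x - y))) = - (LINT y|lebesgue. bump \<rho> (x - y) *\<^sub>R F y)"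
  proof -
    have "\<forall>\<phi> G. test_function \<phi> \<and> (\<forall>x. GDERIV \<phi> x :> G x) \<longrightarrow>
        (LINT x|lebesgue. f x *\<^sub>R G x) = - (LINT x|lebesgue. \<phi> x *\<^sub>R F x)"
      using fF by (simp add: has_weak_gradient_def)
    from this[rule_format, of "\<lambda>y. bump \<rho> (x - y)" "\<lambda>y. - bump_grad \<rho> (x - y)"] show ?thesis
      using test_function_bump[OF r, of x] GDERIV_bump_diff[of \<rho> x] by simp
  qed
  moreover have "(LINT y|lebesgue. f y *\<^sub>R (- bump_grad \<rho> (x - y))) = (LINT y|lborel. f' y *\<^sub>R (- bump_grad \<rho> (x - y)))"
    by (rule integral_lebesgue_eq_lborel) (use ae m in \<open>auto intro!: borel_measurable_scaleR\<close>)
  moreover have "(LINT y|lebesgue. bump \<rho> (x - y) *\<^sub>R F y) = (LINT y|lborel. bump \<rho> (x - y) *\<^sub>R F' y)"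
    by (rule integral_lebesgue_eq_lborel) (use ae m in \<open>auto intro!: borel_measurable_scaleR\<close>)
  ultimately show "(LINT y|lborel. f' y *\<^sub>R bump_grad \<rho> (x - y)) = (LINT y|lborel. bump \<rho> (x - y) *\<^sub>R F' y)"
    by simp
qed

lemma locint_inner:
  fixes F :: "'a::euclidean_space \<Rightarrow> 'b::euclidean_space"
  assumes "locint F"
  shows "locint (\<lambda>x. F x \<bullet> b)"
  unfolding locint_def
proof (intro conjI allI)
  show "(\<lambda>x. F x \<bullet> b) \<in> borel_measurable borel"
    using assms by (intro borel_measurable_inner borel_measurable_const) (simp add: locint_def)
  fix R
  have "integrable lborel (\<lambda>x. (indicator (cball 0 R) x *\<^sub>R F x) \<bullet> b)"
    using assms by (intro integrable_inner_left) (simp add: locint_def)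
  then show "integrable lborel (\<lambda>x. indicator (cball 0 R) x *\<^sub>R (F x \<bullet> b))" by simp
qed

lemma locint_diff:
  fixes F :: "'a::euclidean_space \<Rightarrow> 'b::euclidean_space"
  assumes "locint F" "locint G"
  shows "locint (\<lambda>x. F x - G x)"
  unfolding locint_def
proof (intro conjI allI)
  show "(\<lambda>x. F x - G x) \<in> borel_measurable borel"
    using assms by (intro borel_measurable_diff) (simp_all add: locint_def)
  fix R
  have "integrable lborel (\<lambda>x. indicator (cball 0 R) x *\<^sub>R F x - indicator (cball 0 R) x *\<^sub>R G x)"
    using assms by (intro Bochner_Integration.integrable_diff) (simp_all add: locint_def)
  then show "integrable lborel (\<lambda>x. indicator (cball 0 R) x *\<^sub>R (F x - G x))"
    by (simp only: scaleR_diff_right)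
qed

lemma AE_zero_of_bump_integrals_vector:
  fixes w :: "'a::euclidean_space \<Rightarrow> 'b::euclidean_space"
  assumes w: "locint w" and zero: "\<And>x r. r > 0 \<Longrightarrow> (LINT y|lborel. bump r (x - y) *\<^sub>R w y) = 0"
  shows "AE x in lborel. w x = 0"
proof -
  have "AE x in lborel. w x \<bullet> b = 0" for b
  proof (rule AE_zero_of_bump_integrals[OF locint_inner[OF w]])
    fix x and r :: real
    assume r: "r > 0"
    have "(LINT y|lborel. (bump r (x - y) *\<^sub>R w y) \<bullet> b) = (LINT y|lborel. bump r (x - y) *\<^sub>R w y) \<bullet> b"
      by (intro integral_inner_left integrable_bump_conv w r)
    then show "(LINT y|lborel. bump r (x - y) *\<^sub>R (w y \<bullet> b)) = 0"
      using zero[OF r] by simp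
  qed
  then have "AE x in lborel. \<forall>b\<in>Basis. w x \<bullet> b = 0"
    by (intro AE_finite_allI) auto
  then show ?thesis
    by eventually_elim (rule euclidean_eqI, simp)
qed

lemma weak_pair_unique:
  assumes "weak_pair f F" "weak_pair f G"
  shows "AE x in lborel. F x = G x"
proof -
  have l: "locint F" "locint G"
    using assms by (auto simp: weak_pair_def)
  have "AE x in lborel. F x - G x = 0"
  proof (rule AE_zero_of_bump_integrals_vector[OF locint_diff[OF l]])
    fix x and r :: real
    assume r: "r > 0"
    have "(LINT y|lborel. bump r (x - y) *\<^sub>R F y) = (LINT y|lborel. bump r (x - y) *\<^sub>R G y)"
      using assms r by (simp add: weak_pair_def)
    then show "(LINT y|lborel. bump r (x - y) *\<^sub>R (F y - G y)) = 0"
      using integrable_bump_conv[OF l(1) r] integrable_bump_conv[OF l(2) r] by (simp add: scaleR_diff_right)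
  qed
  then show ?thesis by simp
qed

lemma sqint_of_L2:
  assumes f: "f \<in> L2" and [measurable]: "g \<in> borel_measurable borel" and ae: "AE x in lborel. f x = g x"
  shows "sqint g"
proof -
  have [measurable]: "f \<in> borel_measurable lebesgue" and i: "integrable lebesgue (\<lambda>x. (norm (f x))\<^sup>2)"
    using f by (auto simp: L2_def)
  have "integrable lborel (\<lambda>x. (norm (g x))\<^sup>2)"
    using i by (subst (asm) integral_lebesgue_eq_lborel(2)[where g = "\<lambda>x. (norm (g x))\<^sup>2"]) (use ae in auto)
  then show ?thesis by (simp add: sqint_def)
qed

definition sobolev_pair :: "('a::euclidean_space \<Rightarrow> real) \<Rightarrow> ('a \<Rightarrow> 'a) \<Rightarrow> bool" where
  "sobolev_pair f F \<longleftrightarrow> sqint f \<and> sqint F \<and> weak_pair f F"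

text \<open>The gradient picked by the choice operator need not be literally the square integrable
  one that membership in \<open>H1\<close> provides; uniqueness up to null sets identifies the
  two.\<close>

lemma H1_representative:
  assumes "f \<in> H1"
  obtains f' F' where "sobolev_pair f' F'" "AE x in lborel. f x = f' x"
    "weak_gradient f \<in> borel_measurable lebesgue" "AE x in lborel. weak_gradient f x = F' x"
proof -
  obtain F where F: "f \<in> L2" "F \<in> L2" "has_weak_gradient f F"
    using assms by (auto simp: H1_def)
  have wg: "has_weak_gradient f (weak_gradient f)"
    unfolding weak_gradient_def using someI[of "has_weak_gradient f" F] F(3) by simp
  have mwg: "weak_gradient f \<in> borel_measurable lebesgue"
    using wg by (auto simp: has_weak_gradient_def intro: locally_integrable_measurable)
  obtain f' where f': "f' \<in> borel_measurable borel" "AE x in lborel. f x = f' x"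
    using F(1) by (auto simp: L2_def elim: lebesgue_measurable_borel_representative)
  obtain F' where F': "F' \<in> borel_measurable borel" "AE x in lborel. F x = F' x"
    using F(2) by (auto simp: L2_def elim: lebesgue_measurable_borel_representative)
  obtain G' where G': "G' \<in> borel_measurable borel" "AE x in lborel. weak_gradient f x = G' x"
    using mwg by (rule lebesgue_measurable_borel_representative)
  have "weak_pair f' F'" "weak_pair f' G'"
    using has_weak_gradient_imp_weak_pair[OF F(3) f'(1) F'(1) f'(2) F'(2)]
      has_weak_gradient_imp_weak_pair[OF wg f'(1) G'(1) f'(2) G'(2)] by simp_all
  then have FG: "AE x in lborel. F' x = G' x"
    by (rule weak_pair_unique)
  have "sobolev_pair f' F'"
    unfolding sobolev_pair_def
    using sqint_of_L2[OF F(1) f'] sqint_of_L2[OF F(2) F'] \<open>weak_pair f' F'\<close> by simp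
  moreover have "AE x in lborel. weak_gradient f x = F' x"
    using FG G'(2) by eventually_elim simp
  ultimately show ?thesis
    using that f' mwg by blast
qed

lemma sobolev_pair_zero:
  assumes fF: "sobolev_pair f F" and zero: "AE x in lborel. f x = 0"
  shows "AE x in lborel. F x = 0"
proof (rule AE_zero_of_bump_integrals_vector)
  show "locint F" using fF by (simp add: sobolev_pair_def weak_pair_def)
  fix x and r :: real
  assume r: "r > 0"
  have "(LINT y|lborel. bump r (x - y) *\<^sub>R F y) = (LINT y|lborel. f y *\<^sub>R bump_grad r (x - y))"
    using fF r by (simp add: sobolev_pair_def weak_pair_def)
  also have "\<dots> = (LINT y|(lborel :: 'a measure). 0)"
  proof (rule integral_cong_AE)
    have [measurable]: "f \<in> borel_measurable borel"
      using fF by (simp add: sobolev_pair_def sqint_def)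
    show "(\<lambda>y. f y *\<^sub>R bump_grad r (x - y)) \<in> borel_measurable lborel" by measurable
  qed (use zero in auto)
  finally show "(LINT y|lborel. bump r (x - y) *\<^sub>R F y) = 0" by simp
qed

section \<open>Approximation of Sobolev functions by C^1 functions of compact support\<close>

definition C1c :: "('a::euclidean_space \<Rightarrow> real) \<Rightarrow> ('a \<Rightarrow> 'a) \<Rightarrow> bool" where
  "C1c \<phi> \<Phi> \<longleftrightarrow> (\<forall>x. GDERIV \<phi> x :> \<Phi> x) \<and> continuous_on UNIV \<Phi> \<and> (\<exists>R. \<forall>x. norm x > R \<longrightarrow> \<phi> x = 0 \<and> \<Phi> x = 0)"

definition possq :: "real \<Rightarrow> real" where
  "possq t = (max 0 t)\<^sup>2"

lemma DERIV_possq: "(possq has_real_derivative 2 * max 0 t) (at t)"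
proof (cases t "0 :: real" rule: linorder_cases)
  case less
  have "((\<lambda>_. 0) has_real_derivative 2 * max 0 t) (at t)" using less by simp
  then show ?thesis
    by (rule has_field_derivative_transform_within_open[where S = "{..<0}"])
       (use less in \<open>auto simp: possq_def\<close>)
next
  case greater
  have "((\<lambda>t. t\<^sup>2) has_real_derivative 2 * max 0 t) (at t)"
    using greater by (auto intro!: derivative_eq_intros)
  then show ?thesis
    by (rule has_field_derivative_transform_within_open[where S = "{0<..}"])
       (use greater in \<open>auto simp: possq_def\<close>)
next
  case equal
  have "((\<lambda>h. possq h / h) \<longlongrightarrow> 0) (at 0)"
  proof (rule Lim_null_comparison)
    show "\<forall>\<^sub>F h in at 0. norm (possq h / h) \<le> \<bar>h\<bar>"
      by (rule always_eventually) (auto simp: possq_def max_def power2_eq_square)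
    show "((\<lambda>h::real. \<bar>h\<bar>) \<longlongrightarrow> 0) (at 0)"
      by (rule tendsto_rabs_zero) (rule tendsto_ident_at)
  qed
  then show ?thesis
    using equal by (simp add: DERIV_def possq_def)
qed

text \<open>The squared positive part \<open>possq\<close> has derivative 0 at 0, so the inner one
  leaves the value 1 and the outer one reaches the value 0 without a kink. Working with the squared
  norm avoids the singularity of the norm at the origin.\<close>

definition cutoff :: "real \<Rightarrow> 'a::euclidean_space \<Rightarrow> real" where
  "cutoff R x = possq (1 - possq ((norm x)\<^sup>2 / R\<^sup>2 - 1))"

definition cutoff_grad :: "real \<Rightarrow> 'a::euclidean_space \<Rightarrow> 'a" where
  "cutoff_grad R x = (2 * max 0 (1 - possq ((norm x)\<^sup>2 / R\<^sup>2 - 1)) * - (2 * max 0 ((norm x)\<^sup>2 / R\<^sup>2 - 1)) * (1 / R\<^sup>2)) *\<^sub>R (2 *\<^sub>R x)"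

lemma GDERIV_cutoff: "GDERIV (cutoff R) x :> cutoff_grad R x"
proof -
  have "GDERIV (\<lambda>x::'a. (norm (0 - x))\<^sup>2) x :> 2 *\<^sub>R (x - 0)" by (rule GDERIV_norm_squared)
  then have n: "GDERIV (\<lambda>x::'a. (norm x)\<^sup>2) x :> 2 *\<^sub>R x" by simp
  have "((\<lambda>s. possq (1 - possq (s / R\<^sup>2 - 1))) has_real_derivative
      2 * max 0 (1 - possq (s / R\<^sup>2 - 1)) * - (2 * max 0 (s / R\<^sup>2 - 1) * (1 / R\<^sup>2))) (at s)" for s
  proof -
    have "((\<lambda>s. s / R\<^sup>2 - 1) has_real_derivative 1 / R\<^sup>2 - 0) (at s)"
      by (intro DERIV_diff DERIV_const DERIV_cdivide DERIV_ident)
    from DERIV_chain2[OF DERIV_possq DERIV_diff[OF DERIV_const DERIV_chain2[OF DERIV_possq this]]]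
    show ?thesis by simp
  qed
  from GDERIV_DERIV_compose[OF n this] show ?thesis
    by (simp add: cutoff_def[abs_def] cutoff_grad_def)
qed

lemma continuous_possq [continuous_intros]: "continuous_on S f \<Longrightarrow> continuous_on S (\<lambda>x. possq (f x))"
  unfolding possq_def by (intro continuous_intros)

lemma continuous_cutoff_grad: "R > 0 \<Longrightarrow> continuous_on UNIV (cutoff_grad R)"
  unfolding cutoff_grad_def[abs_def] by (intro continuous_intros) auto

lemma cutoff_range: "0 \<le> cutoff R x" "cutoff R x \<le> 1"
proof -
  have "0 \<le> possq t" for t by (simp add: possq_def)
  then show "0 \<le> cutoff R x" "cutoff R x \<le> 1"
    by (auto simp: cutoff_def possq_def intro!: power_le_one)
qed

lemma cutoff_eq_1: "norm x \<le> R \<Longrightarrow> R > 0 \<Longrightarrow> cutoff R x = 1"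
  and cutoff_grad_eq_0: "norm x \<le> R \<Longrightarrow> R > 0 \<Longrightarrow> cutoff_grad R x = 0"
proof -
  assume "norm x \<le> R" "R > 0"
  then have "(norm x)\<^sup>2 / R\<^sup>2 \<le> 1"
    using power_mono[of "norm x" R 2] by (simp add: divide_le_eq)
  then show "cutoff R x = 1" "cutoff_grad R x = 0"
    by (auto simp: cutoff_def cutoff_grad_def possq_def max_def)
qed

lemma cutoff_eq_0: "norm x \<ge> 2 * R \<Longrightarrow> R > 0 \<Longrightarrow> cutoff R x = 0"
  and cutoff_grad_eq_0': "norm x \<ge> 2 * R \<Longrightarrow> R > 0 \<Longrightarrow> cutoff_grad R x = 0"
proof -
  assume "norm x \<ge> 2 * R" "R > 0"
  then have "(norm x)\<^sup>2 / R\<^sup>2 - 1 \<ge> 1"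
  proof -
    have "4 * R\<^sup>2 \<le> (norm x)\<^sup>2"
      using power_mono[of "2 * R" "norm x" 2] \<open>norm x \<ge> 2 * R\<close> \<open>R > 0\<close> by (simp add: power_mult_distrib)
    then have "2 * R\<^sup>2 \<le> (norm x)\<^sup>2"
      using zero_le_power2[of R] by linarith
    then show ?thesis
      using \<open>R > 0\<close> by (simp add: le_divide_eq)
  qed
  then have "possq ((norm x)\<^sup>2 / R\<^sup>2 - 1) \<ge> 1"
    unfolding possq_def using power_mono[of 1 "max 0 ((norm x)\<^sup>2 / R\<^sup>2 - 1)" 2] by simp
  then show "cutoff R x = 0" "cutoff_grad R x = 0"
    by (auto simp: cutoff_def[of R] cutoff_grad_def possq_def[of "1 - _"] max_def)
qed

text \<open>The product of the two positive parts in the gradient is at most 1, because the first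
  one vanishes once \<open>t\<close> exceeds 1. Only the order 1/R of the bound matters.\<close>

lemma norm_cutoff_grad_le:
  assumes R: "R > 0"
  shows "norm (cutoff_grad R x) \<le> 24 / R"
proof (cases "norm x < 2 * R")
  case True
  define t where "t = (norm x)\<^sup>2 / R\<^sup>2 - 1"
  have "(norm x)\<^sup>2 < 4 * R\<^sup>2"
    using power_strict_mono[OF True, of 2] by (simp add: power_mult_distrib)
  then have t: "t \<le> 3"
    using R by (simp add: t_def divide_le_eq)
  have a: "0 \<le> max 0 (1 - possq t)" "max 0 (1 - possq t) \<le> 1"
    by (auto simp: possq_def)
  have b: "0 \<le> max 0 t" "max 0 t \<le> 3" using t by auto
  have "norm (cutoff_grad R x) = max 0 (1 - possq t) * max 0 t * (8 * norm x / R\<^sup>2)"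
    using a b R by (simp add: cutoff_grad_def t_def[symmetric] abs_mult)
  also have "\<dots> \<le> 1 * (max 0 t) * (8 * norm x / R\<^sup>2)"
    using a b by (intro mult_right_mono) auto
  finally have le: "norm (cutoff_grad R x) \<le> max 0 (1 - possq t) * max 0 t * (8 * norm x / R\<^sup>2)"
    using \<open>norm (cutoff_grad R x) = _\<close> by simp
  have "max 0 (1 - possq t) * max 0 t \<le> 1"
  proof (cases "t \<le> 1")
    case True
    then have "max 0 t \<le> 1" by simp
    with a b show ?thesis by (intro mult_le_one) auto
  next
    case False
    then have "possq t \<ge> 1" unfolding possq_def using power_mono[of 1 "max 0 t" 2] by simp
    then show ?thesis by simp
  qed
  then have "max 0 (1 - possq t) * max 0 t * (8 * norm x / R\<^sup>2) \<le> 1 * (8 * norm x / R\<^sup>2)"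
    by (intro mult_right_mono) auto
  also have "\<dots> \<le> 8 * (2 * R) / R\<^sup>2"
    using True R by (simp add: divide_right_mono)
  also have "\<dots> = 16 / R" using R by (simp add: power2_eq_square)
  also have "\<dots> \<le> 24 / R" using R by (simp add: divide_right_mono)
  finally show ?thesis using le by simp
next
  case False
  then show ?thesis using R by (simp add: cutoff_grad_eq_0')
qed

text \<open>Weak differentiation commutes with mollification, so the mollified \<open>f\<close> is
  of class C^1 with the mollified \<open>F\<close> as gradient. Cutting off adds a multiple of
  \<open>g\<close> that vanishes on growing balls and is dominated by
  \<open>24 * \<bar>g x\<bar>\<close>.\<close>

lemma sobolev_C1c_approx:
  fixes f :: "'a::euclidean_space \<Rightarrow> real"
  assumes fF: "sobolev_pair f F" and e: "e > 0"
  obtains \<phi> \<Phi> where "C1c \<phi> \<Phi>" "sqint \<phi>" "sqint \<Phi>" "sqnorm (\<lambda>x. \<phi> x - f x) < e" "sqnorm (\<lambda>x. \<Phi> x - F x) < e"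
proof -
  have sf: "sqint f" "sqint F" and wp: "weak_pair f F"
    using fF by (auto simp: sobolev_pair_def)
  have lf: "locint f" "locint F"
    using sf sqint_imp_locint by blast+
  \<comment> \<open>Mollification and cutoff each cost e/5, and 2 (e/5) + 2 (e/5) is still below
    e.\<close>
  obtain d1 where d1: "d1 > 0" "\<And>z. norm z < d1 \<Longrightarrow> sqnorm (\<lambda>x. f (x - z) - f x) \<le> e / 5"
    using sqnorm_translation_continuous[OF sf(1), of "e / 5"] e by auto
  obtain d2 where d2: "d2 > 0" "\<And>z. norm z < d2 \<Longrightarrow> sqnorm (\<lambda>x. F (x - z) - F x) \<le> e / 5"
    using sqnorm_translation_continuous[OF sf(2), of "e / 5"] e by auto
  define r where "r = min d1 d2"
  have r: "r > 0" using d1 d2 by (simp add: r_def)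
  define g where "g = mollify r f"
  define G where "G = mollify r F"
  have g: "sqint g" "sqnorm (\<lambda>x. g x - f x) \<le> e / 5" and G: "sqint G" "sqnorm (\<lambda>x. G x - F x) \<le> e / 5"
    unfolding g_def G_def
    by (rule sqnorm_mollify_diff_le[OF sf(1) r] sqnorm_mollify_diff_le[OF sf(2) r], rule d1 d2, simp add: r_def)+
  have contG: "continuous_on UNIV G"
    unfolding G_def mollify_eq_bump[OF lf(2) r, abs_def]
    by (intro continuous_intros continuous_bump_conv lf r)
  have derg: "GDERIV g x :> G x" for x
  proof -
    have "(LINT y|lborel. f y *\<^sub>R bump_grad r (x - y)) = (LINT y|lborel. bump r (x - y) *\<^sub>R F y)"
      using wp r by (simp add: weak_pair_def)
    then have "GDERIV (\<lambda>x. LINT y|lborel. bump r (x - y) *\<^sub>R f y) x :> (LINT y|lborel. bump r (x - y) *\<^sub>R F y)"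
      using GDERIV_bump_conv[OF lf(1) r, of x] by simp
    from GDERIV_mult[OF GDERIV_const this] show ?thesis
      unfolding g_def G_def mollify_eq_bump[OF lf(2) r, abs_def] mollify_eq_bump[OF lf(1) r, abs_def]
        real_scaleR_def scaleR_zero_right add_0_right .
  qed
  define \<phi> where "\<phi> n x = cutoff (real n + 1) x * g x" for n x
  define \<Phi> where "\<Phi> n x = cutoff (real n + 1) x *\<^sub>R G x + g x *\<^sub>R cutoff_grad (real n + 1) x" for n x
  have contg: "continuous_on UNIV g"
    using derg by (rule GDERIV_imp_continuous_on)
  have contc: "continuous_on UNIV (cutoff R :: 'a \<Rightarrow> real)" for R
    using GDERIV_cutoff by (rule GDERIV_imp_continuous_on)
  have C: "C1c (\<phi> n) (\<Phi> n)" for n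
    unfolding C1c_def
  proof (intro conjI allI exI impI)
    show "GDERIV (\<phi> n) x :> \<Phi> n x" for x
      unfolding \<phi>_def[abs_def] \<Phi>_def by (rule GDERIV_mult[OF GDERIV_cutoff derg])
    show "continuous_on UNIV (\<Phi> n)"
      unfolding \<Phi>_def[abs_def] by (intro continuous_intros contc contG contg continuous_cutoff_grad) simp
    show "\<phi> n x = 0" "\<Phi> n x = 0" if "2 * (real n + 1) < norm x" for x
      using that by (simp_all add: \<phi>_def \<Phi>_def cutoff_eq_0 cutoff_grad_eq_0')
  qed
  have [measurable]: "\<phi> n \<in> borel_measurable borel" "\<Phi> n \<in> borel_measurable borel" for n
    using C[of n] by (auto simp: C1c_def intro!: borel_measurable_continuous_onI GDERIV_imp_continuous_on)
  have [measurable]: "g \<in> borel_measurable borel" "G \<in> borel_measurable borel"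
    using g G sqint_measurable by blast+
  have ev: "\<forall>\<^sub>F n in sequentially. norm x \<le> real n + 1" for x :: 'a
  proof -
    obtain N where "norm x \<le> real N" using real_arch_simple by blast
    then show ?thesis by (intro eventually_sequentiallyI[of N]) auto
  qed
  have L1: "L2lim \<phi> g"
  proof (rule L2lim_dominated[OF _ g(1)])
    have "(\<lambda>n. \<phi> n x) \<longlonglongrightarrow> g x" for x
      by (rule tendsto_eventually, rule eventually_mono[OF ev[of x]]) (simp add: \<phi>_def cutoff_eq_1)
    then show "AE x in lborel. (\<lambda>n. \<phi> n x) \<longlonglongrightarrow> g x" by simp
    have "\<bar>\<phi> n x\<bar> \<le> \<bar>g x\<bar>" for n x
      using mult_right_mono[OF cutoff_range(2), of "\<bar>g x\<bar>" "real n + 1" x] cutoff_range(1)[of "real n + 1" x]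
      by (simp add: \<phi>_def abs_mult)
    then show "AE x in lborel. norm (\<phi> n x) \<le> norm (g x)" for n by simp
  qed auto
  have L2: "L2lim \<Phi> G"
  proof (rule L2lim_dominated)
    show "sqint (\<lambda>x. norm (G x) + 24 * \<bar>g x\<bar>)"
      using sqint_add[OF sqint_norm[OF G(1)] sqint_cmult[OF sqint_norm[OF g(1)], of 24]] by simp
    have "(\<lambda>n. \<Phi> n x) \<longlonglongrightarrow> G x" for x
      by (rule tendsto_eventually, rule eventually_mono[OF ev[of x]]) (simp add: \<Phi>_def cutoff_eq_1 cutoff_grad_eq_0)
    then show "AE x in lborel. (\<lambda>n. \<Phi> n x) \<longlonglongrightarrow> G x" by simp
    have "norm (\<Phi> n x) \<le> norm (G x) + 24 * \<bar>g x\<bar>" for n x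
    proof -
      have "norm (cutoff_grad (real n + 1) x) \<le> 24"
        using norm_cutoff_grad_le[of "real n + 1" x] by (rule order_trans) (simp_all add: divide_le_eq)
      then have "\<bar>g x\<bar> * norm (cutoff_grad (real n + 1) x) \<le> \<bar>g x\<bar> * 24"
        by (intro mult_left_mono) auto
      moreover have "cutoff (real n + 1) x * norm (G x) \<le> norm (G x)"
        using mult_right_mono[OF cutoff_range(2), of "norm (G x)"] by simp
      ultimately show ?thesis
        using norm_triangle_ineq[of "cutoff (real n + 1) x *\<^sub>R G x" "g x *\<^sub>R cutoff_grad (real n + 1) x"]
          cutoff_range(1)[of "real n + 1" x]
        by (simp add: \<Phi>_def)
    qed
    then show "AE x in lborel. norm (\<Phi> n x) \<le> norm (norm (G x) + 24 * \<bar>g x\<bar>)" for n by simp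
  qed auto
  have "\<forall>\<^sub>F n in sequentially. sqnorm (\<lambda>x. \<phi> n x - g x) < e / 5 \<and> sqnorm (\<lambda>x. \<Phi> n x - G x) < e / 5"
    using e by (intro eventually_conj order_tendstoD(2)[OF L2limD(3)[OF L1]] order_tendstoD(2)[OF L2limD(3)[OF L2]]) auto
  then obtain n where n: "sqnorm (\<lambda>x. \<phi> n x - g x) < e / 5" "sqnorm (\<lambda>x. \<Phi> n x - G x) < e / 5"
    by (auto dest: eventually_happens)
  show ?thesis
  proof (rule that[OF C])
    show s: "sqint (\<phi> n)" "sqint (\<Phi> n)" using L2limD(1)[OF L1] L2limD(1)[OF L2] by blast+
    show "sqnorm (\<lambda>x. \<phi> n x - f x) < e"
      using sqnorm_triangle[OF s(1) g(1) sf(1)] n(1) g(2) e by linarith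
    show "sqnorm (\<lambda>x. \<Phi> n x - F x) < e"
      using sqnorm_triangle[OF s(2) G(1) sf(2)] n(2) G(2) e by linarith
  qed
qed

lemma L2limI:
  assumes "\<And>n. sqint (fs n)" "sqint f" "\<And>n. sqnorm (\<lambda>x. fs n x - f x) \<le> e n" "e \<longlonglongrightarrow> 0"
  shows "L2lim fs f"
  unfolding L2lim_def
proof (intro conjI allI)
  show "(\<lambda>n. sqnorm (\<lambda>x. fs n x - f x)) \<longlonglongrightarrow> 0"
    by (rule tendsto_sandwich[OF _ _ tendsto_const assms(4)]) (simp_all add: sqnorm_nonneg assms(3))
qed (rule assms)+

lemma sobolev_C1c_sequence:
  fixes f :: "'a::euclidean_space \<Rightarrow> real"
  assumes fF: "sobolev_pair f F"
  obtains \<phi> \<Phi> where "\<And>n. C1c (\<phi> n) (\<Phi> n)" "L2lim \<phi> f" "L2lim \<Phi> F"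
proof -
  define Q where "Q n \<phi> \<Phi> \<longleftrightarrow> C1c \<phi> \<Phi> \<and> sqint \<phi> \<and> sqint \<Phi> \<and> sqnorm (\<lambda>x. \<phi> x - f x) < 1 / (real n + 1) \<and>
      sqnorm (\<lambda>x. \<Phi> x - F x) < 1 / (real n + 1)" for n \<phi> \<Phi>
  have "\<exists>\<phi> \<Phi>. Q n \<phi> \<Phi>" for n
  proof -
    have "1 / (real n + 1) > 0" by simp
    from sobolev_C1c_approx[OF fF this] show ?thesis unfolding Q_def by blast
  qed
  then obtain \<phi> \<Phi> where Q: "\<And>n. Q n (\<phi> n) (\<Phi> n)"
    by metis
  have lim: "(\<lambda>n. 1 / (real n + 1)) \<longlonglongrightarrow> 0"
    using LIMSEQ_inverse_real_of_nat by (simp add: inverse_eq_divide add.commute)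
  have sf: "sqint f" "sqint F" using fF by (auto simp: sobolev_pair_def)
  have "L2lim \<phi> f"
    by (rule L2limI[OF _ sf(1) _ lim]) (use Q in \<open>auto simp: Q_def intro: less_imp_le\<close>)
  moreover have "L2lim \<Phi> F"
    by (rule L2limI[OF _ sf(2) _ lim]) (use Q in \<open>auto simp: Q_def intro: less_imp_le\<close>)
  moreover have "C1c (\<phi> n) (\<Phi> n)" for n
    using Q[of n] by (simp add: Q_def)
  ultimately show ?thesis using that by blast
qed

lemma C1cD:
  assumes "C1c \<phi> \<Phi>"
  shows "GDERIV \<phi> x :> \<Phi> x" "continuous_on UNIV \<Phi>" "continuous_on UNIV \<phi>"
  using assms by (auto simp: C1c_def intro: GDERIV_imp_continuous_on)

lemma C1c_measurable:
  assumes "C1c \<phi> \<Phi>"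
  shows "\<phi> \<in> borel_measurable borel" "\<Phi> \<in> borel_measurable borel"
  using C1cD[OF assms] by (auto intro: borel_measurable_continuous_onI)

lemma Cc_bounded:
  fixes g :: "'a::euclidean_space \<Rightarrow> 'b::euclidean_space"
  assumes g: "continuous_on UNIV g" "\<And>x. norm x > R \<Longrightarrow> g x = 0"
  obtains B where "B \<ge> 0" "\<And>x. norm (g x) \<le> B"
proof -
  have "bounded (g ` cball 0 R)"
    by (intro compact_imp_bounded compact_continuous_image continuous_on_subset[OF g(1)]) auto
  then obtain B where B: "\<And>x. norm x \<le> R \<Longrightarrow> norm (g x) \<le> B"
    by (force simp: bounded_iff)
  have "norm (g x) \<le> max B 0" for x
    using B[of x] g(2)[of x] by (cases "norm x \<le> R") auto
  then show ?thesis using that[of "max B 0"] by auto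
qed

lemma C1c_bounded:
  assumes "C1c \<phi> \<Phi>"
  obtains B R where "B \<ge> 0" "\<And>x. \<bar>\<phi> x\<bar> \<le> B" "\<And>x. norm (\<Phi> x) \<le> B"
    "\<And>x. norm x > R \<Longrightarrow> \<phi> x = 0" "\<And>x. norm x > R \<Longrightarrow> \<Phi> x = 0"
proof -
  obtain R where R: "\<And>x. norm x > R \<Longrightarrow> \<phi> x = 0" "\<And>x. norm x > R \<Longrightarrow> \<Phi> x = 0"
    using assms by (auto simp: C1c_def)
  obtain B1 where B1: "B1 \<ge> 0" "\<And>x. norm (\<phi> x) \<le> B1"
    using Cc_bounded[OF C1cD(3)[OF assms] R(1)] by blast
  obtain B2 where B2: "B2 \<ge> 0" "\<And>x. norm (\<Phi> x) \<le> B2"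
    using Cc_bounded[OF C1cD(2)[OF assms] R(2)] by blast
  have "\<bar>\<phi> x\<bar> \<le> max B1 B2" "norm (\<Phi> x) \<le> max B1 B2" for x
    using B1(2)[of x] B2(2)[of x] by auto
  then show ?thesis using that[of "max B1 B2" R] R B1(1) by auto
qed

lemma C1c_sqint:
  assumes "C1c \<phi> \<Phi>"
  shows "sqint \<phi>" "sqint \<Phi>"
proof -
  obtain B R where *: "B \<ge> 0" "\<And>x. \<bar>\<phi> x\<bar> \<le> B" "\<And>x. norm (\<Phi> x) \<le> B"
    "\<And>x. norm x > R \<Longrightarrow> \<phi> x = 0" "\<And>x. norm x > R \<Longrightarrow> \<Phi> x = 0"
    using C1c_bounded[OF assms] by blast
  show "sqint \<phi>" "sqint \<Phi>"
    by (rule sqint_bounded_support[where B = B and R = R]; use * C1c_measurable[OF assms] in simp)+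
qed

lemma C1c_add: "C1c \<phi> \<Phi> \<Longrightarrow> C1c \<psi> \<Psi> \<Longrightarrow> C1c (\<lambda>x. \<phi> x + \<psi> x) (\<lambda>x. \<Phi> x + \<Psi> x)"
  unfolding C1c_def
proof (elim conjE exE, intro conjI allI)
  fix R S
  assume "\<forall>x. norm x > R \<longrightarrow> \<phi> x = 0 \<and> \<Phi> x = 0" "\<forall>x. norm x > S \<longrightarrow> \<psi> x = 0 \<and> \<Psi> x = 0"
  then show "\<exists>R. \<forall>x. norm x > R \<longrightarrow> \<phi> x + \<psi> x = 0 \<and> \<Phi> x + \<Psi> x = 0"
    by (intro exI[of _ "max R S"]) auto
qed (auto intro: GDERIV_add continuous_intros)

lemma C1c_mult_left:
  assumes s: "\<And>x. GDERIV s x :> S x" "continuous_on UNIV S" and \<phi>: "C1c \<phi> \<Phi>"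
  shows "C1c (\<lambda>x. s x * \<phi> x) (\<lambda>x. s x *\<^sub>R \<Phi> x + \<phi> x *\<^sub>R S x)"
  unfolding C1c_def
proof (intro conjI allI)
  show "GDERIV (\<lambda>x. s x * \<phi> x) x :> s x *\<^sub>R \<Phi> x + \<phi> x *\<^sub>R S x" for x
    by (rule GDERIV_mult[OF s(1) C1cD(1)[OF \<phi>]])
  show "continuous_on UNIV (\<lambda>x. s x *\<^sub>R \<Phi> x + \<phi> x *\<^sub>R S x)"
    by (intro continuous_intros s C1cD[OF \<phi>] GDERIV_imp_continuous_on[of s S])
  show "\<exists>R. \<forall>x. norm x > R \<longrightarrow> s x * \<phi> x = 0 \<and> s x *\<^sub>R \<Phi> x + \<phi> x *\<^sub>R S x = 0"
    using \<phi> by (force simp: C1c_def)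
qed

lemma C1c_mult: "C1c \<phi> \<Phi> \<Longrightarrow> C1c \<psi> \<Psi> \<Longrightarrow> C1c (\<lambda>x. \<phi> x * \<psi> x) (\<lambda>x. \<phi> x *\<^sub>R \<Psi> x + \<psi> x *\<^sub>R \<Phi> x)"
  by (rule C1c_mult_left[OF C1cD(1) C1cD(2)])

lemma C1c_scaleR: "C1c \<phi> \<Phi> \<Longrightarrow> C1c (\<lambda>x. c * \<phi> x) (\<lambda>x. c *\<^sub>R \<Phi> x)"
  using C1c_mult_left[OF GDERIV_const[of c], of \<phi> \<Phi>] by simp

lemma C1c_translate:
  assumes "C1c \<phi> \<Phi>"
  shows "C1c (\<lambda>x. \<phi> (x + a)) (\<lambda>x. \<Phi> (x + a))"
  unfolding C1c_def
proof (intro conjI allI)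
  show "GDERIV (\<lambda>x. \<phi> (x + a)) x :> \<Phi> (x + a)" for x
    unfolding gderiv_def
  proof (rule has_derivative_compose[of "\<lambda>x. x + a" "\<lambda>h. h" x UNIV \<phi> "\<lambda>h. h \<bullet> \<Phi> (x + a)"])
    show "((\<lambda>x. x + a) has_derivative (\<lambda>h. h)) (at x)"
      by (auto intro!: derivative_eq_intros)
    show "(\<phi> has_derivative (\<lambda>h. h \<bullet> \<Phi> (x + a))) (at (x + a))"
      using C1cD(1)[OF assms, of "x + a"] by (simp add: gderiv_def)
  qed
  show "continuous_on UNIV (\<lambda>x. \<Phi> (x + a))"
    by (rule continuous_on_compose2[OF C1cD(2)[OF assms]]) (auto intro!: continuous_intros)
  obtain R where "\<And>x. norm x > R \<Longrightarrow> \<phi> x = 0 \<and> \<Phi> x = 0"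
    using assms by (auto simp: C1c_def)
  then show "\<exists>R. \<forall>x. norm x > R \<longrightarrow> \<phi> (x + a) = 0 \<and> \<Phi> (x + a) = 0"
    using norm_gt_diff[of "-a" R] by (intro exI[of _ "norm a + R"]) (auto simp: norm_minus_commute add.commute)
qed

lemma C1c_lipschitz:
  assumes \<phi>: "C1c \<phi> \<Phi>" and B: "\<And>x. norm (\<Phi> x) \<le> B"
  shows "\<bar>\<phi> (x + h) - \<phi> x\<bar> \<le> B * norm h"
proof -
  have "norm (\<phi> (x + h) - \<phi> x) \<le> B * norm (x + h - x)"
  proof (rule differentiable_bound)
    show "(\<phi> has_derivative (\<lambda>h. h \<bullet> \<Phi> x)) (at x within UNIV)" for x
      using C1cD(1)[OF \<phi>, of x] by (simp add: gderiv_def)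
    show "onorm (\<lambda>h. h \<bullet> \<Phi> x) \<le> B" for x
    proof (rule onorm_le)
      fix h
      show "norm (h \<bullet> \<Phi> x) \<le> B * norm h"
        using Cauchy_Schwarz_ineq2[of h "\<Phi> x"] mult_left_mono[OF B[of x], of "norm h"]
        by (simp add: mult.commute)
    qed
  qed auto
  then show ?thesis by simp
qed

section \<open>Integration by parts through difference quotients\<close>

lemma difference_quotient_integral:
  assumes k: "locint k" and \<phi>: "C1c \<phi> \<Phi>"
  shows "(\<lambda>n. LINT x|lborel. k x * ((\<phi> (x + (1 / (real n + 1)) *\<^sub>R a) - \<phi> x) * (real n + 1))) \<longlonglongrightarrow>
    (LINT x|lborel. k x * (a \<bullet> \<Phi> x))"
proof -
  obtain B R where B: "B \<ge> 0" "\<And>x. \<bar>\<phi> x\<bar> \<le> B" "\<And>x. norm (\<Phi> x) \<le> B"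
    "\<And>x. norm x > R \<Longrightarrow> \<phi> x = 0" "\<And>x. norm x > R \<Longrightarrow> \<Phi> x = 0"
    using C1c_bounded[OF \<phi>] by blast
  have [measurable]: "k \<in> borel_measurable borel" "\<phi> \<in> borel_measurable borel" "\<Phi> \<in> borel_measurable borel"
    using k C1c_measurable[OF \<phi>] by (auto simp: locint_def)
  define h where "h n = (1 / (real n + 1)) *\<^sub>R a" for n
  have h0: "h \<longlonglongrightarrow> 0"
  proof -
    have "(\<lambda>n. 1 / (real n + 1)) \<longlonglongrightarrow> 0"
      using LIMSEQ_inverse_real_of_nat by (simp add: inverse_eq_divide add.commute)
    from tendsto_scaleR[OF this tendsto_const[of a]] show ?thesis by (simp add: h_def[abs_def])
  qed
  have nh: "norm (h n) * (real n + 1) = norm a" for n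
    by (simp add: h_def)
  have hle: "norm (h n) \<le> norm a" for n
    using mult_left_mono[of 1 "real n + 1" "norm (h n)"] nh[of n] by simp
  have lim: "(\<lambda>n. (\<phi> (x + h n) - \<phi> x) * (real n + 1)) \<longlonglongrightarrow> a \<bullet> \<Phi> x" for x
  proof (cases "a = 0")
    case False
    have "(\<lambda>n. norm (\<phi> (x + h n) - \<phi> x - h n \<bullet> \<Phi> x) / norm (h n)) \<longlonglongrightarrow> 0"
    proof (rule filterlim_compose[of "\<lambda>v. norm (\<phi> (x + v) - \<phi> x - v \<bullet> \<Phi> x) / norm v" _ "at 0"])
      show "((\<lambda>v. norm (\<phi> (x + v) - \<phi> x - v \<bullet> \<Phi> x) / norm v) \<longlongrightarrow> 0) (at 0)"
        using C1cD(1)[OF \<phi>, of x] by (simp add: gderiv_def has_derivative_at)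
      show "filterlim h (at 0) sequentially"
        using h0 False by (simp add: filterlim_at h_def)
    qed
    from tendsto_mult_left[OF this, of "norm a"]
    have lim0: "(\<lambda>n. norm a * \<bar>\<phi> (x + h n) - \<phi> x - h n \<bullet> \<Phi> x\<bar> / norm (h n)) \<longlonglongrightarrow> 0"
      by simp
    have "(\<lambda>n. \<bar>(\<phi> (x + h n) - \<phi> x) * (real n + 1) - a \<bullet> \<Phi> x\<bar>) \<longlonglongrightarrow> 0"
    proof (rule Lim_transform_eventually[OF lim0])
      show "\<forall>\<^sub>F n in sequentially. norm a * \<bar>\<phi> (x + h n) - \<phi> x - h n \<bullet> \<Phi> x\<bar> / norm (h n)
          = \<bar>((\<phi> (x + h n) - \<phi> x) * (real n + 1)) - a \<bullet> \<Phi> x\<bar>"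
      proof (intro always_eventually allI)
        fix n
        have "h n \<noteq> 0" using False by (simp add: h_def)
        then have "norm a * \<bar>\<phi> (x + h n) - \<phi> x - h n \<bullet> \<Phi> x\<bar> / norm (h n) =
            \<bar>\<phi> (x + h n) - \<phi> x - h n \<bullet> \<Phi> x\<bar> * \<bar>real n + 1\<bar>"
          unfolding nh[of n, symmetric] by simp
        also have "\<dots> = \<bar>(\<phi> (x + h n) - \<phi> x) * (real n + 1) - (h n \<bullet> \<Phi> x) * (real n + 1)\<bar>"
          by (simp only: abs_mult[symmetric] left_diff_distrib)
        also have "(h n \<bullet> \<Phi> x) * (real n + 1) = a \<bullet> \<Phi> x"
          by (simp add: h_def)
        finally show "norm a * \<bar>\<phi> (x + h n) - \<phi> x - h n \<bullet> \<Phi> x\<bar> / norm (h n)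
          = \<bar>((\<phi> (x + h n) - \<phi> x) * (real n + 1)) - a \<bullet> \<Phi> x\<bar>" .
      qed
    qed
    then show ?thesis
      by (rule LIM_zero_cancel[OF tendsto_rabs_zero_cancel])
  qed (simp add: h_def)
  have "(\<lambda>n. LINT x|lborel. k x * ((\<phi> (x + h n) - \<phi> x) * (real n + 1))) \<longlonglongrightarrow>
      (LINT x|lborel. k x * (a \<bullet> \<Phi> x))"
  proof (rule integral_dominated_convergence)
    show "integrable lborel (\<lambda>x. (B * norm a) *\<^sub>R norm (indicator (cball 0 (R + norm a)) x *\<^sub>R k x))"
      using k by (intro integrable_scaleR_right integrable_norm) (simp add: locint_def)
    show "AE x in lborel. (\<lambda>n. k x * ((\<phi> (x + h n) - \<phi> x) * (real n + 1))) \<longlonglongrightarrow> k x * (a \<bullet> \<Phi> x)"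
      by (intro AE_I2 tendsto_mult_left lim)
    show "AE x in lborel. norm (k x * ((\<phi> (x + h n) - \<phi> x) * (real n + 1))) \<le>
        (B * norm a) *\<^sub>R norm (indicator (cball 0 (R + norm a)) x *\<^sub>R k x)" for n
    proof (intro AE_I2)
      fix x
      show "norm (k x * ((\<phi> (x + h n) - \<phi> x) * (real n + 1))) \<le>
        (B * norm a) *\<^sub>R norm (indicator (cball 0 (R + norm a)) x *\<^sub>R k x)"
      proof (cases "norm x \<le> R + norm a")
        case True
        have "\<bar>\<phi> (x + h n) - \<phi> x\<bar> * (real n + 1) \<le> B * norm (h n) * (real n + 1)"
          using C1c_lipschitz[OF \<phi> B(3)] by (intro mult_right_mono) auto
        then have "\<bar>k x\<bar> * (\<bar>\<phi> (x + h n) - \<phi> x\<bar> * (real n + 1)) \<le> \<bar>k x\<bar> * (B * norm a)"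
          using nh[of n] by (intro mult_left_mono) (auto simp: mult.assoc)
        then show ?thesis using True by (simp add: abs_mult mult_ac)
      next
        case False
        moreover have "norm x \<le> norm (x + h n) + norm (h n)"
          using norm_triangle_ineq4[of "x + h n" "h n"] by simp
        ultimately have "norm (x + h n) > R" "norm x > R"
          using hle[of n] norm_ge_zero[of a] by linarith+
        then show ?thesis using B(1) B(4) by simp
      qed
    qed
  qed measurable
  then show ?thesis by (simp add: h_def)
qed

lemma integrable_Cc:
  fixes g :: "'a::euclidean_space \<Rightarrow> 'b::euclidean_space"
  assumes g: "continuous_on UNIV g" "\<And>x. norm x > R \<Longrightarrow> g x = 0"
  shows "integrable lborel g"
proof -
  obtain B where "B \<ge> 0" "\<And>x. norm (g x) \<le> B"
    using Cc_bounded[OF assms] by blast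
  then show ?thesis
    by (intro integrable_bounded_support[OF borel_measurable_continuous_onI[OF g(1)] _ g(2)])
qed

lemma C1c_integrable:
  assumes "C1c \<phi> \<Phi>"
  shows "integrable lborel \<phi>"
proof -
  obtain R where "\<And>x. norm x > R \<Longrightarrow> \<phi> x = 0"
    using assms by (auto simp: C1c_def)
  then show ?thesis by (rule integrable_Cc[OF C1cD(3)[OF assms]])
qed

text \<open>Every difference quotient has integral 0 by translation invariance of the measure, and
  the quotients converge under the integral.\<close>

lemma integral_directional_derivative:
  assumes \<phi>: "C1c \<phi> \<Phi>"
  shows "(LINT x|lborel. a \<bullet> \<Phi> x) = 0"
proof -
  have one: "locint (\<lambda>_. 1 :: real)"
    by (simp add: locint_def integrable_indicator_cball)
  have "(LINT x|lborel. 1 * ((\<phi> (x + (1 / (real n + 1)) *\<^sub>R a) - \<phi> x) * (real n + 1))) = 0" for n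
  proof -
    have "(LINT x|lborel. \<phi> (x + (1 / (real n + 1)) *\<^sub>R a)) = (LINT x|lborel. \<phi> x)"
      using integral_lborel_translate(1)[OF C1c_measurable(1)[OF \<phi>], of "(1 / (real n + 1)) *\<^sub>R a"]
      by (simp add: add.commute)
    then show ?thesis
      using C1c_integrable[OF \<phi>] C1c_integrable[OF C1c_translate[OF \<phi>]] by simp
  qed
  then show ?thesis
    using difference_quotient_integral[OF one \<phi>, of a] by (simp add: LIMSEQ_const_iff)
qed

lemma C1c_locint:
  assumes "C1c \<phi> \<Phi>"
  shows "locint (\<lambda>x. b \<bullet> \<Phi> x)" "locint \<phi>"
  using locint_inner[OF sqint_imp_locint[OF C1c_sqint(2)[OF assms]], of b] sqint_imp_locint[OF C1c_sqint(1)[OF assms]]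
  by (simp_all only: inner_commute[of b])

lemma C1c_integrable_mult:
  assumes \<phi>: "C1c \<phi> \<Phi>" and \<psi>: "C1c \<psi> \<Psi>"
  shows "integrable lborel (\<lambda>x. \<phi> x * (b \<bullet> \<Psi> x))"
proof (rule integrable_mult_sqint[OF C1c_sqint(1)[OF \<phi>]])
  have "(\<lambda>x. b \<bullet> \<Psi> x) \<in> borel_measurable lborel"
    using C1c_measurable(2)[OF \<psi>] by (intro borel_measurable_inner borel_measurable_const) simp
  then show "sqint (\<lambda>x. b \<bullet> \<Psi> x)"
    by (rule sqint_mono[OF C1c_sqint(2)[OF \<psi>], where C = "norm b"]) (simp add: Cauchy_Schwarz_ineq2)
qed

lemma C1c_integration_by_parts:
  assumes \<phi>: "C1c \<phi> \<Phi>" and \<psi>: "C1c \<psi> \<Psi>"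
  shows "(LINT x|lborel. \<phi> x * (b \<bullet> \<Psi> x)) = - (LINT x|lborel. \<psi> x * (b \<bullet> \<Phi> x))"
  using integral_directional_derivative[OF C1c_mult[OF \<phi> \<psi>], of b]
    C1c_integrable_mult[OF \<phi> \<psi>, of b] C1c_integrable_mult[OF \<psi> \<phi>, of b]
  by (simp add: inner_add_right)

lemma C1c_mixed_derivatives:
  fixes f g :: "'a::euclidean_space \<Rightarrow> real"
  assumes f: "C1c f F" and g: "C1c g G"
  shows "(LINT x|lborel. (b \<bullet> G x) * (a \<bullet> F x)) = (LINT x|lborel. (b \<bullet> F x) * (a \<bullet> G x))"
proof -
  have eq: "(LINT x|lborel. (b \<bullet> G x) * ((f (x + s *\<^sub>R a) - f x) * c)) =
      - (LINT x|lborel. (b \<bullet> F x) * ((g (x + s *\<^sub>R (- a)) - g x) * c))" for s c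
  proof -
    note fs = C1c_translate[OF f, of "s *\<^sub>R a"] and gs = C1c_translate[OF g, of "s *\<^sub>R (- a)"]
    have meas: "(\<lambda>x. g x * (b \<bullet> F (x + s *\<^sub>R a))) \<in> borel_measurable borel"
      by (intro borel_measurable_times C1c_measurable[OF g] borel_measurable_inner C1c_measurable[OF fs]) auto
    have expand: "(LINT x|lborel. (b \<bullet> P x) * ((p x - q x) * c)) =
        c * ((LINT x|lborel. p x * (b \<bullet> P x)) - (LINT x|lborel. q x * (b \<bullet> P x)))"
      if "integrable lborel (\<lambda>x. p x * (b \<bullet> P x))" "integrable lborel (\<lambda>x. q x * (b \<bullet> P x))"
      for p q :: "'a \<Rightarrow> real" and P
    proof -
      have "(\<lambda>x. (b \<bullet> P x) * ((p x - q x) * c)) = (\<lambda>x. c * (p x * (b \<bullet> P x) - q x * (b \<bullet> P x)))"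
        by (simp add: fun_eq_iff algebra_simps)
      then show ?thesis using that by simp
    qed
    have "(LINT x|lborel. (b \<bullet> G x) * ((f (x + s *\<^sub>R a) - f x) * c)) =
        c * ((LINT x|lborel. f (x + s *\<^sub>R a) * (b \<bullet> G x)) - (LINT x|lborel. f x * (b \<bullet> G x)))"
      by (rule expand[OF C1c_integrable_mult[OF fs g] C1c_integrable_mult[OF f g]])
    also have "(LINT x|lborel. f (x + s *\<^sub>R a) * (b \<bullet> G x)) = - (LINT x|lborel. g x * (b \<bullet> F (x + s *\<^sub>R a)))"
      by (rule C1c_integration_by_parts[OF fs g])
    also have "(LINT x|lborel. g x * (b \<bullet> F (x + s *\<^sub>R a))) = (LINT x|lborel. g (x + s *\<^sub>R (- a)) * (b \<bullet> F x))"
      using integral_lborel_translate(1)[OF meas, of "s *\<^sub>R (- a)"] by (simp add: add.commute)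
    also have "(LINT x|lborel. f x * (b \<bullet> G x)) = - (LINT x|lborel. g x * (b \<bullet> F x))"
      by (rule C1c_integration_by_parts[OF f g])
    also have "c * (- (LINT x|lborel. g (x + s *\<^sub>R (- a)) * (b \<bullet> F x)) - - (LINT x|lborel. g x * (b \<bullet> F x))) =
        - (LINT x|lborel. (b \<bullet> F x) * ((g (x + s *\<^sub>R (- a)) - g x) * c))"
      unfolding expand[OF C1c_integrable_mult[OF gs f] C1c_integrable_mult[OF g f]]
      by (simp add: algebra_simps)
    finally show ?thesis .
  qed
  have 1: "(\<lambda>n. LINT x|lborel. (b \<bullet> G x) * ((f (x + (1 / (real n + 1)) *\<^sub>R a) - f x) * (real n + 1))) \<longlonglongrightarrow>
      (LINT x|lborel. (b \<bullet> G x) * (a \<bullet> F x))"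
    by (rule difference_quotient_integral[OF C1c_locint(1)[OF g] f])
  have "(\<lambda>n. LINT x|lborel. (b \<bullet> F x) * ((g (x + (1 / (real n + 1)) *\<^sub>R (- a)) - g x) * (real n + 1))) \<longlonglongrightarrow>
      (LINT x|lborel. (b \<bullet> F x) * ((- a) \<bullet> G x))"
    by (rule difference_quotient_integral[OF C1c_locint(1)[OF f] g])
  from tendsto_minus[OF this] have 2: "(\<lambda>n. LINT x|lborel. (b \<bullet> G x) * ((f (x + (1 / (real n + 1)) *\<^sub>R a) - f x) * (real n + 1))) \<longlonglongrightarrow>
      - (LINT x|lborel. (b \<bullet> F x) * ((- a) \<bullet> G x))"
    unfolding eq .
  from LIMSEQ_unique[OF 1 2] show ?thesis by simp
qed

section \<open>The quarter turn of the plane and Jacobian integrals\<close>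

lemma inner_vec2: "v \<bullet> w = v $ 1 * w $ 1 + v $ 2 * w $ 2" for v w :: "real^2"
  by (simp add: inner_vec_def sum_2)

lemma norm_vec2_squared: "(norm v)\<^sup>2 = (v $ 1)\<^sup>2 + (v $ 2)\<^sup>2" for v :: "real^2"
  unfolding power2_norm_eq_inner inner_vec2 by (simp add: power2_eq_square)

lemma J0_nth [simp]: "J0 v $ 1 = - v $ 2" "J0 v $ 2 = v $ 1"
  by (simp_all add: J0_def)

lemma J0_inner: "J0 v \<bullet> w = v $ 1 * w $ 2 - v $ 2 * w $ 1"
  by (simp add: inner_vec2)

lemma norm_J0 [simp]: "norm (J0 v) = norm v"
  by (rule power2_eq_imp_eq) (simp_all add: norm_vec2_squared)

lemma J0_diff: "J0 (v - w) = J0 v - J0 w"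
  by (simp add: vec_eq_iff forall_2)

lemma continuous_J0 [continuous_intros]: "continuous_on S f \<Longrightarrow> continuous_on S (\<lambda>x. J0 (f x))"
proof (rule continuous_on_compose2[of UNIV J0])
  have "linear J0"
    by (rule linearI) (simp_all add: vec_eq_iff forall_2)
  then show "continuous_on UNIV J0"
    by (simp add: linear_continuous_on linear_conv_bounded_linear)
qed auto

lemma J0_measurable [measurable]: "J0 \<in> borel_measurable borel"
  by (intro borel_measurable_continuous_onI continuous_intros)

text \<open>The Jacobian determinant is a null Lagrangian: it is the difference of the two mixed
  products whose integrals agree.\<close>

lemma integral_Jacobian_zero:
  assumes f: "C1c f F" and g: "C1c g G"
  shows "(LINT x|lborel. J0 (F x) \<bullet> G x) = 0"
proof -
  have c: "axis i 1 \<bullet> v = v $ i" for v :: "real^2" and i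
    by (simp add: inner_axis')
  have s: "sqint (\<lambda>x. F x $ i)" "sqint (\<lambda>x. G x $ i)" for i
  proof -
    have m: "F \<in> borel_measurable borel" "G \<in> borel_measurable borel"
      using C1c_measurable f g by blast+
    have "(\<lambda>x. F x $ i) \<in> borel_measurable borel" "(\<lambda>x. G x $ i) \<in> borel_measurable borel"
      using m[THEN borel_measurable_inner[OF borel_measurable_const[of "axis i 1"]]] by (simp_all add: c)
    then show "sqint (\<lambda>x. F x $ i)" "sqint (\<lambda>x. G x $ i)"
      by (intro sqint_mono[OF C1c_sqint(2)[OF f], where C = 1] sqint_mono[OF C1c_sqint(2)[OF g], where C = 1];
          simp add: component_le_norm_cart)+
  qed
  show ?thesis
    using C1c_mixed_derivatives[OF f g, of "axis 2 1" "axis 1 1"] integrable_mult_sqint[OF s(1) s(2)]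
      integrable_mult_sqint[OF s(2) s(1)]
    by (simp add: c J0_inner mult.commute[of "G _ $ 2" "F _ $ 1"] mult.commute[of "F _ $ 2" "G _ $ 1"])
qed

text \<open>Apply the vanishing Jacobian integral to \<open>f\<close> and the product of
  \<open>s\<close> and \<open>h\<close>, and expand the gradient of the product. The second formula
  exchanges the two functions, with a sign from the skewness of \<open>J0\<close>.\<close>

lemma integral_weighted_Jacobian:
  fixes s :: "real^2 \<Rightarrow> real"
  assumes s: "\<And>x. GDERIV s x :> S x" "continuous_on UNIV S" and f: "C1c f F" and h: "C1c h H"
  shows "(LINT x|lborel. s x * (J0 (F x) \<bullet> H x)) = (LINT x|lborel. h x * (J0 (S x) \<bullet> F x))"
    and "(LINT x|lborel. s x * (J0 (F x) \<bullet> H x)) = - (LINT x|lborel. f x * (J0 (S x) \<bullet> H x))"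
proof -
  have main: "(LINT x|lborel. s x * (J0 (F x) \<bullet> H x)) = (LINT x|lborel. h x * (J0 (S x) \<bullet> F x))"
    if f: "C1c f F" and h: "C1c h H" for f F h H
  proof -
    obtain R where R: "\<And>x. norm x > R \<Longrightarrow> h x = 0" "\<And>x. norm x > R \<Longrightarrow> H x = 0"
      using h by (auto simp: C1c_def)
    have cs: "continuous_on UNIV s" using s(1) by (rule GDERIV_imp_continuous_on)
    have "integrable lborel (\<lambda>x. s x * (J0 (F x) \<bullet> H x))" "integrable lborel (\<lambda>x. h x * (J0 (F x) \<bullet> S x))"
      by (intro integrable_Cc[where R = R] continuous_on_mult continuous_on_inner continuous_J0
          cs s(2) C1cD(2,3)[OF f] C1cD(2,3)[OF h]; simp add: R)+
    moreover have "J0 (F x) \<bullet> (s x *\<^sub>R H x + h x *\<^sub>R S x) = s x * (J0 (F x) \<bullet> H x) + h x * (J0 (F x) \<bullet> S x)" for x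
      by (simp add: inner_add_right)
    moreover have "J0 (F x) \<bullet> S x = - (J0 (S x) \<bullet> F x)" for x
      by (simp add: J0_inner)
    ultimately show ?thesis
      using integral_Jacobian_zero[OF f C1c_mult_left[OF s h]] by simp
  qed
  show "(LINT x|lborel. s x * (J0 (F x) \<bullet> H x)) = (LINT x|lborel. h x * (J0 (S x) \<bullet> F x))"
    by (rule main[OF f h])
  have "s x * (J0 (F x) \<bullet> H x) = - (s x * (J0 (H x) \<bullet> F x))" for x
    by (simp add: J0_inner algebra_simps)
  then show "(LINT x|lborel. s x * (J0 (F x) \<bullet> H x)) = - (LINT x|lborel. f x * (J0 (S x) \<bullet> H x))"
    using main[OF h f] by simp
qed

subsection \<open>The isoperimetric inequality on circles\<close>

lemma cot_half_bound:
  assumes "0 < d" "d < pi"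
  shows "0 < cot (d / 2)" "cot (d / 2) \<le> 2 / d"
proof -
  have s: "0 < sin (d / 2)" and c: "0 < cos (d / 2)"
    using assms by (auto intro!: sin_gt_zero cos_gt_zero)
  then show "0 < cot (d / 2)" by (simp add: cot_def)
  have "d / 2 \<le> tan (d / 2)"
    using abs_tan_ge[of "d / 2"] s c assms by (simp add: tan_def)
  then show "cot (d / 2) \<le> 2 / d"
    using s c assms by (simp add: cot_def tan_def field_simps)
qed

text \<open>A calibration argument: the integrand minus the derivative of
  \<open>c t * ((f t)\<^sup>2 + (h t)\<^sup>2)\<close> is a sum of two squares, because
  \<open>c\<close> solves the Riccati equation c' = -(c^2 + 1/4). The poles of \<open>c\<close> at
  both ends are harmless: \<open>f\<close> and \<open>h\<close> vanish there, so the boundary terms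
  on [d, 2 pi - d] are of order d.\<close>

lemma circle_isoperimetric_pinned:
  fixes f h f' h' :: "real \<Rightarrow> real"
  assumes der: "\<And>t. (f has_real_derivative f' t) (at t)" "\<And>t. (h has_real_derivative h' t) (at t)"
    and cont: "continuous_on UNIV f'" "continuous_on UNIV h'"
    and ends: "f 0 = 0" "h 0 = 0" "f (2 * pi) = 0" "h (2 * pi) = 0"
  shows "0 \<le> integral {0..2 * pi} (\<lambda>t. (f' t)\<^sup>2 + (h' t)\<^sup>2 - (f t * h' t - h t * f' t))"
proof -
  define P where "P t = (f' t)\<^sup>2 + (h' t)\<^sup>2 - (f t * h' t - h t * f' t)" for t
  have contfh: "continuous_on S f" "continuous_on S h" for S
    using der by (meson DERIV_isCont continuous_at_imp_continuous_on)+
  have contP: "continuous_on S P" for S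
    unfolding P_def[abs_def]
    by (intro continuous_intros contfh continuous_on_subset[OF cont(1)] continuous_on_subset[OF cont(2)]) auto
  have bdd: "bounded (g ` {0..2 * pi})" if "continuous_on UNIV g" for g :: "real \<Rightarrow> real"
    by (intro compact_imp_bounded compact_continuous_image continuous_on_subset[OF that]) auto
  obtain B1 B2 K where B1: "\<And>t. t \<in> {0..2 * pi} \<Longrightarrow> \<bar>f' t\<bar> \<le> B1" and B2: "\<And>t. t \<in> {0..2 * pi} \<Longrightarrow> \<bar>h' t\<bar> \<le> B2"
    and K: "\<And>t. t \<in> {0..2 * pi} \<Longrightarrow> \<bar>P t\<bar> \<le> K"
    using bdd[OF cont(1)] bdd[OF cont(2)] bdd[OF contP] unfolding bounded_iff by fastforce
  have lip: "\<bar>g a - g b\<bar> \<le> B * \<bar>a - b\<bar>"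
    if "\<And>t. (g has_real_derivative g' t) (at t)" "\<And>t. t \<in> {0..2 * pi} \<Longrightarrow> \<bar>g' t\<bar> \<le> B"
      "a \<in> {0..2 * pi}" "b \<in> {0..2 * pi}" for g g' :: "real \<Rightarrow> real" and B a b
    using field_differentiable_bound[of "{0..2 * pi}" g g' B a b] that
    by (auto intro: DERIV_subset)
  have main: "- (2 * (B1\<^sup>2 + B2\<^sup>2) + 2 * K) * d \<le> integral {0..2 * pi} P" if d: "0 < d" "d < pi" for d
  proof -
    \<comment> \<open>The extremals are the circles through the origin, u = f + i h = A (exp(it) -
      1). They satisfy u' = (c + i/2) u with this \<open>c\<close>, so both squares vanish on
      them.\<close>
    define c where "c t = cot (t / 2) / 2" for t :: real
    define D where "D t = - ((c t)\<^sup>2 + 1 / 4) * ((f t)\<^sup>2 + (h t)\<^sup>2) + 2 * c t * (f t * f' t + h t * h' t)" for t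
    have *: "((\<lambda>t. c t * ((f t)\<^sup>2 + (h t)\<^sup>2)) has_real_derivative D t) (at t)" if "0 < t" "t < 2 * pi" for t
    proof -
      have s: "sin (t / 2) \<noteq> 0" using that sin_gt_zero[of "t / 2"] by simp
      have "(c has_real_derivative - inverse ((sin (t / 2))\<^sup>2) * (1 / 2) / 2) (at t)"
        unfolding c_def
        by (intro DERIV_cdivide DERIV_chain2[where f = cot and g = "\<lambda>t. t / 2", OF DERIV_cot[OF s]] DERIV_ident)
      moreover have "- inverse ((sin (t / 2))\<^sup>2) * (1 / 2) / 2 = - ((c t)\<^sup>2 + 1 / 4)"
        using s sin_cos_squared_add[of "t / 2"] by (simp add: c_def cot_def field_simps power2_eq_square)
      ultimately have "(c has_real_derivative - ((c t)\<^sup>2 + 1 / 4)) (at t)" by simp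
      then show ?thesis
        unfolding D_def by (auto intro!: derivative_eq_intros der simp: algebra_simps)
    qed
    have "(D has_integral c (2 * pi - d) * ((f (2 * pi - d))\<^sup>2 + (h (2 * pi - d))\<^sup>2) - c d * ((f d)\<^sup>2 + (h d)\<^sup>2)) {d..2 * pi - d}"
    proof (intro fundamental_theorem_of_calculus)
      show "((\<lambda>t. c t * ((f t)\<^sup>2 + (h t)\<^sup>2)) has_vector_derivative D t) (at t within {d..2 * pi - d})"
        if "t \<in> {d..2 * pi - d}" for t
        using * [of t] that d has_field_derivative_at_within
        by (auto simp: has_real_derivative_iff_has_vector_derivative[symmetric])
    qed (use d in auto)
    moreover have "(P has_integral integral {d..2 * pi - d} P) {d..2 * pi - d}"
      by (intro integrable_integral integrable_continuous_real contP)
    moreover have "D t \<le> P t" for t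
    proof -
      have "0 \<le> (f' t - c t * f t + h t / 2)\<^sup>2 + (h' t - c t * h t - f t / 2)\<^sup>2" by simp
      then show ?thesis by (simp add: D_def P_def power2_eq_square algebra_simps)
    qed
    ultimately have low: "c (2 * pi - d) * ((f (2 * pi - d))\<^sup>2 + (h (2 * pi - d))\<^sup>2) - c d * ((f d)\<^sup>2 + (h d)\<^sup>2)
        \<le> integral {d..2 * pi - d} P"
      by (rule has_integral_le)
    have cd: "0 \<le> c d" "c d \<le> 1 / d"
      using cot_half_bound[OF d] by (auto simp: c_def)
    have c2: "c (2 * pi - d) = - c d"
      by (simp add: c_def cot_def diff_divide_distrib sin_diff cos_diff)
    have sq: "(f t)\<^sup>2 + (h t)\<^sup>2 \<le> (B1\<^sup>2 + B2\<^sup>2) * d\<^sup>2" if t: "t = d \<or> t = 2 * pi - d" for t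
    proof -
      have "\<bar>f t\<bar> \<le> B1 * d" "\<bar>h t\<bar> \<le> B2 * d"
        using t d ends lip[OF der(1) B1, of t 0] lip[OF der(1) B1, of t "2 * pi"]
          lip[OF der(2) B2, of t 0] lip[OF der(2) B2, of t "2 * pi"] by auto
      from power_mono[OF this(1), of 2] power_mono[OF this(2), of 2]
      have "(f t)\<^sup>2 \<le> (B1 * d)\<^sup>2" "(h t)\<^sup>2 \<le> (B2 * d)\<^sup>2"
        by simp_all
      then show ?thesis by (simp add: power_mult_distrib algebra_simps)
    qed
    have cs: "c d * ((f t)\<^sup>2 + (h t)\<^sup>2) \<le> (B1\<^sup>2 + B2\<^sup>2) * d" if t: "t = d \<or> t = 2 * pi - d" for t
    proof -
      have "c d * ((f t)\<^sup>2 + (h t)\<^sup>2) \<le> 1 / d * ((B1\<^sup>2 + B2\<^sup>2) * d\<^sup>2)"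
        using cd sq[OF t] d by (intro mult_mono) auto
      also have "\<dots> = (B1\<^sup>2 + B2\<^sup>2) * d" using d by (simp add: power2_eq_square)
      finally show ?thesis .
    qed
    have "- 2 * (B1\<^sup>2 + B2\<^sup>2) * d \<le> integral {d..2 * pi - d} P"
      using low cs[of d] cs[of "2 * pi - d"] unfolding c2 by (simp add: algebra_simps)
    moreover have "integral {0..2 * pi} P = integral {0..d} P + integral {d..2 * pi - d} P + integral {2 * pi - d..2 * pi} P"
      using d Henstock_Kurzweil_Integration.integral_combine[of 0 "2 * pi - d" "2 * pi" P]
        Henstock_Kurzweil_Integration.integral_combine[of 0 d "2 * pi - d" P]
      by (simp add: integrable_continuous_real contP)
    moreover have "norm (integral {0..d} P) \<le> K * (d - 0)" "norm (integral {2 * pi - d..2 * pi} P) \<le> K * (2 * pi - (2 * pi - d))"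
      using d K by (intro integral_bound contP; force)+
    ultimately show ?thesis by (simp add: algebra_simps)
  qed
  have "((\<lambda>d. - (2 * (B1\<^sup>2 + B2\<^sup>2) + 2 * K) * d) \<longlongrightarrow> - (2 * (B1\<^sup>2 + B2\<^sup>2) + 2 * K) * 0) (at_right 0)"
    by (intro tendsto_intros)
  moreover have "\<forall>\<^sub>F d in at_right 0. - (2 * (B1\<^sup>2 + B2\<^sup>2) + 2 * K) * d \<le> integral {0..2 * pi} P"
    by (rule eventually_at_rightI[of 0 pi], rule main) simp_all
  ultimately have "0 \<le> integral {0..2 * pi} P"
    using tendsto_upperbound[of _ "- (2 * (B1\<^sup>2 + B2\<^sup>2) + 2 * K) * 0" "at_right (0::real)"] by simp
  then show ?thesis by (simp add: P_def[abs_def])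
qed

text \<open>Subtracting the initial values changes the integrand by the derivative of
  \<open>f 0 * h t - h 0 * f t\<close>, which integrates to 0 over a period. The skew term is twice
  the enclosed area.\<close>

lemma circle_isoperimetric:
  fixes f h f' h' :: "real \<Rightarrow> real"
  assumes der: "\<And>t. (f has_real_derivative f' t) (at t)" "\<And>t. (h has_real_derivative h' t) (at t)"
    and cont: "continuous_on UNIV f'" "continuous_on UNIV h'"
    and ends: "f (2 * pi) = f 0" "h (2 * pi) = h 0"
  shows "0 \<le> integral {0..2 * pi} (\<lambda>t. (f' t)\<^sup>2 + (h' t)\<^sup>2 - (f t * h' t - h t * f' t))"
proof -
  let ?P = "\<lambda>t. (f' t)\<^sup>2 + (h' t)\<^sup>2 - ((f t - f 0) * h' t - (h t - h 0) * f' t)"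
  have contfh: "continuous_on S f" "continuous_on S h" for S
    using der by (meson DERIV_isCont continuous_at_imp_continuous_on)+
  have "0 \<le> integral {0..2 * pi} ?P"
    by (rule circle_isoperimetric_pinned) (auto intro!: derivative_eq_intros der cont simp: ends)
  moreover have "((\<lambda>t. f 0 * h' t - h 0 * f' t) has_integral
      (f 0 * h (2 * pi) - h 0 * f (2 * pi)) - (f 0 * h 0 - h 0 * f 0)) {0..2 * pi}"
  proof (intro fundamental_theorem_of_calculus)
    show "((\<lambda>t. f 0 * h t - h 0 * f t) has_vector_derivative f 0 * h' t - h 0 * f' t) (at t within {0..2 * pi})" for t
      unfolding has_real_derivative_iff_has_vector_derivative[symmetric]
      by (intro DERIV_diff DERIV_cmult has_field_derivative_at_within[OF der(1)] has_field_derivative_at_within[OF der(2)])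
  qed simp
  then have "((\<lambda>t. f 0 * h' t - h 0 * f' t) has_integral 0) {0..2 * pi}"
    by (simp add: ends)
  moreover have "(?P has_integral integral {0..2 * pi} ?P) {0..2 * pi}"
    by (intro integrable_integral integrable_continuous_real continuous_intros contfh
         continuous_on_subset[OF cont(1)] continuous_on_subset[OF cont(2)]) auto
  ultimately have "((\<lambda>t. ?P t - (f 0 * h' t - h 0 * f' t)) has_integral integral {0..2 * pi} ?P - 0) {0..2 * pi}"
    by (intro has_integral_diff)
  then have "integral {0..2 * pi} (\<lambda>t. ?P t - (f 0 * h' t - h 0 * f' t)) = integral {0..2 * pi} ?P"
    by (simp add: integral_unique)
  moreover have "?P t - (f 0 * h' t - h 0 * f' t) = (f' t)\<^sup>2 + (h' t)\<^sup>2 - (f t * h' t - h t * f' t)" for t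
    by (simp add: algebra_simps)
  ultimately show ?thesis
    using \<open>0 \<le> integral {0..2 * pi} ?P\<close> by simp
qed

subsection \<open>Stereographic coordinates and conformal invariance\<close>

text \<open>The conformal factor: the round metric is \<open>(lam w)\<^sup>2\<close> times the
  Euclidean one, and \<open>(lam w)\<^sup>2\<close> is also the density of spherical area.\<close>

definition lam :: "real^2 \<Rightarrow> real" where
  "lam w = 2 / ((norm w)\<^sup>2 + 1)"

text \<open>The gradient of the \<open>i\<close>-th coordinate for the round metric, which is the
  Euclidean gradient divided by \<open>(lam w)\<^sup>2\<close>. In complex notation the three fields
  are z, (1 - z^2)/2 and i (1 + z^2)/2, hence holomorphic.\<close>

definition sgrad :: "3 \<Rightarrow> real^2 \<Rightarrow> real^2" where
  "sgrad i w = (if i = 1 then w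
     else if i = 2 then vector [(1 + (w $ 2)\<^sup>2 - (w $ 1)\<^sup>2) / 2, - (w $ 1 * w $ 2)]
     else vector [- (w $ 1 * w $ 2), (1 + (w $ 1)\<^sup>2 - (w $ 2)\<^sup>2) / 2])"

text \<open>A quarter turn of the gradient of a height function: the velocity field of the rotations
  of the sphere about the \<open>i\<close>-th axis.\<close>

definition sfield :: "3 \<Rightarrow> real^2 \<Rightarrow> real^2" where
  "sfield i w = J0 (sgrad i w)"

lemma sgrad_nth:
  "sgrad 1 w $ k = w $ k"
  "sgrad 2 w $ 1 = (1 + (w $ 2)\<^sup>2 - (w $ 1)\<^sup>2) / 2" "sgrad 2 w $ 2 = - (w $ 1 * w $ 2)"
  "sgrad 3 w $ 1 = - (w $ 1 * w $ 2)" "sgrad 3 w $ 2 = (1 + (w $ 1)\<^sup>2 - (w $ 2)\<^sup>2) / 2"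
  by (simp_all add: sgrad_def)

lemma one_plus_norm_pos: "0 < (norm w)\<^sup>2 + (1::real)"
  by (rule add_nonneg_pos) simp_all

lemma lam_pos: "0 < lam w"
  by (simp add: lam_def one_plus_norm_pos)

lemma lam_le_2: "lam w \<le> 2"
  using one_plus_norm_pos[of w] by (simp add: lam_def divide_le_eq)

lemma lam_eq: "lam w * (1 + (w $ 1)\<^sup>2 + (w $ 2)\<^sup>2) = 2"
  using one_plus_norm_pos[of w] by (simp add: lam_def norm_vec2_squared field_simps)

lemma continuous_lam [continuous_intros]: "continuous_on S f \<Longrightarrow> continuous_on S (\<lambda>x. lam (f x))"
  unfolding lam_def by (intro continuous_intros ballI) (simp_all add: one_plus_norm_pos[THEN less_imp_neq, symmetric])

lemma lam_measurable [measurable]: "lam \<in> borel_measurable borel"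
  by (intro borel_measurable_continuous_onI continuous_intros)

lemma stereo_nth:
  "stereo w $ 1 = 1 - lam w" "stereo w $ 2 = lam w * w $ 1" "stereo w $ 3 = lam w * w $ 2"
  using one_plus_norm_pos[of w] by (simp_all add: stereo_def lam_def field_simps)

lemma GDERIV_lam: "GDERIV lam w :> - ((lam w)\<^sup>2 *\<^sub>R w)"
proof -
  have "GDERIV (\<lambda>w::real^2. (norm (0 - w))\<^sup>2 + 1) w :> 2 *\<^sub>R (w - 0) + 0"
    by (intro GDERIV_add GDERIV_norm_squared GDERIV_const)
  then have "GDERIV (\<lambda>w::real^2. (norm w)\<^sup>2 + 1) w :> 2 *\<^sub>R w" by simp
  from GDERIV_mult[OF GDERIV_const[of 2] GDERIV_inverse[OF this]] show ?thesis
    using one_plus_norm_pos[of w] by (simp add: lam_def[abs_def] divide_inverse power_mult_distrib)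
qed

lemma GDERIV_nth: "GDERIV (\<lambda>w::real^2. w $ k) w :> axis k 1"
  unfolding gderiv_def by (simp add: inner_axis bounded_linear_vec_nth bounded_linear_imp_has_derivative)

lemma axis_nth2: "axis (1::2) (1::real) $ 1 = 1" "axis (1::2) (1::real) $ 2 = 0"
  "axis (2::2) (1::real) $ 1 = 0" "axis (2::2) (1::real) $ 2 = 1"
  by (simp_all add: axis_def)

lemma GDERIV_stereo: "GDERIV (\<lambda>w. stereo w $ i) w :> (lam w)\<^sup>2 *\<^sub>R sgrad i w"
proof -
  have l: "lam w = (lam w)\<^sup>2 * (1 + (w $ 1)\<^sup>2 + (w $ 2)\<^sup>2) / 2"
    using lam_eq[of w] by (simp add: power2_eq_square mult.assoc)
  consider "i = 1" | "i = 2" | "i = 3" using exhaust_3 by blast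
  then show ?thesis
  proof cases
    case 1
    have "GDERIV (\<lambda>w. 1 - lam w) w :> 0 - - ((lam w)\<^sup>2 *\<^sub>R w)"
      by (intro GDERIV_diff GDERIV_const GDERIV_lam)
    then show ?thesis using 1 by (simp add: stereo_nth sgrad_def)
  next
    case 2
    have "lam w *\<^sub>R axis 1 1 + w $ 1 *\<^sub>R - ((lam w)\<^sup>2 *\<^sub>R w) = (lam w)\<^sup>2 *\<^sub>R sgrad 2 w"
      using l by (simp add: vec_eq_iff forall_2 sgrad_nth axis_nth2 power2_eq_square field_simps)
    then show ?thesis
      using GDERIV_mult[OF GDERIV_lam GDERIV_nth[of 1 w]] 2 by (simp add: stereo_nth)
  next
    case 3
    have "lam w *\<^sub>R axis 2 1 + w $ 2 *\<^sub>R - ((lam w)\<^sup>2 *\<^sub>R w) = (lam w)\<^sup>2 *\<^sub>R sgrad 3 w"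
      using l by (simp add: vec_eq_iff forall_2 sgrad_nth axis_nth2 power2_eq_square field_simps)
    then show ?thesis
      using GDERIV_mult[OF GDERIV_lam GDERIV_nth[of 2 w]] 3 by (simp add: stereo_nth)
  qed
qed

lemma continuous_vec2 [continuous_intros]:
  "continuous_on S f \<Longrightarrow> continuous_on S g \<Longrightarrow> continuous_on S (\<lambda>x. vector [f x, g x] :: real^2)"
proof -
  assume "continuous_on S f" "continuous_on S g"
  then have "continuous_on S (\<lambda>x. f x *\<^sub>R axis 1 1 + g x *\<^sub>R axis 2 1 :: real^2)"
    by (intro continuous_intros)
  moreover have "f x *\<^sub>R axis 1 1 + g x *\<^sub>R axis 2 1 = (vector [f x, g x] :: real^2)" for x
    by (simp add: vec_eq_iff forall_2 axis_nth2)
  ultimately show "continuous_on S (\<lambda>x. vector [f x, g x] :: real^2)" by simp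
qed

lemma continuous_sgrad [continuous_intros]: "continuous_on S f \<Longrightarrow> continuous_on S (\<lambda>x. sgrad i (f x))"
  by (cases "i = 1"; cases "i = 2") (auto simp: sgrad_def intro!: continuous_intros)

lemma continuous_sfield [continuous_intros]: "continuous_on S f \<Longrightarrow> continuous_on S (\<lambda>x. sfield i (f x))"
  unfolding sfield_def by (intro continuous_intros)

lemma continuous_stereo [continuous_intros]: "continuous_on S f \<Longrightarrow> continuous_on S (\<lambda>x. stereo (f x) $ i)"
  by (rule continuous_on_compose2[OF GDERIV_imp_continuous_on[OF GDERIV_stereo]]) auto

text \<open>The left side is the squared spherical length of the gradient. It equals the squared
  length of the tangential part of the \<open>i\<close>-th axis, which is the squared radius of the
  circle of latitude.\<close>

lemma lam_sgrad_norm: "(norm (lam w *\<^sub>R sgrad i w))\<^sup>2 = 1 - (stereo w $ i)\<^sup>2"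
proof -
  have l: "(lam w)\<^sup>2 * (1 + (w $ 1)\<^sup>2 + (w $ 2)\<^sup>2)\<^sup>2 = 4" "lam w * (1 + (w $ 1)\<^sup>2 + (w $ 2)\<^sup>2) = 2"
    using lam_eq[of w] by (simp_all flip: power_mult_distrib)
  consider "i = 1" | "i = 2" | "i = 3" using exhaust_3 by blast
  then show ?thesis
  proof cases
    case 1
    have "(lam w)\<^sup>2 * (1 + (w $ 1)\<^sup>2 + (w $ 2)\<^sup>2) = 2 * lam w"
      using l(2) by (simp add: power2_eq_square mult.assoc)
    then show ?thesis
      unfolding norm_vec2_squared using 1 by (simp add: sgrad_nth stereo_nth power2_eq_square algebra_simps)
  next
    case 2
    then show ?thesis
      unfolding norm_vec2_squared using l(1) by (simp add: sgrad_nth stereo_nth power2_eq_square field_simps)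
  next
    case 3
    then show ?thesis
      unfolding norm_vec2_squared using l(1) by (simp add: sgrad_nth stereo_nth power2_eq_square field_simps)
  qed
qed

lemma stereo_bound: "\<bar>stereo w $ i\<bar> \<le> 1"
proof -
  have "0 \<le> 1 - (stereo w $ i)\<^sup>2"
    unfolding lam_sgrad_norm[symmetric] by simp
  then show ?thesis by (simp add: abs_square_le_1)
qed

lemma lam_sgrad_bound: "lam w * norm (sgrad i w) \<le> 1"
proof -
  have "(norm (lam w *\<^sub>R sgrad i w))\<^sup>2 \<le> 1\<^sup>2"
    unfolding lam_sgrad_norm by simp
  then show ?thesis
    using lam_pos[of w] power2_le_imp_le[of "norm (lam w *\<^sub>R sgrad i w)" 1] by simp
qed

text \<open>In the orthonormal frame along \<open>a\<close> and \<open>J0 a\<close>, with components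
  X_a, X_J and Y_a, Y_J, the right side minus the left side is (X_a - s Y_J)^2 + (Y_a + s X_J)^2.
  Multiplying by \<open>(norm a)\<^sup>2\<close> avoids normalising the frame; the poles, where
  \<open>a = 0\<close> and \<open>s\<close> is 1 or -1, are treated separately.\<close>

lemma frame_energy_nonneg:
  fixes a X Y :: "real^2"
  assumes a: "(norm a)\<^sup>2 = 1 - s\<^sup>2"
  shows "(J0 a \<bullet> X)\<^sup>2 + (J0 a \<bullet> Y)\<^sup>2 + 2 * s * (J0 X \<bullet> Y) \<le> (norm X)\<^sup>2 + (norm Y)\<^sup>2"
proof -
  define S where "S = (norm X)\<^sup>2 + (norm Y)\<^sup>2 - 2 * s * (J0 X \<bullet> Y) - (J0 a \<bullet> X)\<^sup>2 - (J0 a \<bullet> Y)\<^sup>2"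
  have a': "(a $ 1)\<^sup>2 + (a $ 2)\<^sup>2 = 1 - s\<^sup>2" using a by (simp add: norm_vec2_squared)
  have S_eq: "S = (X $ 1)\<^sup>2 + (X $ 2)\<^sup>2 + (Y $ 1)\<^sup>2 + (Y $ 2)\<^sup>2 - 2 * s * (X $ 1 * Y $ 2 - X $ 2 * Y $ 1)
      - (a $ 1 * X $ 2 - a $ 2 * X $ 1)\<^sup>2 - (a $ 1 * Y $ 2 - a $ 2 * Y $ 1)\<^sup>2"
    by (simp add: S_def norm_vec2_squared J0_inner)
  have "0 \<le> S"
  proof (cases "(norm a)\<^sup>2 = 0")
    case True
    then have "a = 0" "s\<^sup>2 = 1" using a by auto
    then have "s = 1 \<or> s = -1" by (simp add: power2_eq_1_iff)
    moreover have "0 \<le> (X $ 1 - s * Y $ 2)\<^sup>2 + (X $ 2 + s * Y $ 1)\<^sup>2" by simp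
    ultimately show ?thesis
      using \<open>a = 0\<close> unfolding S_eq by (auto simp: power2_eq_square algebra_simps)
  next
    case False
    then have pos: "0 < (norm a)\<^sup>2" by simp
    have "(norm a)\<^sup>2 * S = (a \<bullet> X - s * (J0 a \<bullet> Y))\<^sup>2 + (a \<bullet> Y + s * (J0 a \<bullet> X))\<^sup>2"
    proof -
      have s2: "s\<^sup>2 = 1 - (a $ 1)\<^sup>2 - (a $ 2)\<^sup>2" using a' by simp
      show ?thesis
        unfolding S_eq J0_inner norm_vec2_squared unfolding inner_vec2
        using s2 by algebra
    qed
    then have "0 \<le> (norm a)\<^sup>2 * S" by simp
    then show ?thesis using pos by (simp add: zero_le_mult_iff)
  qed
  then show ?thesis by (simp add: S_def)
qed

section \<open>Change of variables and a reflection of the sphere\<close>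

lemma lborel_change_of_variables:
  fixes M :: "real^2 \<Rightarrow> real^2" and c :: "real^2 \<Rightarrow> real"
  assumes S: "S \<in> sets borel"
    and der: "\<And>x. x \<in> S \<Longrightarrow> (M has_derivative M' x) (at x)"
    and inj: "inj_on M S" and im: "M ` S = T" and T: "T \<in> sets borel"
    and c: "integrable lborel (\<lambda>x. indicator T x *\<^sub>R c x)"
  shows "integrable lebesgue (\<lambda>x. indicator S x *\<^sub>R (\<bar>det (matrix (M' x))\<bar> * c (M x)))"
    and "(LINT x|lebesgue. indicator S x *\<^sub>R (\<bar>det (matrix (M' x))\<bar> * c (M x))) = (LINT x|lborel. indicator T x *\<^sub>R c x)"
proof -
  \<comment> \<open>The change of variables theorem is applied to a vector-valued integrand: the
    scalar one is carried along a unit vector and recovered by pairing with it.\<close>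
  let ?e = "axis 1 1 :: real^2"
  let ?f = "\<lambda>x. c x *\<^sub>R ?e"
  have e: "?e \<bullet> ?e = 1" by (simp add: inner_axis_axis)
  have cl: "integrable lebesgue (\<lambda>x. indicator T x *\<^sub>R c x)" "integral\<^sup>L lebesgue (\<lambda>x. indicator T x *\<^sub>R c x) = (LINT x|lborel. indicator T x *\<^sub>R c x)"
    using c integrable_completion integral_completion borel_measurable_integrable by blast+
  have f: "?f absolutely_integrable_on T"
    using integrable_scaleR_left[OF cl(1), of ?e] by (simp add: set_integrable_def)
  have iT: "integral T ?f = (LINT x|lborel. indicator T x *\<^sub>R c x) *\<^sub>R ?e"
    using set_lebesgue_integral_eq_integral(2)[OF f] integral_scaleR_left[of ?e lebesgue "\<lambda>x. indicator T x *\<^sub>R c x"] cl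
    by (simp add: set_lebesgue_integral_def)
  let ?g = "\<lambda>x. \<bar>det (matrix (M' x))\<bar> *\<^sub>R ?f (M x)"
  have g: "?g absolutely_integrable_on S \<and> integral S ?g = integral T ?f"
    using has_absolute_integral_change_of_variables[of S M M' ?f "integral T ?f"] f S inj im
    by (auto intro: has_derivative_at_withinI der)
  then have gi: "integrable lebesgue (\<lambda>x. indicator S x *\<^sub>R ?g x)"
    by (simp add: set_integrable_def)
  have eq: "(indicator S x *\<^sub>R ?g x) \<bullet> ?e = indicator S x *\<^sub>R (\<bar>det (matrix (M' x))\<bar> * c (M x))" for x
    using e by simp
  show "integrable lebesgue (\<lambda>x. indicator S x *\<^sub>R (\<bar>det (matrix (M' x))\<bar> * c (M x)))"
    using integrable_inner_left[OF gi, of ?e] unfolding eq .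
  have "(LINT x|lebesgue. indicator S x *\<^sub>R ?g x) = (LINT x|lborel. indicator T x *\<^sub>R c x) *\<^sub>R ?e"
    using g iT set_lebesgue_integral_eq_integral(2)[of S ?g] by (simp add: set_lebesgue_integral_def)
  then have "(LINT x|lebesgue. indicator S x *\<^sub>R ?g x) \<bullet> ?e = (LINT x|lborel. indicator T x *\<^sub>R c x)"
    using e by simp
  moreover have "(LINT x|lebesgue. (indicator S x *\<^sub>R ?g x) \<bullet> ?e) = (LINT x|lebesgue. indicator S x *\<^sub>R ?g x) \<bullet> ?e"
    by (rule integral_inner_left) (rule gi)
  ultimately show "(LINT x|lebesgue. indicator S x *\<^sub>R (\<bar>det (matrix (M' x))\<bar> * c (M x))) = (LINT x|lborel. indicator T x *\<^sub>R c x)"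
    unfolding eq by simp
qed

text \<open>Under stereographic projection, inversion in the circle of radius \<open>sqrt 2\<close> about \<open>(1, 0)\<close> is the
  reflection of the sphere that exchanges the first two coordinates.\<close>

definition pole :: "real^2" where
  "pole = axis 1 1"

lemma pole_nth: "pole $ 1 = 1" "pole $ 2 = 0"
  by (simp_all add: pole_def axis_nth2)

definition swap :: "real^2 \<Rightarrow> real^2" where
  "swap w = pole + (2 / (norm (w - pole))\<^sup>2) *\<^sub>R (w - pole)"

definition swap' :: "real^2 \<Rightarrow> real^2 \<Rightarrow> real^2" where
  "swap' w h = (2 / (norm (w - pole))\<^sup>2) *\<^sub>R h - (4 * ((w - pole) \<bullet> h) / ((norm (w - pole))\<^sup>2)\<^sup>2) *\<^sub>R (w - pole)"

lemma swap_minus_pole: "swap w - pole = (2 / (norm (w - pole))\<^sup>2) *\<^sub>R (w - pole)"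
  by (simp add: swap_def)

lemma norm_swap_minus_pole:
  assumes "w \<noteq> pole"
  shows "(norm (swap w - pole))\<^sup>2 = 4 / (norm (w - pole))\<^sup>2"
proof -
  define q where "q = (norm (w - pole))\<^sup>2"
  have "(norm (swap w - pole))\<^sup>2 = (2 / q)\<^sup>2 * q"
    unfolding swap_minus_pole q_def by (simp only: norm_scaleR power_mult_distrib power2_abs)
  moreover have "q \<noteq> 0" using assms by (simp add: q_def)
  ultimately show ?thesis unfolding q_def[symmetric] by (simp add: power2_eq_square)
qed

lemma swap_neq_pole: "w \<noteq> pole \<Longrightarrow> swap w \<noteq> pole"
  using swap_minus_pole[of w] by force

lemma swap_swap:
  assumes "w \<noteq> pole"
  shows "swap (swap w) = w"
proof -
  define q where "q = (norm (w - pole))\<^sup>2"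
  have "q \<noteq> 0" using assms by (simp add: q_def)
  have "swap (swap w) - pole = (2 / (4 / q)) *\<^sub>R ((2 / q) *\<^sub>R (w - pole))"
    unfolding swap_minus_pole[of "swap w"] norm_swap_minus_pole[OF assms] unfolding swap_minus_pole[of w] q_def ..
  also have "\<dots> = w - pole" using \<open>q \<noteq> 0\<close> by simp
  finally show ?thesis by simp
qed

lemma has_derivative_swap:
  assumes w: "w \<noteq> pole"
  shows "(swap has_derivative swap' w) (at w)"
proof -
  have n: "(norm (w - pole))\<^sup>2 \<noteq> 0" using w by simp
  have "GDERIV (\<lambda>x. (norm (pole - x))\<^sup>2) w :> 2 *\<^sub>R (w - pole)" by (rule GDERIV_norm_squared)
  then have "((\<lambda>x. (norm (x - pole))\<^sup>2) has_derivative (\<lambda>h. h \<bullet> (2 *\<^sub>R (w - pole)))) (at w)"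
    by (simp add: gderiv_def norm_minus_commute)
  from has_derivative_divide[OF has_derivative_const[of 2] this n]
  have "((\<lambda>x. 2 / (norm (x - pole))\<^sup>2) has_derivative (\<lambda>h. - (4 * ((w - pole) \<bullet> h) / ((norm (w - pole))\<^sup>2)\<^sup>2))) (at w)"
    by (rule has_derivative_eq_rhs) (use n in \<open>auto simp: fun_eq_iff inner_commute divide_simps power2_eq_square\<close>)
  from has_derivative_add[OF has_derivative_const[of pole]
      has_derivative_scaleR[OF this has_derivative_diff[OF has_derivative_ident has_derivative_const[of pole]]]]
  have "((\<lambda>x. pole + (2 / (norm (x - pole))\<^sup>2) *\<^sub>R (x - pole)) has_derivative swap' w) (at w)"
    by (rule has_derivative_eq_rhs) (simp add: swap'_def fun_eq_iff)
  then show ?thesis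
    by (simp add: swap_def[abs_def])
qed

text \<open>The derivative of an inversion is a scalar times a reflection, so its determinant is
  minus the square of that scalar.\<close>

lemma det_swap': "w \<noteq> pole \<Longrightarrow> \<bar>det (matrix (swap' w))\<bar> = 4 / ((norm (w - pole))\<^sup>2)\<^sup>2"
proof -
  assume "w \<noteq> pole"
  define d n where "d = w - pole" and "n = (norm d)\<^sup>2"
  have n: "n \<noteq> 0" "n = (d $ 1)\<^sup>2 + (d $ 2)\<^sup>2"
    unfolding n_def by (use \<open>w \<noteq> pole\<close> in \<open>simp add: d_def\<close>, rule norm_vec2_squared)
  have m: "matrix (swap' w) $ i $ j = 2 / n * (axis j 1 $ i) - 4 * (d $ j) / n\<^sup>2 * (d $ i)" for i j
    by (simp add: matrix_def swap'_def inner_axis flip: d_def n_def)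
  have "det (matrix (swap' w)) = (2 / n) * (2 / n) - (2 / n) * (4 / n\<^sup>2) * ((d $ 1)\<^sup>2 + (d $ 2)\<^sup>2)"
    unfolding det_2 m axis_nth2 by (simp add: power2_eq_square algebra_simps)
  also have "\<dots> = - (4 / n\<^sup>2)"
    unfolding n(2)[symmetric] using n(1) by (simp add: power2_eq_square)
  finally show ?thesis by (simp add: d_def n_def)
qed

text \<open>The factor \<open>2 / (norm (w - pole))\<^sup>2\<close> is the stretching of lengths by
  \<open>swap\<close> at \<open>w\<close>, so the identity expresses that \<open>swap\<close> is an
  isometry of the round metric.\<close>

lemma lam_swap:
  assumes "w \<noteq> pole"
  shows "lam (swap w) * (2 / (norm (w - pole))\<^sup>2) = lam w"
proof -
  define d n where "d = w - pole" and "n = (norm d)\<^sup>2"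
  have n: "n > 0" "n = (d $ 1)\<^sup>2 + (d $ 2)\<^sup>2"
    unfolding n_def by (use assms in \<open>simp add: d_def\<close>, rule norm_vec2_squared)
  have w: "w $ 1 = 1 + d $ 1" "w $ 2 = d $ 2"
    by (simp_all add: d_def pole_def axis_nth2)
  have s: "swap w $ 1 = 1 + 2 / n * d $ 1" "swap w $ 2 = 2 / n * d $ 2"
    unfolding swap_def d_def[symmetric] n_def[symmetric] by (simp_all add: pole_nth)
  have "((norm (swap w))\<^sup>2 + 1) * n = 2 * ((norm w)\<^sup>2 + 1)"
  proof -
    have "((norm (swap w))\<^sup>2 + 1) * n = 2 * n + 4 * d $ 1 + 4 / n * ((d $ 1)\<^sup>2 + (d $ 2)\<^sup>2)"
      unfolding norm_vec2_squared s using n(1) by (simp add: power2_eq_square field_simps)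
    also have "\<dots> = 2 * n + 4 * d $ 1 + 4"
      unfolding n(2)[symmetric] using n(1) by simp
    also have "\<dots> = 2 * ((norm w)\<^sup>2 + 1)"
      unfolding norm_vec2_squared w n(2) by (simp add: power2_eq_square algebra_simps)
    finally show ?thesis .
  qed
  then show ?thesis
    using n(1) one_plus_norm_pos[of w] one_plus_norm_pos[of "swap w"]
    unfolding lam_def n_def[symmetric, unfolded d_def] by (simp add: field_simps)
qed

lemma swap_measurable [measurable]: "swap \<in> borel_measurable borel"
  unfolding swap_def[abs_def] by measurable

lemma AE_neq_pole: "AE w in lborel. w \<noteq> pole"
  using AE_not_negligible[of "{pole}"] by simp

lemma swap_change_of_variables:
  assumes [measurable]: "S \<in> sets borel" "T \<in> sets borel" "g \<in> borel_measurable borel"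
    and im: "swap ` S = T" and S: "pole \<notin> S"
    and int: "integrable lborel (\<lambda>w. indicator T w * ((lam w)\<^sup>2 * g w))"
  shows "integrable lborel (\<lambda>z. indicator S z * ((lam z)\<^sup>2 * g (swap z)))"
    and "(LINT z|lborel. indicator S z * ((lam z)\<^sup>2 * g (swap z))) = (LINT w|lborel. indicator T w * ((lam w)\<^sup>2 * g w))"
proof -
  have ne: "x \<noteq> pole" if "x \<in> S" for x using that S by blast
  have inj: "inj_on swap S"
    by (rule inj_on_inverseI[of _ swap]) (simp add: ne swap_swap)
  have eq: "indicator S z *\<^sub>R (\<bar>det (matrix (swap' z))\<bar> * ((lam (swap z))\<^sup>2 * g (swap z))) = indicator S z * ((lam z)\<^sup>2 * g (swap z))" for z
  proof (cases "z \<in> S")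
    case True
    then have "\<bar>det (matrix (swap' z))\<bar> * (lam (swap z))\<^sup>2 = (lam z)\<^sup>2"
      unfolding lam_swap[OF ne[OF True], symmetric] det_swap'[OF ne[OF True]]
      by (simp add: power_mult_distrib power_divide)
    then show ?thesis by (simp add: mult.assoc[symmetric])
  qed simp
  have int': "integrable lborel (\<lambda>w. indicator T w *\<^sub>R ((lam w)\<^sup>2 * g w))" using int by simp
  note cov = lborel_change_of_variables[OF assms(1) has_derivative_swap[OF ne] inj im assms(2) int', unfolded eq]
  have m: "(\<lambda>z. indicator S z * ((lam z)\<^sup>2 * g (swap z))) \<in> borel_measurable lborel"
    by measurable
  show "integrable lborel (\<lambda>z. indicator S z * ((lam z)\<^sup>2 * g (swap z)))"
    using cov(1) integrable_completion[OF m] by simp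
  show "(LINT z|lborel. indicator S z * ((lam z)\<^sup>2 * g (swap z))) = (LINT w|lborel. indicator T w * ((lam w)\<^sup>2 * g w))"
    using cov(2) integral_completion[OF m] by simp
qed

lemma swap_nonpos_iff:
  assumes "w \<noteq> pole"
  shows "swap w $ 1 \<le> 0 \<longleftrightarrow> norm w \<le> 1"
proof -
  define n where "n = (norm (w - pole))\<^sup>2"
  have "n > 0"
    using assms by (simp add: n_def)
  moreover have "n = (w $ 1 - 1)\<^sup>2 + (w $ 2)\<^sup>2"
    by (simp add: n_def norm_vec2_squared pole_def axis_nth2)
  ultimately have n: "n > 0" "n = (w $ 1 - 1)\<^sup>2 + (w $ 2)\<^sup>2" .
  have "swap w $ 1 = 1 + 2 / n * (w $ 1 - 1)"
    by (simp add: swap_def n_def pole_nth)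
  also have "\<dots> = (n + 2 * (w $ 1 - 1)) / n"
    using n(1) by (simp add: field_simps)
  also have "n + 2 * (w $ 1 - 1) = (norm w)\<^sup>2 - 1"
    unfolding n(2) norm_vec2_squared by (simp add: power2_eq_square algebra_simps)
  finally have "swap w $ 1 \<le> 0 \<longleftrightarrow> (norm w)\<^sup>2 \<le> 1"
    using n(1) by (simp add: divide_le_0_iff)
  then show ?thesis
    by (simp add: abs_square_le_1)
qed

text \<open>Finiteness of the area of the sphere. The isometry \<open>swap\<close> exchanges the
  half plane \<open>?H\<close> with the unit disc without \<open>pole\<close>, a bounded set on
  which the density is at most 4; the map that sends \<open>z\<close> to \<open>- z\<close> then
  covers the opposite half plane.\<close>

lemma integrable_lam_squared: "integrable lborel (\<lambda>w. (lam w)\<^sup>2)"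
proof -
  let ?D = "cball 0 1 - {pole}" and ?H = "{w :: real^2. w $ 1 \<le> 0}"
  have bH: "?H \<in> sets borel" by (intro borel_closed closed_Collect_le continuous_intros)
  have bD: "?D \<in> sets borel" by (intro sets.Diff borel_closed closed_cball closed_singleton)
  have pH: "pole \<notin> ?H" by (simp add: pole_def axis_nth2)
  have im: "swap ` ?H = ?D"
  proof (intro equalityI subsetI)
    fix w assume "w \<in> swap ` ?H"
    then obtain z where z: "w = swap z" "z $ 1 \<le> 0" by auto
    then have "z \<noteq> pole" using pH by auto
    then have "swap z \<noteq> pole" "swap (swap z) = z" by (simp_all add: swap_neq_pole swap_swap)
    then show "w \<in> ?D" using swap_nonpos_iff[of "swap z"] z by simp
  next
    fix w assume "w \<in> ?D"
    then have "w \<noteq> pole" "norm w \<le> 1" by auto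
    then have "w = swap (swap w)" "swap w $ 1 \<le> 0" by (simp_all add: swap_swap swap_nonpos_iff)
    then show "w \<in> swap ` ?H" by blast
  qed
  have "integrable lborel (\<lambda>w. indicator ?D w * ((lam w)\<^sup>2 * (1::real)))"
  proof (rule integrable_bounded_support[where B = 4 and R = 1])
    show "(\<lambda>w. indicator ?D w * ((lam w)\<^sup>2 * (1::real))) \<in> borel_measurable borel"
      using bD by measurable
    show "norm (indicator ?D w * ((lam w)\<^sup>2 * (1::real))) \<le> 4" for w
      using power_mono[OF lam_le_2[of w], of 2] lam_pos[of w] by (auto simp: indicator_def)
  qed auto
  from swap_change_of_variables(1)[OF bH bD _ im pH this]
  have int: "integrable lborel (\<lambda>z. indicator ?H z * (lam z)\<^sup>2)" by simp
  have meas: "(\<lambda>z. indicator ?H z * (lam z)\<^sup>2) \<in> borel_measurable borel"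
    using bH by measurable
  have "lam (0 - z) = lam z" for z by (simp add: lam_def)
  then have int2: "integrable lborel (\<lambda>z. indicator ?H (0 - z) * (lam z)\<^sup>2)"
    using integral_lborel_reflect(2)[OF meas, of 0] int by simp
  show ?thesis
  proof (rule Bochner_Integration.integrable_bound)
    show "integrable lborel (\<lambda>z. indicator ?H z * (lam z)\<^sup>2 + indicator ?H (0 - z) * (lam z)\<^sup>2)"
      by (rule Bochner_Integration.integrable_add[OF int int2])
    show "AE z in lborel. norm ((lam z)\<^sup>2) \<le> norm (indicator ?H z * (lam z)\<^sup>2 + indicator ?H (0 - z) * (lam z)\<^sup>2)"
      by (auto simp: indicator_def)
  qed measurable
qed

lemma integrable_lam_squared_mult:
  fixes g :: "real^2 \<Rightarrow> real"
  assumes [measurable]: "g \<in> borel_measurable borel" and B: "\<And>w. \<bar>g w\<bar> \<le> B"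
  shows "integrable lborel (\<lambda>w. (lam w)\<^sup>2 * g w)"
proof (rule Bochner_Integration.integrable_bound)
  show "integrable lborel (\<lambda>w. (lam w)\<^sup>2 * B)"
    by (intro integrable_mult_left integrable_lam_squared)
  show "AE w in lborel. norm ((lam w)\<^sup>2 * g w) \<le> norm ((lam w)\<^sup>2 * B)"
    using B by (auto simp: abs_mult intro!: mult_left_mono intro: order_trans[OF B abs_ge_self])
qed measurable

lemma swap_integral:
  assumes [measurable]: "g \<in> borel_measurable borel" and B: "\<And>w. \<bar>g w\<bar> \<le> B"
  shows "(LINT z|lborel. (lam z)\<^sup>2 * g (swap z)) = (LINT w|lborel. (lam w)\<^sup>2 * g w)"
proof -
  have im: "swap ` (- {pole}) = - {pole}"
  proof (intro equalityI subsetI)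
    fix w assume "w \<in> - {pole}"
    then have "w = swap (swap w)" "swap w \<in> - {pole}" by (simp_all add: swap_swap swap_neq_pole)
    then show "w \<in> swap ` (- {pole})" by blast
  qed (auto dest: swap_neq_pole)
  have b: "- {pole} \<in> sets borel" by (intro borel_open open_Compl closed_singleton)
  have drop: "(LINT w|lborel. indicator (- {pole}) w * k w) = (LINT w|lborel. k w)"
    if [measurable]: "k \<in> borel_measurable borel" for k :: "real^2 \<Rightarrow> real"
  proof (rule integral_cong_AE)
    show "(\<lambda>w. indicator (- {pole}) w * k w) \<in> borel_measurable lborel" using b by measurable
    show "AE w in lborel. indicator (- {pole}) w * k w = k w"
      using AE_neq_pole by eventually_elim simp
  qed measurable
  have "integrable lborel (\<lambda>w. indicator (- {pole}) w * ((lam w)\<^sup>2 * g w))"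
    using integrable_real_mult_indicator[OF _ integrable_lam_squared_mult[OF assms], of "- {pole}"] b
    by (simp add: mult.commute)
  from swap_change_of_variables(2)[OF b b assms(1) im _ this] show ?thesis
    by (simp add: drop)
qed

section \<open>Rotations of the plane and the circle inequality along their orbits\<close>

definition rot :: "real \<Rightarrow> real^2 \<Rightarrow> real^2" where
  "rot s w = cos s *\<^sub>R w + sin s *\<^sub>R J0 w"

lemma rot_nth: "rot s w $ 1 = cos s * w $ 1 - sin s * w $ 2" "rot s w $ 2 = sin s * w $ 1 + cos s * w $ 2"
  by (simp_all add: rot_def)

lemma norm_rot [simp]: "norm (rot s w) = norm w"
proof (rule power2_eq_imp_eq)
  have "(norm (rot s w))\<^sup>2 = ((cos s)\<^sup>2 + (sin s)\<^sup>2) * ((w $ 1)\<^sup>2 + (w $ 2)\<^sup>2)"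
    unfolding norm_vec2_squared rot_nth by algebra
  then show "(norm (rot s w))\<^sup>2 = (norm w)\<^sup>2"
    by (simp add: norm_vec2_squared)
qed simp_all

lemma rot_rot: "rot s (rot t w) = rot (s + t) w"
  by (simp add: vec_eq_iff forall_2 rot_nth cos_add sin_add algebra_simps)

lemma rot_0 [simp]: "rot 0 w = w"
  by (simp add: rot_def)

lemma linear_rot: "linear (rot s)"
  by (rule linearI) (simp_all add: vec_eq_iff forall_2 rot_nth algebra_simps)

lemma continuous_rot [continuous_intros]:
  assumes f: "continuous_on S f" and g: "continuous_on S g"
  shows "continuous_on S (\<lambda>x. rot (f x) (g x))"
proof -
  have "continuous_on UNIV (cos :: real \<Rightarrow> real)" "continuous_on UNIV (sin :: real \<Rightarrow> real)"
    by (simp_all add: continuous_at_imp_continuous_on)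
  then have "continuous_on S (\<lambda>x. cos (f x))" "continuous_on S (\<lambda>x. sin (f x))"
    using f by (auto elim: continuous_on_compose2)
  then show ?thesis
    unfolding rot_def using g by (intro continuous_intros)
qed

lemma lam_rot [simp]: "lam (rot s w) = lam w"
  by (simp add: lam_def)

text \<open>Lebesgue measure is determined by its values on boxes, and the preimage of a box under a
  rotation is its image under the inverse rotation, of the same measure.\<close>

lemma lborel_distr_rot: "distr lborel borel (rot s) = lborel"
proof (rule sym, rule lborel_eqI)
  have m: "rot s \<in> borel_measurable borel"
    by (intro borel_measurable_continuous_onI continuous_intros)
  fix l u :: "real^2"
  assume le: "\<And>b. b \<in> Basis \<Longrightarrow> l \<bullet> b \<le> u \<bullet> b"
  have orth: "orthogonal_transformation (rot (- s))"
    by (simp add: orthogonal_transformation linear_rot)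
  have vim: "rot s -` box l u = rot (- s) ` box l u"
  proof (intro equalityI subsetI)
    fix x assume "x \<in> rot s -` box l u"
    then have "x = rot (- s) (rot s x)" "rot s x \<in> box l u" by (simp_all add: rot_rot)
    then show "x \<in> rot (- s) ` box l u" by blast
  qed (auto simp: rot_rot)
  have open_im: "rot s -` box l u \<in> sets borel"
    using measurable_sets[OF m, of "box l u"] by simp
  have lm: "rot (- s) ` box l u \<in> lmeasurable"
    by (rule measurable_orthogonal_image[OF orth lmeasurable_box])
  have "emeasure (distr lborel borel (rot s)) (box l u) = emeasure lborel (rot s -` box l u)"
    using m by (subst emeasure_distr) simp_all
  also have "\<dots> = emeasure lebesgue (rot (- s) ` box l u)"
    using open_im unfolding vim by (simp add: emeasure_completion)
  also have "\<dots> = ennreal (measure lebesgue (rot (- s) ` box l u))"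
    using lm by (simp add: emeasure_eq_measure2 fmeasurableD2 emeasure_eq_ennreal_measure)
  also have "measure lebesgue (rot (- s) ` box l u) = measure lebesgue (box l u)"
    by (rule measure_orthogonal_image[OF orth lmeasurable_box])
  also have "\<dots> = (\<Prod>b\<in>Basis. (u - l) \<bullet> b)"
    using le by (simp add: measure_completion measure_lborel_box_eq)
  finally show "emeasure (distr lborel borel (rot s)) (box l u) = (\<Prod>b\<in>Basis. (u - l) \<bullet> b)" .
qed simp

lemma integral_rot:
  fixes g :: "real^2 \<Rightarrow> real"
  assumes [measurable]: "g \<in> borel_measurable borel"
  shows "(LINT w|lborel. g (rot s w)) = (LINT w|lborel. g w)"
    and "integrable lborel (\<lambda>w. g (rot s w)) \<longleftrightarrow> integrable lborel g"
proof -
  have [measurable]: "rot s \<in> borel_measurable borel"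
    by (intro borel_measurable_continuous_onI continuous_intros)
  show "(LINT w|lborel. g (rot s w)) = (LINT w|lborel. g w)"
    using integral_distr[of "rot s" lborel borel g] by (simp add: lborel_distr_rot)
  show "integrable lborel (\<lambda>w. g (rot s w)) \<longleftrightarrow> integrable lborel g"
    using integrable_distr_eq[of "rot s" lborel borel g] by (simp add: lborel_distr_rot)
qed

lemma has_vector_derivative_rot: "((\<lambda>s. rot s w) has_vector_derivative J0 (rot s w)) (at s)"
proof -
  have "((\<lambda>s. cos s *\<^sub>R w + sin s *\<^sub>R J0 w) has_vector_derivative (- sin s) *\<^sub>R w + cos s *\<^sub>R J0 w) (at s)"
    by (intro has_vector_derivative_add)
       (auto intro!: derivative_eq_intros has_vector_derivative_scaleR[THEN has_vector_derivative_eq_rhs])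
  moreover have "(- sin s) *\<^sub>R w + cos s *\<^sub>R J0 w = J0 (rot s w)"
    by (simp add: vec_eq_iff forall_2 rot_nth)
  ultimately show ?thesis by (simp add: rot_def[abs_def])
qed

text \<open>The integrand of the circle inequality for the restrictions of \<open>f\<close> and
  \<open>h\<close> to an orbit of \<open>v\<close>. The sign \<open>c\<close> records whether the
  orbit is traversed along \<open>v\<close> or against it.\<close>

definition hurwitz_density :: "real \<Rightarrow> (real^2 \<Rightarrow> real^2) \<Rightarrow> (real^2 \<Rightarrow> real) \<Rightarrow> (real^2 \<Rightarrow> real^2) \<Rightarrow> (real^2 \<Rightarrow> real) \<Rightarrow> (real^2 \<Rightarrow> real^2) \<Rightarrow> real^2 \<Rightarrow> real" where
  "hurwitz_density c v f F h H w = (v w \<bullet> F w)\<^sup>2 + (v w \<bullet> H w)\<^sup>2 - c * (f w * (v w \<bullet> H w) - h w * (v w \<bullet> F w))"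

text \<open>By the chain rule the restrictions of \<open>f\<close> and \<open>h\<close> to the
  closed curve have derivatives \<open>c\<close> times their derivatives along \<open>v\<close>; in
  the squares \<open>c\<close> disappears, and in the skew term it remains as the
  orientation.\<close>

lemma hurwitz_density_along_circle:
  assumes f: "C1c f F" and h: "C1c h H" and v: "continuous_on UNIV v" and c: "c\<^sup>2 = 1"
    and curve: "\<And>s. ((\<lambda>s. M (rot s z)) has_vector_derivative c *\<^sub>R v (M (rot s z))) (at s)"
  shows "0 \<le> integral {0..2 * pi} (\<lambda>s. hurwitz_density c v f F h H (M (rot s z)))"
    and "continuous_on UNIV (\<lambda>s. hurwitz_density c v f F h H (M (rot s z)))"
proof -
  let ?\<gamma> = "\<lambda>s. M (rot s z)"
  have cg: "continuous_on UNIV ?\<gamma>"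
    using curve by (intro continuous_at_imp_continuous_on ballI has_vector_derivative_continuous)
  have der: "((\<lambda>s. p (?\<gamma> s)) has_real_derivative c * (v (?\<gamma> s) \<bullet> P (?\<gamma> s))) (at s)" if "C1c p P" for p P s
  proof -
    have "((\<lambda>s. p (?\<gamma> s)) has_derivative (\<lambda>t. (t *\<^sub>R (c *\<^sub>R v (?\<gamma> s))) \<bullet> P (?\<gamma> s))) (at s)"
    proof (rule has_derivative_compose[of ?\<gamma> "\<lambda>t. t *\<^sub>R (c *\<^sub>R v (?\<gamma> s))" s UNIV p "\<lambda>h. h \<bullet> P (?\<gamma> s)"])
      show "(?\<gamma> has_derivative (\<lambda>t. t *\<^sub>R (c *\<^sub>R v (?\<gamma> s)))) (at s)"
        using curve[of s] by (simp add: has_vector_derivative_def)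
      show "(p has_derivative (\<lambda>h. h \<bullet> P (?\<gamma> s))) (at (?\<gamma> s))"
        using C1cD(1)[OF that, of "?\<gamma> s"] by (simp add: gderiv_def)
    qed
    moreover have "(\<lambda>t. (t *\<^sub>R (c *\<^sub>R v (?\<gamma> s))) \<bullet> P (?\<gamma> s)) = (\<lambda>t. (c * (v (?\<gamma> s) \<bullet> P (?\<gamma> s))) * t)"
      by (simp add: fun_eq_iff)
    ultimately show ?thesis by (simp add: has_field_derivative_def)
  qed
  have cont: "continuous_on UNIV (\<lambda>s. c * (v (?\<gamma> s) \<bullet> P (?\<gamma> s)))" if "C1c p P" for p P
    by (intro continuous_intros continuous_on_compose2[OF v cg] continuous_on_compose2[OF C1cD(2)[OF that] cg]) auto
  have per: "?\<gamma> (2 * pi) = ?\<gamma> 0" by (simp add: rot_def)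
  have eq: "(c * (v (?\<gamma> s) \<bullet> F (?\<gamma> s)))\<^sup>2 + (c * (v (?\<gamma> s) \<bullet> H (?\<gamma> s)))\<^sup>2
      - (f (?\<gamma> s) * (c * (v (?\<gamma> s) \<bullet> H (?\<gamma> s))) - h (?\<gamma> s) * (c * (v (?\<gamma> s) \<bullet> F (?\<gamma> s)))) =
      hurwitz_density c v f F h H (?\<gamma> s)" for s
    by (simp add: hurwitz_density_def power_mult_distrib c right_diff_distrib mult.left_commute)
  show "0 \<le> integral {0..2 * pi} (\<lambda>s. hurwitz_density c v f F h H (?\<gamma> s))"
    using circle_isoperimetric[OF der[OF f] der[OF h] cont[OF f] cont[OF h]] per unfolding eq by simp
  show "continuous_on UNIV (\<lambda>s. hurwitz_density c v f F h H (?\<gamma> s))"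
    unfolding hurwitz_density_def
    by (intro continuous_intros continuous_on_compose2[OF v cg] continuous_on_compose2[OF C1cD(2)[OF f] cg]
        continuous_on_compose2[OF C1cD(2)[OF h] cg] continuous_on_compose2[OF C1cD(3)[OF f] cg]
        continuous_on_compose2[OF C1cD(3)[OF h] cg]) auto
qed

text \<open>Averaging over the rotations reduces positivity on the sphere to positivity on each circle of latitude.\<close>

lemma integral_hurwitz_density_nonneg:
  assumes f: "C1c f F" and h: "C1c h H" and v: "continuous_on UNIV v" and c: "c\<^sup>2 = 1"
    and M [measurable]: "M \<in> borel_measurable borel"
    and inv: "\<And>g B. g \<in> borel_measurable borel \<Longrightarrow> (\<And>w. \<bar>g w\<bar> \<le> B) \<Longrightarrow>
      (LINT z|lborel. (lam z)\<^sup>2 * g (M z)) = (LINT w|lborel. (lam w)\<^sup>2 * g w)"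
    and curve: "AE z in lborel. \<forall>s. ((\<lambda>s. M (rot s z)) has_vector_derivative c *\<^sub>R v (M (rot s z))) (at s)"
  shows "0 \<le> (LINT w|lborel. (lam w)\<^sup>2 * hurwitz_density c v f F h H w)"
proof -
  let ?G = "hurwitz_density c v f F h H"
  have contG: "continuous_on UNIV ?G"
    unfolding hurwitz_density_def[abs_def] by (intro continuous_intros v C1cD[OF f] C1cD[OF h])
  then have [measurable]: "?G \<in> borel_measurable borel"
    by (rule borel_measurable_continuous_onI)
  obtain R1 R2 where "\<And>x. norm x > R1 \<Longrightarrow> f x = 0 \<and> F x = 0" "\<And>x. norm x > R2 \<Longrightarrow> h x = 0 \<and> H x = 0"
    using f h by (auto simp: C1c_def)
  then have "?G x = 0" if "norm x > max R1 R2" for x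
    using that by (simp add: hurwitz_density_def)
  then obtain B where B: "B \<ge> 0" "\<And>x. norm (?G x) \<le> B"
    using Cc_bounded[OF contG, of "max R1 R2"] by blast
  have rotm: "(\<lambda>p. rot (fst p) (snd p)) \<in> borel_measurable borel"
    by (intro borel_measurable_continuous_onI continuous_intros)
  have [measurable]: "(\<lambda>p. rot (fst p) (snd p)) \<in> borel_measurable (lborel \<Otimes>\<^sub>M lborel)"
    using rotm by (simp add: lborel_prod)
  define I where "I = (LINT w|lborel. (lam w)\<^sup>2 * ?G w)"
  \<comment> \<open>Both \<open>lam\<close> and Lebesgue measure are invariant under rotations, so
    every angle gives the same value.\<close>
  have I: "(LINT z|lborel. (lam z)\<^sup>2 * ?G (M (rot s z))) = I" for s
  proof -
    have "(LINT z|lborel. (lam z)\<^sup>2 * ?G (M (rot s z))) = (LINT z|lborel. (lam (rot s z))\<^sup>2 * ?G (M (rot s z)))"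
      by simp
    also have "\<dots> = (LINT z|lborel. (lam z)\<^sup>2 * ?G (M z))"
      by (rule integral_rot(1)[of "\<lambda>z. (lam z)\<^sup>2 * ?G (M z)"]) measurable
    also have "\<dots> = I"
      unfolding I_def using B(2) by (intro inv[where B = B]) auto
    finally show ?thesis .
  qed
  let ?i = "indicator {0..2 * pi} :: real \<Rightarrow> real"
  have int: "integrable (lborel \<Otimes>\<^sub>M lborel) (\<lambda>(s, z). ?i s * ((lam z)\<^sup>2 * ?G (M (rot s z))))"
  proof (rule Bochner_Integration.integrable_bound)
    have "integrable lborel (\<lambda>s. ?i s * B)"
      by (intro integrable_mult_left) simp
    from integrable_product_lborel[OF this integrable_lam_squared]
    show "integrable (lborel \<Otimes>\<^sub>M lborel) (\<lambda>(s, z). (?i s * B) * (lam (z :: real^2))\<^sup>2)" .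
    have "(\<lambda>p. ?i (fst p) * ((lam (snd p))\<^sup>2 * ?G (M (rot (fst p) (snd p))))) \<in> borel_measurable (lborel \<Otimes>\<^sub>M lborel)"
      by measurable
    then show "(\<lambda>(s, z). ?i s * ((lam z)\<^sup>2 * ?G (M (rot s z)))) \<in> borel_measurable (lborel \<Otimes>\<^sub>M lborel)"
      by (simp add: case_prod_beta')
    show "AE p in lborel \<Otimes>\<^sub>M lborel. norm (case p of (s, z) \<Rightarrow> ?i s * ((lam z)\<^sup>2 * ?G (M (rot s z)))) \<le>
        norm (case p of (s, z) \<Rightarrow> (?i s * B) * (lam z)\<^sup>2)"
    proof (intro AE_I2, clarify)
      fix s and z :: "real^2"
      have "(lam z)\<^sup>2 * \<bar>?G (M (rot s z))\<bar> \<le> (lam z)\<^sup>2 * B"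
        using B(2) by (intro mult_left_mono) auto
      then show "norm (?i s * ((lam z)\<^sup>2 * ?G (M (rot s z)))) \<le> norm ((?i s * B) * (lam z)\<^sup>2)"
        using B(1) by (simp add: abs_mult indicator_def mult.commute)
    qed
  qed
  \<comment> \<open>Integrating the constant over all angles and exchanging the integrals leaves,
    for almost every \<open>z\<close>, an integral over a single closed orbit.\<close>
  have "2 * pi * I = (LINT s|lborel. ?i s * I)"
    by simp
  also have "\<dots> = (LINT s|lborel. LINT z|lborel. ?i s * ((lam z)\<^sup>2 * ?G (M (rot s z))))"
    by (simp add: I)
  also have "\<dots> = (LINT z|lborel. LINT s|lborel. ?i s * ((lam z)\<^sup>2 * ?G (M (rot s z))))"
    using lborel_pair.Fubini_integral[OF int] by simp
  also have "0 \<le> \<dots>"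
  proof (rule integral_nonneg_AE)
    show "AE z in lborel. 0 \<le> (LINT s|lborel. ?i s * ((lam z)\<^sup>2 * ?G (M (rot s z))))"
      using curve
    proof eventually_elim
      case (elim z)
      note circ = hurwitz_density_along_circle[OF f h v c elim[rule_format]]
      have "(LINT s|lborel. ?i s * ?G (M (rot s z))) = integral {0..2 * pi} (\<lambda>s. ?G (M (rot s z)))"
        using set_borel_integral_eq_integral(2)[of "{0..2 * pi}" "\<lambda>s. ?G (M (rot s z))"]
          borel_integrable_atLeastAtMost'[OF continuous_on_subset[OF circ(2)], of 0 "2 * pi"]
        by (simp add: set_lebesgue_integral_def)
      then have "0 \<le> (lam z)\<^sup>2 * (LINT s|lborel. ?i s * ?G (M (rot s z)))"
        using circ(1) by simp
      then show ?case
        by (simp flip: integral_mult_right_zero add: mult.left_commute)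
    qed
  qed
  finally show ?thesis
    using pi_gt_zero by (simp add: I_def zero_le_mult_iff)
qed

subsection \<open>Nonnegativity of the energy\<close>

lemma sfield_nth:
  "sfield 1 w $ 1 = - w $ 2" "sfield 1 w $ 2 = w $ 1"
  "sfield 2 w $ 1 = w $ 1 * w $ 2" "sfield 2 w $ 2 = (1 + (w $ 2)\<^sup>2 - (w $ 1)\<^sup>2) / 2"
  "sfield 3 w $ 1 = - ((1 + (w $ 1)\<^sup>2 - (w $ 2)\<^sup>2) / 2)" "sfield 3 w $ 2 = - (w $ 1 * w $ 2)"
  by (simp_all add: sfield_def sgrad_nth)

text \<open>A reflection reverses the sense of rotation, so the rotation field of the first axis
  goes to minus that of the second. This is the origin of the signs in
  \<open>orient\<close>.\<close>

lemma swap'_J0: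
  assumes "z \<noteq> pole"
  shows "swap' z (J0 z) = - sfield 2 (swap z)"
proof -
  define d n where "d = z - pole" and "n = (norm d)\<^sup>2"
  have n: "n \<noteq> 0" "n = (d $ 1)\<^sup>2 + (d $ 2)\<^sup>2"
    unfolding n_def by (use assms in \<open>simp add: d_def\<close>, rule norm_vec2_squared)
  have z: "z $ 1 = 1 + d $ 1" "z $ 2 = d $ 2"
    by (simp_all add: d_def pole_nth)
  have s: "swap z $ 1 = 1 + 2 / n * d $ 1" "swap z $ 2 = 2 / n * d $ 2"
    unfolding swap_def d_def[symmetric] n_def[symmetric] by (simp_all add: pole_nth)
  have i: "d \<bullet> J0 z = d $ 2"
    by (simp add: inner_vec2 z algebra_simps)
  have c: "swap' z (J0 z) $ k = 2 / n * (J0 z $ k) - 4 * d $ 2 / n\<^sup>2 * d $ k" for k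
    unfolding swap'_def d_def[symmetric] n_def[symmetric] i by simp
  have "swap' z (J0 z) $ 1 = - sfield 2 (swap z) $ 1"
    unfolding c sfield_nth s J0_nth z using n(1) by (simp add: field_simps power2_eq_square)
  moreover have "swap' z (J0 z) $ 2 = - sfield 2 (swap z) $ 2"
  proof -
    have "- sfield 2 (swap z) $ 2 = 2 * (d $ 1) / n + 2 * ((d $ 1)\<^sup>2 + (d $ 2)\<^sup>2) / n\<^sup>2 - 4 * (d $ 2)\<^sup>2 / n\<^sup>2"
      unfolding sfield_nth s using n(1) by (simp add: field_simps power2_eq_square)
    also have "\<dots> = 2 * (d $ 1) / n + 2 / n - 4 * (d $ 2)\<^sup>2 / n\<^sup>2"
      unfolding n(2)[symmetric] using n(1) by (simp add: power2_eq_square)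
    also have "\<dots> = swap' z (J0 z) $ 2"
      unfolding c J0_nth z using n(1) by (simp add: field_simps power2_eq_square)
    finally show ?thesis by simp
  qed
  ultimately show ?thesis
    by (simp add: vec_eq_iff forall_2)
qed

lemma has_vector_derivative_swap_rot:
  assumes "rot s z \<noteq> pole"
  shows "((\<lambda>s. swap (rot s z)) has_vector_derivative - sfield 2 (swap (rot s z))) (at s)"
proof -
  have "((\<lambda>s. swap (rot s z)) has_derivative (\<lambda>t. swap' (rot s z) (t *\<^sub>R J0 (rot s z)))) (at s)"
  proof (rule has_derivative_compose[where g = swap and f = "\<lambda>s. rot s z" and f' = "\<lambda>t. t *\<^sub>R J0 (rot s z)"])
    show "((\<lambda>s. rot s z) has_derivative (\<lambda>t. t *\<^sub>R J0 (rot s z))) (at s)"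
      using has_vector_derivative_rot[of z s] by (simp add: has_vector_derivative_def)
    show "(swap has_derivative swap' (rot s z)) (at (rot s z))"
      by (rule has_derivative_swap[OF assms])
  qed
  moreover have "swap' w (t *\<^sub>R h) = t *\<^sub>R swap' w h" for w h t
    by (simp add: swap'_def scaleR_diff_right mult_ac)
  ultimately show ?thesis
    unfolding has_vector_derivative_def using swap'_J0[OF assms] by simp
qed

lemma AE_norm_neq_1: "AE z in lborel. norm (z :: real^2) \<noteq> 1"
  using AE_not_negligible[OF negligible_sphere[of "0 :: real^2" 1]] by simp

definition orient :: "3 \<Rightarrow> real" where
  "orient i = (if i = 1 then 1 else - 1)"

lemma sphere_hurwitz_orient:
  assumes f: "C1c f F" and h: "C1c h H"
  shows "0 \<le> (LINT w|lborel. (lam w)\<^sup>2 * hurwitz_density (orient i) (sfield i) f F h H w)"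
proof -
  have v: "continuous_on UNIV (sfield i)" by (intro continuous_intros)
  have o: "(orient i)\<^sup>2 = 1" by (simp add: orient_def)
  have J0m: "rot (pi / 2) = J0" by (simp add: rot_def fun_eq_iff)
  \<comment> \<open>Only orbits on the unit circle can meet \<open>pole\<close>, where
    \<open>swap\<close> is singular; the exceptional starting points form a null set.\<close>
  have np: "rot s z \<noteq> pole" if "norm z \<noteq> 1" for s z
  proof
    assume "rot s z = pole"
    then have "norm z = norm pole" using norm_rot[of s z] by simp
    then show False using that by (simp add: pole_def)
  qed
  consider "i = 1" | "i = 2" | "i = 3" using exhaust_3 by blast
  then show ?thesis
  proof cases
    case 1
    have "sfield 1 = J0" by (simp add: sfield_def fun_eq_iff sgrad_def)
    then show ?thesis
      using 1 has_vector_derivative_rot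
      by (intro integral_hurwitz_density_nonneg[OF f h v o, where M = "\<lambda>w. w"]) (simp_all add: orient_def)
  next
    case 2
    show ?thesis
    proof (rule integral_hurwitz_density_nonneg[OF f h v o, where M = swap])
      show "AE z in lborel. \<forall>s. ((\<lambda>s. swap (rot s z)) has_vector_derivative orient i *\<^sub>R sfield i (swap (rot s z))) (at s)"
        using AE_norm_neq_1
      proof eventually_elim
        case (elim z)
        show ?case
          using has_vector_derivative_swap_rot[OF np[OF elim]] 2 by (simp add: orient_def)
      qed
    qed (rule swap_measurable, rule swap_integral)
  next
    case 3
    show ?thesis
    \<comment> \<open>On the sphere the quarter turn \<open>J0\<close> is the rotation about the
      first axis that takes the second axis to the third, so the composite carries the first axis to
      the third and still reverses orientation.\<close>
    proof (rule integral_hurwitz_density_nonneg[OF f h v o, where M = "\<lambda>w. J0 (swap w)"])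
      have lin: "bounded_linear J0"
        using linear_rot[of "pi / 2"] unfolding J0m by (simp add: linear_conv_bounded_linear)
      have J: "J0 (- sfield 2 w) = - sfield 3 (J0 w)" for w
        by (simp add: vec_eq_iff forall_2 sfield_nth)
      show "AE z in lborel. \<forall>s. ((\<lambda>s. J0 (swap (rot s z))) has_vector_derivative orient i *\<^sub>R sfield i (J0 (swap (rot s z)))) (at s)"
        using AE_norm_neq_1
      proof eventually_elim
        case (elim z)
        show ?case
          using bounded_linear.has_vector_derivative[OF lin has_vector_derivative_swap_rot[OF np[OF elim]]] 3
          unfolding J by (simp add: orient_def)
      qed
      show "(\<lambda>w. J0 (swap w)) \<in> borel_measurable borel"
        by (rule measurable_compose[OF swap_measurable J0_measurable])
      fix g :: "real^2 \<Rightarrow> real" and B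
      assume g: "g \<in> borel_measurable borel" "\<And>w. \<bar>g w\<bar> \<le> B"
      have m: "(\<lambda>w. g (J0 w)) \<in> borel_measurable borel"
        by (rule measurable_compose[OF J0_measurable g(1)])
      have m2: "(\<lambda>w. (lam w)\<^sup>2 * g w) \<in> borel_measurable borel"
        using g(1) by measurable
      have "(LINT z|lborel. (lam z)\<^sup>2 * g (J0 (swap z))) = (LINT w|lborel. (lam w)\<^sup>2 * g (J0 w))"
        by (rule swap_integral[OF m g(2)])
      also have "\<dots> = (LINT w|lborel. (lam w)\<^sup>2 * g w)"
        using integral_rot(1)[OF m2, of "pi / 2"] by (simp only: lam_rot) (simp only: J0m)
      finally show "(LINT z|lborel. (lam z)\<^sup>2 * g (J0 (swap z))) = (LINT w|lborel. (lam w)\<^sup>2 * g w)" .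
    qed
  qed
qed

text \<open>Changing the sign of one function reverses the skew term, so both orientations are covered.\<close>

lemma sphere_hurwitz_inequality:
  assumes f: "C1c f F" and h: "C1c h H"
  shows "0 \<le> (LINT w|lborel. (lam w)\<^sup>2 * hurwitz_density (- 1) (sfield i) f F h H w)"
proof (cases "orient i = - 1")
  case True
  then show ?thesis using sphere_hurwitz_orient[OF f h, of i] by simp
next
  case False
  then have o: "orient i = 1" by (simp add: orient_def split: if_splits)
  have "hurwitz_density 1 (sfield i) (\<lambda>x. - 1 * f x) (\<lambda>x. - 1 *\<^sub>R F x) h H w = hurwitz_density (- 1) (sfield i) f F h H w" for w
    by (simp add: hurwitz_density_def)
  then show ?thesis
    using sphere_hurwitz_orient[OF C1c_scaleR[OF f, of "- 1"] h, of i] unfolding o by simp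
qed

definition Bform :: "3 \<Rightarrow> (real^2 \<Rightarrow> real^2) \<Rightarrow> (real^2 \<Rightarrow> real^2) \<Rightarrow> real" where
  "Bform i F H = (LINT w|lborel. stereo w $ i * (J0 (F w) \<bullet> H w))"

lemma J0_scaleR: "J0 (c *\<^sub>R v) = c *\<^sub>R J0 v"
  by (simp add: vec_eq_iff forall_2)

lemma continuous_stereo_gradient: "continuous_on UNIV (\<lambda>w. (lam w)\<^sup>2 *\<^sub>R sgrad i w)"
  by (intro continuous_intros)

text \<open>The quarter turn of the Euclidean gradient of the \<open>i\<close>-th coordinate is
  \<open>(lam w)\<^sup>2 *\<^sub>R sfield i w\<close>, so after integration by parts only
  derivatives along the circles of latitude occur.\<close>

lemma Bform_C1c:
  assumes f: "C1c f F" and h: "C1c h H"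
  shows "Bform i F H = (LINT w|lborel. h w * ((lam w)\<^sup>2 * (sfield i w \<bullet> F w)))"
    and "Bform i F H = - (LINT w|lborel. f w * ((lam w)\<^sup>2 * (sfield i w \<bullet> H w)))"
  using integral_weighted_Jacobian[OF GDERIV_stereo continuous_stereo_gradient f h, of i]
  by (simp_all add: Bform_def J0_scaleR sfield_def)

text \<open>The circle inequality bounds one copy of \<open>2 * Bform i F H\<close> by the integral
  of \<open>?Q\<close>, the squared latitude derivatives. The pointwise frame estimate bounds the
  integral of \<open>?Q\<close> plus the other copy by the squared norms.\<close>

lemma energy_nonneg_C1c:
  assumes f: "C1c f F" and h: "C1c h H"
  shows "4 * Bform i F H \<le> sqnorm F + sqnorm H"
proof -
  let ?v = "sfield i"
  let ?Q = "\<lambda>w. (lam w)\<^sup>2 * ((?v w \<bullet> F w)\<^sup>2 + (?v w \<bullet> H w)\<^sup>2)"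
  obtain R1 R2 where R: "\<And>x. norm x > R1 \<Longrightarrow> f x = 0 \<and> F x = 0" "\<And>x. norm x > R2 \<Longrightarrow> h x = 0 \<and> H x = 0"
    using f h by (auto simp: C1c_def)
  have cv: "continuous_on UNIV ?v" by (intro continuous_intros)
  have cl: "continuous_on UNIV lam" "continuous_on UNIV (\<lambda>w. stereo w $ i)"
    by (intro continuous_intros)+
  note c = cv cl C1cD(2,3)[OF f] C1cD(2,3)[OF h]
  have iQ: "integrable lborel ?Q"
    by (rule integrable_Cc[where R = "max R1 R2"], intro continuous_intros c) (use R in auto)
  have i1: "integrable lborel (\<lambda>w. f w * ((lam w)\<^sup>2 * (?v w \<bullet> H w)))"
    by (rule integrable_Cc[where R = R1], intro continuous_intros c) (use R in auto)
  have i2: "integrable lborel (\<lambda>w. h w * ((lam w)\<^sup>2 * (?v w \<bullet> F w)))"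
    by (rule integrable_Cc[where R = R2], intro continuous_intros c) (use R in auto)
  have iB: "integrable lborel (\<lambda>w. stereo w $ i * (J0 (F w) \<bullet> H w))"
    by (rule integrable_Cc[where R = R2], intro continuous_intros c) (use R in auto)
  have "(lam w)\<^sup>2 * hurwitz_density (- 1) ?v f F h H w =
      ?Q w + f w * ((lam w)\<^sup>2 * (?v w \<bullet> H w)) - h w * ((lam w)\<^sup>2 * (?v w \<bullet> F w))" for w
    by (simp add: hurwitz_density_def algebra_simps)
  then have "0 \<le> (LINT w|lborel. ?Q w + f w * ((lam w)\<^sup>2 * (?v w \<bullet> H w)) - h w * ((lam w)\<^sup>2 * (?v w \<bullet> F w)))"
    using sphere_hurwitz_inequality[OF f h, of i] by simp
  also have "\<dots> = (LINT w|lborel. ?Q w) - Bform i F H - Bform i F H"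
    using Bform_C1c[OF f h, of i]
    by (subst Bochner_Integration.integral_diff[OF Bochner_Integration.integrable_add[OF iQ i1] i2],
        subst Bochner_Integration.integral_add[OF iQ i1]) simp
  finally have 1: "2 * Bform i F H \<le> (LINT w|lborel. ?Q w)" by simp
  have "(LINT w|lborel. ?Q w + 2 * (stereo w $ i * (J0 (F w) \<bullet> H w))) \<le> (LINT w|lborel. (norm (F w))\<^sup>2 + (norm (H w))\<^sup>2)"
  proof (rule integral_mono)
    show "integrable lborel (\<lambda>w. ?Q w + 2 * (stereo w $ i * (J0 (F w) \<bullet> H w)))"
      by (intro Bochner_Integration.integrable_add iQ integrable_mult_right iB)
    show "integrable lborel (\<lambda>w. (norm (F w))\<^sup>2 + (norm (H w))\<^sup>2)"
      by (intro Bochner_Integration.integrable_add sqint_integrable C1c_sqint(2)[OF f] C1c_sqint(2)[OF h])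
    fix w
    show "?Q w + 2 * (stereo w $ i * (J0 (F w) \<bullet> H w)) \<le> (norm (F w))\<^sup>2 + (norm (H w))\<^sup>2"
      using frame_energy_nonneg[OF lam_sgrad_norm[of w i], of "F w" "H w"]
      by (simp add: J0_scaleR sfield_def power_mult_distrib algebra_simps)
  qed
  also have "\<dots> = sqnorm F + sqnorm H"
    unfolding sqnorm_def
    by (intro Bochner_Integration.integral_add sqint_integrable C1c_sqint(2)[OF f] C1c_sqint(2)[OF h])
  also have "(LINT w|lborel. ?Q w + 2 * (stereo w $ i * (J0 (F w) \<bullet> H w))) = (LINT w|lborel. ?Q w) + 2 * Bform i F H"
    unfolding Bform_def by (subst Bochner_Integration.integral_add[OF iQ integrable_mult_right[OF iB]]) simp
  finally show ?thesis using 1 by simp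
qed

lemma sqint_stereo_J0:
  assumes "sqint F"
  shows "sqint (\<lambda>w. (stereo w $ i) *\<^sub>R J0 (F w))"
proof (rule sqint_mono[OF assms, where C = 1])
  have m: "F \<in> borel_measurable borel" using assms by (rule sqint_measurable)
  have "(\<lambda>w. stereo w $ i) \<in> borel_measurable borel"
    by (intro borel_measurable_continuous_onI continuous_intros)
  moreover have "(\<lambda>w. J0 (F w)) \<in> borel_measurable borel"
    by (rule measurable_compose[OF m J0_measurable])
  ultimately show "(\<lambda>w. (stereo w $ i) *\<^sub>R J0 (F w)) \<in> borel_measurable lborel"
    by (simp add: borel_measurable_scaleR)
  show "AE w in lborel. norm ((stereo w $ i) *\<^sub>R J0 (F w)) \<le> 1 * norm (F w)"
    using mult_right_mono[OF stereo_bound[of _ i] norm_ge_zero[of "F _"]] by simp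
qed

lemma Bform_eq_inner: "Bform i F H = (LINT w|lborel. ((stereo w $ i) *\<^sub>R J0 (F w)) \<bullet> H w)"
  by (simp add: Bform_def)

lemma Bform_lim:
  assumes F: "L2lim Fs F" and H: "L2lim Hs H"
  shows "(\<lambda>n. Bform i (Fs n) (Hs n)) \<longlonglongrightarrow> Bform i F H"
  unfolding Bform_eq_inner
proof (rule L2lim_inner[OF _ H])
  show "L2lim (\<lambda>n w. (stereo w $ i) *\<^sub>R J0 (Fs n w)) (\<lambda>w. (stereo w $ i) *\<^sub>R J0 (F w))"
  proof (rule L2lim_bounded_image[OF F, where C = 1])
    show "(\<lambda>w. (stereo w $ i) *\<^sub>R J0 (Fs n w)) \<in> borel_measurable lborel" for n
      using sqint_stereo_J0[OF L2limD(1)[OF F]] by (simp add: sqint_def)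
    show "sqint (\<lambda>w. (stereo w $ i) *\<^sub>R J0 (F w))"
      by (rule sqint_stereo_J0[OF L2limD(2)[OF F]])
    show "norm ((stereo w $ i) *\<^sub>R J0 (Fs n w) - (stereo w $ i) *\<^sub>R J0 (F w)) \<le> 1 * norm (Fs n w - F w)" for n w
      using mult_right_mono[OF stereo_bound[of w i] norm_ge_zero[of "Fs n w - F w"]]
      by (simp flip: scaleR_diff_right J0_diff)
  qed
qed

text \<open>The \<open>L2\<close> closure of the gradients of compactly supported functions of class \<open>C^1\<close>.\<close>

definition grad_closure :: "(real^2 \<Rightarrow> real^2) \<Rightarrow> bool" where
  "grad_closure F \<longleftrightarrow> (\<exists>\<phi> \<Phi>. (\<forall>n. C1c (\<phi> n) (\<Phi> n)) \<and> L2lim \<Phi> F)"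

lemma sobolev_grad_closure:
  assumes "sobolev_pair f F"
  shows "grad_closure F"
  using sobolev_C1c_sequence[OF assms] unfolding grad_closure_def by metis

lemma grad_closure_sqint: "grad_closure F \<Longrightarrow> sqint F"
  unfolding grad_closure_def by (blast dest: L2limD(2))

lemma grad_closure_add_C1c:
  assumes "grad_closure F" "C1c \<psi> \<Psi>"
  shows "grad_closure (\<lambda>x. F x + t *\<^sub>R \<Psi> x)"
proof -
  obtain \<phi> \<Phi> where *: "\<And>n. C1c (\<phi> n) (\<Phi> n)" "L2lim \<Phi> F"
    using assms(1) by (auto simp: grad_closure_def)
  have s: "C1c (\<lambda>x. t * \<psi> x) (\<lambda>x. t *\<^sub>R \<Psi> x)" by (rule C1c_scaleR[OF assms(2)])
  have "C1c (\<lambda>x. \<phi> n x + t * \<psi> x) (\<lambda>x. \<Phi> n x + t *\<^sub>R \<Psi> x)" for n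
    by (rule C1c_add[OF *(1) s])
  moreover have "L2lim (\<lambda>n x. \<Phi> n x + t *\<^sub>R \<Psi> x) (\<lambda>x. F x + t *\<^sub>R \<Psi> x)"
    by (rule L2lim_add[OF *(2) L2lim_const[OF C1c_sqint(2)[OF s]]])
  ultimately show ?thesis
    unfolding grad_closure_def
    by (intro exI[of _ "\<lambda>n x. \<phi> n x + t * \<psi> x"] exI[of _ "\<lambda>n x. \<Phi> n x + t *\<^sub>R \<Psi> x"] conjI allI)
qed

lemma energy_nonneg:
  assumes "grad_closure F" "grad_closure H"
  shows "4 * Bform i F H \<le> sqnorm F + sqnorm H"
proof -
  obtain \<phi> \<Phi> where F: "\<And>n. C1c (\<phi> n) (\<Phi> n)" "L2lim \<Phi> F"
    using assms(1) by (auto simp: grad_closure_def)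
  obtain \<psi> \<Psi> where H: "\<And>n. C1c (\<psi> n) (\<Psi> n)" "L2lim \<Psi> H"
    using assms(2) by (auto simp: grad_closure_def)
  show ?thesis
  proof (rule LIMSEQ_le)
    show "(\<lambda>n. 4 * Bform i (\<Phi> n) (\<Psi> n)) \<longlonglongrightarrow> 4 * Bform i F H"
      by (intro tendsto_mult_left Bform_lim F H)
    show "(\<lambda>n. sqnorm (\<Phi> n) + sqnorm (\<Psi> n)) \<longlonglongrightarrow> sqnorm F + sqnorm H"
      by (intro tendsto_add L2lim_sqnorm F H)
    show "\<exists>N. \<forall>n\<ge>N. 4 * Bform i (\<Phi> n) (\<Psi> n) \<le> sqnorm (\<Phi> n) + sqnorm (\<Psi> n)"
      using energy_nonneg_C1c[OF F(1) H(1)] by blast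
  qed
qed

subsection \<open>Green identities on the sphere\<close>

lemma sqint_lam: "sqint lam"
  using integrable_lam_squared lam_measurable lam_pos by (simp add: sqint_def)

lemma sqint_lam_bound:
  assumes "F \<in> borel_measurable borel" "\<And>w. norm (F w) \<le> K * lam w"
  shows "sqint F"
  by (rule sqint_mono[OF sqint_lam, where C = K]) (use assms lam_pos in \<open>auto simp: abs_of_pos\<close>)

lemma cutoff_grad_measurable: "R > 0 \<Longrightarrow> cutoff_grad R \<in> borel_measurable borel"
  by (rule borel_measurable_continuous_onI[OF continuous_cutoff_grad])

lemma cutoff_measurable: "cutoff R \<in> borel_measurable borel"
  by (rule borel_measurable_continuous_onI[OF GDERIV_imp_continuous_on[OF GDERIV_cutoff]])

text \<open>Dirichlet energy is scale invariant in dimension two: the area 4 pi R^2 of the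
  supporting disc times (24 / R)^2 is 2304 pi for every \<open>R\<close>.\<close>

lemma sqnorm_cutoff_grad:
  assumes R: "R > 0"
  shows "sqint (cutoff_grad R :: real^2 \<Rightarrow> real^2)" "sqnorm (cutoff_grad R :: real^2 \<Rightarrow> real^2) \<le> 2304 * pi"
proof -
  let ?c = "cutoff_grad R :: real^2 \<Rightarrow> real^2"
  show s: "sqint ?c"
    by (rule sqint_bounded_support[where B = "24 / R" and R = "2 * R"])
       (use R in \<open>auto intro: cutoff_grad_measurable norm_cutoff_grad_le cutoff_grad_eq_0'\<close>)
  have "sqnorm ?c \<le> (LINT x|lborel. indicator (cball (0 :: real^2) (2 * R)) x * (24 / R)\<^sup>2)"
    unfolding sqnorm_def
  proof (rule integral_mono)
    show "integrable lborel (\<lambda>x. (norm (?c x))\<^sup>2)" using s by (rule sqint_integrable)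
    show "integrable lborel (\<lambda>x. indicator (cball (0 :: real^2) (2 * R)) x * (24 / R)\<^sup>2)"
      by (intro integrable_mult_left integrable_indicator_cball)
    fix x
    show "(norm (?c x))\<^sup>2 \<le> indicator (cball (0 :: real^2) (2 * R)) x * (24 / R)\<^sup>2"
      using power_mono[OF norm_cutoff_grad_le[OF R, of x], of 2] cutoff_grad_eq_0'[OF _ R, of x]
      by (auto simp: indicator_def)
  qed
  also have "\<dots> = measure lborel (cball (0 :: real^2) (2 * R)) * (24 / R)\<^sup>2"
    by simp
  also have "measure lborel (cball (0 :: real^2) (2 * R)) = pi * (2 * R)\<^sup>2"
    using R content_cball[of "2 * R" "0 :: real^2"] by (simp add: unit_ball_vol_2)
  also have "pi * (2 * R)\<^sup>2 * (24 / R)\<^sup>2 = 2304 * pi"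
    using R by (simp add: power2_eq_square)
  finally show "sqnorm ?c \<le> 2304 * pi" .
qed

text \<open>The gradients of the cutoffs are bounded in \<open>L2\<close> and escape to infinity, so they converge weakly to zero.\<close>

lemma cutoff_limit:
  fixes G \<Phi> :: "real^2 \<Rightarrow> real^2" and \<phi> :: "real^2 \<Rightarrow> real"
  assumes G: "sqint G" and \<Phi>: "sqint \<Phi>" and m: "\<phi> \<in> borel_measurable borel" and K: "\<And>w. \<bar>\<phi> w\<bar> \<le> K"
  shows "(\<lambda>n. LINT w|lborel. G w \<bullet> (cutoff (real n + 1) w *\<^sub>R \<Phi> w + \<phi> w *\<^sub>R cutoff_grad (real n + 1) w)) \<longlonglongrightarrow>
    (LINT w|lborel. G w \<bullet> \<Phi> w)"
proof -
  have mG: "G \<in> borel_measurable borel" "\<Phi> \<in> borel_measurable borel"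
    using G \<Phi> sqint_measurable by blast+
  have ev: "\<forall>\<^sub>F n in sequentially. norm x \<le> real n + 1" for x :: "real^2"
  proof -
    obtain N where "norm x \<le> real N" using real_arch_simple by blast
    then show ?thesis by (intro eventually_sequentiallyI[of N]) auto
  qed
  have l1: "L2lim (\<lambda>n w. cutoff (real n + 1) w *\<^sub>R \<Phi> w) \<Phi>"
  proof (rule L2lim_dominated[OF _ \<Phi>])
    have "(\<lambda>n. cutoff (real n + 1) x *\<^sub>R \<Phi> x) \<longlonglongrightarrow> \<Phi> x" for x
      by (rule tendsto_eventually, rule eventually_mono[OF ev[of x]]) (simp add: cutoff_eq_1)
    then show "AE x in lborel. (\<lambda>n. cutoff (real n + 1) x *\<^sub>R \<Phi> x) \<longlonglongrightarrow> \<Phi> x" by simp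
    have "norm (cutoff (real n + 1) x *\<^sub>R \<Phi> x) \<le> norm (\<Phi> x)" for n x
      using cutoff_range[of "real n + 1" x] mult_left_le_one_le[OF norm_ge_zero[of "\<Phi> x"], of "cutoff (real n + 1) x"] by simp
    then show "AE x in lborel. norm (cutoff (real n + 1) x *\<^sub>R \<Phi> x) \<le> norm (\<Phi> x)" for n by simp
    show "(\<lambda>w. cutoff (real n + 1) w *\<^sub>R \<Phi> w) \<in> borel_measurable lborel" for n
      unfolding measurable_lborel2 by (rule borel_measurable_scaleR[OF cutoff_measurable mG(2)])
  qed (use mG in simp)
  \<comment> \<open>The cutoff gradient vanishes on the removed ball, so the pairing is unchanged,
    while the tail \<open>E n\<close> tends to 0 in mean square. Cauchy-Schwarz with the uniform
    gradient bound finishes.\<close>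
  define E where "E n x = indicator (- cball 0 (real n + 1)) x *\<^sub>R (\<phi> x *\<^sub>R G x)" for n x
  have pm: "(\<lambda>x. \<phi> x *\<^sub>R G x) \<in> borel_measurable borel"
    by (rule borel_measurable_scaleR[OF m mG(1)])
  have Em: "E n \<in> borel_measurable borel" for n
    unfolding E_def[abs_def] by (intro borel_measurable_scaleR pm borel_measurable_indicator) simp
  have pG: "sqint (\<lambda>x. \<phi> x *\<^sub>R G x)"
  proof (rule sqint_mono[OF G])
    have "norm (\<phi> x *\<^sub>R G x) \<le> K * norm (G x)" for x
      unfolding norm_scaleR real_norm_def by (rule mult_right_mono[OF K norm_ge_zero])
    then show "AE x in lborel. norm (\<phi> x *\<^sub>R G x) \<le> K * norm (G x)" by simp
  qed (use pm in simp)
  have l2: "L2lim E (\<lambda>_. 0)"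
  proof (rule L2lim_dominated[OF _ pG])
    have "(\<lambda>n. E n x) \<longlonglongrightarrow> 0" for x
      by (rule tendsto_eventually, rule eventually_mono[OF ev[of x]]) (simp add: E_def indicator_def)
    then show "AE x in lborel. (\<lambda>n. E n x) \<longlonglongrightarrow> 0" by simp
    show "AE x in lborel. norm (E n x) \<le> norm (\<phi> x *\<^sub>R G x)" for n
      by (simp add: E_def indicator_def)
  qed (use Em in simp_all)
  have eq: "G x \<bullet> (\<phi> x *\<^sub>R cutoff_grad (real n + 1) x) = E n x \<bullet> cutoff_grad (real n + 1) x" for n x
    by (cases "norm x \<le> real n + 1") (simp_all add: E_def cutoff_grad_eq_0)
  have lim0: "(\<lambda>n. LINT x|lborel. E n x \<bullet> cutoff_grad (real n + 1) x) \<longlonglongrightarrow> 0"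
  proof (rule Lim_null_comparison)
    show "\<forall>\<^sub>F n in sequentially. norm (LINT x|lborel. E n x \<bullet> cutoff_grad (real n + 1) x) \<le> sqrt (sqnorm (E n)) * sqrt (2304 * pi)"
    proof (intro always_eventually allI)
      fix n
      have "\<bar>LINT x|lborel. E n x \<bullet> cutoff_grad (real n + 1) x\<bar> \<le> sqrt (sqnorm (E n)) * sqrt (sqnorm (cutoff_grad (real n + 1) :: real^2 \<Rightarrow> real^2))"
        by (rule Cauchy_Schwarz_sqint[OF L2limD(1)[OF l2] sqnorm_cutoff_grad(1)]) simp
      also have "\<dots> \<le> sqrt (sqnorm (E n)) * sqrt (2304 * pi)"
        using sqnorm_cutoff_grad(2)[of "real n + 1"] sqnorm_nonneg[of "E n"]
        by (intro mult_left_mono) auto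
      finally show "norm (LINT x|lborel. E n x \<bullet> cutoff_grad (real n + 1) x) \<le> sqrt (sqnorm (E n)) * sqrt (2304 * pi)" by simp
    qed
    have "(\<lambda>n. sqnorm (E n)) \<longlonglongrightarrow> 0"
      using L2limD(3)[OF l2] by simp
    from tendsto_mult_right[OF tendsto_real_sqrt[OF this], of "sqrt (2304 * pi)"]
    show "(\<lambda>n. sqrt (sqnorm (E n)) * sqrt (2304 * pi)) \<longlonglongrightarrow> 0" by simp
  qed
  have split: "(LINT w|lborel. G w \<bullet> (cutoff (real n + 1) w *\<^sub>R \<Phi> w + \<phi> w *\<^sub>R cutoff_grad (real n + 1) w)) =
      (LINT w|lborel. G w \<bullet> (cutoff (real n + 1) w *\<^sub>R \<Phi> w)) + (LINT w|lborel. E n w \<bullet> cutoff_grad (real n + 1) w)" for n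
    unfolding inner_add_right eq
    by (rule Bochner_Integration.integral_add[OF integrable_inner_sqint[OF G L2limD(1)[OF l1]]
          integrable_inner_sqint[OF L2limD(1)[OF l2] sqnorm_cutoff_grad(1)]]) simp
  have "(\<lambda>n. (LINT w|lborel. G w \<bullet> (cutoff (real n + 1) w *\<^sub>R \<Phi> w)) + (LINT w|lborel. E n w \<bullet> cutoff_grad (real n + 1) w)) \<longlonglongrightarrow>
      (LINT w|lborel. G w \<bullet> \<Phi> w) + 0"
    by (intro tendsto_add lim0 L2lim_inner[OF L2lim_const[OF G] l1])
  then show ?thesis unfolding split by simp
qed

text \<open>\<open>sphere_fn \<phi> \<Phi> L\<close>: in stereographic coordinates \<open>\<phi>\<close> has gradient \<open>\<Phi>\<close> and Laplacian \<open>L\<close>, with the decay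
  that a smooth function on the whole sphere has.\<close>

definition sphere_fn :: "(real^2 \<Rightarrow> real) \<Rightarrow> (real^2 \<Rightarrow> real^2) \<Rightarrow> (real^2 \<Rightarrow> real) \<Rightarrow> bool" where
  "sphere_fn \<phi> \<Phi> L \<longleftrightarrow> (\<forall>w. GDERIV \<phi> w :> \<Phi> w) \<and>
     (\<exists>D1 D2. continuous_on UNIV D1 \<and> continuous_on UNIV D2 \<and>
        (\<forall>w. GDERIV (\<lambda>w. \<Phi> w $ 1) w :> D1 w) \<and> (\<forall>w. GDERIV (\<lambda>w. \<Phi> w $ 2) w :> D2 w) \<and>
        (\<forall>w. L w = D1 w $ 1 + D2 w $ 2)) \<and>
     (\<exists>K. \<forall>w. \<bar>\<phi> w\<bar> \<le> K \<and> norm (\<Phi> w) \<le> K * lam w \<and> \<bar>L w\<bar> \<le> K * (lam w)\<^sup>2)"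

lemma continuous_on_vec2_iff:
  "continuous_on S (F :: 'a::topological_space \<Rightarrow> real^2) \<longleftrightarrow> continuous_on S (\<lambda>x. F x $ 1) \<and> continuous_on S (\<lambda>x. F x $ 2)"
proof
  assume "continuous_on S (\<lambda>x. F x $ 1) \<and> continuous_on S (\<lambda>x. F x $ 2)"
  then have "continuous_on S (\<lambda>x. vector [F x $ 1, F x $ 2] :: real^2)" by (intro continuous_vec2) auto
  moreover have "(vector [F x $ 1, F x $ 2] :: real^2) = F x" for x by (simp add: vec_eq_iff forall_2)
  ultimately show "continuous_on S F" by simp
qed (auto intro: continuous_intros)

lemma sphere_fnD:
  assumes "sphere_fn \<phi> \<Phi> L"
  shows "GDERIV \<phi> w :> \<Phi> w" "continuous_on UNIV \<phi>" "continuous_on UNIV \<Phi>" "continuous_on UNIV L"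
    and "sqint \<Phi>" "sqint L"
proof -
  obtain D1 D2 K where *: "\<And>w. GDERIV \<phi> w :> \<Phi> w" "continuous_on UNIV D1" "continuous_on UNIV D2"
    "\<And>w. GDERIV (\<lambda>w. \<Phi> w $ 1) w :> D1 w" "\<And>w. GDERIV (\<lambda>w. \<Phi> w $ 2) w :> D2 w"
    "\<And>w. L w = D1 w $ 1 + D2 w $ 2" "\<And>w. norm (\<Phi> w) \<le> K * lam w" "\<And>w. \<bar>L w\<bar> \<le> K * (lam w)\<^sup>2"
    using assms unfolding sphere_fn_def by blast
  show "GDERIV \<phi> w :> \<Phi> w" "continuous_on UNIV \<phi>"
    using * GDERIV_imp_continuous_on by blast+
  show c\<Phi>: "continuous_on UNIV \<Phi>"
    unfolding continuous_on_vec2_iff using GDERIV_imp_continuous_on[OF *(4)] GDERIV_imp_continuous_on[OF *(5)] by simp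
  have "L = (\<lambda>w. D1 w $ 1 + D2 w $ 2)" using *(6) by (simp add: fun_eq_iff)
  then show cL: "continuous_on UNIV L" using *(2,3) by (auto intro!: continuous_intros)
  show "sqint \<Phi>" by (rule sqint_lam_bound[OF borel_measurable_continuous_onI[OF c\<Phi>] *(7)])
  have K: "0 \<le> K" using order_trans[OF norm_ge_zero *(7)[of 0]] lam_pos[of 0] by (simp add: zero_le_mult_iff)
  have "norm (L w) \<le> (2 * K) * lam w" for w
  proof -
    have "\<bar>L w\<bar> \<le> K * (lam w * lam w)" using *(8)[of w] by (simp add: power2_eq_square)
    also have "\<dots> \<le> K * (2 * lam w)"
      using K lam_pos[of w] lam_le_2[of w] by (intro mult_left_mono mult_right_mono) auto
    finally show ?thesis by simp
  qed
  then show "sqint L" by (rule sqint_lam_bound[OF borel_measurable_continuous_onI[OF cL]])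
qed

lemma sphere_fn_bounded:
  assumes "sphere_fn \<phi> \<Phi> L"
  shows "\<exists>K. \<forall>w. \<bar>\<phi> w\<bar> \<le> K \<and> norm (\<Phi> w) \<le> K * lam w \<and> \<bar>L w\<bar> \<le> K * (lam w)\<^sup>2"
  using assms unfolding sphere_fn_def by blast

lemma Green_C1c:
  assumes \<phi>: "sphere_fn \<phi> \<Phi> L" and g: "C1c g G"
  shows "(LINT w|lborel. g w * L w) = - (LINT w|lborel. G w \<bullet> \<Phi> w)"
proof -
  obtain D1 D2 where D: "continuous_on UNIV D1" "continuous_on UNIV D2"
    "\<And>w. GDERIV (\<lambda>w. \<Phi> w $ 1) w :> D1 w" "\<And>w. GDERIV (\<lambda>w. \<Phi> w $ 2) w :> D2 w"
    "\<And>w. L w = D1 w $ 1 + D2 w $ 2"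
    using \<phi> unfolding sphere_fn_def by blast
  obtain R where R: "\<And>x. norm x > R \<Longrightarrow> g x = 0 \<and> G x = 0"
    using g by (auto simp: C1c_def)
  note c\<Phi> = sphere_fnD(3)[OF \<phi>]
  have z: "(LINT w|lborel. axis k 1 \<bullet> (\<Phi> w $ k *\<^sub>R G w + g w *\<^sub>R D w)) = 0"
    if "\<And>w. GDERIV (\<lambda>w. \<Phi> w $ k) w :> D w" "continuous_on UNIV D" for k D
    by (rule integral_directional_derivative[OF C1c_mult_left[OF that g]])
  have i: "integrable lborel (\<lambda>w. axis k 1 \<bullet> (\<Phi> w $ k *\<^sub>R G w + g w *\<^sub>R D w))"
    if "continuous_on UNIV D" for k D
    by (rule integrable_Cc[where R = R], intro continuous_intros that c\<Phi> C1cD(2,3)[OF g]) (use R in auto)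
  have iL: "integrable lborel (\<lambda>w. g w * L w)" and iG: "integrable lborel (\<lambda>w. G w \<bullet> \<Phi> w)"
    by (rule integrable_Cc[where R = R], intro continuous_intros sphere_fnD[OF \<phi>] C1cD(2,3)[OF g], use R in simp)+
  have "g w * L w + G w \<bullet> \<Phi> w = axis 1 1 \<bullet> (\<Phi> w $ 1 *\<^sub>R G w + g w *\<^sub>R D1 w) + axis 2 1 \<bullet> (\<Phi> w $ 2 *\<^sub>R G w + g w *\<^sub>R D2 w)" for w
    by (simp add: D(5) inner_vec2 axis_nth2 algebra_simps)
  then have "(LINT w|lborel. g w * L w + G w \<bullet> \<Phi> w) =
      (LINT w|lborel. axis 1 1 \<bullet> (\<Phi> w $ 1 *\<^sub>R G w + g w *\<^sub>R D1 w) + axis 2 1 \<bullet> (\<Phi> w $ 2 *\<^sub>R G w + g w *\<^sub>R D2 w))"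
    by (rule arg_cong[OF ext])
  also have "\<dots> = 0"
    unfolding Bochner_Integration.integral_add[OF i[OF D(1)] i[OF D(2)]] z[OF D(3) D(1)] z[OF D(4) D(2)] by simp
  finally show ?thesis
    unfolding Bochner_Integration.integral_add[OF iL iG] by simp
qed

lemma Green_sobolev:
  assumes \<phi>: "sphere_fn \<phi> \<Phi> L" and f: "sobolev_pair f F"
  shows "(LINT w|lborel. f w * L w) = - (LINT w|lborel. F w \<bullet> \<Phi> w)"
proof -
  obtain g G where g: "\<And>n. C1c (g n) (G n)" "L2lim g f" "L2lim G F"
    using sobolev_C1c_sequence[OF f] by blast
  have "(\<lambda>n. LINT w|lborel. g n w \<bullet> L w) \<longlonglongrightarrow> (LINT w|lborel. f w \<bullet> L w)"
    by (rule L2lim_inner[OF g(2) L2lim_const[OF sphere_fnD(6)[OF \<phi>]]])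
  moreover have "(\<lambda>n. - (LINT w|lborel. G n w \<bullet> \<Phi> w)) \<longlonglongrightarrow> - (LINT w|lborel. F w \<bullet> \<Phi> w)"
    by (intro tendsto_minus L2lim_inner[OF g(3) L2lim_const[OF sphere_fnD(5)[OF \<phi>]]])
  moreover have "(LINT w|lborel. g n w \<bullet> L w) = - (LINT w|lborel. G n w \<bullet> \<Phi> w)" for n
    using Green_C1c[OF \<phi> g(1)] by simp
  ultimately have "(LINT w|lborel. f w \<bullet> L w) = - (LINT w|lborel. F w \<bullet> \<Phi> w)"
    by (simp only:) (rule LIMSEQ_unique)
  then show ?thesis by simp
qed

lemma C1c_cutoff:
  assumes \<phi>: "\<And>w. GDERIV \<phi> w :> \<Phi> w" "continuous_on UNIV \<Phi>" and R: "R > 0"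
  shows "C1c (\<lambda>w. cutoff R w * \<phi> w) (\<lambda>w. cutoff R w *\<^sub>R \<Phi> w + \<phi> w *\<^sub>R cutoff_grad R w)"
  unfolding C1c_def
proof (intro conjI allI exI impI)
  show "GDERIV (\<lambda>w. cutoff R w * \<phi> w) w :> cutoff R w *\<^sub>R \<Phi> w + \<phi> w *\<^sub>R cutoff_grad R w" for w
    by (rule GDERIV_mult[OF GDERIV_cutoff \<phi>(1)])
  show "continuous_on UNIV (\<lambda>w. cutoff R w *\<^sub>R \<Phi> w + \<phi> w *\<^sub>R cutoff_grad R w)"
    by (intro continuous_intros \<phi>(2) continuous_cutoff_grad R GDERIV_imp_continuous_on[OF \<phi>(1)]
         GDERIV_imp_continuous_on[OF GDERIV_cutoff])
  show "cutoff R w * \<phi> w = 0" "cutoff R w *\<^sub>R \<Phi> w + \<phi> w *\<^sub>R cutoff_grad R w = 0" if "2 * R < norm w" for w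
    using that R by (simp_all add: cutoff_eq_0 cutoff_grad_eq_0')
qed

text \<open>The projection point is a removable singularity: orthogonality to the gradients of
  cut-off functions passes to the limit by \<open>cutoff_limit\<close>.\<close>

lemma integral_zero_extend:
  assumes \<phi>: "sphere_fn \<phi> \<Phi> L" and G: "sqint G"
    and zero: "\<And>\<psi> \<Psi>. C1c \<psi> \<Psi> \<Longrightarrow> (LINT w|lborel. G w \<bullet> \<Psi> w) = 0"
  shows "(LINT w|lborel. G w \<bullet> \<Phi> w) = 0"
proof -
  obtain K where K: "\<And>w. \<bar>\<phi> w\<bar> \<le> K"
    using sphere_fn_bounded[OF \<phi>] by blast
  have "(LINT w|lborel. G w \<bullet> (cutoff (real n + 1) w *\<^sub>R \<Phi> w + \<phi> w *\<^sub>R cutoff_grad (real n + 1) w)) = 0" for n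
    by (rule zero[OF C1c_cutoff[OF sphere_fnD(1,3)[OF \<phi>]]]) simp
  then show ?thesis
    using cutoff_limit[OF G sphere_fnD(5)[OF \<phi>] borel_measurable_continuous_onI[OF sphere_fnD(2)[OF \<phi>]] K]
    by (simp add: LIMSEQ_const_iff)
qed

lemma lam_le_2_mult: "lam w * lam w \<le> 2 * lam w"
  using lam_pos[of w] lam_le_2[of w] by (intro mult_right_mono) auto

lemma sphere_fnI:
  assumes "\<And>w. GDERIV \<phi> w :> \<Phi> w" "continuous_on UNIV Da" "continuous_on UNIV Db"
    "\<And>w. GDERIV (\<lambda>w. \<Phi> w $ 1) w :> Da w" "\<And>w. GDERIV (\<lambda>w. \<Phi> w $ 2) w :> Db w"
    "\<And>w. L w = Da w $ 1 + Db w $ 2"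
    "\<And>w. \<bar>\<phi> w\<bar> \<le> K" "\<And>w. norm (\<Phi> w) \<le> K * lam w" "\<And>w. \<bar>L w\<bar> \<le> K * (lam w)\<^sup>2"
  shows "sphere_fn \<phi> \<Phi> L"
  unfolding sphere_fn_def using assms by blast

lemma sphere_fnE:
  assumes "sphere_fn \<phi> \<Phi> L"
  obtains D1 D2 K where "\<And>w. GDERIV \<phi> w :> \<Phi> w" "continuous_on UNIV D1" "continuous_on UNIV D2"
    "\<And>w. GDERIV (\<lambda>w. \<Phi> w $ 1) w :> D1 w" "\<And>w. GDERIV (\<lambda>w. \<Phi> w $ 2) w :> D2 w"
    "\<And>w. L w = D1 w $ 1 + D2 w $ 2" "0 \<le> K"
    "\<And>w. \<bar>\<phi> w\<bar> \<le> K" "\<And>w. norm (\<Phi> w) \<le> K * lam w" "\<And>w. \<bar>L w\<bar> \<le> K * (lam w)\<^sup>2"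
proof -
  obtain D1 D2 K where *: "\<And>w. GDERIV \<phi> w :> \<Phi> w" "continuous_on UNIV D1" "continuous_on UNIV D2"
    "\<And>w. GDERIV (\<lambda>w. \<Phi> w $ 1) w :> D1 w" "\<And>w. GDERIV (\<lambda>w. \<Phi> w $ 2) w :> D2 w"
    "\<And>w. L w = D1 w $ 1 + D2 w $ 2"
    "\<And>w. \<bar>\<phi> w\<bar> \<le> K" "\<And>w. norm (\<Phi> w) \<le> K * lam w" "\<And>w. \<bar>L w\<bar> \<le> K * (lam w)\<^sup>2"
    using assms unfolding sphere_fn_def by blast
  have "0 \<le> K" using *(7)[of 0] by linarith
  show ?thesis by (rule that[OF *(1-6) \<open>0 \<le> K\<close> *(7-9)])
qed

lemma sphere_fn_const: "sphere_fn (\<lambda>_. c) (\<lambda>_. 0) (\<lambda>_. 0)"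
  by (rule sphere_fnI[where Da = "\<lambda>_. 0" and Db = "\<lambda>_. 0" and K = "\<bar>c\<bar>"])
     (auto intro: GDERIV_const simp: lam_pos less_imp_le)

lemma sphere_fn_mult:
  assumes "sphere_fn \<phi> \<Phi> L" "sphere_fn \<psi> \<Psi> M"
  shows "sphere_fn (\<lambda>w. \<phi> w * \<psi> w) (\<lambda>w. \<phi> w *\<^sub>R \<Psi> w + \<psi> w *\<^sub>R \<Phi> w)
    (\<lambda>w. \<phi> w * M w + \<psi> w * L w + 2 * (\<Phi> w \<bullet> \<Psi> w))"
proof -
  obtain D1 D2 K where D: "\<And>w. GDERIV \<phi> w :> \<Phi> w" "continuous_on UNIV D1" "continuous_on UNIV D2"
    "\<And>w. GDERIV (\<lambda>w. \<Phi> w $ 1) w :> D1 w" "\<And>w. GDERIV (\<lambda>w. \<Phi> w $ 2) w :> D2 w"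
    "\<And>w. L w = D1 w $ 1 + D2 w $ 2" "0 \<le> K"
    "\<And>w. \<bar>\<phi> w\<bar> \<le> K" "\<And>w. norm (\<Phi> w) \<le> K * lam w" "\<And>w. \<bar>L w\<bar> \<le> K * (lam w)\<^sup>2"
    using sphere_fnE[OF assms(1)] by blast
  obtain E1 E2 J where E: "\<And>w. GDERIV \<psi> w :> \<Psi> w" "continuous_on UNIV E1" "continuous_on UNIV E2"
    "\<And>w. GDERIV (\<lambda>w. \<Psi> w $ 1) w :> E1 w" "\<And>w. GDERIV (\<lambda>w. \<Psi> w $ 2) w :> E2 w"
    "\<And>w. M w = E1 w $ 1 + E2 w $ 2" "0 \<le> J"
    "\<And>w. \<bar>\<psi> w\<bar> \<le> J" "\<And>w. norm (\<Psi> w) \<le> J * lam w" "\<And>w. \<bar>M w\<bar> \<le> J * (lam w)\<^sup>2"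
    using sphere_fnE[OF assms(2)] by blast
  note c = sphere_fnD(2,3)[OF assms(1)] sphere_fnD(2,3)[OF assms(2)]
  show ?thesis
  \<comment> \<open>The factor 4 comes from the Laplacian of a product: two terms with one
    undifferentiated factor, and twice the product of the gradients.\<close>
  proof (rule sphere_fnI[where K = "4 * (K * J)"
        and Da = "\<lambda>w. (\<phi> w *\<^sub>R E1 w + \<Psi> w $ 1 *\<^sub>R \<Phi> w) + (\<psi> w *\<^sub>R D1 w + \<Phi> w $ 1 *\<^sub>R \<Psi> w)"
        and Db = "\<lambda>w. (\<phi> w *\<^sub>R E2 w + \<Psi> w $ 2 *\<^sub>R \<Phi> w) + (\<psi> w *\<^sub>R D2 w + \<Phi> w $ 2 *\<^sub>R \<Psi> w)"])
    fix w
    show "GDERIV (\<lambda>w. \<phi> w * \<psi> w) w :> \<phi> w *\<^sub>R \<Psi> w + \<psi> w *\<^sub>R \<Phi> w"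
      by (rule GDERIV_mult[OF D(1) E(1)])
    show "GDERIV (\<lambda>w. (\<phi> w *\<^sub>R \<Psi> w + \<psi> w *\<^sub>R \<Phi> w) $ 1) w :>
        (\<phi> w *\<^sub>R E1 w + \<Psi> w $ 1 *\<^sub>R \<Phi> w) + (\<psi> w *\<^sub>R D1 w + \<Phi> w $ 1 *\<^sub>R \<Psi> w)"
      using GDERIV_add[OF GDERIV_mult[OF D(1) E(4)] GDERIV_mult[OF E(1) D(4)]] by simp
    show "GDERIV (\<lambda>w. (\<phi> w *\<^sub>R \<Psi> w + \<psi> w *\<^sub>R \<Phi> w) $ 2) w :>
        (\<phi> w *\<^sub>R E2 w + \<Psi> w $ 2 *\<^sub>R \<Phi> w) + (\<psi> w *\<^sub>R D2 w + \<Phi> w $ 2 *\<^sub>R \<Psi> w)"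
      using GDERIV_add[OF GDERIV_mult[OF D(1) E(5)] GDERIV_mult[OF E(1) D(5)]] by simp
    show "\<phi> w * M w + \<psi> w * L w + 2 * (\<Phi> w \<bullet> \<Psi> w) =
        ((\<phi> w *\<^sub>R E1 w + \<Psi> w $ 1 *\<^sub>R \<Phi> w) + (\<psi> w *\<^sub>R D1 w + \<Phi> w $ 1 *\<^sub>R \<Psi> w)) $ 1 +
        ((\<phi> w *\<^sub>R E2 w + \<Psi> w $ 2 *\<^sub>R \<Phi> w) + (\<psi> w *\<^sub>R D2 w + \<Phi> w $ 2 *\<^sub>R \<Psi> w)) $ 2"
      by (simp add: D(6) E(6) inner_vec2 algebra_simps)
    have p: "\<bar>\<phi> w\<bar> * \<bar>\<psi> w\<bar> \<le> K * J" by (intro mult_mono D E) auto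
    have KJ: "0 \<le> K * J" using D(7) E(7) by simp
    show "\<bar>\<phi> w * \<psi> w\<bar> \<le> 4 * (K * J)" unfolding abs_mult using p KJ by linarith
    have p1: "\<bar>\<phi> w\<bar> * norm (\<Psi> w) \<le> K * (J * lam w)" by (intro mult_mono D E) auto
    have p2: "\<bar>\<psi> w\<bar> * norm (\<Phi> w) \<le> J * (K * lam w)" by (intro mult_mono D E) auto
    have l: "0 \<le> K * J * lam w" using KJ lam_pos[of w] by simp
    show "norm (\<phi> w *\<^sub>R \<Psi> w + \<psi> w *\<^sub>R \<Phi> w) \<le> 4 * (K * J) * lam w"
      using norm_triangle_ineq[of "\<phi> w *\<^sub>R \<Psi> w" "\<psi> w *\<^sub>R \<Phi> w"] p1 p2 l by (simp add: mult_ac)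
    have q1: "\<bar>\<phi> w * M w\<bar> \<le> K * (J * (lam w)\<^sup>2)" unfolding abs_mult by (intro mult_mono D E) auto
    have q2: "\<bar>\<psi> w * L w\<bar> \<le> J * (K * (lam w)\<^sup>2)" unfolding abs_mult by (intro mult_mono D E) auto
    have "norm (\<Phi> w) * norm (\<Psi> w) \<le> (K * lam w) * (J * lam w)"
      using D(7) lam_pos[of w] by (intro mult_mono D E) auto
    then have q3: "\<bar>\<Phi> w \<bullet> \<Psi> w\<bar> \<le> K * J * (lam w)\<^sup>2"
      using Cauchy_Schwarz_ineq2[of "\<Phi> w" "\<Psi> w"] by (simp add: power2_eq_square mult_ac)
    have "\<bar>\<phi> w * M w + \<psi> w * L w + 2 * (\<Phi> w \<bullet> \<Psi> w)\<bar> \<le> \<bar>\<phi> w * M w\<bar> + \<bar>\<psi> w * L w\<bar> + 2 * \<bar>\<Phi> w \<bullet> \<Psi> w\<bar>"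
      by linarith
    also have "\<dots> \<le> 4 * (K * J) * (lam w)\<^sup>2"
      using q1 q2 q3 by (simp add: mult_ac)
    finally show "\<bar>\<phi> w * M w + \<psi> w * L w + 2 * (\<Phi> w \<bullet> \<Psi> w)\<bar> \<le> 4 * (K * J) * (lam w)\<^sup>2" .
  qed (intro continuous_intros c D E)+
qed

lemma sphere_fn_add:
  assumes "sphere_fn \<phi> \<Phi> L" "sphere_fn \<psi> \<Psi> M"
  shows "sphere_fn (\<lambda>w. \<phi> w + \<psi> w) (\<lambda>w. \<Phi> w + \<Psi> w) (\<lambda>w. L w + M w)"
proof -
  obtain D1 D2 K where D: "\<And>w. GDERIV \<phi> w :> \<Phi> w" "continuous_on UNIV D1" "continuous_on UNIV D2"
    "\<And>w. GDERIV (\<lambda>w. \<Phi> w $ 1) w :> D1 w" "\<And>w. GDERIV (\<lambda>w. \<Phi> w $ 2) w :> D2 w"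
    "\<And>w. L w = D1 w $ 1 + D2 w $ 2" "0 \<le> K"
    "\<And>w. \<bar>\<phi> w\<bar> \<le> K" "\<And>w. norm (\<Phi> w) \<le> K * lam w" "\<And>w. \<bar>L w\<bar> \<le> K * (lam w)\<^sup>2"
    using sphere_fnE[OF assms(1)] by blast
  obtain E1 E2 J where E: "\<And>w. GDERIV \<psi> w :> \<Psi> w" "continuous_on UNIV E1" "continuous_on UNIV E2"
    "\<And>w. GDERIV (\<lambda>w. \<Psi> w $ 1) w :> E1 w" "\<And>w. GDERIV (\<lambda>w. \<Psi> w $ 2) w :> E2 w"
    "\<And>w. M w = E1 w $ 1 + E2 w $ 2" "0 \<le> J"
    "\<And>w. \<bar>\<psi> w\<bar> \<le> J" "\<And>w. norm (\<Psi> w) \<le> J * lam w" "\<And>w. \<bar>M w\<bar> \<le> J * (lam w)\<^sup>2"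
    using sphere_fnE[OF assms(2)] by blast
  show ?thesis
  proof (rule sphere_fnI[where K = "K + J" and Da = "\<lambda>w. D1 w + E1 w" and Db = "\<lambda>w. D2 w + E2 w"])
    fix w
    show "\<bar>\<phi> w + \<psi> w\<bar> \<le> K + J" using D(8)[of w] E(8)[of w] by linarith
    show "norm (\<Phi> w + \<Psi> w) \<le> (K + J) * lam w"
      using norm_triangle_ineq[of "\<Phi> w" "\<Psi> w"] D(9)[of w] E(9)[of w] by (simp add: distrib_right)
    show "\<bar>L w + M w\<bar> \<le> (K + J) * (lam w)\<^sup>2"
      using D(10)[of w] E(10)[of w] by (simp add: distrib_right)
  qed (use GDERIV_add[OF D(1) E(1)] GDERIV_add[OF D(4) E(4)] GDERIV_add[OF D(5) E(5)] in
       \<open>auto intro!: continuous_intros D E simp: D(6) E(6)\<close>)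
qed

lemma sphere_fn_cmult: "sphere_fn \<phi> \<Phi> L \<Longrightarrow> sphere_fn (\<lambda>w. c * \<phi> w) (\<lambda>w. c *\<^sub>R \<Phi> w) (\<lambda>w. c * L w)"
  using sphere_fn_mult[OF sphere_fn_const[of c], of \<phi> \<Phi> L] by simp

text \<open>Gradient of the \<open>k\<close>-th component of \<open>sgrad i\<close>. By the
  Cauchy-Riemann equations the two quadratic fields share these vectors up to sign and order, which
  is what the middle condition encodes.\<close>

definition sgrad_deriv :: "3 \<Rightarrow> 2 \<Rightarrow> real^2 \<Rightarrow> real^2" where
  "sgrad_deriv i k w = (if i = 1 then axis k 1
     else if (i = 2) = (k = 1) then (if i = 2 then 1 else - 1) *\<^sub>R vector [- w $ 1, w $ 2]
     else vector [- w $ 2, - w $ 1])"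

lemma GDERIV_sgrad: "GDERIV (\<lambda>w. sgrad i w $ k) w :> sgrad_deriv i k w"
proof -
  have m: "GDERIV (\<lambda>w::real^2. w $ a * w $ b) w :> w $ a *\<^sub>R axis b 1 + w $ b *\<^sub>R axis a 1" for a b
    by (rule GDERIV_mult[OF GDERIV_nth GDERIV_nth])
  have q: "GDERIV (\<lambda>w::real^2. (1 / 2) * (1 + w $ a * w $ a - w $ b * w $ b)) w :> w $ a *\<^sub>R axis a 1 - w $ b *\<^sub>R axis b 1" for a b
    using GDERIV_mult[OF GDERIV_const[of "1 / 2"] GDERIV_diff[OF GDERIV_add[OF GDERIV_const[of 1] m[of a a]] m[of b b]]]
    by (rule GDERIV_subst) (simp add: scaleR_add_right scaleR_diff_right flip: scaleR_2)
  have n: "GDERIV (\<lambda>w::real^2. - (w $ 1 * w $ 2)) w :> - (w $ 1 *\<^sub>R axis 2 1 + w $ 2 *\<^sub>R axis 1 1)"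
    by (rule GDERIV_minus[OF m])
  have ne: "(3::3) \<noteq> 1" "(3::3) \<noteq> 2" "(2::3) \<noteq> 1" "(2::2) \<noteq> 1" by simp_all
  consider "i = 1" | "i = 2" "k = 1" | "i = 2" "k = 2" | "i = 3" "k = 1" | "i = 3" "k = 2"
    using exhaust_3[of i] exhaust_2[of k] by blast
  then show ?thesis
  proof cases
    case 1
    then show ?thesis using GDERIV_nth[of k w] by (simp add: sgrad_def sgrad_deriv_def)
  next
    case 2
    have "sgrad_deriv 2 1 w = w $ 2 *\<^sub>R axis 2 1 - w $ 1 *\<^sub>R axis 1 1"
      by (simp add: sgrad_deriv_def vec_eq_iff forall_2 axis_nth2)
    then show ?thesis using q[of 2 1] 2 by (simp add: sgrad_nth power2_eq_square)
  next
    case 3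
    have "sgrad_deriv 2 2 w = - (w $ 1 *\<^sub>R axis 2 1 + w $ 2 *\<^sub>R axis 1 1)"
      by (simp add: sgrad_deriv_def vec_eq_iff forall_2 axis_nth2)
    then show ?thesis using n 3 by (simp add: sgrad_nth)
  next
    case 4
    have "sgrad_deriv 3 1 w = - (w $ 1 *\<^sub>R axis 2 1 + w $ 2 *\<^sub>R axis 1 1)"
      by (simp add: sgrad_deriv_def vec_eq_iff forall_2 axis_nth2)
    then show ?thesis using n 4 by (simp add: sgrad_nth)
  next
    case 5
    have "sgrad_deriv 3 2 w = w $ 1 *\<^sub>R axis 1 1 - w $ 2 *\<^sub>R axis 2 1"
      by (simp add: sgrad_deriv_def vec_eq_iff forall_2 axis_nth2)
    then show ?thesis using q[of 1 2] 5 by (simp add: sgrad_nth power2_eq_square)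
  qed
qed

lemma continuous_sgrad_deriv: "continuous_on UNIV (sgrad_deriv i k)"
  unfolding sgrad_deriv_def[abs_def] by (cases "i = 1"; cases "(i = 2) = (k = 1)") (auto intro!: continuous_intros)

text \<open>Coordinates are eigenfunctions of the spherical Laplacian with eigenvalue -2, and the
  Euclidean Laplacian is \<open>(lam w)\<^sup>2\<close> times the spherical one.\<close>

lemma sphere_fn_stereo: "sphere_fn (\<lambda>w. stereo w $ i) (\<lambda>w. (lam w)\<^sup>2 *\<^sub>R sgrad i w) (\<lambda>w. - 2 * (lam w)\<^sup>2 * stereo w $ i)"
proof -
  define dl where "dl w = (- 2 * (lam w) ^ 3) *\<^sub>R w" for w
  have dl: "GDERIV (\<lambda>w. (lam w)\<^sup>2) w :> dl w" for w
    using GDERIV_mult[OF GDERIV_lam GDERIV_lam, of w]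
    by (simp add: dl_def power2_eq_square power3_eq_cube mult.assoc flip: scaleR_2)
  show ?thesis
  proof (rule sphere_fnI[where K = 2
        and Da = "\<lambda>w. (lam w)\<^sup>2 *\<^sub>R sgrad_deriv i 1 w + sgrad i w $ 1 *\<^sub>R dl w"
        and Db = "\<lambda>w. (lam w)\<^sup>2 *\<^sub>R sgrad_deriv i 2 w + sgrad i w $ 2 *\<^sub>R dl w"])
    have "continuous_on UNIV (\<lambda>w. (lam w)\<^sup>2 *\<^sub>R sgrad_deriv i k w + sgrad i w $ k *\<^sub>R dl w)" for k
      unfolding dl_def by (intro continuous_intros continuous_sgrad_deriv)
    then show "continuous_on UNIV (\<lambda>w. (lam w)\<^sup>2 *\<^sub>R sgrad_deriv i 1 w + sgrad i w $ 1 *\<^sub>R dl w)"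
      "continuous_on UNIV (\<lambda>w. (lam w)\<^sup>2 *\<^sub>R sgrad_deriv i 2 w + sgrad i w $ 2 *\<^sub>R dl w)" by blast+
    fix w
    have l: "lam w * ((w $ 1)\<^sup>2 + (w $ 2)\<^sup>2) = 2 - lam w"
      using lam_eq[of w] by (simp add: algebra_simps)
    show "GDERIV (\<lambda>w. stereo w $ i) w :> (lam w)\<^sup>2 *\<^sub>R sgrad i w" by (rule GDERIV_stereo)
    show "GDERIV (\<lambda>w. ((lam w)\<^sup>2 *\<^sub>R sgrad i w) $ 1) w :> (lam w)\<^sup>2 *\<^sub>R sgrad_deriv i 1 w + sgrad i w $ 1 *\<^sub>R dl w"
      "GDERIV (\<lambda>w. ((lam w)\<^sup>2 *\<^sub>R sgrad i w) $ 2) w :> (lam w)\<^sup>2 *\<^sub>R sgrad_deriv i 2 w + sgrad i w $ 2 *\<^sub>R dl w"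
      using GDERIV_mult[OF dl GDERIV_sgrad] by simp_all
    show "- 2 * (lam w)\<^sup>2 * stereo w $ i = ((lam w)\<^sup>2 *\<^sub>R sgrad_deriv i 1 w + sgrad i w $ 1 *\<^sub>R dl w) $ 1
        + ((lam w)\<^sup>2 *\<^sub>R sgrad_deriv i 2 w + sgrad i w $ 2 *\<^sub>R dl w) $ 2"
    proof -
      define x y a where "x = w $ 1" and "y = w $ 2" and "a = lam w"
      have l': "a * (x\<^sup>2 + y\<^sup>2) = 2 - a" using l by (simp add: x_def y_def a_def)
      consider "i = 1" | "i = 2" | "i = 3" using exhaust_3 by blast
      then show ?thesis
      proof cases
        case 1
        have "- 2 * a\<^sup>2 * (1 - a) = a\<^sup>2 + x * (- 2 * a ^ 3 * x) + (a\<^sup>2 + y * (- 2 * a ^ 3 * y))"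
          using l' by algebra
        then show ?thesis
          using 1 by (simp add: stereo_nth sgrad_nth sgrad_deriv_def axis_nth2 dl_def x_def y_def a_def)
      next
        case 2
        have "- 2 * a\<^sup>2 * (a * x) = a\<^sup>2 * (- x) + (1 + y\<^sup>2 - x\<^sup>2) / 2 * (- 2 * a ^ 3 * x) + (a\<^sup>2 * (- x) + - (x * y) * (- 2 * a ^ 3 * y))"
          using l' by algebra
        then show ?thesis
          using 2 by (simp add: stereo_nth sgrad_nth sgrad_deriv_def dl_def x_def y_def a_def)
      next
        case 3
        have "- 2 * a\<^sup>2 * (a * y) = a\<^sup>2 * (- y) + - (x * y) * (- 2 * a ^ 3 * x) + (a\<^sup>2 * (- y) + (1 + x\<^sup>2 - y\<^sup>2) / 2 * (- 2 * a ^ 3 * y))"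
          using l' by algebra
        then show ?thesis
          using 3 by (simp add: stereo_nth sgrad_nth sgrad_deriv_def dl_def x_def y_def a_def)
      qed
    qed
    show "\<bar>stereo w $ i\<bar> \<le> 2" using stereo_bound[of w i] by linarith
    have "lam w * (lam w * norm (sgrad i w)) \<le> lam w * 1"
      using lam_pos[of w] by (intro mult_left_mono lam_sgrad_bound) simp
    then show "norm ((lam w)\<^sup>2 *\<^sub>R sgrad i w) \<le> 2 * lam w"
      using lam_pos[of w] by (simp add: power2_eq_square mult.assoc)
    have "(lam w)\<^sup>2 * \<bar>stereo w $ i\<bar> \<le> (lam w)\<^sup>2 * 1"
      by (intro mult_left_mono stereo_bound) simp
    then show "\<bar>- 2 * (lam w)\<^sup>2 * stereo w $ i\<bar> \<le> 2 * (lam w)\<^sup>2"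
      by (simp add: abs_mult)
  qed
qed

subsection \<open>Pairs of zero energy\<close>

lemma sfield_bound: "lam w * norm (sfield i w) \<le> 1"
  using lam_sgrad_bound[of w i] by (simp add: sfield_def)

text \<open>Derivative along the rotation field times the area density, so that a Lebesgue integral
  of it is an integral over the sphere.\<close>

definition turn :: "3 \<Rightarrow> (real^2 \<Rightarrow> real^2) \<Rightarrow> real^2 \<Rightarrow> real" where
  "turn i \<Phi> w = (lam w)\<^sup>2 * (sfield i w \<bullet> \<Phi> w)"

lemma turn_bound:
  assumes "norm (\<Phi> w) \<le> K * lam w"
  shows "\<bar>turn i \<Phi> w\<bar> \<le> K * (lam w)\<^sup>2"
proof -
  have "\<bar>sfield i w \<bullet> \<Phi> w\<bar> \<le> norm (sfield i w) * (K * lam w)"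
    using Cauchy_Schwarz_ineq2[of "sfield i w" "\<Phi> w"] mult_left_mono[OF assms norm_ge_zero[of "sfield i w"]] by linarith
  then have "(lam w)\<^sup>2 * \<bar>sfield i w \<bullet> \<Phi> w\<bar> \<le> (lam w)\<^sup>2 * (norm (sfield i w) * (K * lam w))"
    by (intro mult_left_mono) auto
  also have "\<dots> = (K * (lam w)\<^sup>2) * (lam w * norm (sfield i w))"
    by (simp add: power2_eq_square mult_ac)
  also have "\<dots> \<le> (K * (lam w)\<^sup>2) * 1"
  proof (rule mult_left_mono[OF sfield_bound])
    have "0 \<le> K * lam w" using order_trans[OF norm_ge_zero assms] .
    then show "0 \<le> K * (lam w)\<^sup>2" using lam_pos[of w] by (simp add: zero_le_mult_iff)
  qed
  finally show ?thesis by (simp add: turn_def abs_mult)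
qed

lemma continuous_turn: "continuous_on UNIV \<Phi> \<Longrightarrow> continuous_on UNIV (turn i \<Phi>)"
  unfolding turn_def[abs_def] by (intro continuous_intros)

definition turn_field :: "3 \<Rightarrow> real^2 \<Rightarrow> real^2" where
  "turn_field i w = (lam w)\<^sup>2 *\<^sub>R sfield i w"

lemma turn_field_inner: "turn_field i w \<bullet> \<Phi> w = turn i \<Phi> w"
  by (simp add: turn_field_def turn_def)

lemma turn_field_norm: "norm (turn_field i w) \<le> 1 * lam w"
proof -
  have "lam w * (lam w * norm (sfield i w)) \<le> lam w * 1"
    using lam_pos[of w] by (intro mult_left_mono sfield_bound) simp
  then show ?thesis
    using lam_pos[of w] by (simp add: turn_field_def power2_eq_square mult.assoc)
qed

lemma turn_field_measurable: "turn_field i \<in> borel_measurable borel"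
  unfolding turn_field_def[abs_def] by (intro borel_measurable_continuous_onI continuous_intros)

lemma sqint_turn_field: "sqint (turn_field i)"
  by (rule sqint_lam_bound[OF turn_field_measurable turn_field_norm])

lemma sqint_mult_turn_field:
  assumes "sqint h"
  shows "sqint (\<lambda>w. h w *\<^sub>R turn_field i w)"
proof (rule sqint_mono[OF assms, where C = 2])
  show "(\<lambda>w. h w *\<^sub>R turn_field i w) \<in> borel_measurable lborel"
    using sqint_measurable[OF assms] turn_field_measurable by (simp add: borel_measurable_scaleR)
  have "norm (turn_field i w) \<le> 2" for w
    using turn_field_norm[of i w] lam_le_2[of w] by linarith
  then have "\<bar>h w\<bar> * norm (turn_field i w) \<le> \<bar>h w\<bar> * 2" for w
    by (intro mult_left_mono) auto
  then show "AE w in lborel. norm (h w *\<^sub>R turn_field i w) \<le> 2 * norm (h w)"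
    by (simp add: mult.commute)
qed

text \<open>For compactly supported tests this is \<open>Bform_C1c\<close> passed to the limit in
  \<open>h\<close>. Read as orthogonality of one square integrable field to all such gradients, it
  extends to tests on the whole sphere.\<close>

lemma stereo_J0_sobolev:
  assumes h: "sobolev_pair h H" and \<phi>: "sphere_fn \<phi> \<Phi> L"
  shows "(LINT w|lborel. ((stereo w $ i) *\<^sub>R J0 (H w)) \<bullet> \<Phi> w) = - (LINT w|lborel. h w * turn i \<Phi> w)"
proof -
  have s: "sqint h" "sqint H" using h by (auto simp: sobolev_pair_def)
  note sJ = sqint_stereo_J0[OF s(2), of i] and sT = sqint_mult_turn_field[OF s(1), of i]
  have "(LINT w|lborel. ((stereo w $ i) *\<^sub>R J0 (H w) + h w *\<^sub>R turn_field i w) \<bullet> \<Phi> w) = 0"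
  proof (rule integral_zero_extend[OF \<phi> sqint_add[OF sJ sT]])
    fix \<psi> \<Psi> assume \<psi>: "C1c \<psi> (\<Psi> :: real^2 \<Rightarrow> real^2)"
    obtain g G where g: "\<And>n. C1c (g n) (G n)" "L2lim g h" "L2lim G H"
      using sobolev_C1c_sequence[OF h] by blast
    have t: "sqint (\<lambda>w. turn i \<Psi> w)"
    proof -
      obtain R where R: "\<And>x. norm x > R \<Longrightarrow> \<Psi> x = 0" using \<psi> by (auto simp: C1c_def)
      have z: "norm x > R \<Longrightarrow> turn i \<Psi> x = 0" for x using R by (simp add: turn_def)
      obtain B where "\<And>x. norm (turn i \<Psi> x) \<le> B"
        using Cc_bounded[OF continuous_turn[OF C1cD(2)[OF \<psi>]] z] by blast
      then show ?thesis
        by (rule sqint_bounded_support[OF borel_measurable_continuous_onI[OF continuous_turn[OF C1cD(2)[OF \<psi>]]] _ z])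
    qed
    have "(\<lambda>n. Bform i (G n) \<Psi>) \<longlonglongrightarrow> Bform i H \<Psi>"
      by (rule Bform_lim[OF g(3) L2lim_const[OF C1c_sqint(2)[OF \<psi>]]])
    moreover have "(\<lambda>n. - (LINT w|lborel. g n w \<bullet> turn i \<Psi> w)) \<longlonglongrightarrow> - (LINT w|lborel. h w \<bullet> turn i \<Psi> w)"
      by (intro tendsto_minus L2lim_inner[OF g(2) L2lim_const[OF t]])
    moreover have "Bform i (G n) \<Psi> = - (LINT w|lborel. g n w \<bullet> turn i \<Psi> w)" for n
      using Bform_C1c(2)[OF g(1) \<psi>] by (simp add: turn_def)
    ultimately have B: "Bform i H \<Psi> = - (LINT w|lborel. h w \<bullet> turn i \<Psi> w)"
      by (simp only:) (rule LIMSEQ_unique)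
    have "(LINT w|lborel. ((stereo w $ i) *\<^sub>R J0 (H w) + h w *\<^sub>R turn_field i w) \<bullet> \<Psi> w) =
        (LINT w|lborel. ((stereo w $ i) *\<^sub>R J0 (H w)) \<bullet> \<Psi> w) + (LINT w|lborel. (h w *\<^sub>R turn_field i w) \<bullet> \<Psi> w)"
      unfolding inner_add_left
      by (intro Bochner_Integration.integral_add integrable_inner_sqint sJ sT C1c_sqint(2)[OF \<psi>])
    also have "\<dots> = 0"
      using B unfolding Bform_eq_inner by (simp add: turn_field_inner)
    finally show "(LINT w|lborel. ((stereo w $ i) *\<^sub>R J0 (H w) + h w *\<^sub>R turn_field i w) \<bullet> \<Psi> w) = 0" .
  qed
  moreover have "(LINT w|lborel. ((stereo w $ i) *\<^sub>R J0 (H w) + h w *\<^sub>R turn_field i w) \<bullet> \<Phi> w) =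
      (LINT w|lborel. ((stereo w $ i) *\<^sub>R J0 (H w)) \<bullet> \<Phi> w) + (LINT w|lborel. (h w *\<^sub>R turn_field i w) \<bullet> \<Phi> w)"
    unfolding inner_add_left
    by (intro Bochner_Integration.integral_add integrable_inner_sqint sJ sT sphere_fnD(5)[OF \<phi>])
  ultimately show ?thesis
    by (simp add: turn_field_inner)
qed

lemma sq_zero_imp:
  fixes C S :: real
  assumes "\<And>t. 0 \<le> 2 * t * C + t\<^sup>2 * S" "0 \<le> S"
  shows "C = 0"
  using quadratic_nonneg_imp[of 0 C S] assms by simp

lemma integral_inner_combination:
  assumes "sqint F" "sqint G" "sqint \<Psi>"
  shows "(LINT w|lborel. (F w + c *\<^sub>R G w) \<bullet> \<Psi> w) = (LINT w|lborel. F w \<bullet> \<Psi> w) + c * (LINT w|lborel. G w \<bullet> \<Psi> w)"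
    and "(LINT w|lborel. (F w - c *\<^sub>R G w) \<bullet> \<Psi> w) = (LINT w|lborel. F w \<bullet> \<Psi> w) - c * (LINT w|lborel. G w \<bullet> \<Psi> w)"
  using integrable_inner_sqint[OF assms(1,3)] integrable_inner_sqint[OF assms(2,3)]
  by (simp_all add: inner_add_left inner_diff_left)

text \<open>The energy is nonnegative on the closure and vanishes at the pair, so its first
  variation in either component is 0. The two signs differ because \<open>J0\<close> is
  skew.\<close>

lemma Euler_Lagrange:
  assumes F: "grad_closure F" and H: "grad_closure H" and eq: "4 * Bform i F H = sqnorm F + sqnorm H"
    and \<psi>: "C1c \<psi> \<Psi>"
  shows "(LINT w|lborel. (F w + 2 *\<^sub>R ((stereo w $ i) *\<^sub>R J0 (H w))) \<bullet> \<Psi> w) = 0"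
    and "(LINT w|lborel. (H w - 2 *\<^sub>R ((stereo w $ i) *\<^sub>R J0 (F w))) \<bullet> \<Psi> w) = 0"
proof -
  have s: "sqint F" "sqint H" "sqint \<Psi>"
    using F H C1c_sqint[OF \<psi>] grad_closure_sqint by blast+
  note sF = sqint_stereo_J0[OF s(1), of i] and sH = sqint_stereo_J0[OF s(2), of i]
  let ?JF = "\<lambda>w. (stereo w $ i) *\<^sub>R J0 (F w)" and ?JH = "\<lambda>w. (stereo w $ i) *\<^sub>R J0 (H w)"
  have b1: "Bform i (\<lambda>w. F w + t *\<^sub>R \<Psi> w) H = Bform i F H - t * (LINT w|lborel. ?JH w \<bullet> \<Psi> w)" for t
  proof -
    have "stereo w $ i * (J0 (F w + t *\<^sub>R \<Psi> w) \<bullet> H w) = ?JF w \<bullet> H w - t * (?JH w \<bullet> \<Psi> w)" for w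
      by (simp add: J0_inner algebra_simps)
    then show ?thesis
      using integrable_inner_sqint[OF sF s(2)] integrable_inner_sqint[OF sH s(3)]
      unfolding Bform_def[of i "\<lambda>w. F w + t *\<^sub>R \<Psi> w"] Bform_eq_inner by simp
  qed
  have b2: "Bform i F (\<lambda>w. H w + t *\<^sub>R \<Psi> w) = Bform i F H + t * (LINT w|lborel. ?JF w \<bullet> \<Psi> w)" for t
  proof -
    have "?JF w \<bullet> (H w + t *\<^sub>R \<Psi> w) = ?JF w \<bullet> H w + t * (?JF w \<bullet> \<Psi> w)" for w
      by (simp add: inner_add_right)
    then show ?thesis
      using integrable_inner_sqint[OF sF s(2)] integrable_inner_sqint[OF sF s(3)]
      unfolding Bform_eq_inner by simp
  qed
  have "(LINT w|lborel. F w \<bullet> \<Psi> w) + 2 * (LINT w|lborel. ?JH w \<bullet> \<Psi> w) = 0"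
  proof (rule sq_zero_imp[OF _ sqnorm_nonneg[of \<Psi>]])
    fix t
    have "4 * Bform i (\<lambda>w. F w + t *\<^sub>R \<Psi> w) H \<le> sqnorm (\<lambda>w. F w + t *\<^sub>R \<Psi> w) + sqnorm H"
      by (rule energy_nonneg[OF grad_closure_add_C1c[OF F \<psi>] H])
    then show "0 \<le> 2 * t * ((LINT w|lborel. F w \<bullet> \<Psi> w) + 2 * (LINT w|lborel. ?JH w \<bullet> \<Psi> w)) + t\<^sup>2 * sqnorm \<Psi>"
      unfolding b1 sqnorm_linear_combination[OF s(1,3)] using eq by (simp add: algebra_simps)
  qed
  then show "(LINT w|lborel. (F w + 2 *\<^sub>R ?JH w) \<bullet> \<Psi> w) = 0"
    unfolding integral_inner_combination[OF s(1) sH s(3)] .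
  have "(LINT w|lborel. H w \<bullet> \<Psi> w) - 2 * (LINT w|lborel. ?JF w \<bullet> \<Psi> w) = 0"
  proof (rule sq_zero_imp[OF _ sqnorm_nonneg[of \<Psi>]])
    fix t
    have "4 * Bform i F (\<lambda>w. H w + t *\<^sub>R \<Psi> w) \<le> sqnorm F + sqnorm (\<lambda>w. H w + t *\<^sub>R \<Psi> w)"
      by (rule energy_nonneg[OF F grad_closure_add_C1c[OF H \<psi>]])
    then show "0 \<le> 2 * t * ((LINT w|lborel. H w \<bullet> \<Psi> w) - 2 * (LINT w|lborel. ?JF w \<bullet> \<Psi> w)) + t\<^sup>2 * sqnorm \<Psi>"
      unfolding b2 sqnorm_linear_combination[OF s(2,3)] using eq by (simp add: algebra_simps)
  qed
  then show "(LINT w|lborel. (H w - 2 *\<^sub>R ?JF w) \<bullet> \<Psi> w) = 0"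
    unfolding integral_inner_combination[OF s(2) sF s(3)] .
qed

text \<open>Weak form on the sphere of the equations satisfied by the null space of the energy.\<close>

definition null_pair :: "3 \<Rightarrow> (real^2 \<Rightarrow> real) \<Rightarrow> (real^2 \<Rightarrow> real) \<Rightarrow> bool" where
  "null_pair i f h \<longleftrightarrow> (\<forall>\<phi> \<Phi> L. sphere_fn \<phi> \<Phi> L \<longrightarrow>
     (LINT w|lborel. f w * L w) = - 2 * (LINT w|lborel. h w * turn i \<Phi> w) \<and>
     (LINT w|lborel. h w * L w) = 2 * (LINT w|lborel. f w * turn i \<Phi> w))"

text \<open>The first variation equations extend to gradients of functions on the whole sphere.
  Green's identity then rewrites the plain gradient term as an integral against \<open>L\<close>,
  and integration by parts rewrites the \<open>J0\<close> term as one against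
  \<open>turn i \<Phi>\<close>.\<close>

lemma null_pair_minimiser:
  assumes f: "sobolev_pair f F" and h: "sobolev_pair h H" and eq: "4 * Bform i F H = sqnorm F + sqnorm H"
  shows "null_pair i f h"
  unfolding null_pair_def
proof (intro allI impI)
  fix \<phi> \<Phi> L assume \<phi>: "sphere_fn \<phi> \<Phi> L"
  have s: "sqint F" "sqint H" using f h by (auto simp: sobolev_pair_def)
  note gc = sobolev_grad_closure[OF f] sobolev_grad_closure[OF h] and s\<Phi> = sphere_fnD(5)[OF \<phi>]
  note sF = sqint_stereo_J0[OF s(1), of i] and sH = sqint_stereo_J0[OF s(2), of i]
  have "(LINT w|lborel. (F w + 2 *\<^sub>R ((stereo w $ i) *\<^sub>R J0 (H w))) \<bullet> \<Phi> w) = 0"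
    by (rule integral_zero_extend[OF \<phi> sqint_add[OF s(1) sqint_scaleR[OF sH]] Euler_Lagrange(1)[OF gc eq]])
  then have 1: "(LINT w|lborel. F w \<bullet> \<Phi> w) = 2 * (LINT w|lborel. h w * turn i \<Phi> w)"
    unfolding integral_inner_combination[OF s(1) sH s\<Phi>] using stereo_J0_sobolev[OF h \<phi>, of i] by simp
  have "(LINT w|lborel. (H w - 2 *\<^sub>R ((stereo w $ i) *\<^sub>R J0 (F w))) \<bullet> \<Phi> w) = 0"
    by (rule integral_zero_extend[OF \<phi> sqint_diff[OF s(2) sqint_scaleR[OF sF]] Euler_Lagrange(2)[OF gc eq]])
  then have 2: "(LINT w|lborel. H w \<bullet> \<Phi> w) = - 2 * (LINT w|lborel. f w * turn i \<Phi> w)"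
    unfolding integral_inner_combination[OF s(2) sF s\<Phi>] using stereo_J0_sobolev[OF f \<phi>, of i] by simp
  show "(LINT w|lborel. f w * L w) = - 2 * (LINT w|lborel. h w * turn i \<Phi> w) \<and>
     (LINT w|lborel. h w * L w) = 2 * (LINT w|lborel. f w * turn i \<Phi> w)"
    using Green_sobolev[OF \<phi> f] Green_sobolev[OF \<phi> h] 1 2 by simp
qed

lemma integrable_sphere_mult:
  assumes f: "integrable lborel (\<lambda>w. (lam w)\<^sup>2 * f w)" "f \<in> borel_measurable borel"
    and L: "L \<in> borel_measurable borel" "\<And>w. \<bar>L w\<bar> \<le> K * (lam w)\<^sup>2"
  shows "integrable lborel (\<lambda>w. f w * L w)"
proof (rule Bochner_Integration.integrable_bound)
  show "integrable lborel (\<lambda>w. K * ((lam w)\<^sup>2 * f w))" using f(1) by simp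
  show "(\<lambda>w. f w * L w) \<in> borel_measurable lborel" using f(2) L(1) by measurable
  have "\<bar>f w\<bar> * \<bar>L w\<bar> \<le> \<bar>f w\<bar> * \<bar>K * (lam w)\<^sup>2\<bar>" for w
    using L(2)[of w] by (intro mult_left_mono) auto
  then show "AE w in lborel. norm (f w * L w) \<le> norm (K * ((lam w)\<^sup>2 * f w))"
    by (simp add: abs_mult mult_ac)
qed

lemma sphere_fn_measurable:
  assumes "sphere_fn \<phi> \<Phi> L"
  shows "\<phi> \<in> borel_measurable borel" "L \<in> borel_measurable borel" "turn i \<Phi> \<in> borel_measurable borel"
  using sphere_fnD(2,4)[OF assms] continuous_turn[OF sphere_fnD(3)[OF assms]]
  by (auto intro: borel_measurable_continuous_onI)

lemma sphere_fn_integrable: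
  assumes "sphere_fn \<phi> \<Phi> L"
  shows "integrable lborel (\<lambda>w. (lam w)\<^sup>2 * \<phi> w)"
proof -
  obtain K where K: "\<And>w. \<bar>\<phi> w\<bar> \<le> K" using sphere_fn_bounded[OF assms] by blast
  show ?thesis by (rule integrable_lam_squared_mult[OF sphere_fn_measurable(1)[OF assms] K])
qed

text \<open>Cutting off \<open>\<theta>\<close> reduces to compact support; the left side converges
  by domination, the right side by \<open>cutoff_limit\<close>.\<close>

lemma Green_sphere:
  assumes \<theta>: "sphere_fn \<theta> X M" and \<phi>: "sphere_fn \<phi> \<Phi> L"
  shows "(LINT w|lborel. \<theta> w * L w) = - (LINT w|lborel. X w \<bullet> \<Phi> w)"
proof -
  obtain K where K: "\<And>w. \<bar>\<theta> w\<bar> \<le> K" using sphere_fn_bounded[OF \<theta>] by blast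
  obtain J where J: "\<And>w. \<bar>L w\<bar> \<le> J * (lam w)\<^sup>2" using sphere_fn_bounded[OF \<phi>] by blast
  let ?c = "\<lambda>n w. cutoff (real n + 1) w :: real"
  have Gn: "(LINT w|lborel. (?c n w * \<theta> w) * L w) = - (LINT w|lborel. \<Phi> w \<bullet> (?c n w *\<^sub>R X w + \<theta> w *\<^sub>R cutoff_grad (real n + 1) w))" for n
    using Green_C1c[OF \<phi> C1c_cutoff[OF sphere_fnD(1,3)[OF \<theta>], of "real n + 1"]] by (simp add: inner_commute)
  have i: "integrable lborel (\<lambda>w. \<theta> w * L w)"
    by (rule integrable_sphere_mult[OF sphere_fn_integrable[OF \<theta>] sphere_fn_measurable(1)[OF \<theta>] sphere_fn_measurable(2)[OF \<phi>] J])
  have 1: "(\<lambda>n. LINT w|lborel. (?c n w * \<theta> w) * L w) \<longlonglongrightarrow> (LINT w|lborel. \<theta> w * L w)"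
  proof (rule integral_dominated_convergence)
    show "integrable lborel (\<lambda>w. norm (\<theta> w * L w))" using i by (rule integrable_norm)
    show "(\<lambda>w. \<theta> w * L w) \<in> borel_measurable lborel" using i by (rule borel_measurable_integrable)
    show "(\<lambda>w. (?c n w * \<theta> w) * L w) \<in> borel_measurable lborel" for n
      using cutoff_measurable[of "real n + 1"] sphere_fn_measurable(1)[OF \<theta>] sphere_fn_measurable(2)[OF \<phi>] by measurable
    have "(\<lambda>n. (?c n w * \<theta> w) * L w) \<longlonglongrightarrow> \<theta> w * L w" for w
    proof (rule tendsto_eventually)
      obtain N where "norm w \<le> real N" using real_arch_simple by blast
      then show "\<forall>\<^sub>F n in sequentially. (?c n w * \<theta> w) * L w = \<theta> w * L w"
        by (intro eventually_sequentiallyI[of N]) (simp add: cutoff_eq_1)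
    qed
    then show "AE w in lborel. (\<lambda>n. (?c n w * \<theta> w) * L w) \<longlonglongrightarrow> \<theta> w * L w" by simp
    have "\<bar>?c n w\<bar> * \<bar>\<theta> w * L w\<bar> \<le> 1 * \<bar>\<theta> w * L w\<bar>" for n w
      using cutoff_range[of "real n + 1" w] by (intro mult_right_mono) auto
    then show "AE w in lborel. norm ((?c n w * \<theta> w) * L w) \<le> norm (\<theta> w * L w)" for n
      by (simp add: abs_mult mult.assoc)
  qed
  have 2: "(\<lambda>n. LINT w|lborel. (?c n w * \<theta> w) * L w) \<longlonglongrightarrow> - (LINT w|lborel. \<Phi> w \<bullet> X w)"
    unfolding Gn
    by (intro tendsto_minus cutoff_limit[OF sphere_fnD(5)[OF \<phi>] sphere_fnD(5)[OF \<theta>] sphere_fn_measurable(1)[OF \<theta>] K])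
  show ?thesis
    using LIMSEQ_unique[OF 1 2] by (simp add: inner_commute)
qed

lemma Green_sphere_symmetric:
  assumes "sphere_fn \<theta> X M" "sphere_fn \<phi> \<Phi> L"
  shows "(LINT w|lborel. \<theta> w * L w) = (LINT w|lborel. \<phi> w * M w)"
  using Green_sphere[OF assms] Green_sphere[OF assms(2,1)] by (simp add: inner_commute)

text \<open>Rotations preserve area, so the rotation field weighted by the area density is
  divergence free. Concretely it is \<open>J0\<close> of a gradient, and Jacobian integrals
  vanish.\<close>

lemma integral_turn:
  assumes \<phi>: "sphere_fn \<phi> \<Phi> L"
  shows "(LINT w|lborel. turn i \<Phi> w) = 0"
proof -
  have "(LINT w|lborel. turn_field i w \<bullet> \<Phi> w) = 0"
  proof (rule integral_zero_extend[OF \<phi> sqint_turn_field])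
    fix \<psi> \<Psi> assume \<psi>: "C1c \<psi> (\<Psi> :: real^2 \<Rightarrow> real^2)"
    obtain R where R: "\<And>x. norm x > R \<Longrightarrow> \<Psi> x = 0" using \<psi> by (auto simp: C1c_def)
    \<comment> \<open>The cutoff at radius \<open>r\<close> equals 1 wherever \<open>\<Psi>\<close>
      is nonzero, so it replaces the coordinate by a compactly supported function; the 1 ensures a
      positive radius.\<close>
    define r where "r = max R 1"
    have "(LINT w|lborel. J0 (cutoff r w *\<^sub>R ((lam w)\<^sup>2 *\<^sub>R sgrad i w) + (stereo w $ i) *\<^sub>R cutoff_grad r w) \<bullet> \<Psi> w) = 0"
      by (rule integral_Jacobian_zero[OF C1c_cutoff[OF GDERIV_stereo continuous_stereo_gradient] \<psi>]) (simp add: r_def)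
    moreover have "J0 (cutoff r w *\<^sub>R ((lam w)\<^sup>2 *\<^sub>R sgrad i w) + (stereo w $ i) *\<^sub>R cutoff_grad r w) \<bullet> \<Psi> w = turn_field i w \<bullet> \<Psi> w" for w
    proof (cases "norm w \<le> r")
      case True
      then show ?thesis by (simp add: cutoff_eq_1 cutoff_grad_eq_0 r_def turn_field_def sfield_def J0_scaleR)
    next
      case False
      then show ?thesis using R[of w] by (simp add: r_def)
    qed
    ultimately show "(LINT w|lborel. turn_field i w \<bullet> \<Psi> w) = 0" by simp
  qed
  then show ?thesis by (simp add: turn_field_inner)
qed

lemma integral_mult_turn:
  assumes \<theta>: "sphere_fn \<theta> X M" and \<phi>: "sphere_fn \<phi> \<Phi> L"
  shows "(LINT w|lborel. \<theta> w * turn i \<Phi> w) = - (LINT w|lborel. \<phi> w * turn i X w)"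
proof -
  obtain J where J: "\<And>w. norm (\<Phi> w) \<le> J * lam w" using sphere_fn_bounded[OF \<phi>] by blast
  obtain K where K: "\<And>w. norm (X w) \<le> K * lam w" using sphere_fn_bounded[OF \<theta>] by blast
  have "integrable lborel (\<lambda>w. \<theta> w * turn i \<Phi> w)" "integrable lborel (\<lambda>w. \<phi> w * turn i X w)"
    by (rule integrable_sphere_mult[OF sphere_fn_integrable[OF \<theta>] sphere_fn_measurable(1)[OF \<theta>] sphere_fn_measurable(3)[OF \<phi>] turn_bound[OF J]],
        rule integrable_sphere_mult[OF sphere_fn_integrable[OF \<phi>] sphere_fn_measurable(1)[OF \<phi>] sphere_fn_measurable(3)[OF \<theta>] turn_bound[OF K]])
  moreover have "turn i (\<lambda>w. \<theta> w *\<^sub>R \<Phi> w + \<phi> w *\<^sub>R X w) w = \<theta> w * turn i \<Phi> w + \<phi> w * turn i X w" for w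
    by (simp add: turn_def inner_add_right algebra_simps)
  ultimately show ?thesis
    using integral_turn[OF sphere_fn_mult[OF \<theta> \<phi>], of i] by simp
qed

section \<open>The linear space of null pairs and its known elements\<close>

lemma null_pair_add:
  assumes "null_pair i f h" "null_pair i f' h'"
    and m: "f \<in> borel_measurable borel" "h \<in> borel_measurable borel" "f' \<in> borel_measurable borel" "h' \<in> borel_measurable borel"
    and int: "integrable lborel (\<lambda>w. (lam w)\<^sup>2 * f w)" "integrable lborel (\<lambda>w. (lam w)\<^sup>2 * h w)"
      "integrable lborel (\<lambda>w. (lam w)\<^sup>2 * f' w)" "integrable lborel (\<lambda>w. (lam w)\<^sup>2 * h' w)"
  shows "null_pair i (\<lambda>w. f w + c * f' w) (\<lambda>w. h w + c * h' w)"
  unfolding null_pair_def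
proof (intro allI impI)
  fix \<phi> \<Phi> L assume \<phi>: "sphere_fn \<phi> \<Phi> L"
  obtain K where K: "\<And>w. norm (\<Phi> w) \<le> K * lam w" "\<And>w. \<bar>L w\<bar> \<le> K * (lam w)\<^sup>2" using sphere_fn_bounded[OF \<phi>] by blast
  have lin: "(LINT w|lborel. (g w + c * g' w) * P w) = (LINT w|lborel. g w * P w) + c * (LINT w|lborel. g' w * P w)"
    if "P \<in> borel_measurable borel" "\<And>w. \<bar>P w\<bar> \<le> K * (lam w)\<^sup>2" "g \<in> borel_measurable borel" "g' \<in> borel_measurable borel"
      "integrable lborel (\<lambda>w. (lam w)\<^sup>2 * g w)" "integrable lborel (\<lambda>w. (lam w)\<^sup>2 * g' w)" for P g g'
  proof -
    have "(g w + c * g' w) * P w = g w * P w + c * (g' w * P w)" for w by (simp add: algebra_simps)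
    then show ?thesis
      using integrable_sphere_mult[OF that(5,3,1,2)] integrable_sphere_mult[OF that(6,4,1,2)] by simp
  qed
  note M = sphere_fn_measurable(2,3)[OF \<phi>]
  have a: "(LINT w|lborel. f w * L w) = - 2 * (LINT w|lborel. h w * turn i \<Phi> w)" "(LINT w|lborel. h w * L w) = 2 * (LINT w|lborel. f w * turn i \<Phi> w)"
    "(LINT w|lborel. f' w * L w) = - 2 * (LINT w|lborel. h' w * turn i \<Phi> w)" "(LINT w|lborel. h' w * L w) = 2 * (LINT w|lborel. f' w * turn i \<Phi> w)"
    using assms(1,2) \<phi> unfolding null_pair_def by blast+
  show "(LINT w|lborel. (f w + c * f' w) * L w) = - 2 * (LINT w|lborel. (h w + c * h' w) * turn i \<Phi> w) \<and>
     (LINT w|lborel. (h w + c * h' w) * L w) = 2 * (LINT w|lborel. (f w + c * f' w) * turn i \<Phi> w)"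
    unfolding lin[OF M(1) K(2) m(1,3) int(1,3)] lin[OF M(1) K(2) m(2,4) int(2,4)]
      lin[OF M(2) turn_bound[OF K(1)] m(1,3) int(1,3)] lin[OF M(2) turn_bound[OF K(1)] m(2,4) int(2,4)] a
    by (simp add: algebra_simps)
qed

lemma null_pair_const: "null_pair i (\<lambda>_. a) (\<lambda>_. b)"
  unfolding null_pair_def
proof (intro allI impI)
  fix \<phi> \<Phi> L assume \<phi>: "sphere_fn \<phi> \<Phi> L"
  have "(LINT w|lborel. L w) = 0"
    using Green_sphere[OF sphere_fn_const[of 1] \<phi>] by simp
  then show "(LINT w|lborel. a * L w) = - 2 * (LINT w|lborel. b * turn i \<Phi> w) \<and>
     (LINT w|lborel. b * L w) = 2 * (LINT w|lborel. a * turn i \<Phi> w)"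
    using integral_turn[OF \<phi>, of i] by simp
qed

text \<open>Cyclic successor of an axis: \<open>i\<close>, \<open>nxt i\<close>,
  \<open>nxt (nxt i)\<close> are in positive order for each \<open>i\<close>, which lets one formula
  serve all three axes.\<close>

definition nxt :: "3 \<Rightarrow> 3" where
  "nxt i = (if i = 1 then 2 else if i = 2 then 3 else 1)"

text \<open>An infinitesimal rotation about an axis kills the coordinate along that axis and turns
  the other two into each other with opposite signs.\<close>

lemma turn_stereo:
  "turn i (\<lambda>w. (lam w)\<^sup>2 *\<^sub>R sgrad i w) w = 0"
  "turn i (\<lambda>w. (lam w)\<^sup>2 *\<^sub>R sgrad (nxt i) w) w = - ((lam w)\<^sup>2 * stereo w $ nxt (nxt i))"
  "turn i (\<lambda>w. (lam w)\<^sup>2 *\<^sub>R sgrad (nxt (nxt i)) w) w = (lam w)\<^sup>2 * stereo w $ nxt i"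
proof -
  define x y a where "x = w $ 1" and "y = w $ 2" and "a = lam w"
  have l: "a * (x\<^sup>2 + y\<^sup>2) = 2 - a" using lam_eq[of w] by (simp add: x_def y_def a_def algebra_simps)
  have t: "turn i (\<lambda>w. (lam w)\<^sup>2 *\<^sub>R sgrad j w) w = a\<^sup>2 * (a\<^sup>2 * (sfield i w $ 1 * sgrad j w $ 1 + sfield i w $ 2 * sgrad j w $ 2))" for j
    by (simp add: turn_def inner_vec2 a_def distrib_left mult_ac)
  have n: "nxt 1 = 2" "nxt 2 = 3" "nxt 3 = 1" by (simp_all add: nxt_def)
  define X Y Z where "X = (1 + y\<^sup>2 - x\<^sup>2) / 2" and "Y = (1 + x\<^sup>2 - y\<^sup>2) / 2" and "Z = - (x * y)"
  have XY: "2 * X = 1 + y\<^sup>2 - x\<^sup>2" "2 * Y = 1 + x\<^sup>2 - y\<^sup>2" "x * y = - Z" by (simp_all add: X_def Y_def Z_def)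
  note simps = t n sfield_nth sgrad_nth stereo_nth x_def[symmetric] y_def[symmetric] a_def[symmetric]
    X_def[symmetric] Y_def[symmetric] XY(3)
  show "turn i (\<lambda>w. (lam w)\<^sup>2 *\<^sub>R sgrad i w) w = 0"
    by (simp add: turn_def sfield_def J0_inner mult.commute)
  consider "i = 1" | "i = 2" | "i = 3" using exhaust_3 by blast
  then have "a\<^sup>2 * (a\<^sup>2 * (sfield i w $ 1 * sgrad (nxt i) w $ 1 + sfield i w $ 2 * sgrad (nxt i) w $ 2)) = - (a\<^sup>2 * stereo w $ nxt (nxt i)) \<and>
     a\<^sup>2 * (a\<^sup>2 * (sfield i w $ 1 * sgrad (nxt (nxt i)) w $ 1 + sfield i w $ 2 * sgrad (nxt (nxt i)) w $ 2)) = a\<^sup>2 * stereo w $ nxt i"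
  proof cases
    case 1
    have "a\<^sup>2 * (a\<^sup>2 * (- y * X + x * - (- Z))) = - (a\<^sup>2 * (a * y))" "a\<^sup>2 * (a\<^sup>2 * (- y * - (- Z) + x * Y)) = a\<^sup>2 * (a * x)"
      using l XY by - algebra+
    then show ?thesis unfolding 1 simps by blast
  next
    case 2
    have "a\<^sup>2 * (a\<^sup>2 * (- Z * - (- Z) + X * Y)) = - (a\<^sup>2 * (1 - a))" "a\<^sup>2 * (a\<^sup>2 * (- Z * x + X * y)) = a\<^sup>2 * (a * y)"
      using l XY by - algebra+
    then show ?thesis unfolding 2 simps by blast
  next
    case 3
    have "a\<^sup>2 * (a\<^sup>2 * (- Y * x + - (- Z) * y)) = - (a\<^sup>2 * (a * x))" "a\<^sup>2 * (a\<^sup>2 * (- Y * X + - (- Z) * - (- Z))) = a\<^sup>2 * (1 - a)"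
      using l XY by - algebra+
    then show ?thesis unfolding 3 simps by blast
  qed
  then show "turn i (\<lambda>w. (lam w)\<^sup>2 *\<^sub>R sgrad (nxt i) w) w = - ((lam w)\<^sup>2 * stereo w $ nxt (nxt i))"
    "turn i (\<lambda>w. (lam w)\<^sup>2 *\<^sub>R sgrad (nxt (nxt i)) w) w = (lam w)\<^sup>2 * stereo w $ nxt i"
    unfolding t by (simp_all add: a_def)
qed

text \<open>Read as \<open>f + i h\<close>, the two pairs are the conjugate of \<zeta> and i times
  it, which spans a complex line over the reals. The equations follow by moving both the Laplacian
  and the rotation onto the coordinates.\<close>

lemma null_pair_stereo:
  "null_pair i (\<lambda>w. stereo w $ nxt i) (\<lambda>w. - stereo w $ nxt (nxt i))"
  "null_pair i (\<lambda>w. stereo w $ nxt (nxt i)) (\<lambda>w. stereo w $ nxt i)"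
proof -
  let ?j = "nxt i" and ?k = "nxt (nxt i)"
  have *: "(LINT w|lborel. stereo w $ ?j * L w) = 2 * (LINT w|lborel. stereo w $ ?k * turn i \<Phi> w)"
    "(LINT w|lborel. stereo w $ ?k * L w) = - 2 * (LINT w|lborel. stereo w $ ?j * turn i \<Phi> w)"
    if \<phi>: "sphere_fn \<phi> \<Phi> L" for \<phi> \<Phi> L
  proof -
    have g: "(LINT w|lborel. stereo w $ l * L w) = - 2 * (LINT w|lborel. \<phi> w * ((lam w)\<^sup>2 * stereo w $ l))" for l
    proof -
      have "(\<lambda>w. \<phi> w * (- 2 * (lam w)\<^sup>2 * stereo w $ l)) = (\<lambda>w. - 2 * (\<phi> w * ((lam w)\<^sup>2 * stereo w $ l)))"
        by (simp add: fun_eq_iff)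
      then show ?thesis
        unfolding Green_sphere_symmetric[OF sphere_fn_stereo[of l] \<phi>] by (simp only: integral_mult_right_zero)
    qed
    have t: "(LINT w|lborel. stereo w $ l * turn i \<Phi> w) = - (LINT w|lborel. \<phi> w * turn i (\<lambda>w. (lam w)\<^sup>2 *\<^sub>R sgrad l w) w)" for l
      by (rule integral_mult_turn[OF sphere_fn_stereo \<phi>])
    show "(LINT w|lborel. stereo w $ ?j * L w) = 2 * (LINT w|lborel. stereo w $ ?k * turn i \<Phi> w)"
      unfolding g t turn_stereo by simp
    show "(LINT w|lborel. stereo w $ ?k * L w) = - 2 * (LINT w|lborel. stereo w $ ?j * turn i \<Phi> w)"
      unfolding g t turn_stereo by simp
  qed
  show "null_pair i (\<lambda>w. stereo w $ ?j) (\<lambda>w. - stereo w $ ?k)"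
    unfolding null_pair_def using * by simp
  show "null_pair i (\<lambda>w. stereo w $ ?k) (\<lambda>w. stereo w $ ?j)"
    unfolding null_pair_def using * by simp
qed

lemma sphere_fn_cong:
  assumes "sphere_fn \<phi> \<Phi> L" "\<And>w. \<phi> w = \<phi>' w" "\<And>w. \<Phi> w = \<Phi>' w" "\<And>w. L w = L' w"
  shows "sphere_fn \<phi>' \<Phi>' L'"
proof -
  have "\<phi>' = \<phi>" "\<Phi>' = \<Phi>" "L' = L" using assms(2-4) by (simp_all add: fun_eq_iff)
  then show ?thesis using assms(1) by simp
qed

text \<open>Complex-valued functions on the sphere; \<open>P\<close> and \<open>Q\<close> are the two partial derivatives of \<open>u\<close>.\<close>

definition csphere :: "(real^2 \<Rightarrow> complex) \<Rightarrow> (real^2 \<Rightarrow> complex) \<Rightarrow> (real^2 \<Rightarrow> complex) \<Rightarrow> (real^2 \<Rightarrow> complex) \<Rightarrow> bool" where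
  "csphere u P Q L \<longleftrightarrow>
     sphere_fn (\<lambda>w. Re (u w)) (\<lambda>w. vector [Re (P w), Re (Q w)]) (\<lambda>w. Re (L w)) \<and>
     sphere_fn (\<lambda>w. Im (u w)) (\<lambda>w. vector [Im (P w), Im (Q w)]) (\<lambda>w. Im (L w))"

lemma csphere_cong:
  assumes "csphere u P Q L" "\<And>w. u w = u' w" "\<And>w. P w = P' w" "\<And>w. Q w = Q' w" "\<And>w. L w = L' w"
  shows "csphere u' P' Q' L'"
proof -
  have "u' = u" "P' = P" "Q' = Q" "L' = L" using assms(2-5) by (simp_all add: fun_eq_iff)
  then show ?thesis using assms(1) by simp
qed

lemma csphere_one: "csphere (\<lambda>_. 1) (\<lambda>_. 0) (\<lambda>_. 0) (\<lambda>_. 0)"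
  unfolding csphere_def
  by (intro conjI sphere_fn_cong[OF sphere_fn_const]) (auto simp: vec_eq_iff forall_2)

lemma csphere_mult:
  assumes "csphere u P Q L" "csphere v P' Q' L'"
  shows "csphere (\<lambda>w. u w * v w) (\<lambda>w. u w * P' w + v w * P w) (\<lambda>w. u w * Q' w + v w * Q w)
    (\<lambda>w. u w * L' w + v w * L w + 2 * (P w * P' w + Q w * Q' w))"
proof -
  note a = assms(1)[unfolded csphere_def] and b = assms(2)[unfolded csphere_def]
  note rr = sphere_fn_mult[OF conjunct1[OF a] conjunct1[OF b]] and ii = sphere_fn_mult[OF conjunct2[OF a] conjunct2[OF b]]
    and ri = sphere_fn_mult[OF conjunct1[OF a] conjunct2[OF b]] and ir = sphere_fn_mult[OF conjunct2[OF a] conjunct1[OF b]]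
  show ?thesis
    unfolding csphere_def
  proof
    show "sphere_fn (\<lambda>w. Re (u w * v w)) (\<lambda>w. vector [Re (u w * P' w + v w * P w), Re (u w * Q' w + v w * Q w)])
        (\<lambda>w. Re (u w * L' w + v w * L w + 2 * (P w * P' w + Q w * Q' w)))"
      by (rule sphere_fn_cong[OF sphere_fn_add[OF rr sphere_fn_cmult[OF ii, of "- 1"]]])
         (simp_all add: vec_eq_iff forall_2 inner_vec2 algebra_simps)
    show "sphere_fn (\<lambda>w. Im (u w * v w)) (\<lambda>w. vector [Im (u w * P' w + v w * P w), Im (u w * Q' w + v w * Q w)])
        (\<lambda>w. Im (u w * L' w + v w * L w + 2 * (P w * P' w + Q w * Q' w)))"
      by (rule sphere_fn_cong[OF sphere_fn_add[OF ri ir]])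
         (simp_all add: vec_eq_iff forall_2 inner_vec2 algebra_simps)
  qed
qed

section \<open>Complex coordinates and monomials on the sphere\<close>

definition zeta :: "3 \<Rightarrow> real \<Rightarrow> real^2 \<Rightarrow> complex" where
  "zeta i e w = Complex (stereo w $ nxt i) (e * stereo w $ nxt (nxt i))"

definition zeta_part :: "3 \<Rightarrow> real \<Rightarrow> 2 \<Rightarrow> real^2 \<Rightarrow> complex" where
  "zeta_part i e k w = Complex ((lam w)\<^sup>2 * sgrad (nxt i) w $ k) (e * ((lam w)\<^sup>2 * sgrad (nxt (nxt i)) w $ k))"

definition height :: "3 \<Rightarrow> real^2 \<Rightarrow> complex" where
  "height i w = complex_of_real (stereo w $ i)"

definition height_part :: "3 \<Rightarrow> 2 \<Rightarrow> real^2 \<Rightarrow> complex" where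
  "height_part i k w = complex_of_real ((lam w)\<^sup>2 * sgrad i w $ k)"

definition clam :: "real^2 \<Rightarrow> complex" where
  "clam w = complex_of_real ((lam w)\<^sup>2)"

lemma csphere_zeta: "csphere (zeta i e) (zeta_part i e 1) (zeta_part i e 2) (\<lambda>w. - 2 * clam w * zeta i e w)"
  unfolding csphere_def
proof
  show "sphere_fn (\<lambda>w. Re (zeta i e w)) (\<lambda>w. vector [Re (zeta_part i e 1 w), Re (zeta_part i e 2 w)])
      (\<lambda>w. Re (- 2 * clam w * zeta i e w))"
    by (rule sphere_fn_cong[OF sphere_fn_stereo[of "nxt i"]])
       (simp_all add: zeta_def zeta_part_def clam_def vec_eq_iff forall_2 Complex_eq)
  show "sphere_fn (\<lambda>w. Im (zeta i e w)) (\<lambda>w. vector [Im (zeta_part i e 1 w), Im (zeta_part i e 2 w)])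
      (\<lambda>w. Im (- 2 * clam w * zeta i e w))"
    by (rule sphere_fn_cong[OF sphere_fn_cmult[OF sphere_fn_stereo[of "nxt (nxt i)"], of e]])
       (simp_all add: zeta_def zeta_part_def clam_def vec_eq_iff forall_2 Complex_eq)
qed

lemma csphere_height: "csphere (height i) (height_part i 1) (height_part i 2) (\<lambda>w. - 2 * clam w * height i w)"
  unfolding csphere_def
proof
  show "sphere_fn (\<lambda>w. Re (height i w)) (\<lambda>w. vector [Re (height_part i 1 w), Re (height_part i 2 w)])
      (\<lambda>w. Re (- 2 * clam w * height i w))"
    by (rule sphere_fn_cong[OF sphere_fn_stereo[of i]])
       (simp_all add: height_def height_part_def clam_def vec_eq_iff forall_2)
  show "sphere_fn (\<lambda>w. Im (height i w)) (\<lambda>w. vector [Im (height_part i 1 w), Im (height_part i 2 w)])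
      (\<lambda>w. Im (- 2 * clam w * height i w))"
    by (rule sphere_fn_cong[OF sphere_fn_const[of 0]])
       (simp_all add: height_def height_part_def clam_def vec_eq_iff forall_2)
qed

lemma nxt_simps: "nxt 1 = 2" "nxt 2 = 3" "nxt 3 = 1"
  by (simp_all add: nxt_def)

lemma nxt_neq: "nxt i \<noteq> i" "nxt (nxt i) \<noteq> i" "nxt (nxt i) \<noteq> nxt i"
  using exhaust_3[of i] by (auto simp: nxt_simps)

lemma stereo_sum_squares: "(stereo w $ i)\<^sup>2 + (stereo w $ nxt i)\<^sup>2 + (stereo w $ nxt (nxt i))\<^sup>2 = 1"
proof -
  define x y a where "x = w $ 1" and "y = w $ 2" and "a = lam w"
  have l: "a * (x\<^sup>2 + y\<^sup>2) = 2 - a" using lam_eq[of w] by (simp add: x_def y_def a_def algebra_simps)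
  have "(1 - a)\<^sup>2 + (a * x)\<^sup>2 + (a * y)\<^sup>2 = 1" using l by algebra
  then show ?thesis
    using exhaust_3[of i] by (auto simp: nxt_simps stereo_nth x_def y_def a_def)
qed

text \<open>Spherical gradients of the coordinates are the tangential projections of the axes, so
  their Gram matrix is the identity minus the outer square of the position vector.\<close>

lemma sgrad_inner:
  "(lam w)\<^sup>2 * (sgrad p w $ 1 * sgrad q w $ 1 + sgrad p w $ 2 * sgrad q w $ 2) = (if p = q then 1 else 0) - stereo w $ p * stereo w $ q"
proof -
  define x y a where "x = w $ 1" and "y = w $ 2" and "a = lam w"
  have l: "a * (x\<^sup>2 + y\<^sup>2) = 2 - a" using lam_eq[of w] by (simp add: x_def y_def a_def algebra_simps)
  define X Y Z where "X = (1 + y\<^sup>2 - x\<^sup>2) / 2" and "Y = (1 + x\<^sup>2 - y\<^sup>2) / 2" and "Z = - (x * y)"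
  have XY: "2 * X = 1 + y\<^sup>2 - x\<^sup>2" "2 * Y = 1 + x\<^sup>2 - y\<^sup>2" "Z = - (x * y)" by (simp_all add: X_def Y_def Z_def)
  note simps = sgrad_nth stereo_nth x_def[symmetric] y_def[symmetric] a_def[symmetric] X_def[symmetric] Y_def[symmetric] Z_def[symmetric]
  have e: "a\<^sup>2 * (x * x + y * y) = 1 - (1 - a) * (1 - a)"
    "a\<^sup>2 * (x * X + y * Z) = 0 - (1 - a) * (a * x)" "a\<^sup>2 * (x * Z + y * Y) = 0 - (1 - a) * (a * y)"
    "a\<^sup>2 * (X * X + Z * Z) = 1 - (a * x) * (a * x)" "a\<^sup>2 * (Z * Z + Y * Y) = 1 - (a * y) * (a * y)"
    "a\<^sup>2 * (X * Z + Z * Y) = 0 - (a * x) * (a * y)"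
    "a\<^sup>2 * (X * x + Z * y) = 0 - (a * x) * (1 - a)" "a\<^sup>2 * (Z * x + Y * y) = 0 - (a * y) * (1 - a)"
    "a\<^sup>2 * (Z * X + Y * Z) = 0 - (a * y) * (a * x)"
    using l XY by - algebra+
  have ne: "(1::3) \<noteq> 2" "(1::3) \<noteq> 3" "(2::3) \<noteq> 3" "(2::3) \<noteq> 1" "(3::3) \<noteq> 1" "(3::3) \<noteq> 2" by simp_all
  consider "p = 1" "q = 1" | "p = 1" "q = 2" | "p = 1" "q = 3" | "p = 2" "q = 1" | "p = 2" "q = 2" | "p = 2" "q = 3"
    | "p = 3" "q = 1" | "p = 3" "q = 2" | "p = 3" "q = 3"
    using exhaust_3[of p] exhaust_3[of q] by blast
  then show ?thesis
    by cases (simp_all only: simps e ne if_True if_False simp_thms)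
qed

text \<open>The coefficient vector (1, i e) is isotropic for the bilinear product because
  \<open>e\<^sup>2 = 1\<close>, so the identity part of the Gram matrix cancels in the first
  relation; in the second it vanishes since the axes are orthogonal.\<close>

lemma zeta_relations:
  assumes e: "e\<^sup>2 = 1"
  shows "zeta_part i e 1 w * zeta_part i e 1 w + zeta_part i e 2 w * zeta_part i e 2 w = - (clam w * zeta i e w * zeta i e w)"
    and "zeta_part i e 1 w * height_part i 1 w + zeta_part i e 2 w * height_part i 2 w = - (clam w * zeta i e w * height i w)"
    and "height_part i 1 w * height_part i 1 w + height_part i 2 w * height_part i 2 w = clam w * (1 - height i w * height i w)"
proof -
  define l where "l = (lam w)\<^sup>2"
  define p1 p2 q1 q2 r1 r2 s t z where "p1 = sgrad (nxt i) w $ 1" and "p2 = sgrad (nxt i) w $ 2"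
    and "q1 = sgrad (nxt (nxt i)) w $ 1" and "q2 = sgrad (nxt (nxt i)) w $ 2"
    and "r1 = sgrad i w $ 1" and "r2 = sgrad i w $ 2"
    and "s = stereo w $ nxt i" and "t = stereo w $ nxt (nxt i)" and "z = stereo w $ i"
  note d = this l_def
  have pp: "l * (p1 * p1 + p2 * p2) = 1 - s * s" and qq: "l * (q1 * q1 + q2 * q2) = 1 - t * t"
    and rr: "l * (r1 * r1 + r2 * r2) = 1 - z * z" and pq: "l * (p1 * q1 + p2 * q2) = - (s * t)"
    and pr: "l * (p1 * r1 + p2 * r2) = - (s * z)" and qr: "l * (q1 * r1 + q2 * r2) = - (t * z)"
    using sgrad_inner[of w "nxt i" "nxt i"] sgrad_inner[of w "nxt (nxt i)" "nxt (nxt i)"] sgrad_inner[of w i i]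
      sgrad_inner[of w "nxt i" "nxt (nxt i)"] sgrad_inner[of w "nxt i" i] sgrad_inner[of w "nxt (nxt i)" i] nxt_neq[of i]
    by (simp_all add: d)
  have "(l * p1 * (l * p1) - (e * (l * q1)) * (e * (l * q1))) + (l * p2 * (l * p2) - (e * (l * q2)) * (e * (l * q2))) = - (l * s * s - l * (e * t) * (e * t))"
    "l * p1 * (e * (l * q1)) + e * (l * q1) * (l * p1) + (l * p2 * (e * (l * q2)) + e * (l * q2) * (l * p2)) = - (l * s * (e * t) + l * (e * t) * s)"
    using pp qq pq e[symmetric] by - algebra+
  then show "zeta_part i e 1 w * zeta_part i e 1 w + zeta_part i e 2 w * zeta_part i e 2 w = - (clam w * zeta i e w * zeta i e w)"
    unfolding zeta_part_def zeta_def clam_def d[symmetric] by (simp add: complex_eq_iff)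
  have "l * p1 * (l * r1) + l * p2 * (l * r2) = - (l * s * z)"
    "e * (l * q1) * (l * r1) + e * (l * q2) * (l * r2) = - (l * (e * t) * z)"
    using pr qr by - algebra+
  then show "zeta_part i e 1 w * height_part i 1 w + zeta_part i e 2 w * height_part i 2 w = - (clam w * zeta i e w * height i w)"
    unfolding zeta_part_def zeta_def clam_def height_def height_part_def d[symmetric] by (simp add: complex_eq_iff)
  have "l * r1 * (l * r1) + l * r2 * (l * r2) = l * (1 - z * z)"
    using rr by algebra
  then show "height_part i 1 w * height_part i 1 w + height_part i 2 w * height_part i 2 w = clam w * (1 - height i w * height i w)"
    unfolding clam_def height_def height_part_def d[symmetric] by (simp add: complex_eq_iff)
qed

text \<open>A power of an isotropic linear form is a harmonic polynomial, so
  \<open>zeta i e w ^ m\<close> is a spherical harmonic of degree \<open>m\<close>, with eigenvalue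
  -m(m + 1).\<close>

lemma csphere_zeta_power:
  assumes e: "e\<^sup>2 = 1"
  shows "csphere (\<lambda>w. zeta i e w ^ m) (\<lambda>w. of_nat m * zeta i e w ^ (m - 1) * zeta_part i e 1 w)
    (\<lambda>w. of_nat m * zeta i e w ^ (m - 1) * zeta_part i e 2 w) (\<lambda>w. clam w * (- (of_nat m * (of_nat m + 1)) * zeta i e w ^ m))"
proof (induction m)
  case 0
  show ?case by (rule csphere_cong[OF csphere_one]) simp_all
next
  case (Suc m)
  show ?case
  proof (rule csphere_cong[OF csphere_mult[OF Suc csphere_zeta]])
    fix w
    \<comment> \<open>For \<open>m = 0\<close> the exponent is truncated, and the vanishing factor
      \<open>of_nat m\<close> makes the identity true there as well.\<close>
    have p: "of_nat m * zeta i e w ^ (m - 1) * zeta i e w = of_nat m * zeta i e w ^ m" by (cases m) simp_all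
    show "zeta i e w ^ m * zeta i e w = zeta i e w ^ Suc m" by simp
    have g: "zeta i e w ^ m * zeta_part i e k w + zeta i e w * (of_nat m * zeta i e w ^ (m - 1) * zeta_part i e k w) =
        of_nat (Suc m) * zeta i e w ^ (Suc m - 1) * zeta_part i e k w" for k
      by (cases m) (simp_all add: algebra_simps)
    show "zeta i e w ^ m * zeta_part i e 1 w + zeta i e w * (of_nat m * zeta i e w ^ (m - 1) * zeta_part i e 1 w) =
        of_nat (Suc m) * zeta i e w ^ (Suc m - 1) * zeta_part i e 1 w" by (rule g)
    show "zeta i e w ^ m * zeta_part i e 2 w + zeta i e w * (of_nat m * zeta i e w ^ (m - 1) * zeta_part i e 2 w) =
        of_nat (Suc m) * zeta i e w ^ (Suc m - 1) * zeta_part i e 2 w" by (rule g)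
    note r = zeta_relations(1)[OF e, of i w]
    define A a x M l P Q where "A = zeta i e w" and "a = zeta i e w ^ m" and "x = zeta i e w ^ (m - 1)" and "M = (of_nat m :: complex)"
      and "l = clam w" and "P = zeta_part i e 1 w" and "Q = zeta_part i e 2 w"
    note d = this
    have "M * x * A = M * a" "P * P + Q * Q = - (l * A * A)" using p r by (simp_all add: d)
    then have "a * (- 2 * l * A) + A * (l * (- (M * (M + 1)) * a)) + 2 * (M * x * P * P + M * x * Q * Q) = l * (- ((M + 1) * (M + 1 + 1)) * (A * a))"
      by algebra
    then show "zeta i e w ^ m * (- 2 * clam w * zeta i e w) + zeta i e w * (clam w * (- (of_nat m * (of_nat m + 1)) * zeta i e w ^ m)) +
        2 * (of_nat m * zeta i e w ^ (m - 1) * zeta_part i e 1 w * zeta_part i e 1 w + of_nat m * zeta i e w ^ (m - 1) * zeta_part i e 2 w * zeta_part i e 2 w)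
      = clam w * (- (of_nat (Suc m) * (of_nat (Suc m) + 1)) * zeta i e w ^ Suc m)"
      unfolding d by (simp add: add.commute)
  qed
qed

text \<open>The Laplacian reproduces the monomial and adds one with the same power of
  \<open>zeta i e\<close> and the power of \<open>height i\<close> lowered by two. So the moments
  obey a two-step recursion in \<open>k\<close> with \<open>m\<close> fixed. Truncated exponents
  occur only with factors that vanish at them.\<close>

lemma csphere_monomial:
  assumes e: "e\<^sup>2 = 1"
  shows "csphere (\<lambda>w. zeta i e w ^ m * height i w ^ k)
    (\<lambda>w. of_nat m * zeta i e w ^ (m - 1) * height i w ^ k * zeta_part i e 1 w + of_nat k * zeta i e w ^ m * height i w ^ (k - 1) * height_part i 1 w)
    (\<lambda>w. of_nat m * zeta i e w ^ (m - 1) * height i w ^ k * zeta_part i e 2 w + of_nat k * zeta i e w ^ m * height i w ^ (k - 1) * height_part i 2 w)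
    (\<lambda>w. clam w * (- ((of_nat m + of_nat k) * (of_nat m + of_nat k + 1)) * (zeta i e w ^ m * height i w ^ k) +
        of_nat k * (of_nat k - 1) * (zeta i e w ^ m * height i w ^ (k - 2))))"
proof (induction k)
  case 0
  show ?case by (rule csphere_cong[OF csphere_zeta_power[OF e, of i m]]) simp_all
next
  case (Suc k)
  show ?case
  proof (rule csphere_cong[OF csphere_mult[OF Suc csphere_height]])
    fix w
    have m: "of_nat m * zeta i e w ^ (m - 1) * zeta i e w = of_nat m * zeta i e w ^ m" by (cases m) simp_all
    have k: "of_nat k * height i w ^ (k - 1) * height i w = of_nat k * height i w ^ k" by (cases k) simp_all
    have k': "of_nat k * (of_nat k - 1) * height i w ^ (k - 2) * height i w = of_nat k * (of_nat k - 1) * height i w ^ (k - 1)"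
      by (cases k; cases "k - 1") simp_all
    show "zeta i e w ^ m * height i w ^ k * height i w = zeta i e w ^ m * height i w ^ Suc k" by simp
    define A B a x b y t M K l where "A = zeta i e w" and "B = height i w" and "a = zeta i e w ^ m" and "x = zeta i e w ^ (m - 1)"
      and "b = height i w ^ k" and "y = height i w ^ (k - 1)" and "t = height i w ^ (k - 2)"
      and "M = (of_nat m :: complex)" and "K = (of_nat k :: complex)" and "l = clam w"
    note d = this
    have h: "M * x * A = M * a" "K * y * B = K * b" "K * (K - 1) * t * B = K * (K - 1) * y" using m k k' by (simp_all add: d)
    have "a * b * H + B * (M * x * b * P + K * a * y * H) = M * x * (B * b) * P + (K + 1) * a * b * H" for P H
      using h by algebra
    then have g: "zeta i e w ^ m * height i w ^ k * height_part i j w +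
        height i w * (of_nat m * zeta i e w ^ (m - 1) * height i w ^ k * zeta_part i e j w + of_nat k * zeta i e w ^ m * height i w ^ (k - 1) * height_part i j w) =
        of_nat m * zeta i e w ^ (m - 1) * height i w ^ Suc k * zeta_part i e j w + of_nat (Suc k) * zeta i e w ^ m * height i w ^ (Suc k - 1) * height_part i j w" for j
      unfolding d by (simp add: add.commute)
    show "zeta i e w ^ m * height i w ^ k * height_part i 1 w +
        height i w * (of_nat m * zeta i e w ^ (m - 1) * height i w ^ k * zeta_part i e 1 w + of_nat k * zeta i e w ^ m * height i w ^ (k - 1) * height_part i 1 w) =
        of_nat m * zeta i e w ^ (m - 1) * height i w ^ Suc k * zeta_part i e 1 w + of_nat (Suc k) * zeta i e w ^ m * height i w ^ (Suc k - 1) * height_part i 1 w"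
      by (rule g)
    show "zeta i e w ^ m * height i w ^ k * height_part i 2 w +
        height i w * (of_nat m * zeta i e w ^ (m - 1) * height i w ^ k * zeta_part i e 2 w + of_nat k * zeta i e w ^ m * height i w ^ (k - 1) * height_part i 2 w) =
        of_nat m * zeta i e w ^ (m - 1) * height i w ^ Suc k * zeta_part i e 2 w + of_nat (Suc k) * zeta i e w ^ m * height i w ^ (Suc k - 1) * height_part i 2 w"
      by (rule g)
    define P Q S T where "P = zeta_part i e 1 w" and "Q = zeta_part i e 2 w" and "S = height_part i 1 w" and "T = height_part i 2 w"
    note d = d this
    have "P * S + Q * T = - (l * A * B)" "S * S + T * T = l * (1 - B * B)"
      using zeta_relations(2,3)[OF e, of i w] by (simp_all add: d)
    with h have "a * b * (- 2 * l * B) + B * (l * (- ((M + K) * (M + K + 1)) * (a * b) + K * (K - 1) * (a * t))) +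
        2 * ((M * x * b * P + K * a * y * S) * S + (M * x * b * Q + K * a * y * T) * T) =
      l * (- ((M + (K + 1)) * (M + (K + 1) + 1)) * (a * (B * b)) + (K + 1) * (K + 1 - 1) * (a * y))"
      by algebra
    then show "zeta i e w ^ m * height i w ^ k * (- 2 * clam w * height i w) +
        height i w * (clam w * (- ((of_nat m + of_nat k) * (of_nat m + of_nat k + 1)) * (zeta i e w ^ m * height i w ^ k) +
          of_nat k * (of_nat k - 1) * (zeta i e w ^ m * height i w ^ (k - 2)))) +
        2 * ((of_nat m * zeta i e w ^ (m - 1) * height i w ^ k * zeta_part i e 1 w + of_nat k * zeta i e w ^ m * height i w ^ (k - 1) * height_part i 1 w) * height_part i 1 w +
          (of_nat m * zeta i e w ^ (m - 1) * height i w ^ k * zeta_part i e 2 w + of_nat k * zeta i e w ^ m * height i w ^ (k - 1) * height_part i 2 w) * height_part i 2 w) =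
      clam w * (- ((of_nat m + of_nat (Suc k)) * (of_nat m + of_nat (Suc k) + 1)) * (zeta i e w ^ m * height i w ^ Suc k) +
          of_nat (Suc k) * (of_nat (Suc k) - 1) * (zeta i e w ^ m * height i w ^ (Suc k - 2)))"
    proof -
      have "(of_nat (Suc k) :: complex) = K + 1" "height i w ^ Suc k = B * b" "height i w ^ (Suc k - 2) = y"
        by (simp_all add: d)
      then show ?thesis using \<open>a * b * (- 2 * l * B) + _ + _ = _\<close> unfolding d by (simp only:)
    qed
  qed
qed

subsection \<open>Moments\<close>

lemma integral_Complex_mult:
  assumes "integrable lborel (\<lambda>w. f w * a w)" "integrable lborel (\<lambda>w. f w * b w)"
    and "integrable lborel (\<lambda>w. h w * a w)" "integrable lborel (\<lambda>w. h w * b w)"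
  shows "(LINT w|lborel. Complex (f w) (h w) * Complex (a w) (b w)) =
    Complex ((LINT w|lborel. f w * a w) - (LINT w|lborel. h w * b w)) ((LINT w|lborel. f w * b w) + (LINT w|lborel. h w * a w))"
proof -
  have "Complex (f w) (h w) * Complex (a w) (b w) =
      complex_of_real (f w * a w - h w * b w) + \<i> * complex_of_real (f w * b w + h w * a w)" for w
    by (simp add: complex_eq_iff)
  moreover
  have "integrable lborel (\<lambda>w. f w * a w - h w * b w)" "integrable lborel (\<lambda>w. f w * b w + h w * a w)"
    using assms by simp_all
  then have J: "integrable lborel (\<lambda>w. complex_of_real (f w * a w - h w * b w))"
      "integrable lborel (\<lambda>w. complex_of_real (f w * b w + h w * a w))"
    by - (rule integrable_of_real, assumption)+
  ultimately have "(LINT w|lborel. Complex (f w) (h w) * Complex (a w) (b w)) =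
      complex_of_real (LINT w|lborel. f w * a w - h w * b w) + \<i> * complex_of_real (LINT w|lborel. f w * b w + h w * a w)"
    using Bochner_Integration.integral_add[OF J(1) integrable_mult_right[OF J(2), of \<i>]]
    by (simp only: integral_mult_right_zero integral_complex_of_real simp_thms)
  then show ?thesis
    using assms by (simp add: complex_eq_iff)
qed

text \<open>Integrability is with respect to spherical area: constants and coordinate functions have
  to be subtracted from a null pair, and these are not square integrable on the plane.\<close>

definition npair :: "3 \<Rightarrow> (real^2 \<Rightarrow> real) \<Rightarrow> (real^2 \<Rightarrow> real) \<Rightarrow> bool" where
  "npair i f h \<longleftrightarrow> null_pair i f h \<and> f \<in> borel_measurable borel \<and> h \<in> borel_measurable borel \<and>
     integrable lborel (\<lambda>w. (lam w)\<^sup>2 * f w) \<and> integrable lborel (\<lambda>w. (lam w)\<^sup>2 * h w)"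

lemma npair_add:
  assumes "npair i f h" "npair i f' h'"
  shows "npair i (\<lambda>w. f w + c * f' w) (\<lambda>w. h w + c * h' w)"
proof -
  note a = assms[unfolded npair_def]
  have n: "null_pair i (\<lambda>w. f w + c * f' w) (\<lambda>w. h w + c * h' w)"
    by (rule null_pair_add) (use a in simp_all)
  have lin: "integrable lborel (\<lambda>w. (lam w)\<^sup>2 * (g w + c * g' w))"
    if "integrable lborel (\<lambda>w. (lam w)\<^sup>2 * g w)" "integrable lborel (\<lambda>w. (lam w)\<^sup>2 * g' w)" for g g'
  proof -
    have "(\<lambda>w. (lam w)\<^sup>2 * (g w + c * g' w)) = (\<lambda>w. (lam w)\<^sup>2 * g w + c * ((lam w)\<^sup>2 * g' w))"
      by (simp add: fun_eq_iff algebra_simps)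
    then show ?thesis
      using Bochner_Integration.integrable_add[OF that(1) integrable_mult_right[OF that(2), of c]] by simp
  qed
  have m: "(\<lambda>w. g w + c * g' w) \<in> borel_measurable borel"
    if "g \<in> borel_measurable borel" "g' \<in> borel_measurable borel" for g g' :: "real^2 \<Rightarrow> real"
    using that by measurable
  show ?thesis unfolding npair_def using n lin m a by blast
qed

lemma npair_const: "npair i (\<lambda>_. a) (\<lambda>_. b)"
  unfolding npair_def using null_pair_const[of i a b] integrable_lam_squared by simp

lemma npair_stereo:
  "npair i (\<lambda>w. stereo w $ nxt i) (\<lambda>w. - stereo w $ nxt (nxt i))"
  "npair i (\<lambda>w. stereo w $ nxt (nxt i)) (\<lambda>w. stereo w $ nxt i)"
proof -
  have "(\<lambda>w. stereo w $ j) \<in> borel_measurable borel" "integrable lborel (\<lambda>w. (lam w)\<^sup>2 * stereo w $ j)" for j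
    using sphere_fn_measurable(1)[OF sphere_fn_stereo] sphere_fn_integrable[OF sphere_fn_stereo] by blast+
  then show "npair i (\<lambda>w. stereo w $ nxt i) (\<lambda>w. - stereo w $ nxt (nxt i))"
    "npair i (\<lambda>w. stereo w $ nxt (nxt i)) (\<lambda>w. stereo w $ nxt i)"
    unfolding npair_def using null_pair_stereo[of i] by simp_all
qed

definition cturn :: "3 \<Rightarrow> (real^2 \<Rightarrow> complex) \<Rightarrow> (real^2 \<Rightarrow> complex) \<Rightarrow> real^2 \<Rightarrow> complex" where
  "cturn i P Q w = clam w * (of_real (sfield i w $ 1) * P w + of_real (sfield i w $ 2) * Q w)"

text \<open>The two real equations are the real and imaginary parts of one complex equation for real
  tests, and complex linearity extends it to complex tests.\<close>

lemma npair_csphere: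
  assumes np: "npair i f h" and u: "csphere u P Q L"
  shows "(LINT w|lborel. Complex (f w) (h w) * L w) = 2 * \<i> * (LINT w|lborel. Complex (f w) (h w) * cturn i P Q w)"
proof -
  note n = np[unfolded npair_def]
  define \<Phi> \<Psi> where "\<Phi> w = (vector [Re (P w), Re (Q w)] :: real^2)" and "\<Psi> w = (vector [Im (P w), Im (Q w)] :: real^2)" for w
  have re: "sphere_fn (\<lambda>w. Re (u w)) \<Phi> (\<lambda>w. Re (L w))" and im: "sphere_fn (\<lambda>w. Im (u w)) \<Psi> (\<lambda>w. Im (L w))"
    using u unfolding csphere_def \<Phi>_def[abs_def] \<Psi>_def[abs_def] by blast+
  have int: "integrable lborel (\<lambda>w. g w * M w)" "integrable lborel (\<lambda>w. g w * turn i X w)"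
    if s: "sphere_fn v X M" and g: "integrable lborel (\<lambda>w. (lam w)\<^sup>2 * g w)" "g \<in> borel_measurable borel" for v X M g
  proof -
    obtain K where K: "\<And>w. norm (X w) \<le> K * lam w \<and> \<bar>M w\<bar> \<le> K * (lam w)\<^sup>2" using sphere_fn_bounded[OF s] by blast
    show "integrable lborel (\<lambda>w. g w * M w)"
      by (rule integrable_sphere_mult[OF g sphere_fn_measurable(2)[OF s] conjunct2[OF K]])
    show "integrable lborel (\<lambda>w. g w * turn i X w)"
      by (rule integrable_sphere_mult[OF g sphere_fn_measurable(3)[OF s] turn_bound[OF conjunct1[OF K]]])
  qed
  have f: "integrable lborel (\<lambda>w. (lam w)\<^sup>2 * f w)" "f \<in> borel_measurable borel"
    and h: "integrable lborel (\<lambda>w. (lam w)\<^sup>2 * h w)" "h \<in> borel_measurable borel" using n by blast+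
  have e: "(LINT w|lborel. f w * M w) = - 2 * (LINT w|lborel. h w * turn i X w)" "(LINT w|lborel. h w * M w) = 2 * (LINT w|lborel. f w * turn i X w)"
    if "sphere_fn v X M" for v X M
    using n that unfolding null_pair_def by blast+
  have L: "L w = Complex (Re (L w)) (Im (L w))" for w by simp
  have T: "cturn i P Q w = Complex (turn i \<Phi> w) (turn i \<Psi> w)" for w
    by (simp add: cturn_def turn_def clam_def \<Phi>_def \<Psi>_def inner_vec2 complex_eq_iff)
  have "(LINT w|lborel. Complex (f w) (h w) * L w) = (LINT w|lborel. Complex (f w) (h w) * Complex (Re (L w)) (Im (L w)))"
    by simp
  also have "\<dots> = Complex ((LINT w|lborel. f w * Re (L w)) - (LINT w|lborel. h w * Im (L w))) ((LINT w|lborel. f w * Im (L w)) + (LINT w|lborel. h w * Re (L w)))"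
    by (rule integral_Complex_mult[OF int(1)[OF re f] int(1)[OF im f] int(1)[OF re h] int(1)[OF im h]])
  also have "\<dots> = 2 * \<i> * Complex ((LINT w|lborel. f w * turn i \<Phi> w) - (LINT w|lborel. h w * turn i \<Psi> w)) ((LINT w|lborel. f w * turn i \<Psi> w) + (LINT w|lborel. h w * turn i \<Phi> w))"
    unfolding e[OF re] e[OF im] by (simp add: complex_eq_iff)
  also have "\<dots> = 2 * \<i> * (LINT w|lborel. Complex (f w) (h w) * cturn i P Q w)"
    unfolding T integral_Complex_mult[OF int(2)[OF re f] int(2)[OF im f] int(2)[OF re h] int(2)[OF im h]] ..
  finally show ?thesis .
qed

lemma sfield_zeta:
  assumes e: "e\<^sup>2 = 1"
  shows "of_real (sfield i w $ 1) * zeta_part i e 1 w + of_real (sfield i w $ 2) * zeta_part i e 2 w = \<i> * of_real e * zeta i e w"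
    and "of_real (sfield i w $ 1) * height_part i 1 w + of_real (sfield i w $ 2) * height_part i 2 w = 0"
proof -
  have l: "(lam w)\<^sup>2 \<noteq> 0" using lam_pos[of w] by simp
  have t: "turn i (\<lambda>w. (lam w)\<^sup>2 *\<^sub>R sgrad j w) w =
      (lam w)\<^sup>2 * (sfield i w $ 1 * ((lam w)\<^sup>2 * sgrad j w $ 1) + sfield i w $ 2 * ((lam w)\<^sup>2 * sgrad j w $ 2))" for j
    by (simp add: turn_def inner_vec2)
  have 1: "sfield i w $ 1 * ((lam w)\<^sup>2 * sgrad i w $ 1) + sfield i w $ 2 * ((lam w)\<^sup>2 * sgrad i w $ 2) = 0"
    using turn_stereo(1)[of i w] l unfolding t by simp
  have 2: "sfield i w $ 1 * ((lam w)\<^sup>2 * sgrad (nxt i) w $ 1) + sfield i w $ 2 * ((lam w)\<^sup>2 * sgrad (nxt i) w $ 2) = - stereo w $ nxt (nxt i)"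
  proof -
    have "(lam w)\<^sup>2 * (sfield i w $ 1 * ((lam w)\<^sup>2 * sgrad (nxt i) w $ 1) + sfield i w $ 2 * ((lam w)\<^sup>2 * sgrad (nxt i) w $ 2)) = (lam w)\<^sup>2 * (- stereo w $ nxt (nxt i))"
      using turn_stereo(2)[of i w] unfolding t by simp
    then show ?thesis using l by (simp only: mult_cancel_left simp_thms)
  qed
  have 3: "sfield i w $ 1 * ((lam w)\<^sup>2 * sgrad (nxt (nxt i)) w $ 1) + sfield i w $ 2 * ((lam w)\<^sup>2 * sgrad (nxt (nxt i)) w $ 2) = stereo w $ nxt i"
  proof -
    have "(lam w)\<^sup>2 * (sfield i w $ 1 * ((lam w)\<^sup>2 * sgrad (nxt (nxt i)) w $ 1) + sfield i w $ 2 * ((lam w)\<^sup>2 * sgrad (nxt (nxt i)) w $ 2)) = (lam w)\<^sup>2 * (stereo w $ nxt i)"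
      using turn_stereo(3)[of i w] unfolding t by simp
    then show ?thesis using l by (simp only: mult_cancel_left simp_thms)
  qed
  define a b p p' q q' s t where "a = sfield i w $ 1" and "b = sfield i w $ 2" and "p = (lam w)\<^sup>2 * sgrad (nxt i) w $ 1" and "p' = (lam w)\<^sup>2 * sgrad (nxt i) w $ 2"
    and "q = (lam w)\<^sup>2 * sgrad (nxt (nxt i)) w $ 1" and "q' = (lam w)\<^sup>2 * sgrad (nxt (nxt i)) w $ 2" and "s = stereo w $ nxt i" and "t = stereo w $ nxt (nxt i)"
  note d = this
  have "a * p + b * p' = - t" "a * q + b * q' = s" using 2 3 by (simp_all add: d)
  then have "a * p + b * p' = - (e * (e * t))" "a * (e * q) + b * (e * q') = e * s" using e[symmetric] by - algebra+
  then show "of_real (sfield i w $ 1) * zeta_part i e 1 w + of_real (sfield i w $ 2) * zeta_part i e 2 w = \<i> * of_real e * zeta i e w"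
    unfolding zeta_part_def zeta_def d[symmetric] by (simp add: complex_eq_iff)
  show "of_real (sfield i w $ 1) * height_part i 1 w + of_real (sfield i w $ 2) * height_part i 2 w = 0"
    unfolding height_part_def using 1 by (simp flip: of_real_mult of_real_add)
qed

lemma zeta_measurable [measurable]: "zeta i e \<in> borel_measurable borel" "height i \<in> borel_measurable borel"
proof -
  have "continuous_on UNIV (\<lambda>w. stereo w $ j)" for j
    using sphere_fnD(2)[OF sphere_fn_stereo] by blast
  then show "zeta i e \<in> borel_measurable borel" "height i \<in> borel_measurable borel"
    unfolding zeta_def[abs_def] height_def[abs_def] Complex_eq by (intro borel_measurable_continuous_onI continuous_intros; simp)+
qed

lemma norm_zeta_le: "e\<^sup>2 = 1 \<Longrightarrow> norm (zeta i e w) \<le> 1" and norm_height_le: "norm (height i w) \<le> 1"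
proof -
  assume e: "e\<^sup>2 = 1"
  have "(stereo w $ nxt i)\<^sup>2 + (e * stereo w $ nxt (nxt i))\<^sup>2 \<le> 1"
    unfolding power_mult_distrib e using stereo_sum_squares[of w i] zero_le_power2[of "stereo w $ i"] by linarith
  then show "norm (zeta i e w) \<le> 1" by (simp add: zeta_def cmod_def)
next
  show "norm (height i w) \<le> 1" using stereo_bound[of w i] by (simp add: height_def)
qed

lemma norm_monomial_le: "e\<^sup>2 = 1 \<Longrightarrow> norm (zeta i e w ^ m * height i w ^ k) \<le> 1"
  by (simp add: norm_mult norm_power mult_le_one power_le_one norm_zeta_le norm_height_le)

lemma integrable_mult_bounded:
  fixes W g :: "real^2 \<Rightarrow> complex"
  assumes W: "integrable lborel W" and g: "g \<in> borel_measurable borel" "\<And>w. norm (g w) \<le> K"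
  shows "integrable lborel (\<lambda>w. W w * g w)"
proof (rule Bochner_Integration.integrable_bound)
  show "integrable lborel (\<lambda>w. K * norm (W w))" using integrable_norm[OF W] by simp
  show "(\<lambda>w. W w * g w) \<in> borel_measurable lborel"
    using borel_measurable_integrable[OF W] g(1) by measurable
  have "norm (W w * g w) \<le> norm (K * norm (W w))" for w
    using mult_left_mono[OF g(2)[of w] norm_ge_zero[of "W w"]] order_trans[OF norm_ge_zero g(2)[of w]]
    by (simp add: norm_mult abs_mult mult.commute)
  then show "AE w in lborel. norm (W w * g w) \<le> norm (K * norm (W w))" by simp
qed

definition cpair :: "(real^2 \<Rightarrow> real) \<Rightarrow> (real^2 \<Rightarrow> real) \<Rightarrow> real^2 \<Rightarrow> complex" where
  "cpair f h w = clam w * Complex (f w) (h w)"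

lemma cpair_integrable:
  assumes "npair i f h"
  shows "integrable lborel (cpair f h)"
proof -
  have "cpair f h = (\<lambda>w. complex_of_real ((lam w)\<^sup>2 * f w) + \<i> * complex_of_real ((lam w)\<^sup>2 * h w))"
    by (simp add: fun_eq_iff cpair_def clam_def complex_eq_iff)
  moreover have "integrable lborel (\<lambda>w. complex_of_real ((lam w)\<^sup>2 * f w) + \<i> * complex_of_real ((lam w)\<^sup>2 * h w))"
    using assms unfolding npair_def
    by (intro Bochner_Integration.integrable_add integrable_mult_right integrable_of_real) auto
  ultimately show ?thesis by simp
qed

text \<open>The rotation field multiplies the monomial by i e m, and the factor 2 i of the equation
  turns this into -2 e m, which joins the Laplace eigenvalue on the left.\<close>

lemma moment_recursion:
  assumes np: "npair i f h" and e: "e\<^sup>2 = 1"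
  shows "((of_nat m + of_nat k) * (of_nat m + of_nat k + 1) - 2 * of_real e * of_nat m) * (LINT w|lborel. cpair f h w * (zeta i e w ^ m * height i w ^ k)) =
    of_nat k * (of_nat k - 1) * (LINT w|lborel. cpair f h w * (zeta i e w ^ m * height i w ^ (k - 2)))"
proof -
  let ?N = "(of_nat m + of_nat k) * (of_nat m + of_nat k + 1) :: complex" and ?K = "of_nat k * (of_nat k - 1) :: complex"
  let ?M = "\<lambda>k w. zeta i e w ^ m * height i w ^ k"
  have int: "integrable lborel (\<lambda>w. cpair f h w * ?M k w)" for k
    by (rule integrable_mult_bounded[OF cpair_integrable[OF np] _ norm_monomial_le[OF e]]) measurable
  define P where "P j w = of_nat m * zeta i e w ^ (m - 1) * height i w ^ k * zeta_part i e j w + of_nat k * zeta i e w ^ m * height i w ^ (k - 1) * height_part i j w" for j w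
  have cs: "csphere (?M k) (P 1) (P 2) (\<lambda>w. clam w * (- ?N * ?M k w + ?K * ?M (k - 2) w))"
    using csphere_monomial[OF e, of i m k] unfolding P_def[abs_def] .
  have T: "cturn i (P 1) (P 2) w = clam w * (of_nat m * \<i> * of_real e * ?M k w)" for w
  proof -
    define A a x b y a1 b1 p p' q q' where "A = zeta i e w" and "a = zeta i e w ^ m" and "x = zeta i e w ^ (m - 1)" and "b = height i w ^ k" and "y = height i w ^ (k - 1)"
      and "a1 = complex_of_real (sfield i w $ 1)" and "b1 = complex_of_real (sfield i w $ 2)"
      and "p = zeta_part i e 1 w" and "p' = zeta_part i e 2 w" and "q = height_part i 1 w" and "q' = height_part i 2 w"
    note d = this
    define M E where "M = (of_nat m :: complex)" and "E = complex_of_real e"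
    note d = d this
    have "M * x * A = M * a" unfolding d by (cases m) simp_all
    moreover have "a1 * p + b1 * p' = \<i> * E * A" "a1 * q + b1 * q' = 0" using sfield_zeta[OF e, of i w] by (simp_all add: d)
    ultimately have "a1 * (M * x * b * p + of_nat k * a * y * q) + b1 * (M * x * b * p' + of_nat k * a * y * q') = M * \<i> * E * (a * b)"
      by algebra
    then show ?thesis unfolding cturn_def P_def d by simp
  qed
  have "(LINT w|lborel. Complex (f w) (h w) * (clam w * (- ?N * ?M k w + ?K * ?M (k - 2) w))) =
      2 * \<i> * (LINT w|lborel. Complex (f w) (h w) * (clam w * (of_nat m * \<i> * of_real e * ?M k w)))"
    using npair_csphere[OF np cs] unfolding T .
  moreover have "(\<lambda>w. Complex (f w) (h w) * (clam w * (- ?N * ?M k w + ?K * ?M (k - 2) w))) =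
      (\<lambda>w. - ?N * (cpair f h w * ?M k w) + ?K * (cpair f h w * ?M (k - 2) w))"
    by (rule ext) (simp only: cpair_def, algebra)
  moreover have "(\<lambda>w. Complex (f w) (h w) * (clam w * (of_nat m * \<i> * of_real e * ?M k w))) =
      (\<lambda>w. (of_nat m * \<i> * of_real e) * (cpair f h w * ?M k w))"
    by (rule ext) (simp only: cpair_def mult_ac)
  ultimately have "- ?N * (LINT w|lborel. cpair f h w * ?M k w) + ?K * (LINT w|lborel. cpair f h w * ?M (k - 2) w) =
      2 * \<i> * ((of_nat m * \<i> * of_real e) * (LINT w|lborel. cpair f h w * ?M k w))"
    using Bochner_Integration.integral_add[OF integrable_mult_right[OF int[of k], of "- ?N"] integrable_mult_right[OF int[of "k - 2"], of ?K]]
    by (simp only: integral_mult_right_zero)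
  moreover have "2 * \<i> * ((of_nat m * \<i> * of_real e) * X) = 2 * (\<i> * \<i>) * (of_real e * of_nat m * X)" for X
    by (simp only: mult_ac)
  ultimately have "- ?N * (LINT w|lborel. cpair f h w * ?M k w) + ?K * (LINT w|lborel. cpair f h w * ?M (k - 2) w) =
      2 * - 1 * (of_real e * of_nat m * (LINT w|lborel. cpair f h w * ?M k w))"
    by (simp only: i_squared)
  then show ?thesis by algebra
qed

lemma moments_vanish:
  assumes np: "npair i f h" and e: "e\<^sup>2 = 1"
    and zero: "(LINT w|lborel. cpair f h w) = 0" "(LINT w|lborel. cpair f h w * zeta i 1 w) = 0"
  shows "(LINT w|lborel. cpair f h w * (zeta i e w ^ m * height i w ^ k)) = 0"
proof (induction k rule: less_induct)
  case (less k)
  have e': "e = 1 \<or> e = - 1" using e by (simp add: power2_eq_1_iff)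
  \<comment> \<open>The first two cases are exactly the zeros of the recursion coefficient, and
    there the moment vanishes by assumption. For n = m + k at least 2 one has n (n + 1) > 2 n, which
    is at least 2 e m.\<close>
  consider "m = 0" "k = 0" | "m = 1" "k = 0" "e = 1" | "\<not> (m = 0 \<and> k = 0)" "\<not> (m = 1 \<and> k = 0 \<and> e = 1)" by blast
  then show ?case
  proof cases
    case 3
    have "(real m + real k) * (real m + real k + 1) - 2 * e * real m \<noteq> 0"
    proof (cases "m + k = 1")
      case True
      then have "m = 0 \<and> k = 1 \<or> m = 1 \<and> k = 0" by auto
      then show ?thesis using 3 e' by auto
    next
      case False
      define n where "n = real m + real k"
      have "2 \<le> m + k" using 3 False by linarith
      then have n: "2 \<le> n" "real m \<le> n" "0 \<le> real m" by (simp_all add: n_def)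
      have "2 * e * real m \<le> 2 * n" using e' n by auto
      also have "2 * n < n * (n + 1)" using n(1) mult_right_mono[of 2 n n] by (simp add: distrib_left)
      finally show ?thesis by (simp add: n_def)
    qed
    then have "complex_of_real ((real m + real k) * (real m + real k + 1) - 2 * e * real m) \<noteq> 0"
      by (simp only: of_real_eq_0_iff simp_thms)
    then have c: "(of_nat m + of_nat k) * (of_nat m + of_nat k + 1) - 2 * of_real e * of_nat m \<noteq> (0 :: complex)"
      by simp
    have "of_nat k * (of_nat k - 1) * (LINT w|lborel. cpair f h w * (zeta i e w ^ m * height i w ^ (k - 2))) = 0"
    proof (cases "k < 2")
      case True
      then have "k = 0 \<or> k = 1" by auto
      then show ?thesis by auto
    next
      case False
      then show ?thesis using less[of "k - 2"] by simp
    qed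
    then have "((of_nat m + of_nat k) * (of_nat m + of_nat k + 1) - 2 * of_real e * of_nat m) * (LINT w|lborel. cpair f h w * (zeta i e w ^ m * height i w ^ k)) = 0"
      using moment_recursion[OF np e, of m k] by (simp only:)
    then show ?thesis
      using c by (simp only: mult_eq_0_iff simp_thms)
  qed (use zero in simp_all)
qed

lemma integral_lam_squared_pos: "0 < (LINT w|lborel. (lam w)\<^sup>2)"
proof -
  have "0 < measure lborel (cball (0 :: real^2) 1)"
    using content_cball_pos[of 1 "0 :: real^2"] by simp
  also have "\<dots> = (LINT w|lborel. indicator (cball (0 :: real^2) 1) w)" by simp
  also have "\<dots> \<le> (LINT w|lborel. (lam w)\<^sup>2)"
  proof (rule integral_mono[OF _ integrable_lam_squared])
    show "integrable lborel (indicator (cball (0 :: real^2) 1) :: _ \<Rightarrow> real)" by (rule integrable_indicator_cball)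
    fix w
    have "1 \<le> lam w" if "norm w \<le> 1"
      using power_mono[OF that, of 2] one_plus_norm_pos[of w] by (simp add: lam_def)
    then show "indicator (cball (0 :: real^2) 1) w \<le> (lam w)\<^sup>2"
      by (auto simp: indicator_def)
  qed
  finally show ?thesis .
qed

lemma integral_sphere_Laplacian:
  assumes "sphere_fn \<phi> \<Phi> L"
  shows "(LINT w|lborel. L w) = 0"
  using Green_sphere[OF sphere_fn_const[of 1] assms] by simp

lemma integral_lam_stereo: "(LINT w|lborel. (lam w)\<^sup>2 * stereo w $ j) = 0"
proof -
  have "(LINT w|lborel. - 2 * ((lam w)\<^sup>2 * stereo w $ j)) = 0"
    using integral_sphere_Laplacian[OF sphere_fn_stereo[of j]] by (simp only: mult.assoc)
  then show ?thesis unfolding integral_mult_right_zero by simp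
qed

lemma integrable_lam_stereo_squared: "integrable lborel (\<lambda>w. (lam w)\<^sup>2 * (stereo w $ j)\<^sup>2)"
  using sphere_fn_integrable[OF sphere_fn_mult[OF sphere_fn_stereo sphere_fn_stereo], of j j] by (simp add: power2_eq_square)

text \<open>The Laplacian of a squared coordinate s is \<open>(lam w)\<^sup>2\<close> times 2 - 6
  s^2, and Laplacians integrate to 0. The value of the area itself never enters.\<close>

lemma integral_lam_stereo_squared: "3 * (LINT w|lborel. (lam w)\<^sup>2 * (stereo w $ j)\<^sup>2) = (LINT w|lborel. (lam w)\<^sup>2)"
proof -
  let ?s = "\<lambda>w. stereo w $ j" and ?g = "\<lambda>w. (lam w)\<^sup>2 *\<^sub>R sgrad j w"
  have "?s w * (- 2 * (lam w)\<^sup>2 * ?s w) + ?s w * (- 2 * (lam w)\<^sup>2 * ?s w) + 2 * (?g w \<bullet> ?g w) =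
      2 * (lam w)\<^sup>2 - 6 * ((lam w)\<^sup>2 * (?s w)\<^sup>2)" for w
  proof -
    have "?g w \<bullet> ?g w = (lam w)\<^sup>2 * ((lam w)\<^sup>2 * (sgrad j w $ 1 * sgrad j w $ 1 + sgrad j w $ 2 * sgrad j w $ 2))"
      by (simp add: inner_vec2 power2_eq_square algebra_simps)
    also have "\<dots> = (lam w)\<^sup>2 * (1 - ?s w * ?s w)" unfolding sgrad_inner by simp
    finally have g: "?g w \<bullet> ?g w = (lam w)\<^sup>2 * (1 - ?s w * ?s w)" .
    show ?thesis unfolding g by (simp add: power2_eq_square algebra_simps)
  qed
  then have "(LINT w|lborel. 2 * (lam w)\<^sup>2 - 6 * ((lam w)\<^sup>2 * (?s w)\<^sup>2)) = 0"
    using integral_sphere_Laplacian[OF sphere_fn_mult[OF sphere_fn_stereo sphere_fn_stereo], of j j] by (simp only:)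
  then show ?thesis
    using integrable_lam_squared integrable_lam_stereo_squared[of j] by simp
qed

lemma clam_integrable: "integrable lborel clam"
  unfolding clam_def[abs_def] by (rule integrable_of_real[OF integrable_lam_squared])

lemma integral_clam: "(LINT w|lborel. clam w) = of_real (LINT w|lborel. (lam w)\<^sup>2)"
  unfolding clam_def integral_complex_of_real ..

lemma integrable_clam_zeta: "e\<^sup>2 = 1 \<Longrightarrow> integrable lborel (\<lambda>w. clam w * zeta i e w)"
  by (rule integrable_mult_bounded[OF clam_integrable zeta_measurable(1) norm_zeta_le])

lemma integral_clam_zeta: "(LINT w|lborel. clam w * zeta i e w) = 0"
proof -
  have "(LINT w|lborel. Complex (1 * (lam w)\<^sup>2) (0 * (lam w)\<^sup>2) * Complex (1 * stereo w $ nxt i) (e * stereo w $ nxt (nxt i))) = 0"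
  proof -
    have a: "integrable lborel (\<lambda>w. (c * (lam w)\<^sup>2) * (d * stereo w $ j))" "(LINT w|lborel. (c * (lam w)\<^sup>2) * (d * stereo w $ j)) = 0" for c d j
    proof -
      have "(\<lambda>w. (c * (lam w)\<^sup>2) * (d * stereo w $ j)) = (\<lambda>w. (c * d) * ((lam w)\<^sup>2 * stereo w $ j))"
        by (simp add: fun_eq_iff)
      then show "integrable lborel (\<lambda>w. (c * (lam w)\<^sup>2) * (d * stereo w $ j))" "(LINT w|lborel. (c * (lam w)\<^sup>2) * (d * stereo w $ j)) = 0"
        using sphere_fn_integrable[OF sphere_fn_stereo[of j]] integral_lam_stereo[of j] by (simp_all only: integrable_mult_right integral_mult_right_zero mult_zero_right)
    qed
    show ?thesis
      unfolding integral_Complex_mult[OF a(1)[of 1 1 "nxt i"] a(1)[of 1 e "nxt (nxt i)"] a(1)[of 0 1 "nxt i"] a(1)[of 0 e "nxt (nxt i)"]] a(2)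
      by (simp add: complex_eq_iff)
  qed
  moreover have "Complex (1 * (lam w)\<^sup>2) (0 * (lam w)\<^sup>2) * Complex (1 * stereo w $ nxt i) (e * stereo w $ nxt (nxt i)) = clam w * zeta i e w" for w
    by (simp add: clam_def zeta_def complex_eq_iff)
  ultimately show ?thesis by simp
qed

lemma zeta_conjugate: "e\<^sup>2 = 1 \<Longrightarrow> zeta i (- e) w * zeta i e w = of_real ((stereo w $ nxt i)\<^sup>2 + (stereo w $ nxt (nxt i))\<^sup>2)"
  and zeta_conjugate': "e\<^sup>2 = 1 \<Longrightarrow> zeta i (- e) w * zeta i e w = 1 - height i w ^ 2"
proof -
  assume e: "e\<^sup>2 = 1"
  then have e': "e * e = 1" by (simp add: power2_eq_square)
  show 1: "zeta i (- e) w * zeta i e w = of_real ((stereo w $ nxt i)\<^sup>2 + (stereo w $ nxt (nxt i))\<^sup>2)"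
    using e' by (simp add: zeta_def complex_eq_iff power2_eq_square)
  show "zeta i (- e) w * zeta i e w = 1 - height i w ^ 2"
  proof -
    have "(stereo w $ nxt i)\<^sup>2 + (stereo w $ nxt (nxt i))\<^sup>2 = 1 - (stereo w $ i)\<^sup>2"
      using stereo_sum_squares[of w i] by linarith
    then show ?thesis unfolding 1 height_def by (simp only:) simp
  qed
qed

text \<open>Projection of u = f + i h onto the known solutions, of the form a + b times
  \<open>zeta i (- 1)\<close>. Both \<open>zeta i 1\<close> and \<open>zeta i (- 1)\<close> have
  mean 0 and their product has mean 2/3, so the two moment conditions decouple; this explains the
  denominators of \<open>a\<close> and \<open>b\<close>.\<close>

lemma npair_subtract:
  assumes np: "npair i f h"
  shows "\<exists>a1 a2 b1 b2. npair i (\<lambda>w. f w - (a1 + b1 * stereo w $ nxt i + b2 * stereo w $ nxt (nxt i)))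
      (\<lambda>w. h w - (a2 + b2 * stereo w $ nxt i - b1 * stereo w $ nxt (nxt i))) \<and>
    (LINT w|lborel. cpair (\<lambda>w. f w - (a1 + b1 * stereo w $ nxt i + b2 * stereo w $ nxt (nxt i)))
      (\<lambda>w. h w - (a2 + b2 * stereo w $ nxt i - b1 * stereo w $ nxt (nxt i))) w) = 0 \<and>
    (LINT w|lborel. cpair (\<lambda>w. f w - (a1 + b1 * stereo w $ nxt i + b2 * stereo w $ nxt (nxt i)))
      (\<lambda>w. h w - (a2 + b2 * stereo w $ nxt i - b1 * stereo w $ nxt (nxt i))) w * zeta i 1 w) = 0"
proof -
  define m where "m = (LINT w|lborel. (lam w)\<^sup>2)"
  have m: "complex_of_real m \<noteq> 0" using integral_lam_squared_pos by (simp add: m_def)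
  define a where "a = (LINT w|lborel. cpair f h w) / of_real m"
  define b where "b = (LINT w|lborel. cpair f h w * zeta i 1 w) / (2 / 3 * of_real m)"
  let ?f = "\<lambda>w. f w - (Re a + Re b * stereo w $ nxt i + Im b * stereo w $ nxt (nxt i))"
  let ?h = "\<lambda>w. h w - (Im a + Im b * stereo w $ nxt i - Re b * stereo w $ nxt (nxt i))"
  have np': "npair i ?f ?h"
  proof -
    have "?f = (\<lambda>w. f w + - 1 * Re a + - Re b * stereo w $ nxt i + - Im b * stereo w $ nxt (nxt i))"
      "?h = (\<lambda>w. h w + - 1 * Im a + - Re b * (- stereo w $ nxt (nxt i)) + - Im b * stereo w $ nxt i)"
      by (simp_all add: fun_eq_iff)
    moreover have "npair i (\<lambda>w. f w + - 1 * Re a + - Re b * stereo w $ nxt i + - Im b * stereo w $ nxt (nxt i))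
      (\<lambda>w. h w + - 1 * Im a + - Re b * (- stereo w $ nxt (nxt i)) + - Im b * stereo w $ nxt i)"
      by (rule npair_add[OF npair_add[OF npair_add[OF np npair_const] npair_stereo(1)] npair_stereo(2)])
    ultimately show ?thesis by (simp only:)
  qed
  have c: "cpair ?f ?h w = cpair f h w - a * clam w - b * (clam w * zeta i (- 1) w)" for w
    by (simp add: cpair_def clam_def zeta_def complex_eq_iff algebra_simps)
  have i0: "integrable lborel (cpair f h)" by (rule cpair_integrable[OF np])
  have i1: "integrable lborel (\<lambda>w. cpair f h w * zeta i 1 w)"
    by (rule integrable_mult_bounded[OF i0 zeta_measurable(1) norm_zeta_le]) simp
  have iz: "integrable lborel (\<lambda>w. clam w * zeta i (- 1) w)" "integrable lborel (\<lambda>w. clam w * zeta i 1 w)"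
    by (rule integrable_clam_zeta, simp)+
  have z2: "(clam w * zeta i (- 1) w) * zeta i 1 w = of_real ((lam w)\<^sup>2 * (stereo w $ nxt i)\<^sup>2 + (lam w)\<^sup>2 * (stereo w $ nxt (nxt i))\<^sup>2)" for w
    using zeta_conjugate[of 1 i w] by (simp add: clam_def mult.assoc distrib_left)
  have i2: "integrable lborel (\<lambda>w. (clam w * zeta i (- 1) w) * zeta i 1 w)"
    by (rule integrable_mult_bounded[OF iz(1) zeta_measurable(1) norm_zeta_le]) simp
  have "(LINT w|lborel. (clam w * zeta i (- 1) w) * zeta i 1 w) =
      of_real ((LINT w|lborel. (lam w)\<^sup>2 * (stereo w $ nxt i)\<^sup>2) + (LINT w|lborel. (lam w)\<^sup>2 * (stereo w $ nxt (nxt i))\<^sup>2))"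
    unfolding z2 integral_complex_of_real
    using Bochner_Integration.integral_add[OF integrable_lam_stereo_squared[of "nxt i"] integrable_lam_stereo_squared[of "nxt (nxt i)"]]
    by (simp only:)
  also have "(LINT w|lborel. (lam w)\<^sup>2 * (stereo w $ nxt i)\<^sup>2) + (LINT w|lborel. (lam w)\<^sup>2 * (stereo w $ nxt (nxt i))\<^sup>2) = 2 / 3 * m"
    using integral_lam_stereo_squared[of "nxt i"] integral_lam_stereo_squared[of "nxt (nxt i)"] unfolding m_def by linarith
  finally have v2: "(LINT w|lborel. (clam w * zeta i (- 1) w) * zeta i 1 w) = 2 / 3 * of_real m" by simp
  have "(LINT w|lborel. cpair ?f ?h w) = (LINT w|lborel. cpair f h w) - a * (LINT w|lborel. clam w) - b * (LINT w|lborel. clam w * zeta i (- 1) w)"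
    unfolding c using i0 clam_integrable iz(1) by simp
  also have "\<dots> = 0"
    unfolding integral_clam integral_clam_zeta using m by (simp add: a_def m_def)
  finally have 1: "(LINT w|lborel. cpair ?f ?h w) = 0" .
  have "cpair ?f ?h w * zeta i 1 w = cpair f h w * zeta i 1 w - a * (clam w * zeta i 1 w) - b * ((clam w * zeta i (- 1) w) * zeta i 1 w)" for w
    unfolding c by (simp add: left_diff_distrib mult.assoc)
  then have "(LINT w|lborel. cpair ?f ?h w * zeta i 1 w) =
      (LINT w|lborel. cpair f h w * zeta i 1 w - a * (clam w * zeta i 1 w) - b * ((clam w * zeta i (- 1) w) * zeta i 1 w))"
    by (simp only:)
  also have "\<dots> = (LINT w|lborel. cpair f h w * zeta i 1 w) - a * (LINT w|lborel. clam w * zeta i 1 w) - b * (LINT w|lborel. (clam w * zeta i (- 1) w) * zeta i 1 w)"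
    using Bochner_Integration.integral_diff[OF Bochner_Integration.integrable_diff[OF i1 integrable_mult_right[OF iz(2), of a]] integrable_mult_right[OF i2, of b]]
      Bochner_Integration.integral_diff[OF i1 integrable_mult_right[OF iz(2), of a]]
    by (simp only: integral_mult_right_zero)
  also have "\<dots> = 0"
    unfolding integral_clam_zeta v2 using m by (simp add: b_def)
  finally have 2: "(LINT w|lborel. cpair ?f ?h w * zeta i 1 w) = 0" .
  show ?thesis using np' 1 2 by blast
qed

text \<open>The functions \<open>g\<close> for which \<open>g W\<close> has vanishing moments; this class is stable under multiplication by
  the coordinates, because \<open>\<zeta> \<zeta>' = 1 - z\<^sup>2\<close> for the two conjugate functions \<open>\<zeta>\<close>, \<open>\<zeta>'\<close>.\<close>

definition annih :: "3 \<Rightarrow> (real^2 \<Rightarrow> complex) \<Rightarrow> (real^2 \<Rightarrow> complex) \<Rightarrow> bool" where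
  "annih i W g \<longleftrightarrow> g \<in> borel_measurable borel \<and> (\<exists>K. \<forall>w. norm (g w) \<le> K) \<and>
     (\<forall>e m k. e\<^sup>2 = 1 \<longrightarrow> (LINT w|lborel. W w * (g w * (zeta i e w ^ m * height i w ^ k))) = 0)"

lemma annih_zero: "annih i W g \<Longrightarrow> e\<^sup>2 = 1 \<Longrightarrow> (LINT w|lborel. W w * (g w * (zeta i e w ^ m * height i w ^ k))) = 0"
  by (simp add: annih_def)

lemma annih_integrable:
  assumes W: "integrable lborel W" and g: "annih i W g" and e: "e\<^sup>2 = 1"
  shows "integrable lborel (\<lambda>w. W w * (g w * (zeta i e w ^ m * height i w ^ k)))"
proof -
  obtain K where K: "\<And>w. norm (g w) \<le> K" using g unfolding annih_def by blast
  have [measurable]: "g \<in> borel_measurable borel" using g by (simp add: annih_def)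
  have "norm (g w * (zeta i e w ^ m * height i w ^ k)) \<le> K" for w
    using mult_mono[OF K norm_monomial_le[OF e, of i w m k] order_trans[OF norm_ge_zero K] norm_ge_zero] by (simp only: norm_mult mult_1_right)
  then show ?thesis by (intro integrable_mult_bounded[OF W]) measurable
qed

lemma annih_combine:
  assumes W: "integrable lborel W" and g: "annih i W g" "annih i W g'"
  shows "annih i W (\<lambda>w. c * g w + c' * g' w)"
  unfolding annih_def
proof (intro conjI allI impI)
  have [measurable]: "g \<in> borel_measurable borel" "g' \<in> borel_measurable borel" using g by (simp_all add: annih_def)
  show "(\<lambda>w. c * g w + c' * g' w) \<in> borel_measurable borel" by measurable
  obtain K K' where K: "\<And>w. norm (g w) \<le> K" "\<And>w. norm (g' w) \<le> K'" using g unfolding annih_def by blast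
  have "norm (c * g w + c' * g' w) \<le> norm c * K + norm c' * K'" for w
    using norm_triangle_ineq[of "c * g w" "c' * g' w"] mult_left_mono[OF K(1)[of w] norm_ge_zero[of c]] mult_left_mono[OF K(2)[of w] norm_ge_zero[of c']]
    by (simp add: norm_mult)
  then show "\<exists>K. \<forall>w. norm (c * g w + c' * g' w) \<le> K" by blast
  fix e :: real and m k :: nat assume e: "e\<^sup>2 = 1"
  let ?M = "\<lambda>w. zeta i e w ^ m * height i w ^ k"
  have "(\<lambda>w. W w * ((c * g w + c' * g' w) * ?M w)) = (\<lambda>w. c * (W w * (g w * ?M w)) + c' * (W w * (g' w * ?M w)))"
    by (simp add: fun_eq_iff algebra_simps)
  then show "(LINT w|lborel. W w * ((c * g w + c' * g' w) * ?M w)) = 0"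
    using Bochner_Integration.integral_add[OF integrable_mult_right[OF annih_integrable[OF W g(1) e]] integrable_mult_right[OF annih_integrable[OF W g(2) e]],
        of c m k c' m k] annih_zero[OF g(1) e, of m k] annih_zero[OF g(2) e, of m k]
    by (simp only: integral_mult_right_zero) simp
qed

lemma annih_mult_measurable_bounded:
  assumes g: "annih i W g" and v: "v \<in> borel_measurable borel" "\<And>w. norm (v w) \<le> 1"
  shows "(\<lambda>w. g w * v w) \<in> borel_measurable borel" "\<exists>K. \<forall>w. norm (g w * v w :: complex) \<le> K"
proof -
  show "(\<lambda>w. g w * v w) \<in> borel_measurable borel" using g v(1) by (auto simp: annih_def)
  obtain K where K: "\<And>w. norm (g w) \<le> K" using g unfolding annih_def by blast
  have "norm (g w * v w) \<le> K" for w
    using mult_mono[OF K v(2) order_trans[OF norm_ge_zero K] norm_ge_zero] by (simp only: norm_mult mult_1_right)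
  then show "\<exists>K. \<forall>w. norm (g w * v w) \<le> K" by blast
qed

lemma annih_height:
  assumes g: "annih i W g"
  shows "annih i W (\<lambda>w. g w * height i w)"
  unfolding annih_def
proof (intro conjI allI impI annih_mult_measurable_bounded[OF g] zeta_measurable norm_height_le)
  fix e :: real and m k :: nat assume e: "e\<^sup>2 = 1"
  have "(\<lambda>w. W w * (g w * height i w * (zeta i e w ^ m * height i w ^ k))) = (\<lambda>w. W w * (g w * (zeta i e w ^ m * height i w ^ Suc k)))"
    by (simp add: fun_eq_iff mult_ac)
  then show "(LINT w|lborel. W w * (g w * height i w * (zeta i e w ^ m * height i w ^ k))) = 0"
    using annih_zero[OF g e, of m "Suc k"] by (simp only:)
qed

lemma annih_zeta:
  assumes W: "integrable lborel W" and g: "annih i W g" and e': "e'\<^sup>2 = 1"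
  shows "annih i W (\<lambda>w. g w * zeta i e' w)"
  unfolding annih_def
proof (intro conjI allI impI annih_mult_measurable_bounded[OF g] zeta_measurable norm_zeta_le[OF e'])
  fix e :: real and m k :: nat assume e: "e\<^sup>2 = 1"
  have "e = e' \<or> e' = - e" using e e' by (auto simp: power2_eq_1_iff)
  then show "(LINT w|lborel. W w * (g w * zeta i e' w * (zeta i e w ^ m * height i w ^ k))) = 0"
  proof
    assume "e = e'"
    then have "(\<lambda>w. W w * (g w * zeta i e' w * (zeta i e w ^ m * height i w ^ k))) = (\<lambda>w. W w * (g w * (zeta i e w ^ Suc m * height i w ^ k)))"
      by (simp add: fun_eq_iff mult_ac)
    then show ?thesis using annih_zero[OF g e, of "Suc m" k] by (simp only:)
  next
    assume e'': "e' = - e"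
    show ?thesis
    proof (cases m)
      case 0
      then have "(\<lambda>w. W w * (g w * zeta i e' w * (zeta i e w ^ m * height i w ^ k))) = (\<lambda>w. W w * (g w * (zeta i e' w ^ 1 * height i w ^ k)))"
        by (simp add: fun_eq_iff mult_ac)
      then show ?thesis using annih_zero[OF g e', of 1 k] by (simp only:)
    next
      case (Suc n)
      have "W w * (g w * zeta i e' w * (zeta i e w ^ m * height i w ^ k)) =
          W w * (g w * (zeta i e w ^ n * height i w ^ k)) - W w * (g w * (zeta i e w ^ n * height i w ^ (k + 2)))" for w
      proof -
        have "W w * (g w * zeta i e' w * (zeta i e w ^ m * height i w ^ k)) = W w * g w * (zeta i (- e) w * zeta i e w) * (zeta i e w ^ n * height i w ^ k)"
          by (simp add: Suc e'' mult_ac)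
        also have "\<dots> = W w * (g w * (zeta i e w ^ n * height i w ^ k)) - W w * (g w * (zeta i e w ^ n * height i w ^ (k + 2)))"
          unfolding zeta_conjugate'[OF e] by (simp add: power_add power2_eq_square algebra_simps)
        finally show ?thesis .
      qed
      then show ?thesis
        using Bochner_Integration.integral_diff[OF annih_integrable[OF W g e] annih_integrable[OF W g e], of n k n "k + 2"]
          annih_zero[OF g e, of n k] annih_zero[OF g e, of n "k + 2"] by (simp only:) simp
    qed
  qed
qed

lemma annih_stereo:
  assumes W: "integrable lborel W" and g: "annih i W g"
  shows "annih i W (\<lambda>w. g w * of_real (stereo w $ a))"
proof -
  have z: "annih i W (\<lambda>w. g w * zeta i 1 w)" "annih i W (\<lambda>w. g w * zeta i (- 1) w)"
    by (rule annih_zeta[OF W g], simp)+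
  consider "a = i" | "a = nxt i" | "a = nxt (nxt i)"
    using exhaust_3[of a] exhaust_3[of i] by (auto simp: nxt_simps)
  then show ?thesis
  proof cases
    case 1
    then show ?thesis using annih_height[OF g] by (simp add: height_def)
  next
    case 2
    have "(\<lambda>w. g w * of_real (stereo w $ a)) = (\<lambda>w. 1 / 2 * (g w * zeta i 1 w) + 1 / 2 * (g w * zeta i (- 1) w))"
      unfolding 2 zeta_def by (simp add: fun_eq_iff complex_eq_iff field_simps)
    then show ?thesis using annih_combine[OF W z, of "1 / 2" "1 / 2"] by (simp only:)
  next
    case 3
    have "(\<lambda>w. g w * of_real (stereo w $ a)) = (\<lambda>w. (- \<i> / 2) * (g w * zeta i 1 w) + (\<i> / 2) * (g w * zeta i (- 1) w))"
      unfolding 3 zeta_def by (simp add: fun_eq_iff complex_eq_iff field_simps)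
    then show ?thesis using annih_combine[OF W z, of "- \<i> / 2" "\<i> / 2"] by (simp only:)
  qed
qed

text \<open>Induction with \<open>g\<close> arbitrary, so that a product of polynomials is absorbed
  one factor at a time; a linear form is a combination of the three coordinates.\<close>

lemma annih_polynomial:
  assumes W: "integrable lborel W" and p: "real_polynomial_function (p :: real^3 \<Rightarrow> real)"
  shows "annih i W g \<Longrightarrow> annih i W (\<lambda>w. g w * of_real (p (stereo w)))"
  using p
proof (induction arbitrary: g rule: real_polynomial_function.induct)
  case (linear f)
  have f: "f x = x $ 1 * f (axis 1 1) + (x $ 2 * f (axis 2 1) + x $ 3 * f (axis 3 1))" for x
  proof -
    interpret bounded_linear f by fact
    have "x = x $ 1 *\<^sub>R axis 1 1 + (x $ 2 *\<^sub>R axis 2 1 + x $ 3 *\<^sub>R axis 3 1)"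
      by (simp add: vec_eq_iff forall_3 axis_def)
    then have "f x = f (x $ 1 *\<^sub>R axis 1 1 + (x $ 2 *\<^sub>R axis 2 1 + x $ 3 *\<^sub>R axis 3 1))" by simp
    then show ?thesis by (simp add: add scaleR)
  qed
  have c: "of_real (f (axis 1 1)) * (g w * of_real (stereo w $ 1)) +
      1 * (of_real (f (axis 2 1)) * (g w * of_real (stereo w $ 2)) + of_real (f (axis 3 1)) * (g w * of_real (stereo w $ 3))) = g w * of_real (f (stereo w))" for w
    unfolding f[of "stereo w"] by (simp add: algebra_simps)
  note s = annih_stereo[OF W linear(2)]
  show ?case
    using annih_combine[OF W s[of 1] annih_combine[OF W s[of 2] s[of 3]],
        of "of_real (f (axis 1 1))" 1 "of_real (f (axis 2 1))" "of_real (f (axis 3 1))"]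
    unfolding c .
next
  case (const c)
  have "c * g w + 0 * g w = g w * of_real c" if "c = of_real c'" for c c' w by (simp add: that)
  then show ?case using annih_combine[OF W const const, of "of_real c" 0] by (simp add: mult.commute)
next
  case (add f f')
  show ?case using annih_combine[OF W add(3)[OF add(5)] add(4)[OF add(5)], of 1 1] by (simp add: distrib_left)
next
  case (mult f f')
  show ?case using mult(4)[OF mult(3)[OF mult(5)]] by (simp add: mult.assoc)
qed

subsection \<open>Vanishing of pairs of zero energy\<close>

lemma stereo_measurable: "continuous_on (sphere 0 1) (G :: real^3 \<Rightarrow> real) \<Longrightarrow> (\<lambda>w. G (stereo w)) \<in> borel_measurable borel"
proof -
  assume G: "continuous_on (sphere 0 1) G"
  have "continuous_on UNIV (\<lambda>w. \<chi> i. stereo w $ i)"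
    by (intro continuous_on_vec_lambda continuous_intros)
  then have "continuous_on UNIV stereo" by simp
  from continuous_on_compose2[OF G this] have "continuous_on UNIV (\<lambda>w. G (stereo w))"
    using stereo_in_sphere by blast
  then show ?thesis by (rule borel_measurable_continuous_onI)
qed

text \<open>By Stone-Weierstrass polynomials are uniformly dense on the sphere, and a uniform error
  \<open>e\<close> changes the integral by at most \<open>e\<close> times the L1 norm of
  \<open>W\<close>.\<close>

lemma integral_sphere_continuous:
  fixes G :: "real^3 \<Rightarrow> real"
  assumes W: "integrable lborel W" and one: "annih i W (\<lambda>_. 1)" and G: "continuous_on (sphere 0 1) G"
  shows "integrable lborel (\<lambda>w. W w * of_real (G (stereo w)))" "(LINT w|lborel. W w * of_real (G (stereo w))) = 0"
proof -
  have "bounded (G ` sphere 0 1)"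
    by (rule compact_imp_bounded[OF compact_continuous_image[OF G compact_sphere]])
  then obtain B where B: "\<forall>x\<in>G ` sphere 0 1. norm x \<le> B" unfolding bounded_iff by blast
  have Gm: "(\<lambda>w. complex_of_real (G (stereo w))) \<in> borel_measurable borel"
    using stereo_measurable[OF G] by measurable
  show i: "integrable lborel (\<lambda>w. W w * of_real (G (stereo w)))"
  proof (rule integrable_mult_bounded[OF W Gm])
    show "norm (complex_of_real (G (stereo w))) \<le> B" for w
      using B stereo_in_sphere[of w] unfolding norm_of_real by auto
  qed
  define N where "N = (LINT w|lborel. norm (W w))"
  have N: "0 \<le> N" by (simp add: N_def)
  define X where "X = (LINT w|lborel. W w * of_real (G (stereo w)))"
  have le: "norm X \<le> e * N" if e: "e > 0" for e
  proof -
    obtain p where p: "real_polynomial_function p" "\<And>x. x \<in> sphere 0 1 \<Longrightarrow> \<bar>G x - p x\<bar> < e"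
      using Stone_Weierstrass_real_polynomial_function[OF compact_sphere G e] by metis
    have a: "annih i W (\<lambda>w. 1 * of_real (p (stereo w)))" by (rule annih_polynomial[OF W p(1) one])
    have ip: "integrable lborel (\<lambda>w. W w * of_real (p (stereo w)))" and zp: "(LINT w|lborel. W w * of_real (p (stereo w))) = 0"
      using annih_integrable[OF W a, of 1 0 0] annih_zero[OF a, of 1 0 0] by simp_all
    have "X = (LINT w|lborel. W w * of_real (G (stereo w)) - W w * of_real (p (stereo w)))"
      unfolding Bochner_Integration.integral_diff[OF i ip] zp X_def by simp
    also have "norm \<dots> \<le> (LINT w|lborel. e * norm (W w))"
    proof (rule Bochner_Integration.integral_norm_bound_integral)
      show "integrable lborel (\<lambda>w. W w * of_real (G (stereo w)) - W w * of_real (p (stereo w)))"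
        by (rule Bochner_Integration.integrable_diff[OF i ip])
      show "integrable lborel (\<lambda>w. e * norm (W w))" using integrable_norm[OF W] by simp
      fix w
      have "norm (W w * of_real (G (stereo w)) - W w * of_real (p (stereo w))) = norm (W w) * \<bar>G (stereo w) - p (stereo w)\<bar>"
        unfolding right_diff_distrib[symmetric] of_real_diff[symmetric] norm_mult norm_of_real ..
      also have "\<dots> \<le> norm (W w) * e"
        using p(2)[OF stereo_in_sphere[of w]] by (intro mult_left_mono) auto
      finally show "norm (W w * of_real (G (stereo w)) - W w * of_real (p (stereo w))) \<le> e * norm (W w)"
        by (simp add: mult.commute)
    qed
    finally show ?thesis by (simp add: N_def)
  qed
  have "norm X = 0"
  proof (rule ccontr)
    assume "norm X \<noteq> 0"
    then have X: "0 < norm X" by simp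
    define M where "M = N + 1"
    have M: "M > 0" "N \<le> M" using N by (simp_all add: M_def)
    define e where "e = norm X / (2 * M)"
    have "e > 0" using X M by (simp add: e_def)
    then have "norm X \<le> e * N" by (rule le)
    also have "\<dots> \<le> e * M" using \<open>e > 0\<close> M by simp
    also have "\<dots> = norm X / 2" using M by (simp add: e_def)
    finally show False using X by simp
  qed
  then show "(LINT w|lborel. W w * of_real (G (stereo w))) = 0" by (simp add: X_def)
qed

text \<open>Stereographic projection is inverted by (x_2, x_3) / (1 - x_1), where 1 - x_1 is
  \<open>lam\<close> on the sphere. On the ball of radius \<open>R\<close> one has
  \<open>lam w \<ge> 2 * d\<close>; the leading factor of \<open>G\<close> is 1 there and 0 where
  \<open>lam w \<le> d\<close>, and truncating the denominator at \<open>d\<close> keeps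
  \<open>G\<close> continuous near the projection point.\<close>

lemma stereo_extend:
  fixes \<phi> :: "real^2 \<Rightarrow> real"
  assumes \<phi>: "continuous_on UNIV \<phi>" "\<And>w. norm w > R \<Longrightarrow> \<phi> w = 0"
  shows "\<exists>G. continuous_on UNIV G \<and> (\<forall>w. G (stereo w) = \<phi> w)"
proof -
  define d where "d = 1 / (1 + R\<^sup>2)"
  have pos: "1 + R\<^sup>2 > 0" by (rule add_pos_nonneg) simp_all
  then have d: "d > 0" by (simp add: d_def)
  define G where "G x = min 1 (max 0 ((1 - x $ 1) / d - 1)) * \<phi> ((1 / max (1 - x $ 1) d) *\<^sub>R vector [x $ 2, x $ 3])" for x :: "real^3"
  have nz: "max (1 - x $ 1) d \<noteq> 0" for x :: "real^3" using d by auto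
  have "continuous_on UNIV (\<lambda>x::real^3. vector [x $ 2, x $ 3] :: real^2)"
    by (intro continuous_vec2 continuous_intros)
  then have c: "continuous_on UNIV (\<lambda>x::real^3. \<phi> ((1 / max (1 - x $ 1) d) *\<^sub>R vector [x $ 2, x $ 3]))"
    using nz by (intro continuous_on_compose2[OF \<phi>(1)] continuous_intros) auto
  have "continuous_on UNIV G"
    unfolding G_def[abs_def] using d by (intro continuous_intros c) auto
  moreover have "G (stereo w) = \<phi> w" for w
  proof (cases "lam w \<ge> d")
    case True
    have "(vector [lam w * w $ 1, lam w * w $ 2] :: real^2) = lam w *\<^sub>R w"
      by (simp add: vec_eq_iff forall_2)
    then have G: "G (stereo w) = min 1 (max 0 (lam w / d - 1)) * \<phi> w"
      using True d by (simp add: G_def stereo_nth max_def)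
    show ?thesis
    proof (cases "norm w \<le> R")
      case le: True
      have "1 + (norm w)\<^sup>2 \<le> 1 + R\<^sup>2" using le by (simp add: power_mono)
      then have "2 * d \<le> lam w"
        using one_plus_norm_pos[of w] unfolding d_def lam_def by (simp add: frac_le add.commute)
      then have "1 \<le> lam w / d - 1" using d by (simp add: field_simps)
      then show ?thesis unfolding G by simp
    next
      case False
      then show ?thesis unfolding G using \<phi>(2)[of w] by simp
    qed
  next
    case False
    have "R < norm w"
    proof (rule ccontr)
      assume "\<not> R < norm w"
      then have "1 + (norm w)\<^sup>2 \<le> 1 + R\<^sup>2" by (simp add: power_mono)
      then have "d \<le> 1 / ((norm w)\<^sup>2 + 1)" using one_plus_norm_pos[of w] unfolding d_def by (simp add: frac_le add.commute)
      also have "\<dots> \<le> lam w" using one_plus_norm_pos[of w] by (simp add: lam_def divide_right_mono)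
      finally show False using False by simp
    qed
    moreover have "lam w / d - 1 \<le> 0" using False d by (simp add: field_simps)
    ultimately show ?thesis using \<phi>(2)[of w] by (simp add: G_def stereo_nth)
  qed
  ultimately show ?thesis by blast
qed

lemma annih_imp_AE_zero:
  assumes np: "npair i f h" and one: "annih i (cpair f h) (\<lambda>_. 1)"
  shows "AE w in lborel. f w = 0" "AE w in lborel. h w = 0"
proof -
  note n = np[unfolded npair_def]
  have b: "(LINT y|lborel. bump r (x - y) *\<^sub>R ((lam y)\<^sup>2 * f y)) = 0" "(LINT y|lborel. bump r (x - y) *\<^sub>R ((lam y)\<^sup>2 * h y)) = 0"
    if r: "r > 0" for x r
  proof -
    have c: "continuous_on UNIV (\<lambda>y. bump r (x - y) :: real)"
      by (intro continuous_on_compose2[OF continuous_bump] continuous_intros) auto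
    have z: "bump r (x - y) = 0" if "norm y > norm x + r" for y
      using that norm_triangle_ineq2[of y x] r by (intro bump_eq_0) (simp_all add: norm_minus_commute)
    obtain G where G: "continuous_on UNIV G" "\<And>w. G (stereo w) = bump r (x - w)"
      using stereo_extend[OF c z] by metis
    have "continuous_on (sphere 0 1) G" using G(1) continuous_on_subset by blast
    note I = integral_sphere_continuous[OF cpair_integrable[OF np] one this, unfolded G(2)]
    have e: "Re (cpair f h w * of_real (bump r (x - w))) = bump r (x - w) *\<^sub>R ((lam w)\<^sup>2 * f w)"
      "Im (cpair f h w * of_real (bump r (x - w))) = bump r (x - w) *\<^sub>R ((lam w)\<^sup>2 * h w)" for w
      by (simp_all add: cpair_def clam_def)
    show "(LINT y|lborel. bump r (x - y) *\<^sub>R ((lam y)\<^sup>2 * f y)) = 0" "(LINT y|lborel. bump r (x - y) *\<^sub>R ((lam y)\<^sup>2 * h y)) = 0"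
      using integral_Re[OF I(1)] integral_Im[OF I(1)] unfolding I(2) e by simp_all
  qed
  have loc: "locint (\<lambda>w. (lam w)\<^sup>2 * g w)" if "integrable lborel (\<lambda>w. (lam w)\<^sup>2 * g w)" for g
    unfolding locint_def
  proof (intro conjI allI)
    show "(\<lambda>w. (lam w)\<^sup>2 * g w) \<in> borel_measurable borel" using borel_measurable_integrable[OF that] by simp
    show "integrable lborel (\<lambda>x. indicator (cball 0 R) x *\<^sub>R ((lam x)\<^sup>2 * g x))" for R
      by (rule integrable_mult_indicator[OF _ that]) simp
  qed
  have lf: "locint (\<lambda>w. (lam w)\<^sup>2 * f w)" and lh: "locint (\<lambda>w. (lam w)\<^sup>2 * h w)"
    using n loc by blast+
  have "AE w in lborel. (lam w)\<^sup>2 * f w = 0" by (rule AE_zero_of_bump_integrals[OF lf b(1)])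
  then show "AE w in lborel. f w = 0" by eventually_elim (use lam_pos in \<open>auto simp: less_imp_neq[symmetric]\<close>)
  have "AE w in lborel. (lam w)\<^sup>2 * h w = 0" by (rule AE_zero_of_bump_integrals[OF lh b(2)])
  then show "AE w in lborel. h w = 0" by eventually_elim (use lam_pos in \<open>auto simp: less_imp_neq[symmetric]\<close>)
qed

lemma npair_affine:
  assumes np: "npair i f h"
  shows "\<exists>a1 a2 b1 b2. (AE w in lborel. f w = a1 + b1 * stereo w $ nxt i + b2 * stereo w $ nxt (nxt i)) \<and>
    (AE w in lborel. h w = a2 + b2 * stereo w $ nxt i - b1 * stereo w $ nxt (nxt i))"
proof -
  obtain a1 a2 b1 b2 where
    s: "npair i (\<lambda>w. f w - (a1 + b1 * stereo w $ nxt i + b2 * stereo w $ nxt (nxt i))) (\<lambda>w. h w - (a2 + b2 * stereo w $ nxt i - b1 * stereo w $ nxt (nxt i)))"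
    "(LINT w|lborel. cpair (\<lambda>w. f w - (a1 + b1 * stereo w $ nxt i + b2 * stereo w $ nxt (nxt i)))
      (\<lambda>w. h w - (a2 + b2 * stereo w $ nxt i - b1 * stereo w $ nxt (nxt i))) w) = 0"
    "(LINT w|lborel. cpair (\<lambda>w. f w - (a1 + b1 * stereo w $ nxt i + b2 * stereo w $ nxt (nxt i)))
      (\<lambda>w. h w - (a2 + b2 * stereo w $ nxt i - b1 * stereo w $ nxt (nxt i))) w * zeta i 1 w) = 0"
    using npair_subtract[OF np] by blast
  have "annih i (cpair (\<lambda>w. f w - (a1 + b1 * stereo w $ nxt i + b2 * stereo w $ nxt (nxt i)))
      (\<lambda>w. h w - (a2 + b2 * stereo w $ nxt i - b1 * stereo w $ nxt (nxt i)))) (\<lambda>_. 1)"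
    unfolding annih_def using moments_vanish[OF s(1) _ s(2,3)] by auto
  from annih_imp_AE_zero[OF s(1) this]
  have "AE w in lborel. f w = a1 + b1 * stereo w $ nxt i + b2 * stereo w $ nxt (nxt i)"
    "AE w in lborel. h w = a2 + b2 * stereo w $ nxt i - b1 * stereo w $ nxt (nxt i)" by simp_all
  then show ?thesis by blast
qed

section \<open>Decay in the plane against the null space of the sphere\<close>

lemma integral_lborel_scale2:
  fixes g :: "real^2 \<Rightarrow> real"
  assumes [measurable]: "g \<in> borel_measurable borel"
  shows "(LINT w|lborel. g w) = 4 * (LINT w|lborel. g (2 *\<^sub>R w))"
proof -
  have "(LINT w|lborel. g w) = (LINT w|density (distr lborel borel (\<lambda>x. 2 *\<^sub>R x)) (\<lambda>_. ennreal 4). g w)"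
    using lborel_affine[of 2 "0 :: real^2"] by simp
  also have "\<dots> = (LINT w|distr lborel borel (\<lambda>x. 2 *\<^sub>R x). 4 *\<^sub>R g w)"
    by (rule integral_density) auto
  also have "\<dots> = (LINT w|lborel. 4 *\<^sub>R g (2 *\<^sub>R w))"
    by (rule integral_distr) auto
  finally show ?thesis by simp
qed

text \<open>The dilation by 2 shows that \<open>4 * lam (2 *\<^sub>R w)\<close> and
  \<open>lam w\<close> would have equal integrals. Yet four times their difference dominates
  \<open>(lam w)\<^sup>2\<close>, whose integral is positive.\<close>

lemma not_integrable_lam: "\<not> integrable lborel lam"
proof
  assume i: "integrable lborel lam"
  have n: "(norm (2 *\<^sub>R w))\<^sup>2 = 4 * (norm w)\<^sup>2" for w :: "real^2"
    by (simp add: power_mult_distrib)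
  have i2: "integrable lborel (\<lambda>w. lam (2 *\<^sub>R w))"
  proof (rule Bochner_Integration.integrable_bound[OF i])
    show "(\<lambda>w. lam (2 *\<^sub>R w)) \<in> borel_measurable lborel" by measurable
    have "lam (2 *\<^sub>R w) \<le> lam w" for w
    proof -
      have "0 < 4 * (norm w)\<^sup>2 + 1" using zero_le_power2[of "norm w"] by linarith
      then show ?thesis
        unfolding lam_def n by (intro divide_left_mono[OF _ _ mult_pos_pos[OF _ one_plus_norm_pos]]) simp_all
    qed
    then show "AE w in lborel. norm (lam (2 *\<^sub>R w)) \<le> norm (lam w)"
      using lam_pos by (simp add: abs_of_pos)
  qed
  have "(LINT w|lborel. (lam w)\<^sup>2) \<le> (LINT w|lborel. 4 * (4 * lam (2 *\<^sub>R w) - lam w))"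
  proof (rule integral_mono[OF integrable_lam_squared])
    show "integrable lborel (\<lambda>w. 4 * (4 * lam (2 *\<^sub>R w) - lam w))" using i i2 by simp
    fix w :: "real^2"
    define s where "s = (norm w)\<^sup>2 + 1"
    define t where "t = 4 * (norm w)\<^sup>2 + 1"
    have st: "0 < s" "0 < t" "t \<le> 4 * s" "4 * s - t = 3"
      unfolding s_def t_def using zero_le_power2[of "norm w"] by - (linarith | simp add: algebra_simps)+
    have "4 * (4 * (2 / t) - 2 / s) = 8 * (4 * s - t) / (t * s)" using st(1,2) by (simp add: field_simps)
    also have "\<dots> = 24 / (t * s)" unfolding st(4) by simp
    also have "\<dots> \<ge> 24 / ((4 * s) * s)" using st by (intro divide_left_mono mult_right_mono mult_pos_pos) auto
    finally have "24 / ((4 * s) * s) \<le> 4 * (4 * (2 / t) - 2 / s)" .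
    moreover have "(2 / s)\<^sup>2 \<le> 24 / ((4 * s) * s)" using st(1) by (simp add: power2_eq_square divide_simps)
    ultimately have "(2 / s)\<^sup>2 \<le> 4 * (4 * (2 / t) - 2 / s)" by linarith
    then show "(lam w)\<^sup>2 \<le> 4 * (4 * lam (2 *\<^sub>R w) - lam w)"
      by (simp add: lam_def n s_def t_def)
  qed
  also have "\<dots> = 4 * (4 * (LINT w|lborel. lam (2 *\<^sub>R w)) - (LINT w|lborel. lam w))" using i i2 by simp
  also have "\<dots> = 0" using integral_lborel_scale2[OF lam_measurable] by simp
  finally show False using integral_lam_squared_pos by simp
qed

text \<open>Up to a multiple of the square integrable \<open>lam\<close>, the function is
  \<open>q\<close>. The even part of \<open>q\<close> is the constant \<open>c0 + c1\<close>, which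
  must vanish. What remains has size 1/|w|; adding the squares of \<open>q\<close> and of its
  quarter turn removes the angular dependence and leaves a multiple of
  \<open>2 * lam w - (lam w)\<^sup>2\<close>, which is not integrable.\<close>

lemma affine_not_sqint:
  assumes f: "sqint f" and eq: "AE w in lborel. f w = c0 + c1 * stereo w $ 1 + c2 * stereo w $ 2 + c3 * stereo w $ 3"
  shows "c0 + c1 = 0" "c2 = 0" "c3 = 0"
proof -
  define q where "q w = (c0 + c1) + lam w * (c2 * w $ 1 + c3 * w $ 2)" for w
  have qm [measurable]: "q \<in> borel_measurable borel"
    unfolding q_def[abs_def] by (intro borel_measurable_continuous_onI continuous_intros)
  have q: "sqint q"
  proof (rule sqint_mono[where C = 1])
    show "sqint (\<lambda>w. f w + c1 * lam w)" by (rule sqint_add[OF f sqint_cmult[OF sqint_lam]])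
    show "q \<in> borel_measurable lborel" by simp
    show "AE w in lborel. norm (q w) \<le> 1 * norm (f w + c1 * lam w)"
      using eq by eventually_elim (simp add: q_def stereo_nth algebra_simps)
  qed
  have qr: "sqint (\<lambda>w. q (0 - w))"
    using sqint_integrable[OF q] integral_lborel_reflect(2)[of "\<lambda>w. (norm (q w))\<^sup>2" 0] by (simp add: sqint_def)
  have "q w + q (0 - w) = 2 * (c0 + c1)" for w
    by (simp add: q_def lam_def algebra_simps)
  then have "sqint (\<lambda>w::real^2. 2 * (c0 + c1))" using sqint_add[OF q qr] by simp
  then have "integrable lborel (\<lambda>w::real^2. (norm (2 * (c0 + c1)))\<^sup>2)" by (rule sqint_integrable)
  then show c: "c0 + c1 = 0"
    by (auto simp: integrable_iff_bounded ennreal_mult_less_top)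
  have rq: "sqint (\<lambda>w. q (rot (pi / 2) w))"
  proof -
    have "rot (pi / 2) \<in> borel_measurable borel"
      by (intro borel_measurable_continuous_onI continuous_intros)
    then have "(\<lambda>w. q (rot (pi / 2) w)) \<in> borel_measurable borel"
      by (rule measurable_compose) (rule qm)
    then show ?thesis
      using sqint_integrable[OF q] integral_rot(2)[of "\<lambda>w. (norm (q w))\<^sup>2" "pi / 2"] by (simp add: sqint_def)
  qed
  have sum: "(norm (q w))\<^sup>2 + (norm (q (rot (pi / 2) w)))\<^sup>2 = (c2\<^sup>2 + c3\<^sup>2) * (2 * lam w - (lam w)\<^sup>2)" for w
  proof -
    define x y a where "x = w $ 1" and "y = w $ 2" and "a = lam w"
    have l: "a * (x\<^sup>2 + y\<^sup>2) = 2 - a" using lam_eq[of w] by (simp add: x_def y_def a_def algebra_simps)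
    have "(a * (c2 * x + c3 * y))\<^sup>2 + (a * (c2 * - y + c3 * x))\<^sup>2 = (c2\<^sup>2 + c3\<^sup>2) * (2 * a - a\<^sup>2)"
      using l by algebra
    then show ?thesis
      unfolding q_def c lam_rot rot_nth by (simp add: x_def y_def a_def)
  qed
  have int: "integrable lborel (\<lambda>w. (norm (q w))\<^sup>2 + (norm (q (rot (pi / 2) w)))\<^sup>2)"
    by (rule Bochner_Integration.integrable_add[OF sqint_integrable[OF q] sqint_integrable[OF rq]])
  define k where "k = c2\<^sup>2 + c3\<^sup>2"
  have i: "integrable lborel (\<lambda>w. k * (2 * lam w - (lam w)\<^sup>2))"
    using int unfolding sum k_def .
  have "k = 0"
  proof (rule ccontr)
    assume ne: "k \<noteq> 0"
    have "integrable lborel (\<lambda>w. 2 * lam w - (lam w)\<^sup>2)"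
      using integrable_mult_right[OF i, of "1 / k"] ne by simp
    from integrable_mult_right[OF Bochner_Integration.integrable_add[OF this integrable_lam_squared], of "1 / 2"]
    have "integrable lborel lam" by simp
    then show False using not_integrable_lam by simp
  qed
  then show "c2 = 0" "c3 = 0" by (simp_all add: k_def sum_power2_eq_zero_iff)
qed

lemma sobolev_npair:
  assumes f: "sobolev_pair f F" and h: "sobolev_pair h H" and eq: "4 * Bform i F H = sqnorm F + sqnorm H"
  shows "npair i f h"
proof -
  have s: "sqint f" "sqint h" using f h by (simp_all add: sobolev_pair_def)
  have l2: "sqint (\<lambda>w. (lam w)\<^sup>2)"
  proof (rule sqint_lam_bound[where K = 2])
    show "(\<lambda>w. (lam w)\<^sup>2) \<in> borel_measurable borel" by measurable
    show "norm ((lam w)\<^sup>2) \<le> 2 * lam w" for w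
      using lam_le_2_mult[of w] by (simp add: power2_eq_square)
  qed
  have "integrable lborel (\<lambda>w. (lam w)\<^sup>2 * g w)" "g \<in> borel_measurable borel" if "sqint g" for g
    using integrable_inner_sqint[OF l2 that] sqint_measurable[OF that] by simp_all
  then show ?thesis
    unfolding npair_def using null_pair_minimiser[OF f h eq] s by blast
qed

lemma energy_eq_0_imp:
  assumes f: "sobolev_pair f F" and h: "sobolev_pair h H" and eq: "4 * Bform i F H = sqnorm F + sqnorm H"
  shows "AE w in lborel. f w = 0" "AE w in lborel. h w = 0"
proof -
  have s: "sqint f" "sqint h" using f h by (simp_all add: sobolev_pair_def)
  obtain a1 a2 b1 b2 where e: "AE w in lborel. f w = a1 + b1 * stereo w $ nxt i + b2 * stereo w $ nxt (nxt i)"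
      "AE w in lborel. h w = a2 + b2 * stereo w $ nxt i - b1 * stereo w $ nxt (nxt i)"
    using npair_affine[OF sobolev_npair[OF f h eq]] by blast
  have "a1 = 0 \<and> a2 = 0 \<and> b1 = 0 \<and> b2 = 0"
  proof -
    \<comment> \<open>For \<open>i = 2\<close> and \<open>i = 3\<close> one of the coefficients sits
      next to the first coordinate and is seen only through \<open>c0 + c1\<close>. Since
      \<open>f\<close> and \<open>h\<close> share \<open>b1\<close> and \<open>b2\<close> with the
      coordinates exchanged, the other function exposes it.\<close>
    consider "i = 1" | "i = 2" | "i = 3" using exhaust_3 by blast
    then show ?thesis
    proof cases
      case 1
      have "AE w in lborel. f w = a1 + 0 * stereo w $ 1 + b1 * stereo w $ 2 + b2 * stereo w $ 3"
        "AE w in lborel. h w = a2 + 0 * stereo w $ 1 + b2 * stereo w $ 2 + (- b1) * stereo w $ 3"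
        using e by (simp_all add: 1 nxt_simps)
      from affine_not_sqint[OF s(1) this(1)] affine_not_sqint[OF s(2) this(2)] show ?thesis by simp
    next
      case 2
      have "AE w in lborel. f w = a1 + b2 * stereo w $ 1 + 0 * stereo w $ 2 + b1 * stereo w $ 3"
        "AE w in lborel. h w = a2 + (- b1) * stereo w $ 1 + 0 * stereo w $ 2 + b2 * stereo w $ 3"
        using e by (simp_all add: 2 nxt_simps algebra_simps)
      from affine_not_sqint[OF s(1) this(1)] affine_not_sqint[OF s(2) this(2)] show ?thesis by simp
    next
      case 3
      have "AE w in lborel. f w = a1 + b1 * stereo w $ 1 + b2 * stereo w $ 2 + 0 * stereo w $ 3"
        "AE w in lborel. h w = a2 + b2 * stereo w $ 1 + (- b1) * stereo w $ 2 + 0 * stereo w $ 3"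
        using e by (simp_all add: 3 nxt_simps)
      from affine_not_sqint[OF s(1) this(1)] affine_not_sqint[OF s(2) this(2)] show ?thesis by simp
    qed
  qed
  then show "AE w in lborel. f w = 0" "AE w in lborel. h w = 0" using e by simp_all
qed

subsection \<open>The inequality for gradients\<close>

lemma sobolev_pair_scaleR:
  fixes f :: "'a::euclidean_space \<Rightarrow> real"
  assumes "sobolev_pair f F"
  shows "sobolev_pair (\<lambda>x. c * f x) (\<lambda>x. c *\<^sub>R F x)"
proof -
  have s: "sqint (\<lambda>x. c * f x)" "sqint (\<lambda>x. c *\<^sub>R F x)"
    using assms sqint_cmult sqint_scaleR by (auto simp: sobolev_pair_def)
  have eq: "(LINT y|lborel. (c * f y) *\<^sub>R bump_grad r (x - y)) = (LINT y|lborel. bump r (x - y) *\<^sub>R (c *\<^sub>R F y))"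
    if r: "r > 0" for x r
  proof -
    have l: "(c * f y) *\<^sub>R bump_grad r (x - y) = c *\<^sub>R (f y *\<^sub>R bump_grad r (x - y))" for y
      by simp
    have "bump r (x - y) *\<^sub>R (c *\<^sub>R F y) = c *\<^sub>R (bump r (x - y) *\<^sub>R F y)" for y
      by simp
    moreover have "(LINT y|lborel. f y *\<^sub>R bump_grad r (x - y)) = (LINT y|lborel. bump r (x - y) *\<^sub>R F y)"
      using assms r by (simp add: sobolev_pair_def weak_pair_def)
    ultimately show ?thesis unfolding l by (simp only: integral_scaleR_right)
  qed
  show ?thesis
    unfolding sobolev_pair_def weak_pair_def by (intro conjI allI impI s s[THEN sqint_imp_locint] eq)
qed

lemma Bform_scaleR: "Bform i (\<lambda>w. a *\<^sub>R F w) (\<lambda>w. b *\<^sub>R H w) = a * b * Bform i F H"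
proof -
  have "stereo w $ i * (J0 (a *\<^sub>R F w) \<bullet> (b *\<^sub>R H w)) = (a * b) * (stereo w $ i * (J0 (F w) \<bullet> H w))" for w
    by (simp add: J0_scaleR)
  then show ?thesis unfolding Bform_def by (simp only: integral_mult_right_zero)
qed

lemma Bform_self: "Bform i F F = 0"
  by (simp add: Bform_def J0_inner mult.commute)

text \<open>\<open>Bform\<close> of a gradient with itself is 0 by skewness, so a function with
  vanishing gradient forms with itself a pair of zero energy.\<close>

lemma sobolev_pair_sqnorm_eq_0:
  fixes f :: "real^2 \<Rightarrow> real"
  assumes f: "sobolev_pair f F"
  shows "sqnorm F = 0 \<longleftrightarrow> (AE w in lborel. f w = 0)"
proof
  assume "sqnorm F = 0"
  then show "AE w in lborel. f w = 0"
    using energy_eq_0_imp(1)[OF f f, of 1] by (simp add: Bform_self)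
next
  assume "AE w in lborel. f w = 0"
  then have F: "AE w in lborel. F w = 0" by (rule sobolev_pair_zero[OF f])
  have "(LINT w|lborel. (norm (F w))\<^sup>2) = 0"
    by (rule integral_eq_zero_AE) (use F in eventually_elim, simp)
  then show "sqnorm F = 0" by (simp add: sqnorm_def)
qed

text \<open>Normalising both gradients to length 1 converts the energy inequality into product form.
  With both norms positive, equality would give a normalised pair of zero energy, hence
  \<open>f\<close> zero and its gradient norm zero, a contradiction.\<close>

lemma sobolev_pair_inequality:
  fixes f h :: "real^2 \<Rightarrow> real"
  assumes f: "sobolev_pair f F" and h: "sobolev_pair h H"
  shows "2 * Bform i F H \<le> sqrt (sqnorm F) * sqrt (sqnorm H)"
    and "2 * Bform i F H = sqrt (sqnorm F) * sqrt (sqnorm H) \<longleftrightarrow> (AE w in lborel. f w = 0) \<or> (AE w in lborel. h w = 0)"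
proof -
  have "2 * Bform i F H \<le> sqrt (sqnorm F) * sqrt (sqnorm H) \<and>
    (2 * Bform i F H = sqrt (sqnorm F) * sqrt (sqnorm H) \<longleftrightarrow> sqnorm F = 0 \<or> sqnorm H = 0)"
  proof (cases "sqnorm F = 0 \<or> sqnorm H = 0")
    case True
    have "AE w in lborel. F w = 0 \<or> H w = 0"
    proof -
      consider "AE w in lborel. F w = 0" | "AE w in lborel. H w = 0"
        using True sobolev_pair_zero[OF f] sobolev_pair_zero[OF h] sobolev_pair_sqnorm_eq_0[OF f] sobolev_pair_sqnorm_eq_0[OF h] by blast
      then show ?thesis by cases (erule eventually_mono, simp)+
    qed
    then have "AE w in lborel. stereo w $ i * (J0 (F w) \<bullet> H w) = 0"
      by eventually_elim (auto simp: J0_inner)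
    then have "Bform i F H = 0"
      unfolding Bform_def by (rule integral_eq_zero_AE)
    then show ?thesis using True by auto
  next
    case False
    define A B where "A = sqrt (sqnorm F)" and "B = sqrt (sqnorm H)"
    have AB: "A > 0" "B > 0" "A\<^sup>2 = sqnorm F" "B\<^sup>2 = sqnorm H"
      using False sqnorm_nonneg[of F] sqnorm_nonneg[of H] by (auto simp: A_def B_def order_le_less)
    note f' = sobolev_pair_scaleR[OF f, of "1 / A"] and h' = sobolev_pair_scaleR[OF h, of "1 / B"]
    have n: "sqnorm (\<lambda>x. (1 / A) *\<^sub>R F x) = 1" "sqnorm (\<lambda>x. (1 / B) *\<^sub>R H x) = 1"
      unfolding sqnorm_scaleR using AB False by (simp_all add: power_divide)
    have b: "Bform i (\<lambda>x. (1 / A) *\<^sub>R F x) (\<lambda>x. (1 / B) *\<^sub>R H x) = Bform i F H / (A * B)"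
      unfolding Bform_scaleR by simp
    have "4 * (Bform i F H / (A * B)) \<le> 2"
      using energy_nonneg[OF sobolev_grad_closure[OF f'] sobolev_grad_closure[OF h'], of i] unfolding b n by simp
    then have le: "2 * Bform i F H \<le> A * B" using AB by (simp add: field_simps)
    have "2 * Bform i F H \<noteq> A * B"
    proof
      assume "2 * Bform i F H = A * B"
      then have half: "Bform i F H = A * B / 2" by linarith
      have q: "Bform i F H / (A * B) = 1 / 2" unfolding half using AB by simp
      have "4 * Bform i (\<lambda>x. (1 / A) *\<^sub>R F x) (\<lambda>x. (1 / B) *\<^sub>R H x) = sqnorm (\<lambda>x. (1 / A) *\<^sub>R F x) + sqnorm (\<lambda>x. (1 / B) *\<^sub>R H x)"
        unfolding b n q by simp
      from energy_eq_0_imp(1)[OF f' h' this] have "AE w in lborel. f w = 0" using AB by simp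
      then show False using False sobolev_pair_sqnorm_eq_0[OF f] by simp
    qed
    then show ?thesis using le False by (simp add: A_def B_def)
  qed
  then show "2 * Bform i F H \<le> sqrt (sqnorm F) * sqrt (sqnorm H)"
    "2 * Bform i F H = sqrt (sqnorm F) * sqrt (sqnorm H) \<longleftrightarrow> (AE w in lborel. f w = 0) \<or> (AE w in lborel. h w = 0)"
    using sobolev_pair_sqnorm_eq_0[OF f] sobolev_pair_sqnorm_eq_0[OF h] by simp_all
qed

lemma L2_norm_eq_sqnorm:
  fixes G F :: "'a::euclidean_space \<Rightarrow> 'b::euclidean_space"
  assumes G: "G \<in> borel_measurable lebesgue" and F: "sqint F" and eq: "AE x in lborel. G x = F x"
  shows "L2_norm G = sqrt (sqnorm F)"
proof -
  have "(\<lambda>x. (norm (F x))\<^sup>2) \<in> borel_measurable borel" using sqint_measurable[OF F] by measurable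
  moreover have "(\<lambda>x. (norm (G x))\<^sup>2) \<in> borel_measurable lebesgue" using G by measurable
  moreover have "AE x in lborel. (norm (G x))\<^sup>2 = (norm (F x))\<^sup>2" using eq by eventually_elim simp
  ultimately show ?thesis
    unfolding L2_norm_def sqnorm_def using integral_lebesgue_eq_lborel(1) by metis
qed

text \<open>Both sides depend only on classes modulo null sets, so functions and gradients may be
  replaced by Borel representatives, for which the statement is
  \<open>sobolev_pair_inequality\<close>.\<close>

theorem corollary1p1:
  fixes f h :: "real^2 \<Rightarrow> real" and i :: 3
  assumes "f \<in> H1" and "h \<in> H1"
  shows "2 * (LINT w|lebesgue. stereo w $ i * (J0 (weak_gradient f w) \<bullet> weak_gradient h w))
           \<le> L2_norm (weak_gradient f) * L2_norm (weak_gradient h)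
         \<and> (2 * (LINT w|lebesgue. stereo w $ i * (J0 (weak_gradient f w) \<bullet> weak_gradient h w))
           = L2_norm (weak_gradient f) * L2_norm (weak_gradient h)
         \<longleftrightarrow> (AE w in lebesgue. f w = 0) \<or> (AE w in lebesgue. h w = 0))"
proof -
  obtain f' F where f: "sobolev_pair f' F" "AE x in lborel. f x = f' x"
    "weak_gradient f \<in> borel_measurable lebesgue" "AE x in lborel. weak_gradient f x = F x"
    using H1_representative[OF assms(1)] by blast
  obtain h' H where h: "sobolev_pair h' H" "AE x in lborel. h x = h' x"
    "weak_gradient h \<in> borel_measurable lebesgue" "AE x in lborel. weak_gradient h x = H x"
    using H1_representative[OF assms(2)] by blast
  have s: "sqint F" "sqint H" using f(1) h(1) by (simp_all add: sobolev_pair_def)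
  have st: "(\<lambda>w. stereo w $ i) \<in> borel_measurable borel"
    by (intro borel_measurable_continuous_onI continuous_intros)
  have "(LINT w|lebesgue. stereo w $ i * (J0 (weak_gradient f w) \<bullet> weak_gradient h w)) = (LINT w|lborel. stereo w $ i * (J0 (F w) \<bullet> H w))"
  proof (rule integral_lebesgue_eq_lborel(1))
    have "(\<lambda>w. stereo w $ i) \<in> borel_measurable lebesgue"
      using st by (intro measurable_completion) simp
    moreover have "(\<lambda>w. J0 (weak_gradient f w)) \<in> borel_measurable lebesgue"
      by (rule measurable_compose[OF f(3) J0_measurable])
    ultimately show "(\<lambda>w. stereo w $ i * (J0 (weak_gradient f w) \<bullet> weak_gradient h w)) \<in> borel_measurable lebesgue"
      using h(3) by (intro borel_measurable_times borel_measurable_inner)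
    have "(\<lambda>w. J0 (F w)) \<in> borel_measurable borel"
      by (rule measurable_compose[OF sqint_measurable[OF s(1)] J0_measurable])
    then show "(\<lambda>w. stereo w $ i * (J0 (F w) \<bullet> H w)) \<in> borel_measurable borel"
      using st sqint_measurable[OF s(2)] by (intro borel_measurable_times borel_measurable_inner)
    show "AE w in lborel. stereo w $ i * (J0 (weak_gradient f w) \<bullet> weak_gradient h w) = stereo w $ i * (J0 (F w) \<bullet> H w)"
      using f(4) h(4) by eventually_elim simp
  qed
  then have B: "(LINT w|lebesgue. stereo w $ i * (J0 (weak_gradient f w) \<bullet> weak_gradient h w)) = Bform i F H"
    by (simp add: Bform_def)
  have "(AE w in lborel. f w = 0) \<longleftrightarrow> (AE w in lborel. f' w = 0)" "(AE w in lborel. h w = 0) \<longleftrightarrow> (AE w in lborel. h' w = 0)"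
    using f(2) h(2) by (auto elim: eventually_elim2)
  then show ?thesis
    unfolding B L2_norm_eq_sqnorm[OF f(3) s(1) f(4)] L2_norm_eq_sqnorm[OF h(3) s(2) h(4)] AE_completion_iff
    using sobolev_pair_inequality[OF f(1) h(1), of i] by simp
qed

end
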